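(* Let $n\ge 1$ and $\alpha=\tfrac{2n-1}{2}$. As a module for the joint action of $\mathfrak{g}=\mathfrak{spo}(2n|1)$ and $\mathfrak{g}'=\mathfrak{osp}(2|2)$, $$\mathrm{S}(E)=\mathrm{V}^{2n|1}_{(0_n)}\otimes \mathrm{V}^{2|2}_{(\alpha,-\alpha)}\ \oplus\ \mathrm{V}^{2n|1}_{(0_n)}\otimes \mathrm{V}^{2|2}_{(1+\alpha,\,2n-\alpha)}\ \oplus\ \bigoplus_{d=0}^{\infty}\bigoplus_{k=1}^{n}\Big(\mathrm{V}^{2n|1}_{(d+1,1_{k-1},0_{n-k})}\otimes \mathrm{V}^{2|2}_{(d+1+\alpha,\,k-1-\alpha)}\ \oplus\ \mathrm{V}^{2n|1}_{(d+1,1_{k-1},0_{n-k})}\otimes \mathrm{V}^{2|2}_{(d+1+\alpha,\,2n-k-\alpha)}\Big),$$ where $\mathrm{V}^{2n|1}_{\lambda}$ is the irreducible $\mathfrak{spo}(2n|1)$-module of highest weight $\lambda$ and $\mathrm{V}^{2|2}_{(a,b)}$ is the irreducible $\mathfrak{osp}(2|2)$-module of highest weight $(a,b)$.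
   Context: Everything is over $\mathbb{C}$. $V=\mathbb{C}^{2n|1}$ has even basis vectors $u_1,\dots,u_{2n}$, odd basis vector $u_{2n+1}$, and bilinear form $B$ with $B(u_i,u_{2n+1-i})=1=-B(u_{2n+1-i},u_i)$ for $1\le i\le n$, $B(u_{2n+1},u_{2n+1})=1$, all other pairings of basis vectors zero. $\mathfrak{g}=\mathfrak{spo}(2n|1)\subset\mathfrak{gl}(2n|1)$ is spanned by homogeneous $X$ with $B(Xv,w)+(-1)^{|X||v|}B(v,Xw)=0$. With $\mathrm{E}_{i,j}$ the matrix units, its Cartan subalgebra is spanned by $\mathrm{E}_{i,i}-\mathrm{E}_{2n+1-i,2n+1-i}$, $1\le i\le n$, and a weight $(\lambda_1,\dots,\lambda_n)$ lists the eigenvalues of these elements. The Borel subalgebra $\mathfrak{b}^{\mathrm{spo}}$ has even part the upper triangular matrices in $\mathfrak{sp}(2n)$ and odd part $\bigoplus_{k=1}^n\mathbb{C}(\mathrm{E}_{k,2n+1}+\mathrm{E}_{2n+1,2n+1-k})$; highest weights are with respect to it. $0_a$, $1_a$ denote $(0,\dots,0)$, $(1,\dots,1)$ of length $a$. $X'=\mathbb{C}^{1|1}$ has even basis vector $v_1$ and odd basis vector $w_1$; $E=V\otimes X'$ has even basis $x_i=u_i\otimes v_1$ ($1\le i\le 2n$), $x_{2n+1}=u_{2n+1}\otimes w_1$ and odd basis $\eta_i=u_i\otimes w_1$ ($1\le i\le 2n$), $\eta_{2n+1}=u_{2n+1}\otimes v_1$. $\mathrm{S}(E)=\mathbb{C}[x_1,\dots,x_{2n+1}]\otimes\Lambda(\eta_1,\dots,\eta_{2n+1})$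 is the supersymmetric algebra; $\mathfrak{g}$ acts on $E$ by $X(v\otimes v')=Xv\otimes v'$ and on $\mathrm{S}(E)$ by superderivations. $\mathfrak{g}'=\mathfrak{osp}(2|2)$ acts on $\mathrm{S}(E)$ as the span of the following operators, which supercommute with $\mathfrak{g}$: $F_{1,1}=\sum_{i=1}^{2n}x_i\partial_{x_i}+\eta_{2n+1}\partial_{\eta_{2n+1}}+\frac{2n-1}{2}$, $F_{2,2}=\sum_{i=1}^{2n}\eta_i\partial_{\eta_i}+x_{2n+1}\partial_{x_{2n+1}}-\frac{2n-1}{2}$, $F_{2,1}=x_{2n+1}\partial_{\eta_{2n+1}}-\sum_{i=1}^{2n}\eta_i\partial_{x_i}$, $F_{1,2}=\eta_{2n+1}\partial_{x_{2n+1}}-\sum_{i=1}^{2n}x_i\partial_{\eta_i}$, $D_{12}=\partial_{x_{2n+1}}\partial_{\eta_{2n+1}}+\sum_{i=1}^n(\partial_{x_i}\partial_{\eta_{2n+1-i}}-\partial_{x_{2n+1-i}}\partial_{\eta_i})$, $D_{22}=\partial_{x_{2n+1}}^2+2\sum_{i=1}^n\partial_{\eta_i}\partial_{\eta_{2n+1-i}}$, $R_{12}=x_{2n+1}\eta_{2n+1}+\sum_{i=1}^n(\eta_ix_{2n+1-i}-\eta_{2n+1-i}x_i)$, $R_{22}=x_{2n+1}^2+2\sum_{i=1}^n\eta_i\eta_{2n+1-i}$. Put $\mathfrak{n}'^{+}=\mathrm{span}\{D_{12},D_{22}\}$. Highest weights $(a,b)$ of $\mathfrak{g}'$ are with respect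 to the Borel subalgebra $\mathrm{span}\{F_{1,1},F_{2,2},F_{1,2}\}\oplus\mathfrak{n}'^{+}$: the highest weight vector is killed by $F_{1,2},D_{12},D_{22}$ and has $F_{1,1}$- and $F_{2,2}$-eigenvalues $a$ and $b$. Irreducible highest weight modules are considered up to parity shift, and $\otimes$ is the outer tensor product. *)

theory Defs
  imports Complex_Main "HOL-Library.Poly_Mapping"
begin

section \<open>Superspaces with a homogeneous basis\<close>

text \<open>A super vector space is given by a set of homogeneous basis elements together with
  their parities (\<^term>\<open>True\<close> = odd); its vectors are the finitely supported complex
  functions on that set. Parities add by \<open>\<noteq>\<close>.\<close>

type_synonym 'b cvec = "'b \<Rightarrow>\<^sub>0 complex"

abbreviation lookup :: "('b \<Rightarrow>\<^sub>0 'c::zero) \<Rightarrow> 'b \<Rightarrow> 'c" where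
  "lookup \<equiv> Poly_Mapping.lookup"

abbreviation keys :: "('b \<Rightarrow>\<^sub>0 'c::zero) \<Rightarrow> 'b set" where
  "keys \<equiv> Poly_Mapping.keys"

definition cscale :: "complex \<Rightarrow> 'b cvec \<Rightarrow> 'b cvec"  (infixr "\<cdot>" 75) where
  "c \<cdot> v = Poly_Mapping.map ((*) c) v"

lemma lookup_cscale [simp]: "lookup (c \<cdot> v) b = c * lookup v b"
  unfolding cscale_def by (simp add: Poly_Mapping.map.rep_eq when_def)

interpretation cvec: vector_space "(\<cdot>) :: complex \<Rightarrow> 'b cvec \<Rightarrow> 'b cvec"
  by unfold_locales (auto intro!: poly_mapping_eqI simp: lookup_add algebra_simps)

definition bvec :: "'b \<Rightarrow> 'b cvec" where
  "bvec b = Poly_Mapping.single b 1"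

definition lin :: "('b \<Rightarrow> 'c cvec) \<Rightarrow> 'b cvec \<Rightarrow> 'c cvec" where
  "lin g v = (\<Sum>b\<in>keys v. lookup v b \<cdot> g b)"

record 'b superspace =
  basis :: "'b set"
  par :: "'b \<Rightarrow> bool"

definition vecs :: "('b, 'z) superspace_scheme \<Rightarrow> 'b cvec set" where
  "vecs U = {v. keys v \<subseteq> basis U}"

definition hom_part :: "('b, 'z) superspace_scheme \<Rightarrow> bool \<Rightarrow> 'b cvec set" where
  "hom_part U p = {v. keys v \<subseteq> {b \<in> basis U. par U b = p}}"

definition ksign :: "bool \<Rightarrow> bool \<Rightarrow> complex" where
  "ksign p q = (if p \<and> q then -1 else 1)"

definition linear_on :: "'b cvec set \<Rightarrow> ('b cvec \<Rightarrow> 'c cvec) \<Rightarrow> bool" where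
  "linear_on A f \<longleftrightarrow>
     (\<forall>u\<in>A. \<forall>v\<in>A. f (u + v) = f u + f v) \<and> (\<forall>c. \<forall>v\<in>A. f (c \<cdot> v) = c \<cdot> f v)"


section \<open>Modules over Lie superalgebras of operators\<close>

text \<open>A Lie superalgebra of operators is given by its even and its odd part; the bracket is the
  supercommutator. A representation \<open>\<rho>\<close> is likewise given by its restrictions
  \<open>\<rho> False\<close>, \<open>\<rho> True\<close> to the even and the odd part.\<close>

type_synonym 'u lie_super = "bool \<Rightarrow> ('u cvec \<Rightarrow> 'u cvec) set"

definition supercomm :: "bool \<Rightarrow> bool \<Rightarrow> ('u cvec \<Rightarrow> 'u cvec) \<Rightarrow> ('u cvec \<Rightarrow> 'u cvec) \<Rightarrow> 'u cvec \<Rightarrow> 'u cvec" where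
  "supercomm p q X Y = (\<lambda>u. X (Y u) - ksign p q \<cdot> Y (X u))"

record ('u, 'b) supermod = "'b superspace" +
  rep :: "bool \<Rightarrow> ('u cvec \<Rightarrow> 'u cvec) \<Rightarrow> 'b cvec \<Rightarrow> 'b cvec"

definition supermodule :: "'u lie_super \<Rightarrow> ('u, 'b) supermod \<Rightarrow> bool" where
  "supermodule L M \<longleftrightarrow>
     (\<forall>p. \<forall>X\<in>L p. linear_on (vecs M) (rep M p X) \<and>
        (\<forall>q. rep M p X ` hom_part M q \<subseteq> hom_part M (p \<noteq> q))) \<and>
     (\<forall>p. \<forall>X\<in>L p. \<forall>Y\<in>L p. \<forall>a b. \<forall>v\<in>vecs M.
        rep M p (\<lambda>u. a \<cdot> X u + b \<cdot> Y u) v = a \<cdot> rep M p X v + b \<cdot> rep M p Y v) \<and>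
     (\<forall>p q. \<forall>X\<in>L p. \<forall>Y\<in>L q. \<forall>v\<in>vecs M.
        rep M (p \<noteq> q) (supercomm p q X Y) v =
          rep M p X (rep M q Y v) - ksign p q \<cdot> rep M q Y (rep M p X v))"

definition submodule :: "'u lie_super \<Rightarrow> ('u, 'b) supermod \<Rightarrow> 'b cvec set \<Rightarrow> bool" where
  "submodule L M N \<longleftrightarrow>
     N \<subseteq> vecs M \<and> cvec.subspace N \<and>
     (\<forall>v\<in>N. \<exists>v0 \<in> N \<inter> hom_part M False. \<exists>v1 \<in> N \<inter> hom_part M True. v = v0 + v1) \<and>
     (\<forall>p. \<forall>X\<in>L p. rep M p X ` N \<subseteq> N)"

definition irreducible :: "'u lie_super \<Rightarrow> ('u, 'b) supermod \<Rightarrow> bool" where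
  "irreducible L M \<longleftrightarrow>
     supermodule L M \<and> vecs M \<noteq> {0} \<and> (\<forall>N. submodule L M N \<longrightarrow> N = {0} \<or> N = vecs M)"


subsection \<open>Joint modules, outer tensor products and direct sums\<close>

record ('u, 'w, 'b) joint_mod = "'b superspace" +
  lrep :: "bool \<Rightarrow> ('u cvec \<Rightarrow> 'u cvec) \<Rightarrow> 'b cvec \<Rightarrow> 'b cvec"
  rrep :: "bool \<Rightarrow> ('w cvec \<Rightarrow> 'w cvec) \<Rightarrow> 'b cvec \<Rightarrow> 'b cvec"

definition tensor_vec :: "'b cvec \<Rightarrow> 'c cvec \<Rightarrow> ('b \<times> 'c) cvec" where
  "tensor_vec v w = lin (\<lambda>b. lin (\<lambda>c. bvec (b, c)) w) v"

text \<open>\<open>X (v \<otimes> w) = X v \<otimes> w\<close> and \<open>Y (v \<otimes> w) = (-1)\<^bsup>|Y||v|\<^esup> v \<otimes> Y w\<close>.\<close>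

definition outer_tensor :: "('u, 'b) supermod \<Rightarrow> ('w, 'c) supermod \<Rightarrow> ('u, 'w, 'b \<times> 'c) joint_mod" where
  "outer_tensor V W =
     \<lparr> basis = basis V \<times> basis W,
       par = (\<lambda>(b, c). par V b \<noteq> par W c),
       lrep = (\<lambda>p X. lin (\<lambda>(b, c). tensor_vec (rep V p X (bvec b)) (bvec c))),
       rrep = (\<lambda>p Y. lin (\<lambda>(b, c).
                 ksign p (par V b) \<cdot> tensor_vec (bvec b) (rep W p Y (bvec c)))) \<rparr>"

definition inject :: "'i \<Rightarrow> 'b cvec \<Rightarrow> ('i \<times> 'b) cvec" where
  "inject i = lin (\<lambda>b. bvec (i, b))"

definition direct_sum :: "'i set \<Rightarrow> ('i \<Rightarrow> ('u, 'w, 'b) joint_mod) \<Rightarrow> ('u, 'w, 'i \<times> 'b) joint_mod" where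
  "direct_sum I M =
     \<lparr> basis = (SIGMA i:I. basis (M i)),
       par = (\<lambda>(i, b). par (M i) b),
       lrep = (\<lambda>p X. lin (\<lambda>(i, b). inject i (lrep (M i) p X (bvec b)))),
       rrep = (\<lambda>p Y. lin (\<lambda>(i, b). inject i (rrep (M i) p Y (bvec b)))) \<rparr>"

definition joint_iso :: "'u lie_super \<Rightarrow> 'w lie_super \<Rightarrow>
    ('u, 'w, 'b) joint_mod \<Rightarrow> ('u, 'w, 'c) joint_mod \<Rightarrow> bool" where
  "joint_iso L L' M N \<longleftrightarrow> (\<exists>\<phi>.
     linear_on (vecs M) \<phi> \<and> bij_betw \<phi> (vecs M) (vecs N) \<and>
     (\<forall>p. \<phi> ` hom_part M p \<subseteq> hom_part N p) \<and>
     (\<forall>p. \<forall>X\<in>L p. \<forall>v\<in>vecs M. \<phi> (lrep M p X v) = lrep N p X (\<phi> v)) \<and>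
     (\<forall>p. \<forall>Y\<in>L' p. \<forall>v\<in>vecs M. \<phi> (rrep M p Y v) = rrep N p Y (\<phi> v)))"


section \<open>The Lie superalgebra spo(2n|1)\<close>

definition natural :: "nat \<Rightarrow> nat superspace" where
  "natural n = \<lparr> basis = {1..2*n+1}, par = (\<lambda>i. i = 2*n+1) \<rparr>"

definition form_basis :: "nat \<Rightarrow> nat \<Rightarrow> nat \<Rightarrow> complex" where
  "form_basis n i j =
     (if i \<in> {1..n} \<and> j = 2*n+1-i then 1
      else if j \<in> {1..n} \<and> i = 2*n+1-j then -1
      else if i = 2*n+1 \<and> j = 2*n+1 then 1 else 0)"

definition form :: "nat \<Rightarrow> nat cvec \<Rightarrow> nat cvec \<Rightarrow> complex" where
  "form n v w =
     (\<Sum>i\<in>{1..2*n+1}. \<Sum>j\<in>{1..2*n+1}. lookup v i * lookup w j * form_basis n i j)"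

definition matunit :: "nat \<Rightarrow> nat \<Rightarrow> nat cvec \<Rightarrow> nat cvec" where
  "matunit i j v = lookup v j \<cdot> bvec i"

definition entry :: "(nat cvec \<Rightarrow> nat cvec) \<Rightarrow> nat \<Rightarrow> nat \<Rightarrow> complex" where
  "entry X i j = lookup (X (bvec j)) i"

definition gl :: "nat \<Rightarrow> nat lie_super" where
  "gl n p = {X. (\<exists>a. X = (\<lambda>v. \<Sum>i\<in>{1..2*n+1}. \<Sum>j\<in>{1..2*n+1}. a i j \<cdot> matunit i j v)) \<and>
                (\<forall>q. X ` hom_part (natural n) q \<subseteq> hom_part (natural n) (p \<noteq> q))}"

definition spo :: "nat \<Rightarrow> nat lie_super" where
  "spo n p = {X \<in> gl n p. \<forall>q. \<forall>v\<in>hom_part (natural n) q. \<forall>w\<in>vecs (natural n).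
                form n (X v) w + ksign p q * form n v (X w) = 0}"

definition spo_cartan :: "nat \<Rightarrow> nat \<Rightarrow> nat cvec \<Rightarrow> nat cvec" where
  "spo_cartan n i = (\<lambda>v. matunit i i v - matunit (2*n+1-i) (2*n+1-i) v)"

text \<open>The nilradical of the Borel subalgebra: the strictly upper triangular matrices in
  \<open>sp(2n)\<close>, and the odd root vectors below.\<close>

definition spo_nil_even :: "nat \<Rightarrow> (nat cvec \<Rightarrow> nat cvec) set" where
  "spo_nil_even n = {X \<in> spo n False. \<forall>i\<in>{1..2*n}. \<forall>j\<in>{1..2*n}. j \<le> i \<longrightarrow> entry X i j = 0}"

definition spo_nil_odd :: "nat \<Rightarrow> nat \<Rightarrow> nat cvec \<Rightarrow> nat cvec" where
  "spo_nil_odd n k = (\<lambda>v. matunit k (2*n+1) v + matunit (2*n+1) (2*n+1-k) v)"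

text \<open>Weights are lists \<open>[\<lambda>\<^sub>1, \<dots>, \<lambda>\<^sub>n]\<close>, indexed from 0. The parity of the highest weight
  vector is left open, so the module is determined up to isomorphism and parity shift.\<close>

definition spo_irreducible :: "nat \<Rightarrow> complex list \<Rightarrow> (nat, 'b) supermod \<Rightarrow> bool" where
  "spo_irreducible n lam M \<longleftrightarrow>
     length lam = n \<and> irreducible (spo n) M \<and>
     (\<exists>p. \<exists>v\<in>hom_part M p. v \<noteq> 0 \<and>
        (\<forall>X\<in>spo_nil_even n. rep M False X v = 0) \<and>
        (\<forall>k\<in>{1..n}. rep M True (spo_nil_odd n k) v = 0) \<and>
        (\<forall>i\<in>{1..n}. rep M False (spo_cartan n i) v = lam ! (i - 1) \<cdot> v))"


section \<open>The supersymmetric algebra S(E)\<close>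

text \<open>The basis element \<open>(a, {s\<^sub>1 < \<dots> < s\<^sub>k})\<close> is the monomial
  \<open>x\<^bsup>a\<^esup> \<eta>\<^bsub>s\<^sub>1\<^esub> \<dots> \<eta>\<^bsub>s\<^sub>k\<^esub>\<close>.\<close>

type_synonym smono = "(nat \<Rightarrow>\<^sub>0 nat) \<times> nat set"

definition SE_space :: "nat \<Rightarrow> smono superspace" where
  "SE_space n =
     \<lparr> basis = {(a, S). keys a \<subseteq> {1..2*n+1} \<and> S \<subseteq> {1..2*n+1}},
       par = (\<lambda>(a, S). odd (card S)) \<rparr>"

definition inversions :: "nat set \<Rightarrow> nat set \<Rightarrow> nat" where
  "inversions S T = card {(s, t) \<in> S \<times> T. t < s}"

fun mono_mult :: "smono \<Rightarrow> smono \<Rightarrow> smono cvec" where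
  "mono_mult (a, S) (b, T) =
     (if S \<inter> T = {} then (-1) ^ inversions S T \<cdot> bvec (a + b, S \<union> T) else 0)"

definition smult :: "smono cvec \<Rightarrow> smono cvec \<Rightarrow> smono cvec"  (infixr "\<star>" 75) where
  "f \<star> g = lin (\<lambda>m. lin (mono_mult m) g) f"

definition xvar :: "nat \<Rightarrow> smono cvec" where
  "xvar i = bvec (Poly_Mapping.single i 1, {})"

definition evar :: "nat \<Rightarrow> smono cvec" where
  "evar i = bvec (0, {i})"

definition dx :: "nat \<Rightarrow> smono cvec \<Rightarrow> smono cvec" where
  "dx i = lin (\<lambda>(a, S). of_nat (lookup a i) \<cdot> bvec (a - Poly_Mapping.single i 1, S))"

definition de :: "nat \<Rightarrow> smono cvec \<Rightarrow> smono cvec" where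
  "de i = lin (\<lambda>(a, S).
     if i \<in> S then (-1) ^ card {s \<in> S. s < i} \<cdot> bvec (a, S - {i}) else 0)"

text \<open>The generator \<open>u\<^sub>i \<otimes> v\<^sub>1\<close> (for \<open>s = False\<close>) resp. \<open>u\<^sub>i \<otimes> w\<^sub>1\<close> (for \<open>s = True\<close>)
  and the corresponding partial derivative.\<close>

definition gen :: "nat \<Rightarrow> nat \<Rightarrow> bool \<Rightarrow> smono cvec" where
  "gen n i s = (if (i = 2*n+1) = s then xvar i else evar i)"

definition dgen :: "nat \<Rightarrow> nat \<Rightarrow> bool \<Rightarrow> smono cvec \<Rightarrow> smono cvec" where
  "dgen n i s = (if (i = 2*n+1) = s then dx i else de i)"

definition emb :: "nat \<Rightarrow> nat cvec \<Rightarrow> bool \<Rightarrow> smono cvec" where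
  "emb n v s = (\<Sum>i\<in>{1..2*n+1}. lookup v i \<cdot> gen n i s)"

text \<open>The superderivation extending \<open>X (v \<otimes> v') = X v \<otimes> v'\<close>; see \<open>spo_act_emb\<close> and
  \<open>spo_act_superderivation\<close> below.\<close>

definition spo_act :: "nat \<Rightarrow> (nat cvec \<Rightarrow> nat cvec) \<Rightarrow> smono cvec \<Rightarrow> smono cvec" where
  "spo_act n X f =
     (\<Sum>s\<in>UNIV. \<Sum>j\<in>{1..2*n+1}. emb n (X (bvec j)) s \<star> dgen n j s f)"


subsection \<open>The action is by superderivations\<close>

interpretation cvec_pair: vector_space_pair
  "(\<cdot>) :: complex \<Rightarrow> 'b cvec \<Rightarrow> 'b cvec" "(\<cdot>) :: complex \<Rightarrow> 'c cvec \<Rightarrow> 'c cvec"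
  ..

abbreviation clinear :: "('b cvec \<Rightarrow> 'c cvec) \<Rightarrow> bool" where
  "clinear \<equiv> Vector_Spaces.linear (\<cdot>) (\<cdot>)"

lemma clinearI:
  assumes "\<And>u v. F (u + v) = F u + F v" "\<And>c v. F (c \<cdot> v) = c \<cdot> F v"
  shows "clinear F"
  by unfold_locales (auto simp: assms)

lemma lin_superset:
  assumes "finite A" "keys v \<subseteq> A"
  shows "lin g v = (\<Sum>b\<in>A. lookup v b \<cdot> g b)"
  unfolding lin_def
  by (rule sum.mono_neutral_left) (use assms in \<open>auto simp: in_keys_iff\<close>)

lemma linear_lin: "clinear (lin (g :: 'b \<Rightarrow> 'c cvec))"
proof (rule clinearI)
  fix u v :: "'b cvec"
  let ?A = "keys u \<union> keys v"
  have "lin g (u + v) = (\<Sum>b\<in>?A. lookup (u + v) b \<cdot> g b)"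
    by (rule lin_superset) (use keys_add[of u v] in auto)
  also have "\<dots> = lin g u + lin g v"
    by (simp add: lin_superset[of ?A] lookup_add cvec.scale_left_distrib sum.distrib)
  finally show "lin g (u + v) = lin g u + lin g v" .
next
  fix c and v :: "'b cvec"
  have "lin g (c \<cdot> v) = (\<Sum>b\<in>keys v. lookup (c \<cdot> v) b \<cdot> g b)"
    by (rule lin_superset) (auto simp: in_keys_iff)
  then show "lin g (c \<cdot> v) = c \<cdot> lin g v"
    by (simp add: lin_def cvec.scale_sum_right)
qed

lemmas lin_simps = cvec_pair.linear_add[OF linear_lin] cvec_pair.linear_scale[OF linear_lin]
  cvec_pair.linear_0[OF linear_lin]

lemma lin_bvec [simp]: "lin g (bvec b) = g b"
  by (simp add: lin_def bvec_def)

lemma lin_fun_add: "lin (\<lambda>b. g b + h b) v = lin g v + lin h v"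
  by (simp add: lin_def cvec.scale_right_distrib sum.distrib)

lemma lin_fun_scale: "lin (\<lambda>b. c \<cdot> g b) v = c \<cdot> lin g v"
  by (simp add: lin_def cvec.scale_sum_right mult.commute)

lemma cvec_expand: "v = (\<Sum>b\<in>keys v. lookup v b \<cdot> bvec b)"
  by (rule poly_mapping_eqI)
    (auto simp: lookup_sum bvec_def lookup_single when_def in_keys_iff sum.delta if_distrib cong: if_cong)

lemma linear_eqI:
  assumes "clinear F" "clinear G" "\<And>b. b \<in> keys v \<Longrightarrow> F (bvec b) = G (bvec b)"
  shows "F v = G v"
proof -
  have "F v = (\<Sum>b\<in>keys v. lookup v b \<cdot> F (bvec b))"
    by (subst cvec_expand) (simp add: cvec_pair.linear_sum[OF assms(1)] cvec_pair.linear_scale[OF assms(1)])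
  also have "\<dots> = (\<Sum>b\<in>keys v. lookup v b \<cdot> G (bvec b))"
    using assms(3) by (intro sum.cong) auto
  also have "\<dots> = G v"
    by (subst (4) cvec_expand) (simp add: cvec_pair.linear_sum[OF assms(2)] cvec_pair.linear_scale[OF assms(2)])
  finally show ?thesis .
qed

lemma smult_add_left: "(f + f') \<star> g = f \<star> g + f' \<star> g"
  and smult_scale_left: "(c \<cdot> f) \<star> g = c \<cdot> (f \<star> g)"
  and smult_add_right: "f \<star> (g + g') = f \<star> g + f \<star> g'"
  and smult_scale_right: "f \<star> (c \<cdot> g) = c \<cdot> (f \<star> g)"
  by (simp_all add: smult_def lin_simps lin_fun_add lin_fun_scale)

lemma linear_smult_left: "clinear (\<lambda>f. f \<star> g)" and linear_smult_right: "clinear (\<lambda>g. f \<star> g)"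
  by (auto intro!: clinearI simp: smult_add_left smult_scale_left smult_add_right smult_scale_right)

lemmas smult_linear_simps = smult_add_left smult_scale_left smult_add_right smult_scale_right
  cvec_pair.linear_0[OF linear_smult_left] cvec_pair.linear_0[OF linear_smult_right]
  cvec_pair.linear_sum[OF linear_smult_left] cvec_pair.linear_sum[OF linear_smult_right]

lemma smult_bvec [simp]: "bvec m \<star> bvec m' = mono_mult m m'"
  by (simp add: smult_def)

lemma linear_dx: "clinear (dx i)" and linear_de: "clinear (de i)"
  by (simp_all add: dx_def de_def linear_lin)

lemma clinear_add: "clinear F \<Longrightarrow> clinear G \<Longrightarrow> clinear (\<lambda>v. F v + G v)"
  and clinear_cmul: "clinear F \<Longrightarrow> clinear (\<lambda>v. c \<cdot> F v)"
  and clinear_comp: "clinear F \<Longrightarrow> clinear G' \<Longrightarrow> clinear (\<lambda>v. F (G' v))"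
  by (auto intro!: clinearI simp: cvec_pair.linear_add cvec_pair.linear_scale
       cvec.scale_right_distrib cvec.scale_left_commute)

lemma linear_dgen: "clinear (dgen n i s)"
  by (simp add: dgen_def linear_dx linear_de)

lemma bilinear_eqI:
  assumes "\<And>g. clinear (\<lambda>f. F f g)" "\<And>f. clinear (F f)"
    and "\<And>g. clinear (\<lambda>f. G f g)" "\<And>f. clinear (G f)"
    and "\<And>b c. b \<in> keys f \<Longrightarrow> c \<in> keys g \<Longrightarrow> F (bvec b) (bvec c) = G (bvec b) (bvec c)"
  shows "F f g = G f g"
  by (rule linear_eqI[OF assms(1,3)], rule linear_eqI[OF assms(2,4)], rule assms(5))


lemma inversions_empty [simp]: "inversions {} T = 0" "inversions S {} = 0"
  by (simp_all add: inversions_def)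

lemma inversions_insert_left:
  assumes "finite S" "finite T" "i \<notin> S"
  shows "inversions (insert i S) T = inversions S T + card {t \<in> T. t < i}"
proof -
  have "{(s, t) \<in> insert i S \<times> T. t < s} = {(s, t) \<in> S \<times> T. t < s} \<union> Pair i ` {t \<in> T. t < i}"
    by auto
  moreover have "card (Pair i ` {t \<in> T. t < i}) = card {t \<in> T. t < i}"
    by (intro card_image) (auto simp: inj_on_def)
  moreover have "finite {(s, t) \<in> S \<times> T. t < s}"
    by (rule finite_subset[of _ "S \<times> T"]) (use assms in auto)
  moreover have "{(s, t) \<in> S \<times> T. t < s} \<inter> Pair i ` {t \<in> T. t < i} = {}" using assms by auto
  ultimately show ?thesis
    using assms by (simp add: inversions_def card_Un_disjoint)
qed

lemma inversions_insert_right: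
  assumes "finite S" "finite T" "i \<notin> T"
  shows "inversions S (insert i T) = inversions S T + card {s \<in> S. i < s}"
proof -
  have "{(s, t) \<in> S \<times> insert i T. t < s} = {(s, t) \<in> S \<times> T. t < s} \<union> (\<lambda>s. (s, i)) ` {s \<in> S. i < s}"
    by auto
  moreover have "card ((\<lambda>s. (s, i)) ` {s \<in> S. i < s}) = card {s \<in> S. i < s}"
    by (intro card_image) (auto simp: inj_on_def)
  moreover have "finite {(s, t) \<in> S \<times> T. t < s}"
    by (rule finite_subset[of _ "S \<times> T"]) (use assms in auto)
  moreover have "{(s, t) \<in> S \<times> T. t < s} \<inter> (\<lambda>s. (s, i)) ` {s \<in> S. i < s} = {}" using assms by auto
  ultimately show ?thesis
    using assms by (simp add: inversions_def card_Un_disjoint)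
qed

lemma card_greater:
  assumes "finite S" "i \<notin> S"
  shows "card S = card {s \<in> S. s < i} + card {s \<in> S. i < (s::nat)}"
proof -
  have "S = {s \<in> S. s < i} \<union> {s \<in> S. i < s}" using assms by (auto, metis linorder_neqE_nat)
  then have "card S = card ({s \<in> S. s < i} \<union> {s \<in> S. i < s})" by simp
  also have "\<dots> = card {s \<in> S. s < i} + card {s \<in> S. i < s}"
    using assms by (intro card_Un_disjoint) auto
  finally show ?thesis .
qed

lemma card_less_Un:
  assumes "finite S" "finite T" "S \<inter> T = {}"
  shows "card {s \<in> S \<union> T. s < (i::nat)} = card {s \<in> S. s < i} + card {s \<in> T. s < i}"
proof -
  have "{s \<in> S \<union> T. s < i} = {s \<in> S. s < i} \<union> {s \<in> T. s < i}" by auto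
  then show ?thesis using assms by (simp add: card_Un_disjoint disjoint_iff)
qed

lemma card_less_insert [simp]: "card {s. (s = i \<or> s \<in> S) \<and> s < i} = card {s \<in> S. s < (i::nat)}"
  by (rule arg_cong[of _ _ card]) auto

lemma card_less_insert_Un [simp]:
  assumes "finite S" "finite T" "S \<inter> T = {}"
  shows "card {s. (s = i \<or> s \<in> S \<or> s \<in> T) \<and> s < i} = card {s \<in> S. s < (i::nat)} + card {s \<in> T. s < i}"
  using card_less_insert[of i "S \<union> T"] card_less_Un[OF assms, of i] by simp

lemma minus_one_power_parity: "even (k + l) \<Longrightarrow> (-1 :: complex) ^ k = (-1) ^ l"
  by (auto simp: minus_one_power_iff)

lemma xvar_smult_mono: "xvar i \<star> bvec (a, S) = bvec (Poly_Mapping.single i 1 + a, S)"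
  by (simp add: xvar_def)

lemma evar_smult_mono: "evar i \<star> bvec (a, S) =
    (if i \<in> S then 0 else (-1) ^ card {s \<in> S. s < i} \<cdot> bvec (a, insert i S))"
proof -
  have "inversions {i} S = card {s \<in> S. s < i}"
  proof -
    have "{(s, t) \<in> {i} \<times> S. t < s} = Pair i ` {s \<in> S. s < i}" by auto
    then show ?thesis by (simp add: inversions_def card_image inj_on_def)
  qed
  then show ?thesis by (simp add: evar_def)
qed

lemma dx_mono: "dx i (bvec (a, S)) = of_nat (lookup a i) \<cdot> bvec (a - Poly_Mapping.single i 1, S)"
  by (simp add: dx_def)

lemma de_mono: "de i (bvec (a, S)) =
    (if i \<in> S then (-1) ^ card {s \<in> S. s < i} \<cdot> bvec (a, S - {i}) else 0)"
  by (simp add: de_def)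

lemma xvar_assoc_mono:
  "(xvar i \<star> bvec (a, S)) \<star> bvec (b, T) = xvar i \<star> (bvec (a, S) \<star> bvec (b, T))"
  by (simp add: xvar_smult_mono smult_linear_simps add.assoc)

lemma xvar_swap_mono:
  "bvec (a, S) \<star> (xvar i \<star> bvec (b, T)) = xvar i \<star> (bvec (a, S) \<star> bvec (b, T))"
  by (simp add: xvar_smult_mono smult_linear_simps add.left_commute)

lemma evar_assoc_mono:
  assumes "finite S" "finite T"
  shows "(evar i \<star> bvec (a, S)) \<star> bvec (b, T) = evar i \<star> (bvec (a, S) \<star> bvec (b, T))"
proof (cases "i \<notin> S \<and> i \<notin> T \<and> S \<inter> T = {}")
  case True
  then show ?thesis
    using assms by (simp add: evar_smult_mono smult_linear_simps inversions_insert_left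
        card_less_Un[unfolded Un_iff] power_add mult.commute mult.left_commute)
next
  case False
  then show ?thesis
    by (auto simp: evar_smult_mono smult_linear_simps)
qed

lemma evar_swap_mono:
  assumes "finite S" "finite T"
  shows "bvec (a, S) \<star> (evar i \<star> bvec (b, T)) =
    (-1) ^ card S \<cdot> evar i \<star> (bvec (a, S) \<star> bvec (b, T))"
proof (cases "i \<notin> S \<and> i \<notin> T \<and> S \<inter> T = {}")
  case True
  then show ?thesis
    using assms card_greater[of S i]
    by (auto simp: evar_smult_mono smult_linear_simps inversions_insert_right card_less_Un[unfolded Un_iff]
        simp flip: power_add intro!: arg_cong2[of _ _ _ _ "(\<cdot>)"] minus_one_power_parity)
next
  case False
  then show ?thesis
    by (auto simp: evar_smult_mono smult_linear_simps)
qed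

lemma dx_leibniz_mono:
  "dx i (bvec (a, S) \<star> bvec (b, T)) =
     dx i (bvec (a, S)) \<star> bvec (b, T) + bvec (a, S) \<star> dx i (bvec (b, T))"
proof -
  have 1: "a + b - Poly_Mapping.single i 1 = (a - Poly_Mapping.single i 1) + b" if "lookup a i \<noteq> 0"
    using that by (intro poly_mapping_eqI) (auto simp: lookup_add lookup_minus lookup_single when_def)
  have 2: "a + b - Poly_Mapping.single i 1 = a + (b - Poly_Mapping.single i 1)" if "lookup b i \<noteq> 0"
    using that by (intro poly_mapping_eqI) (auto simp: lookup_add lookup_minus lookup_single when_def)
  show ?thesis
    by (cases "lookup a i = 0"; cases "lookup b i = 0")
      (simp_all add: dx_mono smult_linear_simps lookup_add cvec_pair.linear_scale[OF linear_dx]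
        cvec_pair.linear_0[OF linear_dx] cvec.scale_left_distrib cvec.scale_right_distrib mult.commute
        flip: 1[simplified] 2[simplified])
qed

lemma de_leibniz_mono:
  assumes fin: "finite S" "finite T"
  shows "de i (bvec (a, S) \<star> bvec (b, T)) =
     de i (bvec (a, S)) \<star> bvec (b, T) + (-1) ^ card S \<cdot> bvec (a, S) \<star> de i (bvec (b, T))"
proof -
  note simps = de_mono smult_linear_simps cvec_pair.linear_scale[OF linear_de]
    cvec_pair.linear_0[OF linear_de]
  define S' T' where "S' = S - {i}" and "T' = T - {i}"
  have fin': "finite S'" "finite T'" "i \<notin> S'" "i \<notin> T'" using fin by (auto simp: S'_def T'_def)
  consider "i \<notin> S" "i \<notin> T" | "S = insert i S'" "i \<notin> T" | "i \<notin> S" "T = insert i T'"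
    | "S = insert i S'" "T = insert i T'"
    by (auto simp: S'_def T'_def)
  then show ?thesis
  proof cases
    case 1
    then show ?thesis by (simp add: simps)
  next
    case 2
    have "insert i (S' \<union> T) - {i} = S' \<union> T" using 2 fin' by auto
    with 2 fin fin' show ?thesis
      by (auto simp: simps inversions_insert_left card_less_Un[unfolded Un_iff] card_less_insert_Un
          simp flip: power_add intro!: arg_cong2[of _ _ _ _ "(\<cdot>)"] minus_one_power_parity)
  next
    case 3
    have "insert i (S \<union> T') - {i} = S \<union> T'" using 3 fin' by auto
    with 3 fin fin' card_greater[of S i] show ?thesis
      by (auto simp: simps inversions_insert_right card_less_Un[unfolded Un_iff] card_less_insert_Un
          simp flip: power_add intro!: arg_cong2[of _ _ _ _ "(\<cdot>)"] minus_one_power_parity)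
  next
    case 4
    show ?thesis
    proof (cases "S' \<inter> T' = {}")
      case True
      have "{s. (s = i \<or> s \<in> S') \<and> i < s} = {s \<in> S'. i < s}" by auto
      with 4 fin fin' True card_greater[of S' i] show ?thesis
        by (auto simp: simps inversions_insert_left inversions_insert_right minus_one_power_iff
            simp flip: cvec.scale_left_distrib)
    next
      case False
      with 4 fin' show ?thesis by (auto simp: simps)
    qed
  qed
qed


lemma sum_bool: "(\<Sum>s\<in>(UNIV :: bool set). f s) = f False + f True"
  by (simp add: UNIV_bool add.commute)

lemma gen_mono_cases:
  assumes "finite S"
  shows "\<exists>c a' S'. finite S' \<and> dgen n j s (bvec (a, S)) = c \<cdot> bvec (a', S')"
proof (cases "(j = 2*n+1) = s")
  case True
  then show ?thesis using assms unfolding dgen_def by (auto simp: dx_mono)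
next
  case False
  show ?thesis
  proof (cases "j \<in> S")
    case True
    with False assms show ?thesis unfolding dgen_def
      by (intro exI[of _ "(-1) ^ card {s \<in> S. s < j}"] exI[of _ a] exI[of _ "S - {j}"]) (auto simp: de_mono)
  next
    case False': False
    with False assms show ?thesis unfolding dgen_def
      by (intro exI[of _ 0] exI[of _ a] exI[of _ S]) (auto simp: de_mono)
  qed
qed

definition gen_odd :: "nat \<Rightarrow> nat \<Rightarrow> bool \<Rightarrow> bool" where
  "gen_odd n i s = ((i = 2*n+1) \<noteq> s)"

lemma gen_assoc_mono:
  assumes "finite S" "finite T"
  shows "(gen n i s \<star> bvec (a, S)) \<star> bvec (b, T) = gen n i s \<star> (bvec (a, S) \<star> bvec (b, T))"
  using assms by (auto simp: gen_def xvar_assoc_mono evar_assoc_mono)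

lemma gen_swap_mono:
  assumes "finite S" "finite T"
  shows "bvec (a, S) \<star> (gen n i s \<star> bvec (b, T)) =
    ksign (gen_odd n i s) (odd (card S)) \<cdot> gen n i s \<star> (bvec (a, S) \<star> bvec (b, T))"
  using assms by (auto simp: gen_def gen_odd_def ksign_def xvar_swap_mono evar_swap_mono)

lemma dgen_leibniz_mono:
  assumes "finite S" "finite T"
  shows "dgen n i s (bvec (a, S) \<star> bvec (b, T)) =
    dgen n i s (bvec (a, S)) \<star> bvec (b, T) +
    ksign (gen_odd n i s) (odd (card S)) \<cdot> bvec (a, S) \<star> dgen n i s (bvec (b, T))"
  using assms by (auto simp: dgen_def gen_odd_def ksign_def dx_leibniz_mono de_leibniz_mono simp del: smult_bvec)

lemma gl_entry:
  assumes "X \<in> gl n p" "i \<in> {1..2*n+1}" "j \<in> {1..2*n+1}" "entry X i j \<noteq> 0"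
  shows "(i = 2*n+1) = (p \<noteq> (j = 2*n+1))"
proof -
  have "bvec j \<in> hom_part (natural n) (j = 2*n+1)"
    using assms(3) by (auto simp: hom_part_def natural_def bvec_def)
  then have "X (bvec j) \<in> hom_part (natural n) (p \<noteq> (j = 2*n+1))"
    using assms(1) by (auto simp: gl_def)
  moreover have "i \<in> keys (X (bvec j))"
    using assms(4) by (simp add: entry_def in_keys_iff)
  ultimately show ?thesis by (auto simp: hom_part_def natural_def)
qed

lemma spo_act_expand:
  "spo_act n X f = (\<Sum>s\<in>UNIV. \<Sum>j\<in>{1..2*n+1}. \<Sum>i\<in>{1..2*n+1}.
     entry X i j \<cdot> gen n i s \<star> dgen n j s f)"
  by (simp add: spo_act_def emb_def entry_def smult_linear_simps)

lemma linear_spo_act: "clinear (spo_act n X)"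
  unfolding spo_act_expand
  by (rule clinearI)
    (simp_all add: cvec_pair.linear_add[OF linear_dgen] cvec_pair.linear_scale[OF linear_dgen]
      smult_linear_simps cvec.scale_right_distrib sum.distrib cvec.scale_sum_right mult.commute del: sum.cl_ivl_Suc)

lemma spo_act_leibniz_mono:
  assumes X: "X \<in> gl n p" and fin: "finite S" "finite T"
  shows "spo_act n X (bvec (a, S) \<star> bvec (b, T)) =
    spo_act n X (bvec (a, S)) \<star> bvec (b, T) +
    ksign p (odd (card S)) \<cdot> bvec (a, S) \<star> spo_act n X (bvec (b, T))"
proof -
  let ?m = "bvec (a, S)" and ?m' = "bvec (b, T)"
  have "entry X i j \<cdot> gen n i s \<star> dgen n j s (?m \<star> ?m') =
      (entry X i j \<cdot> gen n i s \<star> dgen n j s ?m) \<star> ?m' +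
      ksign p (odd (card S)) \<cdot> ?m \<star> (entry X i j \<cdot> gen n i s \<star> dgen n j s ?m')"
    if ij: "i \<in> {1..2*n+1}" "j \<in> {1..2*n+1}" for i j s
  proof (cases "entry X i j = 0")
    case False
    obtain c1 a1 S1 where 1: "finite S1" "dgen n j s ?m = c1 \<cdot> bvec (a1, S1)"
      using gen_mono_cases[OF fin(1), of n j s a] by metis
    obtain c2 a2 S2 where 2: "finite S2" "dgen n j s ?m' = c2 \<cdot> bvec (a2, S2)"
      using gen_mono_cases[OF fin(2), of n j s b] by metis
    have A: "gen n i s \<star> (dgen n j s ?m \<star> ?m') = (gen n i s \<star> dgen n j s ?m) \<star> ?m'"
      unfolding 1(2) using gen_assoc_mono[OF 1(1) fin(2)] by (simp only: smult_linear_simps)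
    have B: "?m \<star> (gen n i s \<star> dgen n j s ?m') =
        ksign (gen_odd n i s) (odd (card S)) \<cdot> gen n i s \<star> (?m \<star> dgen n j s ?m')"
      unfolding 2(2) using gen_swap_mono[OF fin(1) 2(1)]
      by (simp only: smult_linear_simps) (simp add: mult.commute)
    have "ksign p (odd (card S)) * ksign (gen_odd n i s) (odd (card S)) = ksign (gen_odd n j s) (odd (card S))"
      using gl_entry[OF X ij False] by (auto simp: ksign_def gen_odd_def)
    then show ?thesis
      by (simp only: dgen_leibniz_mono[OF fin] smult_add_right smult_scale_right smult_scale_left A B
          cvec.scale_right_distrib cvec.scale_scale) (simp add: mult.commute mult.left_commute)
  qed (simp add: smult_linear_simps)
  then show ?thesis
    by (simp add: spo_act_expand smult_linear_simps cvec.scale_sum_right sum.distrib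
        del: smult_bvec sum.cl_ivl_Suc)
qed

lemma spo_act_superderivation:
  assumes X: "X \<in> gl n p" and f: "f \<in> hom_part (SE_space n) q" and g: "g \<in> vecs (SE_space n)"
  shows "spo_act n X (f \<star> g) = spo_act n X f \<star> g + ksign p q \<cdot> f \<star> spo_act n X g"
proof (rule bilinear_eqI[where F = "\<lambda>f g. spo_act n X (f \<star> g)"
      and G = "\<lambda>f g. spo_act n X f \<star> g + ksign p q \<cdot> f \<star> spo_act n X g"])
  note lins = cvec_pair.linear_add[OF linear_spo_act] cvec_pair.linear_scale[OF linear_spo_act]
    smult_linear_simps cvec.scale_right_distrib cvec.scale_left_commute
  show "clinear (\<lambda>f. spo_act n X (f \<star> g))" "clinear (\<lambda>g. spo_act n X (f \<star> g))"
    "clinear (\<lambda>f. spo_act n X f \<star> g + ksign p q \<cdot> f \<star> spo_act n X g)"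
    "clinear (\<lambda>g. spo_act n X f \<star> g + ksign p q \<cdot> f \<star> spo_act n X g)" for f g
    by (auto intro!: clinearI simp: lins)
next
  fix m m' assume m: "m \<in> keys f" and m': "m' \<in> keys g"
  obtain a S b T where [simp]: "m = (a, S)" "m' = (b, T)" by fastforce
  have "S \<subseteq> {1..2*n+1}" "odd (card S) = q" "T \<subseteq> {1..2*n+1}"
    using m m' f g by (auto simp: hom_part_def vecs_def SE_space_def simp del: atLeastAtMost_iff)
  then have "finite S" "odd (card S) = q" "finite T"
    using finite_subset by blast+
  with spo_act_leibniz_mono[OF X, of S T a b]
  show "spo_act n X (bvec m \<star> bvec m') =
      spo_act n X (bvec m) \<star> bvec m' + ksign p q \<cdot> bvec m \<star> spo_act n X (bvec m')"
    by simp
qed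

lemma gen_smult_one: "gen n i s \<star> bvec (0, {}) = gen n i s"
  by (auto simp: gen_def xvar_smult_mono evar_smult_mono) (simp_all add: xvar_def evar_def)

lemma dgen_gen: "dgen n j s (gen n i t) = (if i = j \<and> s = t then bvec (0, {}) else 0)"
proof -
  have k: "{s. s = k \<and> s < k} = {}" for k :: nat by auto
  show ?thesis
    by (auto simp: k dgen_def gen_def xvar_def evar_def dx_mono de_mono lookup_single when_def)
qed

lemma spo_act_gen:
  assumes "i \<in> {1..2*n+1}"
  shows "spo_act n X (gen n i s) = emb n (X (bvec i)) s"
proof -
  have "spo_act n X (gen n i s) = (\<Sum>t\<in>UNIV. \<Sum>j\<in>{1..2*n+1}. if j = i \<and> t = s then emb n (X (bvec i)) s else 0)"
    unfolding spo_act_def dgen_gen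
    by (intro sum.cong refl) (auto simp: emb_def smult_linear_simps gen_smult_one)
  also have "\<dots> = emb n (X (bvec i)) s"
    using assms by (cases s) (simp_all add: sum_bool)
  finally show ?thesis .
qed

lemma spo_act_emb:
  assumes X: "X \<in> gl n p" and v: "v \<in> vecs (natural n)"
  shows "spo_act n X (emb n v s) = emb n (X v) s"
proof (rule linear_eqI[where F = "\<lambda>v. spo_act n X (emb n v s)" and G = "\<lambda>v. emb n (X v) s"])
  have emb: "clinear (\<lambda>v. emb n v s)"
    by (rule clinearI) (simp_all add: emb_def lookup_add cvec.scale_left_distrib sum.distrib
      cvec.scale_sum_right del: sum.cl_ivl_Suc)
  then show "clinear (\<lambda>v. spo_act n X (emb n v s))"
    by (rule clinear_comp[OF linear_spo_act])
  obtain a where a: "X = (\<lambda>v. \<Sum>i\<in>{1..2*n+1}. \<Sum>j\<in>{1..2*n+1}. a i j \<cdot> matunit i j v)"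
    using X by (auto simp: gl_def)
  have "clinear X"
    unfolding a by (rule clinearI)
      (simp_all add: matunit_def lookup_add cvec.scale_right_distrib cvec.scale_left_distrib sum.distrib
        cvec.scale_sum_right mult.left_commute distrib_left)
  with emb show "clinear (\<lambda>v. emb n (X v) s)"
    by (rule clinear_comp)
next
  fix i assume "i \<in> keys v"
  then have i: "i \<in> {1..2*n+1}" using v by (auto simp: vecs_def natural_def)
  have "emb n (bvec i) s = (\<Sum>k\<in>{1..2*n+1}. if k = i then gen n i s else 0)"
    unfolding emb_def by (intro sum.cong) (auto simp: bvec_def lookup_single)
  with i have "emb n (bvec i) s = gen n i s" by simp
  then show "spo_act n X (emb n (bvec i) s) = emb n (X (bvec i)) s"
    using i by (simp add: spo_act_gen)
qed


section \<open>The Lie superalgebra osp(2|2) of operators on S(E)\<close>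

definition alpha :: "nat \<Rightarrow> complex" where
  "alpha n = (2 * of_nat n - 1) / 2"

definition F11 :: "nat \<Rightarrow> smono cvec \<Rightarrow> smono cvec" where
  "F11 n f = (\<Sum>i\<in>{1..2*n}. xvar i \<star> dx i f) + evar (2*n+1) \<star> de (2*n+1) f + alpha n \<cdot> f"

definition F22 :: "nat \<Rightarrow> smono cvec \<Rightarrow> smono cvec" where
  "F22 n f = (\<Sum>i\<in>{1..2*n}. evar i \<star> de i f) + xvar (2*n+1) \<star> dx (2*n+1) f - alpha n \<cdot> f"

definition F21 :: "nat \<Rightarrow> smono cvec \<Rightarrow> smono cvec" where
  "F21 n f = xvar (2*n+1) \<star> de (2*n+1) f - (\<Sum>i\<in>{1..2*n}. evar i \<star> dx i f)"

definition F12 :: "nat \<Rightarrow> smono cvec \<Rightarrow> smono cvec" where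
  "F12 n f = evar (2*n+1) \<star> dx (2*n+1) f - (\<Sum>i\<in>{1..2*n}. xvar i \<star> de i f)"

definition D12 :: "nat \<Rightarrow> smono cvec \<Rightarrow> smono cvec" where
  "D12 n f = dx (2*n+1) (de (2*n+1) f) +
     (\<Sum>i\<in>{1..n}. dx i (de (2*n+1-i) f) - dx (2*n+1-i) (de i f))"

definition D22 :: "nat \<Rightarrow> smono cvec \<Rightarrow> smono cvec" where
  "D22 n f = dx (2*n+1) (dx (2*n+1) f) + 2 \<cdot> (\<Sum>i\<in>{1..n}. de i (de (2*n+1-i) f))"

definition R12 :: "nat \<Rightarrow> smono cvec \<Rightarrow> smono cvec" where
  "R12 n f = (xvar (2*n+1) \<star> evar (2*n+1) +
     (\<Sum>i\<in>{1..n}. evar i \<star> xvar (2*n+1-i) - evar (2*n+1-i) \<star> xvar i)) \<star> f"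

definition R22 :: "nat \<Rightarrow> smono cvec \<Rightarrow> smono cvec" where
  "R22 n f = (xvar (2*n+1) \<star> xvar (2*n+1) +
     2 \<cdot> (\<Sum>i\<in>{1..n}. evar i \<star> evar (2*n+1-i))) \<star> f"

text \<open>All these formulas define operators on the algebra in infinitely many variables
  \<open>x\<^sub>i, \<eta>\<^sub>i\<close>; they preserve \<open>S(E)\<close>, involve only the variables of \<open>S(E)\<close>, and linear relations
  and supercommutators are the same on both spaces.\<close>

definition osp :: "nat \<Rightarrow> smono lie_super" where
  "osp n p =
     (if p then {\<lambda>f. a \<cdot> F12 n f + b \<cdot> F21 n f + c \<cdot> D12 n f + d \<cdot> R12 n f | a b c d. True}
      else {\<lambda>f. a \<cdot> F11 n f + b \<cdot> F22 n f + c \<cdot> D22 n f + d \<cdot> R22 n f | a b c d. True})"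

definition osp_irreducible :: "nat \<Rightarrow> complex \<times> complex \<Rightarrow> (smono, 'b) supermod \<Rightarrow> bool" where
  "osp_irreducible n mu M \<longleftrightarrow>
     irreducible (osp n) M \<and>
     (\<exists>p. \<exists>v\<in>hom_part M p. v \<noteq> 0 \<and>
        rep M True (F12 n) v = 0 \<and> rep M True (D12 n) v = 0 \<and> rep M False (D22 n) v = 0 \<and>
        rep M False (F11 n) v = fst mu \<cdot> v \<and> rep M False (F22 n) v = snd mu \<cdot> v)"

definition SE :: "nat \<Rightarrow> (nat, smono, smono) joint_mod" where
  "SE n = \<lparr> basis = basis (SE_space n), par = par (SE_space n),
            lrep = (\<lambda>p X. spo_act n X), rrep = (\<lambda>p Y. Y) \<rparr>"


section \<open>The summands\<close>

datatype summand = Triv_lo | Triv_hi | Hook_lo nat nat | Hook_hi nat nat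

definition summands :: "nat \<Rightarrow> summand set" where
  "summands n = {Triv_lo, Triv_hi} \<union>
     (\<Union>d. \<Union>k\<in>{1..n}. {Hook_lo d k, Hook_hi d k})"

definition hook_weight :: "nat \<Rightarrow> nat \<Rightarrow> nat \<Rightarrow> complex list" where
  "hook_weight n d k = [of_nat d + 1] @ replicate (k - 1) 1 @ replicate (n - k) 0"

fun spo_weight :: "nat \<Rightarrow> summand \<Rightarrow> complex list" where
  "spo_weight n Triv_lo = replicate n 0"
| "spo_weight n Triv_hi = replicate n 0"
| "spo_weight n (Hook_lo d k) = hook_weight n d k"
| "spo_weight n (Hook_hi d k) = hook_weight n d k"

fun osp_weight :: "nat \<Rightarrow> summand \<Rightarrow> complex \<times> complex" where
  "osp_weight n Triv_lo = (alpha n, - alpha n)"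
| "osp_weight n Triv_hi = (1 + alpha n, 2 * of_nat n - alpha n)"
| "osp_weight n (Hook_lo d k) = (of_nat d + 1 + alpha n, of_nat k - 1 - alpha n)"
| "osp_weight n (Hook_hi d k) = (of_nat d + 1 + alpha n, 2 * of_nat n - of_nat k - alpha n)"

end

theory Submission
  imports Defs "HOL-Library.FuncSet" "HOL-Library.Countable_Set"
begin

text \<open>
  Both Lie superalgebras act through odd generators: spo(2n|1) through $2n$ operators $O_i$, osp(2|2)
  through $F_{1,2}, D_{12}, F_{2,1}, R_{12}$, and the two families anticommute. The bilinear form with
  orthogonal monomials of suitable nonzero norms is contravariant for both. A joint highest weight
  vector is determined by its restriction to $x_1 = 1$, $x_2 = \dots = x_{2n} = \eta_{2n+1} = 0$, which is
  built from harmonic polynomials in $x_{2n+1}$ and the remaining $\eta_i$; in each degree $l \le 2n+1$ there is, up to scalars,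
  one admissible harmonic $h_l$, the top one being $r^{2n+1}$. Hence the joint highest weight vectors are
  $1$ and $F_{1,2}(x_1^d h_l)$ with $1 \le l \le 2n$, or $d = 0$ and $l = 2n+1$. They are pairwise
  orthogonal with nonzero norms, so the form is nondegenerate on their orbits; this gives
  irreducibility of the orbits, and an orthogonal complement of their sum would contain a further
  joint highest weight vector. Multiplication by
  $r^{2n+1}$ identifies the two spo(2n|1)-modules with the same highest weight.
\<close>

subsection \<open>Multiplication and derivation operators\<close>

text \<open>Complete reducibility is not assumed anywhere; the contravariant form takes over its
  role. Submodules are controlled through the singular vectors they contain, and exhaustion of S(E)
  is a duality argument inside one total degree at a time. The obstacle is that the spo-module of a
  summand may depend on the weight alone, while two joint highest weight vectors with different osp
  weights share each spo weight. Their orbits have to be matched by operators: an element of the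
  algebra generated by the \<open>om i\<close> kills one of the two vectors exactly when it kills
  the other. The exponent in r^(2n+1) is 2 - M, where M = 1 - 2n is the superdimension of the space
  with one even and 2n odd coordinates: r^(2-M) is the analogue of the fundamental solution of the
  Laplacian, here a polynomial. The operator F_{1,2} in F_{1,2}(x_1^d h_l) is an odd reflection:
  x_1^d h_l itself is singular for the Borel subalgebra with F_{2,1} in place of F_{1,2}.\<close>

definition mx :: "nat \<Rightarrow> smono cvec \<Rightarrow> smono cvec" where
  "mx i f = xvar i \<star> f"

definition me :: "nat \<Rightarrow> smono cvec \<Rightarrow> smono cvec" where
  "me i f = evar i \<star> f"

lemma linear_mx: "clinear (mx i)" and linear_me: "clinear (me i)"
  using linear_smult_right[of "xvar i"] linear_smult_right[of "evar i"]
  by (simp_all add: mx_def[abs_def] me_def[abs_def])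

lemma clinear_id: "clinear (\<lambda>f. f)"
  by (rule clinearI) auto
lemma clinear_zero: "clinear (\<lambda>f. 0)"
  by (rule clinearI) auto
lemma clinear_diff: "clinear F \<Longrightarrow> clinear G \<Longrightarrow> clinear (\<lambda>v. F v - G v)"
  by (auto intro!: clinearI simp: cvec_pair.linear_add cvec_pair.linear_scale
       cvec.scale_right_diff_distrib)
lemma clinear_neg: "clinear F \<Longrightarrow> clinear (\<lambda>v. - F v)"
  by (auto intro!: clinearI simp: cvec_pair.linear_add cvec_pair.linear_scale)
lemma clinear_sum: "(\<And>i. i \<in> I \<Longrightarrow> clinear (F i)) \<Longrightarrow> clinear (\<lambda>v. \<Sum>i\<in>I. F i v)"
  by (rule clinearI) (simp_all add: cvec_pair.linear_add cvec_pair.linear_scale sum.distrib cvec.scale_sum_right)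
lemma clinear_if: "clinear F \<Longrightarrow> clinear G \<Longrightarrow> clinear (\<lambda>v. if P then F v else G v)"
  by (cases P) auto

lemmas clin = clinear_id clinear_zero clinear_add clinear_diff clinear_neg clinear_cmul clinear_sum clinear_if
  clinear_comp[OF linear_mx] clinear_comp[OF linear_me] clinear_comp[OF linear_dx] clinear_comp[OF linear_de]
  linear_mx linear_me linear_dx linear_de

lemmas clinD = cvec_pair.linear_add cvec_pair.linear_diff cvec_pair.linear_neg cvec_pair.linear_scale
  cvec_pair.linear_0 cvec_pair.linear_sum

lemmas mx_lin [simp] = clinD[OF linear_mx]
lemmas me_lin [simp] = clinD[OF linear_me]
lemmas dx_lin [simp] = clinD[OF linear_dx]
lemmas de_lin [simp] = clinD[OF linear_de]

lemma op_eqI: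
  assumes "clinear F" "clinear G" "\<And>a S. F (bvec (a, S)) = G (bvec (a, S))"
  shows "F f = G (f :: smono cvec)"
proof (rule linear_eqI[OF assms(1,2)])
  fix b :: smono
  show "F (bvec b) = G (bvec b)" by (cases b) (simp add: assms(3))
qed

text \<open>Koszul sign of sorting \<eta>_i into the increasing product over \<open>S\<close>;
  multiplication and derivation carry the same sign.\<close>

definition sg :: "nat \<Rightarrow> nat set \<Rightarrow> complex" where
  "sg i S = (-1) ^ card {s \<in> S. s < i}"

lemma sg_insert: "sg i (insert j S) = (if j < i \<and> j \<notin> S then - sg i S else sg i S)"
proof -
  have fin: "finite {s \<in> S. s < i}" by (rule finite_subset[of _ "{..<i}"]) auto
  show ?thesis
  proof (cases "j < i \<and> j \<notin> S")
    case True
    then have "{s \<in> insert j S. s < i} = insert j {s \<in> S. s < i}" by auto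
    with True fin show ?thesis by (simp add: sg_def)
  next
    case False
    then have "{s \<in> insert j S. s < i} = {s \<in> S. s < i}" by auto
    with False show ?thesis by (auto simp: sg_def)
  qed
qed

lemma sg_remove: "sg i (S - {j}) = (if j < i \<and> j \<in> S then - sg i S else sg i S)"
  using sg_insert[of i j "S - {j}"] by (cases "j \<in> S") (auto simp: insert_absorb)

lemma sg_sq [simp]: "sg i S * sg i S = 1" "sg i S * (sg i S * z) = z"
  by (simp_all add: sg_def flip: power_add mult.assoc)

lemma mx_bvec: "mx i (bvec (a, S)) = bvec (Poly_Mapping.single i 1 + a, S)"
  by (simp add: mx_def xvar_smult_mono)
lemma me_bvec: "me i (bvec (a, S)) = (if i \<in> S then 0 else sg i S \<cdot> bvec (a, insert i S))"
  by (simp add: me_def evar_smult_mono sg_def)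
lemma dx_bvec: "dx i (bvec (a, S)) = of_nat (lookup a i) \<cdot> bvec (a - Poly_Mapping.single i 1, S)"
  by (rule dx_mono)
lemma de_bvec: "de i (bvec (a, S)) = (if i \<in> S then sg i S \<cdot> bvec (a, S - {i}) else 0)"
  by (simp add: de_mono sg_def)

lemmas op_bvec = mx_bvec me_bvec dx_bvec de_bvec

lemma mx_mx: "mx i (mx j f) = mx j (mx i f)"
  by (rule op_eqI[of "\<lambda>f. mx i (mx j f)" "\<lambda>f. mx j (mx i f)"]; (intro clin)?) (simp add: op_bvec add.left_commute)

lemma dx_dx: "dx i (dx j f) = dx j (dx i f)"
proof (rule op_eqI[of "\<lambda>f. dx i (dx j f)" "\<lambda>f. dx j (dx i f)"]; (intro clin)?)
  fix a S
  show "dx i (dx j (bvec (a, S))) = dx j (dx i (bvec (a, S)))"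
    by (cases "i = j") (auto simp: op_bvec lookup_minus lookup_single diff_diff_eq add.commute mult.commute)
qed

lemma dx_mx: "dx i (mx j f) = mx j (dx i f) + (if i = j then f else 0)"
proof (rule op_eqI[of "\<lambda>f. dx i (mx j f)" "\<lambda>f. mx j (dx i f) + (if i = j then f else 0)"]; (intro clin)?)
  fix a S
  show "dx i (mx j (bvec (a, S))) = mx j (dx i (bvec (a, S))) + (if i = j then bvec (a, S) else 0)"
  proof (cases "i = j")
    case True
    have "Poly_Mapping.single j 1 + (a - Poly_Mapping.single j 1) = a" if "lookup a j \<noteq> 0"
      using that by (intro poly_mapping_eqI) (auto simp: lookup_add lookup_minus lookup_single when_def)
    with True show ?thesis
      by (cases "lookup a j = 0")
         (auto simp: op_bvec lookup_add lookup_single cvec.scale_left_distrib algebra_simps)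
  next
    case False
    then have "Poly_Mapping.single j 1 + a - Poly_Mapping.single i 1 = Poly_Mapping.single j 1 + (a - Poly_Mapping.single i 1)"
      by (intro poly_mapping_eqI) (auto simp: lookup_add lookup_minus lookup_single when_def)
    with False show ?thesis by (simp add: op_bvec lookup_add lookup_single)
  qed
qed

lemma me_me: "me i (me j f) = - me j (me i f)"
  by (rule op_eqI[of "\<lambda>f. me i (me j f)" "\<lambda>f. - me j (me i f)"]; (intro clin)?)
     (auto simp: op_bvec sg_insert insert_commute mult.commute)

lemma me_me_same [simp]: "me i (me i f) = 0"
  by (rule op_eqI[of "\<lambda>f. me i (me i f)" "\<lambda>f. 0"]; (intro clin)?) (auto simp: op_bvec)

lemma de_de: "de i (de j f) = - de j (de i f)"
proof (rule op_eqI[of "\<lambda>f. de i (de j f)" "\<lambda>f. - de j (de i f)"]; (intro clin)?)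
  fix a S
  have "S - {i} - {j} = S - {j} - {i}" by auto
  then show "de i (de j (bvec (a, S))) = - de j (de i (bvec (a, S)))"
    by (auto simp: op_bvec sg_remove mult.commute)
qed

lemma de_de_same [simp]: "de i (de i f) = 0"
  by (rule op_eqI[of "\<lambda>f. de i (de i f)" "\<lambda>f. 0"]; (intro clin)?) (auto simp: op_bvec)

lemma de_me: "de i (me j f) = (if i = j then f else 0) - me j (de i f)"
proof (rule op_eqI[of "\<lambda>f. de i (me j f)" "\<lambda>f. (if i = j then f else 0) - me j (de i f)"]; (intro clin)?)
  fix a S
  have "insert j S - {i} = insert j (S - {i})" if "i \<noteq> j" using that by auto
  then show "de i (me j (bvec (a, S))) = (if i = j then bvec (a, S) else 0) - me j (de i (bvec (a, S)))"
    by (auto simp: op_bvec sg_insert sg_remove insert_absorb mult.commute)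
qed

lemma me_mx: "me i (mx j f) = mx j (me i f)"
  by (rule op_eqI[of "\<lambda>f. me i (mx j f)" "\<lambda>f. mx j (me i f)"]; (intro clin)?) (auto simp: op_bvec)
lemma de_mx: "de i (mx j f) = mx j (de i f)"
  by (rule op_eqI[of "\<lambda>f. de i (mx j f)" "\<lambda>f. mx j (de i f)"]; (intro clin)?) (auto simp: op_bvec)
lemma dx_me: "dx i (me j f) = me j (dx i f)"
  by (rule op_eqI[of "\<lambda>f. dx i (me j f)" "\<lambda>f. me j (dx i f)"]; (intro clin)?) (auto simp: op_bvec mult.commute)
lemma de_dx: "de i (dx j f) = dx j (de i f)"
  by (rule op_eqI[of "\<lambda>f. de i (dx j f)" "\<lambda>f. dx j (de i f)"]; (intro clin)?) (auto simp: op_bvec mult.commute)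

lemmas ccr = dx_mx de_me me_mx de_mx dx_me de_dx

lemma op_if [simp]:
  "mx i (if b then f else 0) = (if b then mx i f else 0)"
  "me i (if b then f else 0) = (if b then me i f else 0)"
  "dx i (if b then f else 0) = (if b then dx i f else 0)"
  "de i (if b then f else 0) = (if b then de i f else 0)"
  "k \<cdot> (if b then f else 0) = (if b then k \<cdot> f else 0)"
  "- (if b then f else 0) = (if b then - f else (0 :: smono cvec))"
  by simp_all

lemmas scale_simps = cvec.scale_right_distrib cvec.scale_right_diff_distrib cvec.scale_sum_right
lemmas sum_simps = sum.distrib sum_subtractf sum_negf

subsection \<open>The generators of the dual pair\<close>

locale howe =
  fixes n :: nat
  assumes n_pos: "1 \<le> n"
begin

text \<open>The variables are indexed by \<open>J = I \<union> {cc}\<close>; \<open>cc\<close> stands for $2n+1$, \<open>pr\<close> for the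
  involution pairing $u_i$ with $u_{2n+1-i}$ in the form, and \<open>sn\<close> for its sign.\<close>

definition cc :: nat where "cc = 2*n+1"
definition I :: "nat set" where "I = {1..2*n}"
definition J :: "nat set" where "J = {1..2*n+1}"
definition pr :: "nat \<Rightarrow> nat" where "pr i = 2*n+1-i"
definition sn :: "nat \<Rightarrow> complex" where "sn i = (if i \<le> n then 1 else -1)"

lemma fin_I [simp]: "finite I" and fin_J [simp]: "finite J" by (simp_all add: I_def J_def)
lemma J_eq: "J = insert cc I" by (auto simp: I_def J_def cc_def)
lemma cc_notin [simp]: "cc \<notin> I" by (simp add: I_def cc_def)
lemma cc_J [simp]: "cc \<in> J" by (simp add: J_eq)
lemma I_J [simp]: "i \<in> I \<Longrightarrow> i \<in> J" by (simp add: J_eq)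
lemma I_ne_cc [simp]: "i \<in> I \<Longrightarrow> i \<noteq> cc" "i \<in> I \<Longrightarrow> cc \<noteq> i" by auto
lemma pr_I [simp]: "i \<in> I \<Longrightarrow> pr i \<in> I" by (auto simp: I_def pr_def)
lemma pr_pr [simp]: "i \<in> I \<Longrightarrow> pr (pr i) = i" by (auto simp: I_def pr_def)
lemma pr_ne [simp]: "i \<in> I \<Longrightarrow> pr i \<noteq> i" "i \<in> I \<Longrightarrow> i \<noteq> pr i"
  by (auto simp: I_def pr_def) presburger+
lemma sn_pr [simp]: "i \<in> I \<Longrightarrow> sn (pr i) = - sn i" by (auto simp: I_def pr_def sn_def)
lemma sn_sq [simp]: "sn i * sn i = 1" "sn i * (sn i * z) = z" by (auto simp: sn_def)
lemma pr_eq_iff: "i \<in> I \<Longrightarrow> j \<in> I \<Longrightarrow> pr i = j \<longleftrightarrow> i = pr j" by auto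
lemma sum_pr: "(\<Sum>i\<in>I. f (pr i)) = (\<Sum>i\<in>I. f i)"
  by (rule sum.reindex_bij_witness[of _ pr pr]) auto

lemma sum_delta_pr [simp]:
  fixes X :: "nat \<Rightarrow> 'b :: comm_monoid_add"
  shows "(\<Sum>i\<in>I. if pr i = j then X i else 0) = (if j \<in> I then X (pr j) else 0)"
    "(\<Sum>i\<in>I. if j = pr i then X i else 0) = (if j \<in> I then X (pr j) else 0)"
proof -
  have "(\<Sum>i\<in>I. if pr i = j then X i else 0) = (\<Sum>i\<in>I. if i = j then X (pr i) else 0)"
    by (rule sum.reindex_bij_witness[of _ pr pr]) auto
  then show "(\<Sum>i\<in>I. if pr i = j then X i else 0) = (if j \<in> I then X (pr j) else 0)" by simp
  then show "(\<Sum>i\<in>I. if j = pr i then X i else 0) = (if j \<in> I then X (pr j) else 0)"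
    by (simp add: eq_commute[of j])
qed

text \<open>The odd operators \<open>om i\<close> generate the action of spo(2n|1), and \<open>p1\<close>, \<open>p2\<close>, \<open>q1\<close>, \<open>q2\<close>
  (that is $F_{1,2}$, $D_{12}$, $F_{2,1}$, $R_{12}$) generate osp(2|2). The even elements are
  obtained as anticommutators; \<open>degS\<close>, \<open>degL\<close> are $F_{1,1}$, $F_{2,2}$ without the constants.\<close>

definition om where
  "om i f = mx i (de cc f) + me i (dx cc f) + sn i \<cdot> me cc (dx (pr i) f) + sn i \<cdot> mx cc (de (pr i) f)"
definition p1 where
  "p1 f = me cc (dx cc f) - (\<Sum>i\<in>I. mx i (de i f))"
definition q1 where
  "q1 f = mx cc (de cc f) - (\<Sum>i\<in>I. me i (dx i f))"
definition p2 where
  "p2 f = dx cc (de cc f) + (\<Sum>i\<in>I. sn i \<cdot> dx i (de (pr i) f))"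
definition q2 where
  "q2 f = mx cc (me cc f) + (\<Sum>i\<in>I. sn i \<cdot> me i (mx (pr i) f))"
definition degS where
  "degS f = me cc (de cc f) + (\<Sum>i\<in>I. mx i (dx i f))"
definition degL where
  "degL f = mx cc (dx cc f) + (\<Sum>i\<in>I. me i (de i f))"
definition d22 where
  "d22 f = dx cc (dx cc f) + (\<Sum>i\<in>I. sn i \<cdot> de i (de (pr i) f))"
definition r22 where
  "r22 f = mx cc (mx cc f) + (\<Sum>i\<in>I. sn i \<cdot> me i (me (pr i) f))"

lemma linear_om: "clinear (om i)" and linear_p1: "clinear p1" and linear_q1: "clinear q1"
  and linear_p2: "clinear p2" and linear_q2: "clinear q2" and linear_degS: "clinear degS"
  and linear_degL: "clinear degL" and linear_d22: "clinear d22" and linear_r22: "clinear r22"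
  unfolding om_def[abs_def] p1_def[abs_def] q1_def[abs_def] p2_def[abs_def] q2_def[abs_def]
    degS_def[abs_def] degL_def[abs_def] d22_def[abs_def] r22_def[abs_def] by (intro clin)+

lemmas lin1 [simp] = clinD[OF linear_om] clinD[OF linear_p1] clinD[OF linear_q1] clinD[OF linear_p2]
  clinD[OF linear_q2] clinD[OF linear_degS] clinD[OF linear_degL] clinD[OF linear_d22] clinD[OF linear_r22]

text \<open>The supercommutators of \<open>p1\<close> and \<open>p2\<close> with the elementary
  operators. The relations of the dual pair below follow by pushing \<open>p1\<close> or
  \<open>p2\<close> through sums of products, without returning to monomials.\<close>

lemma p1_mx: "p1 (mx j f) = mx j (p1 f) + (if j = cc then me cc f else 0)"
  by (auto simp: p1_def ccr mx_mx[of _ j])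
lemma p1_me: "p1 (me j f) = - me j (p1 f) - (if j \<in> I then mx j f else 0)"
  by (cases "j = cc") (simp_all add: p1_def ccr me_me[of cc j] sum_simps)
lemma p1_dx: "p1 (dx j f) = dx j (p1 f) + (if j \<in> I then de j f else 0)"
  by (simp add: p1_def ccr dx_dx[of _ j] sum_simps eq_commute[of _ j])
lemma p1_de: "p1 (de j f) = - de j (p1 f) + (if j = cc then dx cc f else 0)"
  by (auto simp: p1_def ccr de_de[of _ j] sum_simps)

lemma p2_mx: "p2 (mx j f) = mx j (p2 f) + (if j = cc then de cc f else if j \<in> I then sn j \<cdot> de (pr j) f else 0)"
  by (simp add: p2_def ccr scale_simps sum_simps)
lemma p2_me: "p2 (me j f) = - me j (p2 f) + (if j = cc then dx cc f else if j \<in> I then - sn j \<cdot> dx (pr j) f else 0)"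
  by (auto simp: p2_def ccr scale_simps sum_simps)
lemma p2_dx: "p2 (dx j f) = dx j (p2 f)"
  by (simp add: p2_def ccr dx_dx[of _ j])
lemma p2_de: "p2 (de j f) = - de j (p2 f)"
  by (simp add: p2_def ccr de_de[of _ j] sum_simps)

lemmas p1_comm = p1_mx p1_me p1_dx p1_de
lemmas p2_comm = p2_mx p2_me p2_dx p2_de

lemma om_p1: "i \<in> I \<Longrightarrow> om i (p1 f) = - p1 (om i f)"
  by (simp add: om_def p1_comm scale_simps)
lemma om_p2: "i \<in> I \<Longrightarrow> om i (p2 f) = - p2 (om i f)"
  by (simp add: om_def p2_comm scale_simps de_dx de_de[of cc "pr i"] dx_dx[of cc "pr i"])

lemma vec_eq_neg_self: "x = - x \<Longrightarrow> x = (0 :: 'b cvec)"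
proof (rule poly_mapping_eqI)
  fix k assume "x = - x"
  then have "lookup x k = lookup (- x) k" by (rule arg_cong)
  then show "lookup x k = lookup 0 k" by simp
qed

text \<open>The involution \<open>pr\<close> pairs the terms off. Typically \<open>sn i\<close> is
  multiplied by something symmetric in i and \<open>pr i\<close>, such as a product of two even
  variables.\<close>

lemma sum_antisym:
  fixes F :: "nat \<Rightarrow> 'b cvec"
  assumes "\<And>i. i \<in> I \<Longrightarrow> F (pr i) = - F i"
  shows "(\<Sum>i\<in>I. F i) = 0"
proof -
  have "(\<Sum>i\<in>I. F i) = (\<Sum>i\<in>I. - F i)"
    by (subst sum_pr[symmetric]) (simp add: assms)
  then show ?thesis by (intro vec_eq_neg_self) (simp add: sum_negf)
qed

text \<open>Only the inner \<open>p1\<close> is expanded; the outer one supercommutes with every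
  factor that occurs in it, so no correction terms arise.\<close>

lemma p1_p1: "p1 (p1 f) = 0"
proof -
  have "p1 (p1 f) = p1 (me cc (dx cc f) - (\<Sum>i\<in>I. mx i (de i f)))"
    by (simp only: p1_def[of f])
  also have "\<dots> = - p1 (p1 f)"
    by (simp add: p1_comm p1_def[of "p1 f"] sum_simps)
  finally show ?thesis by (rule vec_eq_neg_self)
qed

lemma p1_p2: "p1 (p2 f) = d22 f - p2 (p1 f)"
proof -
  have "p1 (p2 f) = p1 (dx cc (de cc f) + (\<Sum>i\<in>I. sn i \<cdot> dx i (de (pr i) f)))"
    by (simp only: p2_def[of f])
  also have "\<dots> = d22 f - p2 (p1 f)"
    by (simp add: p1_comm p2_def[of "p1 f"] scale_simps sum_simps d22_def de_dx)
  finally show ?thesis .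
qed

lemma p1_q1: "p1 (q1 f) = degS f + degL f - q1 (p1 f)"
proof -
  have "p1 (q1 f) = p1 (mx cc (de cc f) - (\<Sum>i\<in>I. me i (dx i f)))"
    by (simp only: q1_def[of f])
  also have "\<dots> = degS f + degL f - q1 (p1 f)"
    by (simp add: p1_comm q1_def[of "p1 f"] scale_simps sum_simps degS_def degL_def)
  finally show ?thesis .
qed

lemma p2_q1: "p2 (q1 f) = - q1 (p2 f)"
proof -
  have *: "(\<Sum>i\<in>I. sn i \<cdot> dx (pr i) (dx i f)) = 0"
    by (rule sum_antisym) (simp add: dx_dx)
  have "p2 (q1 f) = p2 (mx cc (de cc f) - (\<Sum>i\<in>I. me i (dx i f)))"
    by (simp only: q1_def[of f])
  also have "\<dots> = - q1 (p2 f)"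
    using * by (simp add: p2_comm q1_def[of "p2 f"] scale_simps sum_simps)
  finally show ?thesis .
qed

lemma p1_q2: "p1 (q2 f) = - q2 (p1 f)"
proof -
  have *: "(\<Sum>i\<in>I. sn i \<cdot> mx i (mx (pr i) f)) = 0"
    by (rule sum_antisym) (simp add: mx_mx)
  have "p1 (q2 f) = p1 (mx cc (me cc f) + (\<Sum>i\<in>I. sn i \<cdot> me i (mx (pr i) f)))"
    by (simp only: q2_def[of f])
  also have "\<dots> = - q2 (p1 f)"
    using * by (simp add: p1_comm q2_def[of "p1 f"] scale_simps sum_simps)
  finally show ?thesis .
qed

lemma card_I: "card I = 2*n" by (simp add: I_def)

lemma sum_const_cvec: "finite A \<Longrightarrow> (\<Sum>i\<in>A. f) = of_nat (card A) \<cdot> (f :: 'b cvec)"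
  by (induction rule: finite_induct) (auto simp: cvec.scale_left_distrib)

text \<open>Reordering contributes -1 for each of the 2n indices in \<open>I\<close> and +1 for the
  index 2n+1. The constant is twice \<alpha>, so the shifts in F_{1,1} and F_{2,2} absorb it and the
  anticommutator of \<open>p2\<close> and \<open>q2\<close> is F_{2,2} - F_{1,1}.\<close>

lemma p2_q2: "p2 (q2 f) = degL f - degS f - (2 * of_nat n - 1) \<cdot> f - q2 (p2 f)"
proof -
  have "p2 (q2 f) = p2 (mx cc (me cc f) + (\<Sum>i\<in>I. sn i \<cdot> me i (mx (pr i) f)))"
    by (simp only: q2_def[of f])
  also have "\<dots> = degL f - degS f - (2 * of_nat n - 1) \<cdot> f - q2 (p2 f)"
    using sum_pr[of "\<lambda>i. mx i (dx i f)"]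
    by (simp add: p2_comm q2_def[of "p2 f"] scale_simps sum_simps ccr degS_def degL_def
        sum_const_cvec card_I cvec.scale_left_diff_distrib)
  finally show ?thesis .
qed

end

section \<open>Gradings of a space with a basis, and homogeneous operators\<close>

lemma keys_bvec [simp]: "keys (bvec m) = {m}"
  by (simp add: bvec_def)

lemma lookup_bvec: "lookup (bvec m) m' = (if m = m' then 1 else 0)"
  by (simp add: bvec_def lookup_single when_def)

lemma keys_cscale: "keys (c \<cdot> f) \<subseteq> keys f"
  by (auto simp: in_keys_iff)

lemma keys_sum_sub: "keys (\<Sum>i\<in>A. (F i :: 'b cvec)) \<subseteq> (\<Union>i\<in>A. keys (F i))"
  by (rule keys_sum)

lemma clinear_expand:
  assumes "clinear A"
  shows "A f = (\<Sum>m\<in>keys f. lookup f m \<cdot> A (bvec m))"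
proof -
  have "A f = A (\<Sum>m\<in>keys f. lookup f m \<cdot> bvec m)"
    using cvec_expand[of f] by (rule arg_cong)
  then show ?thesis by (simp only: clinD(6)[OF assms] clinD(4)[OF assms])
qed

lemma keys_clinear:
  assumes "clinear A"
  shows "keys (A f) \<subseteq> (\<Union>m\<in>keys f. keys (A (bvec m)))"
proof -
  have "keys (A f) \<subseteq> (\<Union>m\<in>keys f. keys (lookup f m \<cdot> A (bvec m)))"
    by (subst clinear_expand[OF assms]) (rule keys_sum_sub)
  also have "\<dots> \<subseteq> (\<Union>m\<in>keys f. keys (A (bvec m)))"
    by (intro UN_mono keys_cscale subset_refl)
  finally show ?thesis .
qed

definition shifts :: "('b \<Rightarrow> int) \<Rightarrow> int \<Rightarrow> ('b cvec \<Rightarrow> 'b cvec) \<Rightarrow> bool" where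
  "shifts w k A \<longleftrightarrow> clinear A \<and> (\<forall>m. \<forall>m'\<in>keys (A (bvec m)). w m' = w m + k)"

definition homd :: "('b \<Rightarrow> int) \<Rightarrow> int \<Rightarrow> 'b cvec \<Rightarrow> bool" where
  "homd w t f \<longleftrightarrow> (\<forall>m\<in>keys f. w m = t)"

definition cmp :: "('b \<Rightarrow> int) \<Rightarrow> int \<Rightarrow> 'b cvec \<Rightarrow> 'b cvec" where
  "cmp w t = lin (\<lambda>m. if w m = t then bvec m else 0)"

definition diag :: "('b \<Rightarrow> complex) \<Rightarrow> 'b cvec \<Rightarrow> 'b cvec" where
  "diag w = lin (\<lambda>m. w m \<cdot> bvec m)"

lemma linear_cmp: "clinear (cmp w t)" and linear_diag: "clinear (diag u)"
  by (simp_all add: cmp_def diag_def linear_lin)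

lemma cmp_bvec: "cmp w t (bvec m) = (if w m = t then bvec m else 0)"
  by (simp add: cmp_def)
lemma diag_bvec: "diag u (bvec m) = u m \<cdot> bvec m"
  by (simp add: diag_def)

lemma lookup_clinear:
  assumes "clinear A"
  shows "lookup (A f) m = (\<Sum>b\<in>keys f. lookup f b * lookup (A (bvec b)) m)"
  by (subst clinear_expand[OF assms]) (simp add: lookup_sum)

lemma lookup_diag: "lookup (diag u f) m = u m * lookup f m"
proof -
  have "lookup (diag u f) m = (\<Sum>b\<in>keys f. if b = m then lookup f m * u m else 0)"
    by (subst lookup_clinear[OF linear_diag], intro sum.cong) (auto simp: diag_bvec lookup_bvec)
  then show ?thesis by (auto simp: in_keys_iff)
qed

lemma lookup_cmp: "lookup (cmp w t f) m = (if w m = t then lookup f m else 0)"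
proof -
  have "lookup (cmp w t f) m = (\<Sum>b\<in>keys f. if b = m then (if w m = t then lookup f m else 0) else 0)"
    by (subst lookup_clinear[OF linear_cmp], intro sum.cong) (auto simp: cmp_bvec lookup_bvec)
  then show ?thesis by (auto simp: in_keys_iff)
qed

lemma keys_cmp: "keys (cmp w t f) = {m \<in> keys f. w m = t}"
  by (auto simp: in_keys_iff lookup_cmp split: if_splits)

lemma homdD: "homd w t f \<Longrightarrow> lookup f m \<noteq> 0 \<Longrightarrow> w m = t"
  by (simp add: homd_def in_keys_iff)

lemma homd_cmp: "homd w t (cmp w t f)"
  by (auto simp: homd_def keys_cmp)

lemma homd_diag: "homd w t f \<longleftrightarrow> diag (\<lambda>m. of_int (w m)) f = of_int t \<cdot> f"
proof
  assume "homd w t f"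
  then show "diag (\<lambda>m. of_int (w m)) f = of_int t \<cdot> f"
    by (intro poly_mapping_eqI) (auto simp: homd_def lookup_diag in_keys_iff)
next
  assume *: "diag (\<lambda>m. of_int (w m)) f = of_int t \<cdot> f"
  show "homd w t f" unfolding homd_def
  proof
    fix m assume "m \<in> keys f"
    then show "w m = t"
      using arg_cong[OF *, of "\<lambda>f. lookup f m"] by (simp add: lookup_diag in_keys_iff)
  qed
qed

lemma cmp_homd: "homd w t f \<Longrightarrow> cmp w t f = f"
  by (intro poly_mapping_eqI) (auto simp: lookup_cmp homd_def in_keys_iff)

lemma homd_ne: "homd w t f \<Longrightarrow> homd w t' f \<Longrightarrow> t \<noteq> t' \<Longrightarrow> f = 0"
  by (metis all_not_in_conv homd_def keys_eq_empty)

lemma homd_add: "homd w t f \<Longrightarrow> homd w t g \<Longrightarrow> homd w t (f + g)"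
  using keys_add[of f g] by (fastforce simp: homd_def)
lemma homd_scale: "homd w t f \<Longrightarrow> homd w t (c \<cdot> f)"
  using keys_cscale[of c f] by (auto simp: homd_def)
lemma homd_0 [simp]: "homd w t 0" by (simp add: homd_def)

lemma shifts_linear: "shifts w k A \<Longrightarrow> clinear A" by (simp add: shifts_def)

lemma shifts_keys:
  assumes "shifts w k A" "m' \<in> keys (A f)"
  shows "\<exists>m\<in>keys f. w m' = w m + k"
  using assms keys_clinear[OF shifts_linear[OF assms(1)], of f] by (fastforce simp: shifts_def)

lemma shifts_homd: "shifts w k A \<Longrightarrow> homd w t f \<Longrightarrow> homd w (t + k) (A f)"
  unfolding homd_def using shifts_keys by fastforce

lemma shifts_cmp:
  assumes "shifts w k A"
  shows "cmp w (t + k) (A f) = A (cmp w t f)"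
proof (rule linear_eqI[where F = "\<lambda>f. cmp w (t + k) (A f)" and G = "\<lambda>f. A (cmp w t f)"])
  note l = shifts_linear[OF assms]
  show "clinear (\<lambda>f. cmp w (t + k) (A f))" "clinear (\<lambda>f. A (cmp w t f))"
    by (rule clinear_comp[OF linear_cmp l], rule clinear_comp[OF l linear_cmp])
  fix m
  have h: "homd w (w m + k) (A (bvec m))" using assms by (auto simp: shifts_def homd_def)
  show "cmp w (t + k) (A (bvec m)) = A (cmp w t (bvec m))"
  proof (cases "w m = t")
    case True
    then show ?thesis using cmp_homd[OF h] by (simp add: cmp_bvec)
  next
    case False
    have "cmp w (t + k) (A (bvec m)) = 0"
    proof (rule poly_mapping_eqI)
      fix m' show "lookup (cmp w (t + k) (A (bvec m))) m' = lookup 0 m'"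
        using homdD[OF h, of m'] False
        by (cases "lookup (A (bvec m)) m' = 0") (auto simp: lookup_cmp)
    qed
    then show ?thesis using False by (simp add: cmp_bvec clinD(5)[OF l])
  qed
qed

lemma shifts_add: "shifts w k F \<Longrightarrow> shifts w k G \<Longrightarrow> shifts w k (\<lambda>f. F f + G f)"
  unfolding shifts_def using keys_add by (fastforce intro: clinear_add)
lemma shifts_diff: "shifts w k F \<Longrightarrow> shifts w k G \<Longrightarrow> shifts w k (\<lambda>f. F f - G f)"
  unfolding shifts_def using keys_diff by (fastforce intro: clinear_diff)
lemma shifts_scale: "shifts w k F \<Longrightarrow> shifts w k (\<lambda>f. c \<cdot> F f)"
  unfolding shifts_def using keys_cscale by (fastforce intro: clinear_cmul)
lemma shifts_sum: "(\<And>i. i \<in> A \<Longrightarrow> shifts w k (F i)) \<Longrightarrow> shifts w k (\<lambda>f. \<Sum>i\<in>A. F i f)"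
  unfolding shifts_def using keys_sum_sub by (fastforce intro!: clinear_sum)
lemma shifts_id: "shifts w 0 (\<lambda>f. f)"
  by (simp add: shifts_def clinear_id)
lemma shifts_comp:
  assumes "shifts w k F" "shifts w l G" "k + l = j"
  shows "shifts w j (\<lambda>f. F (G f))"
  unfolding shifts_def
proof (intro conjI allI ballI)
  show "clinear (\<lambda>f. F (G f))" using assms by (auto intro: clinear_comp shifts_linear)
  fix m m' assume "m' \<in> keys (F (G (bvec m)))"
  then obtain m1 where "m1 \<in> keys (G (bvec m))" "w m' = w m1 + k"
    using shifts_keys[OF assms(1)] by blast
  then show "w m' = w m + j" using assms(2,3) by (auto simp: shifts_def)
qed

section \<open>Gradings of S(E), and the contravariant form\<close>

context howe
begin

text \<open>One definition for all gradings by weights of the variables: \<open>wL\<close>,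
  \<open>wS\<close>, \<open>wT\<close> and \<open>wG\<close> below are instances, and so are the
  auxiliary gradings used for leading-term arguments.\<close>

definition wt :: "(nat \<Rightarrow> int) \<Rightarrow> (nat \<Rightarrow> int) \<Rightarrow> smono \<Rightarrow> int" where
  "wt wx we m = (\<Sum>i\<in>J. wx i * int (lookup (fst m) i) + (if i \<in> snd m then we i else 0))"

lemma wt_mx: "i \<in> J \<Longrightarrow> wt wx we (Poly_Mapping.single i 1 + a, S) = wt wx we (a, S) + wx i"
proof -
  assume i: "i \<in> J"
  have "wt wx we (Poly_Mapping.single i 1 + a, S) = (\<Sum>j\<in>J. (wx j * int (lookup a j) + (if j \<in> S then we j else 0)) + (if j = i then wx i else 0))"
    unfolding wt_def by (intro sum.cong) (auto simp: lookup_add lookup_single algebra_simps)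
  with i show ?thesis by (simp add: wt_def sum.distrib)
qed

lemma wt_me: "i \<in> J \<Longrightarrow> i \<notin> S \<Longrightarrow> wt wx we (a, insert i S) = wt wx we (a, S) + we i"
proof -
  assume i: "i \<in> J" "i \<notin> S"
  have "wt wx we (a, insert i S) = (\<Sum>j\<in>J. (wx j * int (lookup a j) + (if j \<in> S then we j else 0)) + (if j = i then we i else 0))"
    unfolding wt_def using i by (intro sum.cong) auto
  with i show ?thesis by (simp add: wt_def sum.distrib)
qed

lemma single_add_diff: "lookup a i \<noteq> 0 \<Longrightarrow> Poly_Mapping.single i 1 + (a - Poly_Mapping.single i (1::nat)) = a"
  by (intro poly_mapping_eqI) (auto simp: lookup_add lookup_minus lookup_single when_def)

lemma shifts_mx: "i \<in> J \<Longrightarrow> shifts (wt wx we) (wx i) (mx i)"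
  unfolding shifts_def using wt_mx[of i] by (auto simp: linear_mx mx_bvec)
lemma shifts_me: "i \<in> J \<Longrightarrow> shifts (wt wx we) (we i) (me i)"
  unfolding shifts_def
proof (intro conjI linear_me allI ballI)
  fix m m' assume i: "i \<in> J" and m': "m' \<in> keys (me i (bvec m))"
  obtain a S where [simp]: "m = (a, S)" by (cases m)
  have "i \<notin> S" "m' = (a, insert i S)"
    using m' keys_cscale[of "sg i S" "bvec (a, insert i S)"] by (auto simp: me_bvec split: if_splits)
  with i show "wt wx we m' = wt wx we m + we i" by (simp add: wt_me)
qed
lemma shifts_dx: "i \<in> J \<Longrightarrow> shifts (wt wx we) (- wx i) (dx i)"
  unfolding shifts_def
proof (intro conjI linear_dx allI ballI)
  fix m m' assume i: "i \<in> J" and m': "m' \<in> keys (dx i (bvec m))"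
  obtain a S where [simp]: "m = (a, S)" by (cases m)
  have "lookup a i \<noteq> 0" "m' = (a - Poly_Mapping.single i 1, S)"
    using m' keys_cscale[of "of_nat (lookup a i)" "bvec (a - Poly_Mapping.single i 1, S)"]
    by (auto simp: dx_bvec in_keys_iff split: if_splits)
  with wt_mx[OF i, of wx we "a - Poly_Mapping.single i 1" S] single_add_diff[of a i]
  show "wt wx we m' = wt wx we m + - wx i" by simp
qed
lemma shifts_de: "i \<in> J \<Longrightarrow> shifts (wt wx we) (- we i) (de i)"
  unfolding shifts_def
proof (intro conjI linear_de allI ballI)
  fix m m' assume i: "i \<in> J" and m': "m' \<in> keys (de i (bvec m))"
  obtain a S where [simp]: "m = (a, S)" by (cases m)
  have "i \<in> S" "m' = (a, S - {i})"
    using m' keys_cscale[of "sg i S" "bvec (a, S - {i})"] by (auto simp: de_bvec split: if_splits)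
  with wt_me[OF i, of "S - {i}" wx we a]
  show "wt wx we m' = wt wx we m + - we i" by (simp add: insert_absorb)
qed

lemmas shifts_rules = shifts_add shifts_diff shifts_scale shifts_sum shifts_id
  shifts_comp[OF shifts_mx] shifts_comp[OF shifts_me] shifts_comp[OF shifts_dx] shifts_comp[OF shifts_de]

lemma euler_x: "i \<in> J \<Longrightarrow> mx i (dx i f) = diag (\<lambda>m. of_nat (lookup (fst m) i)) f"
proof (rule op_eqI[of "\<lambda>f. mx i (dx i f)" "diag (\<lambda>m. of_nat (lookup (fst m) i))"])
  fix a S
  show "mx i (dx i (bvec (a, S))) = diag (\<lambda>m. of_nat (lookup (fst m) i)) (bvec (a, S))"
    using single_add_diff[of a i] by (cases "lookup a i = 0") (auto simp: op_bvec diag_bvec)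
qed (intro clin linear_diag)+

lemma euler_e: "i \<in> J \<Longrightarrow> me i (de i f) = diag (\<lambda>m. if i \<in> snd m then 1 else 0) f"
proof (rule op_eqI[of "\<lambda>f. me i (de i f)" "diag (\<lambda>m. if i \<in> snd m then 1 else 0)"])
  fix a S
  show "me i (de i (bvec (a, S))) = diag (\<lambda>m. if i \<in> snd m then 1 else 0) (bvec (a, S))"
    by (auto simp: op_bvec diag_bvec sg_remove insert_absorb)
qed (intro clin linear_diag)+

lemma euler: "(\<Sum>i\<in>J. of_int (wx i) \<cdot> mx i (dx i f) + of_int (we i) \<cdot> me i (de i f)) =
    diag (\<lambda>m. of_int (wt wx we m)) f"
proof (rule poly_mapping_eqI)
  fix m
  show "lookup (\<Sum>i\<in>J. of_int (wx i) \<cdot> mx i (dx i f) + of_int (we i) \<cdot> me i (de i f)) m =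
      lookup (diag (\<lambda>m. of_int (wt wx we m)) f) m"
    unfolding lookup_sum lookup_diag wt_def of_int_sum sum_distrib_right
    by (intro sum.cong) (auto simp: lookup_add euler_x euler_e lookup_diag algebra_simps)
qed

definition SEv :: "smono cvec set" where "SEv = vecs (SE_space n)"

lemma SEv_iff: "f \<in> SEv \<longleftrightarrow> (\<forall>(a, S)\<in>keys f. keys a \<subseteq> J \<and> S \<subseteq> J)"
  by (auto simp: SEv_def vecs_def SE_space_def J_def)

lemma subspace_SEv: "cvec.subspace SEv"
  unfolding cvec.subspace_def
proof (intro conjI ballI allI)
  show "x + y \<in> SEv" if "x \<in> SEv" "y \<in> SEv" for x y
    using that keys_add[of x y] unfolding SEv_iff by blast
  show "k \<cdot> x \<in> SEv" if "x \<in> SEv" for x k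
    using that keys_cscale[of k x] unfolding SEv_iff by blast
qed (simp add: SEv_iff)

lemmas SE_simps [simp] = cvec.subspace_0[OF subspace_SEv] cvec.subspace_add[OF subspace_SEv]
  cvec.subspace_diff[OF subspace_SEv] cvec.subspace_neg[OF subspace_SEv] cvec.subspace_scale[OF subspace_SEv]
lemmas SE_sum [simp] = cvec.subspace_sum[OF subspace_SEv]

lemma SE_clinear:
  assumes "clinear A" "f \<in> SEv" "\<And>a S. keys a \<subseteq> J \<Longrightarrow> S \<subseteq> J \<Longrightarrow> A (bvec (a, S)) \<in> SEv"
  shows "A f \<in> SEv"
proof (subst clinear_expand[OF assms(1)], intro SE_sum SE_simps)
  fix m assume "m \<in> keys f"
  with assms(2) have "case m of (a, S) \<Rightarrow> keys a \<subseteq> J \<and> S \<subseteq> J" by (auto simp: SEv_iff)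
  then show "A (bvec m) \<in> SEv" using assms(3) by (cases m) simp
qed

lemma bvec_SE: "keys a \<subseteq> J \<Longrightarrow> S \<subseteq> J \<Longrightarrow> bvec (a, S) \<in> SEv"
  by (auto simp: SEv_iff)

lemma SE_mx [simp]: "i \<in> J \<Longrightarrow> f \<in> SEv \<Longrightarrow> mx i f \<in> SEv"
  by (rule SE_clinear[OF linear_mx])
    (auto simp: mx_bvec intro!: bvec_SE dest!: subsetD[OF keys_add])
lemma SE_me [simp]: "i \<in> J \<Longrightarrow> f \<in> SEv \<Longrightarrow> me i f \<in> SEv"
  by (rule SE_clinear[OF linear_me]) (auto simp: me_bvec intro!: bvec_SE SE_simps)
lemma SE_dx [simp]: "f \<in> SEv \<Longrightarrow> dx i f \<in> SEv"
  by (rule SE_clinear[OF linear_dx])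
    (auto simp: dx_bvec lookup_minus in_keys_iff subset_iff intro!: bvec_SE SE_simps)
lemma SE_de [simp]: "f \<in> SEv \<Longrightarrow> de i f \<in> SEv"
  by (rule SE_clinear[OF linear_de]) (auto simp: de_bvec intro!: bvec_SE SE_simps)

lemma SE_ops [simp]: "f \<in> SEv \<Longrightarrow> i \<in> I \<Longrightarrow> om i f \<in> SEv" "f \<in> SEv \<Longrightarrow> p1 f \<in> SEv"
  "f \<in> SEv \<Longrightarrow> p2 f \<in> SEv" "f \<in> SEv \<Longrightarrow> q1 f \<in> SEv" "f \<in> SEv \<Longrightarrow> q2 f \<in> SEv"
  "f \<in> SEv \<Longrightarrow> d22 f \<in> SEv" "f \<in> SEv \<Longrightarrow> r22 f \<in> SEv"
  by (simp_all add: om_def p1_def p2_def q1_def q2_def d22_def r22_def)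

definition vac :: "smono cvec" where "vac = bvec (0, {})"

lemma vac_SE [simp]: "vac \<in> SEv" by (simp add: vac_def bvec_SE)
lemma dx_vac [simp]: "dx i vac = 0" and de_vac [simp]: "de i vac = 0"
  by (simp_all add: vac_def op_bvec)
lemma vac_ne [simp]: "vac \<noteq> 0"
  by (metis vac_def keys_bvec keys_zero insert_not_empty)

text \<open>With all variables in degree 1, the Euler identity turns vanishing derivatives into
  total degree 0.\<close>

lemma const_vac:
  assumes "f \<in> SEv" "\<And>i. i \<in> J \<Longrightarrow> dx i f = 0" "\<And>i. i \<in> J \<Longrightarrow> de i f = 0"
  shows "\<exists>g. f = g \<cdot> vac"
proof
  have "diag (\<lambda>m. of_int (wt (\<lambda>_. 1) (\<lambda>_. 1) m)) f = of_int 0 \<cdot> f"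
    unfolding euler[symmetric] using assms by simp
  then have h: "homd (wt (\<lambda>_. 1) (\<lambda>_. 1)) 0 f" by (simp only: homd_diag)
  have "m = (0, {})" if "m \<in> keys f" for m
  proof -
    obtain a S where m: "m = (a, S)" by (cases m)
    have sub: "keys a \<subseteq> J" "S \<subseteq> J" using assms(1) that m by (auto simp: SEv_iff)
    have "wt (\<lambda>_. 1) (\<lambda>_. 1) m = 0" using h that by (auto simp: homd_def)
    then have "\<forall>i\<in>J. int (lookup a i) + (if i \<in> S then 1 else 0) = 0"
      unfolding wt_def m by (subst (asm) sum_nonneg_eq_0_iff) auto
    then have "\<forall>i\<in>J. lookup a i = 0 \<and> i \<notin> S" by (auto split: if_splits)
    then have "\<And>i. i \<in> J \<Longrightarrow> i \<notin> keys a" "\<And>i. i \<in> J \<Longrightarrow> i \<notin> S" by (auto simp: in_keys_iff)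
    with sub have "S = {}" "keys a = {}" by blast+
    then show ?thesis unfolding m keys_eq_empty by simp
  qed
  then show "f = lookup f (0, {}) \<cdot> vac"
    by (intro poly_mapping_eqI) (auto simp: vac_def lookup_bvec in_keys_iff)
qed

text \<open>The weights \<open>wgt\<close> are chosen so that the form \<open>B\<close> with orthogonal monomials is contravariant:
  the adjoint of \<open>p1\<close> is \<open>q1\<close>, that of \<open>p2\<close> is \<open>q2\<close>, and that of \<open>om i\<close> is a multiple of \<open>om (pr i)\<close>.\<close>

definition sgm :: "nat \<Rightarrow> complex" where "sgm i = (if i \<in> I then sn i else 1)"

lemma sgm_I [simp]: "i \<in> I \<Longrightarrow> sgm i = sn i" and sgm_cc [simp]: "sgm cc = 1" and sgm_ne [simp]: "sgm i \<noteq> 0"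
  by (auto simp: sgm_def sn_def)
lemma sgm_sq [simp]: "sgm i * sgm i = 1" "sgm i * (sgm i * z) = z" by (auto simp: sgm_def)

text \<open>Norms of a Fischer form with signs: the factorials make multiplication by x_i adjoint to
  its derivative, and \<open>sgm\<close> repeats the signs of the symplectic pairing so that the
  factors \<open>sn\<close> match under transposition.\<close>

definition wgt :: "smono \<Rightarrow> complex" where
  "wgt m = (\<Prod>i\<in>J. fact (lookup (fst m) i) * sgm i ^ lookup (fst m) i * (if i \<in> snd m then sgm i else 1))"

lemma wgt_ne [simp]: "wgt m \<noteq> 0" by (simp add: wgt_def)

lemma wgt_mx: "i \<in> J \<Longrightarrow> wgt (Poly_Mapping.single i 1 + a, S) = sgm i * (of_nat (lookup a i) + 1) * wgt (a, S)"
  unfolding wgt_def by (subst (1 2) prod.remove[of _ i]) (auto simp: lookup_add lookup_single algebra_simps intro!: prod.cong)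
lemma wgt_me: "i \<in> J \<Longrightarrow> i \<notin> S \<Longrightarrow> wgt (a, insert i S) = sgm i * wgt (a, S)"
  unfolding wgt_def by (subst (1 2) prod.remove[of _ i]) (auto intro!: prod.cong)

definition B :: "smono cvec \<Rightarrow> smono cvec \<Rightarrow> complex" where
  "B f g = (\<Sum>m\<in>keys f. lookup f m * lookup g m * wgt m)"

lemma B_superset: "finite A \<Longrightarrow> keys f \<subseteq> A \<Longrightarrow> B f g = (\<Sum>m\<in>A. lookup f m * lookup g m * wgt m)"
  unfolding B_def by (rule sum.mono_neutral_left) (auto simp: in_keys_iff)

lemma B_sym: "B f g = B g f"
  using B_superset[of "keys f \<union> keys g" f g] B_superset[of "keys f \<union> keys g" g f]
  by (simp add: mult.commute mult.left_commute)

lemma B_add_left: "B (f + f') g = B f g + B f' g"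
  using keys_add[of f f'] by (subst (1 2 3) B_superset[of "keys f \<union> keys f'"]) 
    (auto simp: lookup_add algebra_simps sum.distrib)
lemma B_scale_left: "B (k \<cdot> f) g = k * B f g"
  using keys_cscale[of k f] by (subst (1 2) B_superset[of "keys f"]) (auto simp: sum_distrib_left mult.assoc)
lemma B_add_right: "B f (g + g') = B f g + B f g'"
  by (metis B_sym B_add_left)
lemma B_scale_right: "B f (k \<cdot> g) = k * B f g"
  by (metis B_sym B_scale_left)
lemma B_0 [simp]: "B 0 g = 0" "B f 0 = 0" by (simp_all add: B_def)
lemma B_neg: "B (- f) g = - B f g" "B f (- g) = - B f g"
  using B_scale_left[of "-1" f g] B_scale_right[of f "-1" g] by (simp_all add: B_def)
lemma B_diff: "B (f - f') g = B f g - B f' g" "B f (g - g') = B f g - B f g'"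
  using B_add_left[of f "- f'" g] B_add_right[of f g "- g'"] by (simp_all add: B_neg)
lemma B_sum: "B (\<Sum>i\<in>A. F i) g = (\<Sum>i\<in>A. B (F i) g)" "B f (\<Sum>i\<in>A. G i) = (\<Sum>i\<in>A. B f (G i))"
  by (induction A rule: infinite_finite_induct) (auto simp: B_add_left B_add_right)

lemmas B_lin = B_add_left B_add_right B_scale_left B_scale_right B_neg B_diff B_sum

lemma B_bvec: "B (bvec m) (bvec m') = (if m = m' then wgt m else 0)"
  by (simp add: B_def lookup_bvec)

lemma B_bvec_right: "B f (bvec m) = lookup f m * wgt m"
  by (subst B_sym) (simp add: B_def lookup_bvec)

lemma B_nondeg: "(\<And>g. B f g = 0) \<Longrightarrow> f = 0"
proof (rule poly_mapping_eqI)
  fix m assume "\<And>g. B f g = 0"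
  from this[of "bvec m"] show "lookup f m = lookup 0 m" by (simp add: B_bvec_right)
qed

lemma B_adjI:
  assumes "clinear A" "clinear A'" "\<And>a S b T. B (A (bvec (a, S))) (bvec (b, T)) = k * B (bvec (a, S)) (A' (bvec (b, T)))"
  shows "B (A f) g = k * B f (A' g)"
proof -
  have *: "B (A (bvec m)) (bvec m') = k * B (bvec m) (A' (bvec m'))" for m m'
    by (cases m; cases m') (simp add: assms(3))
  have "B (A f) g = (\<Sum>m\<in>keys f. \<Sum>m'\<in>keys g. lookup f m * (lookup g m' * B (A (bvec m)) (bvec m')))"
    using arg_cong2[OF clinear_expand[OF assms(1), of f] cvec_expand[of g], of B]
    by (simp add: B_lin sum_distrib_left sum.swap[where A = "keys g" and B = "keys f"] mult.left_commute)
  also have "\<dots> = (\<Sum>m\<in>keys f. \<Sum>m'\<in>keys g. lookup f m * (lookup g m' * (k * B (bvec m) (A' (bvec m')))))"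
    by (simp only: *)
  also have "\<dots> = k * (\<Sum>m\<in>keys f. lookup f m * B (bvec m) (A' g))"
    using arg_cong[OF clinear_expand[OF assms(2), of g], of "B (bvec _)"] by (simp add: B_lin sum_distrib_left algebra_simps)
  also have "\<dots> = k * B f (A' g)"
    using arg_cong[OF cvec_expand[of f], of "\<lambda>f. B f (A' g)"] by (simp add: B_lin)
  finally show ?thesis .
qed

lemma B_mx: "i \<in> J \<Longrightarrow> B (mx i f) g = sgm i * B f (dx i g)"
proof (rule B_adjI[OF linear_mx linear_dx])
  fix a S b T assume i: "i \<in> J"
  show "B (mx i (bvec (a, S))) (bvec (b, T)) = sgm i * B (bvec (a, S)) (dx i (bvec (b, T)))"
  proof (cases "lookup b i = 0")
    case True
    then have "Poly_Mapping.single i 1 + a \<noteq> b" by (auto simp: lookup_add)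
    with True show ?thesis by (simp add: op_bvec B_bvec)
  next
    case False
    then have *: "Poly_Mapping.single i 1 + a = b \<longleftrightarrow> a = b - Poly_Mapping.single i 1"
      using single_add_diff[OF False] by (metis add_diff_cancel_left')
    show ?thesis
    proof (cases "a = b - Poly_Mapping.single i 1 \<and> S = T")
      case True
      with * have b: "b = Poly_Mapping.single i 1 + a" by simp
      then have "lookup b i = Suc (lookup a i)" by (simp add: lookup_add)
      with True b show ?thesis
        using wgt_mx[OF i, of a T] by (simp add: op_bvec B_bvec B_lin algebra_simps)
    next
      case False
      with * show ?thesis by (auto simp: op_bvec B_bvec B_lin)
    qed
  qed
qed

lemma B_me: "i \<in> J \<Longrightarrow> B (me i f) g = sgm i * B f (de i g)"
proof (rule B_adjI[OF linear_me linear_de])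
  fix a S b T assume i: "i \<in> J"
  show "B (me i (bvec (a, S))) (bvec (b, T)) = sgm i * B (bvec (a, S)) (de i (bvec (b, T)))"
  proof (cases "i \<notin> S \<and> T = insert i S \<and> a = b")
    case True
    then have "insert i S - {i} = S" by auto
    with True i show ?thesis by (simp add: op_bvec B_bvec B_lin wgt_me sg_insert)
  next
    case False
    then have "i \<notin> S \<Longrightarrow> (a, insert i S) \<noteq> (b, T)" "i \<in> T \<Longrightarrow> (a, S) \<noteq> (b, T - {i})" by auto
    then show ?thesis by (auto simp: op_bvec B_bvec B_lin)
  qed
qed

lemma B_dx: "i \<in> J \<Longrightarrow> B (dx i f) g = sgm i * B f (mx i g)"
  by (metis B_mx B_sym sgm_sq(2))
lemma B_de: "i \<in> J \<Longrightarrow> B (de i f) g = sgm i * B f (me i g)"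
  by (metis B_me B_sym sgm_sq(2))

lemmas B_ops = B_mx B_me B_dx B_de

lemma B_p1: "B (p1 f) g = B f (q1 g)"
  by (simp add: p1_def q1_def B_lin B_ops me_mx de_mx dx_me)
lemma B_q1: "B (q1 f) g = B f (p1 g)"
  by (metis B_p1 B_sym)
lemma B_p2: "B (p2 f) g = B f (q2 g)"
proof -
  have "(\<Sum>i\<in>I. sn i * B f (me (pr i) (mx i g))) = - (\<Sum>i\<in>I. sn i * B f (me i (mx (pr i) g)))"
    by (subst sum_pr[symmetric]) (simp add: sum_negf)
  then show ?thesis
    by (simp add: p2_def q2_def B_lin B_ops me_mx sum_negf)
qed
lemma B_q2: "B (q2 f) g = B f (p2 g)"
  by (metis B_p2 B_sym)
lemma B_om: "i \<in> I \<Longrightarrow> B (om i f) g = - B f (om (pr i) g)"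
  by (simp add: om_def B_lin B_ops me_mx de_mx dx_me de_dx algebra_simps)
lemma B_d22: "B (d22 f) g = B f (r22 g)"
  by (simp add: d22_def r22_def B_lin B_ops me_me[of "pr _"] sum_negf)

lemma B_r22: "B (r22 f) g = B f (d22 g)"
  by (metis B_d22 B_sym)

text \<open>Transposed from \<open>om_p1\<close>: the difference is paired with an arbitrary vector,
  and the form is nondegenerate on the space of all monomials.\<close>

lemma om_q1: "i \<in> I \<Longrightarrow> om i (q1 f) = - q1 (om i f)"
proof -
  assume i: "i \<in> I"
  have "om i (q1 f) + q1 (om i f) = 0"
    by (rule B_nondeg) (simp add: B_lin B_om B_q1 om_p1 i)
  then show ?thesis by (simp add: eq_neg_iff_add_eq_0)
qed
lemma om_q2: "i \<in> I \<Longrightarrow> om i (q2 f) = - q2 (om i f)"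
proof -
  assume i: "i \<in> I"
  have "om i (q2 f) + q2 (om i f) = 0"
    by (rule B_nondeg) (simp add: B_lin B_om B_q2 om_p2 i)
  then show ?thesis by (simp add: eq_neg_iff_add_eq_0)
qed
lemma q1_q2: "q1 (q2 f) = r22 f - q2 (q1 f)"
proof -
  have "q1 (q2 f) - (r22 f - q2 (q1 f)) = 0"
  proof (rule B_nondeg)
    fix g show "B (q1 (q2 f) - (r22 f - q2 (q1 f))) g = 0"
      by (simp add: B_lin B_q1 B_q2 B_r22 p1_p2)
  qed
  then show ?thesis by simp
qed
subsection \<open>Harmonic polynomials in one even and the paired odd variables\<close>

text \<open>Drops the k outermost pairs {i, \<open>pr i\<close>}. The inductions over N use
  \<open>Ik (n - N)\<close>, the N innermost pairs, and each step adds the pair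
  \<open>n - N\<close>, \<open>pr (n - N)\<close>.\<close>

definition Ik :: "nat \<Rightarrow> nat set" where "Ik k = {i \<in> I. k < i \<and> k < pr i}"

lemma Ik_I: "i \<in> Ik k \<Longrightarrow> i \<in> I" by (simp add: Ik_def)
lemma Ik_pr [simp]: "i \<in> Ik k \<Longrightarrow> pr i \<in> Ik k" by (simp add: Ik_def)
lemma fin_Ik [simp]: "finite (Ik k)" by (auto simp: Ik_def)
lemma Ik_0: "Ik 0 = I" by (auto simp: Ik_def I_def pr_def)
lemma Ik_n: "Ik n = {}" by (auto simp: Ik_def I_def pr_def)
lemma Ik_eq: "Ik k = {k+1..2*n-k}" by (auto simp: Ik_def I_def pr_def)
lemma card_Ik: "card (Ik k) = 2*n - 2*k" by (simp add: Ik_eq)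

lemma Ik_step:
  assumes "N < n"
  shows "Ik (n - Suc N) = insert (n - N) (insert (pr (n - N)) (Ik (n - N)))"
    "n - N \<in> I" "n - N \<le> n" "n < pr (n - N)" "n - N \<notin> Ik (n - N)" "pr (n - N) \<notin> Ik (n - N)"
    "sn (n - N) = 1" "n - N \<in> Ik (n - Suc N)" "pr (n - N) \<in> Ik (n - Suc N)"
    "i \<in> Ik (n - N) \<Longrightarrow> i \<in> Ik (n - Suc N)"
  using assms by (auto simp: Ik_def I_def pr_def sn_def)

declare Ik_I [simp]

lemma cc_Ik [simp]: "cc \<notin> Ik k" using Ik_I cc_notin by blast
lemma pr_Ik_iff [simp]: "i \<in> I \<Longrightarrow> pr i \<in> Ik k \<longleftrightarrow> i \<in> Ik k"
  using Ik_pr[of "pr i" k] by auto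

lemma two_scale: "2 \<cdot> v = v + (v :: 'b cvec)"
  by (rule poly_mapping_eqI) (simp add: lookup_add)
lemmas cvec_ext = poly_mapping_eqI
lemmas cvec_coord = lookup_add lookup_minus algebra_simps

lemma sum_Ik_pr: "(\<Sum>i\<in>Ik k. f (pr i)) = (\<Sum>i\<in>Ik k. f i)"
  by (rule sum.reindex_bij_witness[of _ pr pr]) auto

lemma sum_delta_Ik [simp]:
  fixes X :: "nat \<Rightarrow> 'b :: comm_monoid_add"
  shows "(\<Sum>i\<in>Ik k. if pr i = j then X i else 0) = (if j \<in> Ik k then X (pr j) else 0)"
    "(\<Sum>i\<in>Ik k. if j = pr i then X i else 0) = (if j \<in> Ik k then X (pr j) else 0)"
proof -
  have "(\<Sum>i\<in>Ik k. if pr i = j then X i else 0) = (\<Sum>i\<in>Ik k. if i = j then X (pr i) else 0)"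
    by (rule sum.reindex_bij_witness[of _ pr pr]) auto
  then show "(\<Sum>i\<in>Ik k. if pr i = j then X i else 0) = (if j \<in> Ik k then X (pr j) else 0)" by simp
  then show "(\<Sum>i\<in>Ik k. if j = pr i then X i else 0) = (if j \<in> Ik k then X (pr j) else 0)"
    by (simp add: eq_commute[of j])
qed

text \<open>Multiplication by the squared radius in x_{2n+1} and the odd variables of
  \<open>Ik k\<close>. Both members of a pair occur in the sum, which accounts for the factor 2 in
  r^2.\<close>

definition RR :: "nat \<Rightarrow> smono cvec \<Rightarrow> smono cvec" where
  "RR k f = mx cc (mx cc f) + (\<Sum>i\<in>Ik k. sn i \<cdot> me i (me (pr i) f))"

lemma linear_RR: "clinear (RR k)"
  unfolding RR_def[abs_def] by (intro clin)
lemmas RR_lin [simp] = clinD[OF linear_RR]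

lemma RR_0: "RR 0 f = r22 f" by (simp add: RR_def r22_def Ik_0)

lemma RR_mx: "RR k (mx j f) = mx j (RR k f)"
  by (simp add: RR_def me_mx mx_mx[of _ j])
lemma RR_me: "RR k (me j f) = me j (RR k f)"
  by (simp add: RR_def me_mx me_me[of _ j])
lemma dx_RR: "dx i (RR k f) = RR k (dx i f) + (if i = cc then 2 \<cdot> mx cc f else 0)"
  by (auto simp: RR_def ccr scale_simps cvec.scale_left_distrib[of 1 1, simplified])
lemma de_RR: "de i (RR k f) = RR k (de i f) + (if i \<in> Ik k then (2 * sn i) \<cdot> me (pr i) f else 0)"
  by (auto simp: RR_def ccr scale_simps sum_simps simp flip: cvec.scale_left_distrib)

lemma RR_step:
  assumes "N < n"
  shows "RR (n - Suc N) f = RR (n - N) f + 2 \<cdot> me (n - N) (me (pr (n - N)) f)"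
proof -
  have "me (pr (n - N)) (me (n - N) f) = - me (n - N) (me (pr (n - N)) f)" by (rule me_me)
  then show ?thesis
    using Ik_step(1,5,6,7)[OF assms] Ik_step(2)[OF assms, THEN pr_pr] Ik_step(2)[OF assms, THEN sn_pr]
      Ik_step(2)[OF assms, THEN pr_ne(2)]
    by (simp add: RR_def cvec.scale_left_distrib[of 1 1, simplified])
qed

lemma SE_RR [simp]: "f \<in> SEv \<Longrightarrow> RR k f \<in> SEv"
  by (simp add: RR_def)

lemma mx_inj: "i \<in> J \<Longrightarrow> mx i f = 0 \<Longrightarrow> f = 0"
proof (rule poly_mapping_eqI)
  fix m :: smono assume i: "i \<in> J" and 0: "mx i f = 0"
  obtain a S where m: "m = (a, S)" by (cases m)
  have "B (mx i f) (bvec (Poly_Mapping.single i 1 + a, S)) = sgm i * ((1 + of_nat (lookup a i)) * (lookup f m * wgt m))"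
    by (subst B_mx[OF i]) (simp add: dx_bvec B_scale_right B_bvec_right m lookup_add)
  moreover have "(1 + of_nat (lookup a i) :: complex) \<noteq> 0"
    by (metis of_nat_Suc of_nat_eq_0_iff old.nat.distinct(2))
  ultimately show "lookup f m = lookup 0 m" using 0 by simp
qed

text \<open>Leading terms in x_{2n+1}: the square of x_{2n+1} raises this degree by 2 and acts
  injectively, while the odd part of r^2 preserves it.\<close>

lemma RR_inj:
  assumes "RR k f = 0" shows "f = 0"
proof (rule ccontr)
  assume "f \<noteq> 0"
  let ?w = "wt (\<lambda>i. if i = cc then 1 else 0) (\<lambda>_. 0)"
  define A where "A f = mx cc (mx cc f)" for f
  define C where "C f = (\<Sum>i\<in>Ik k. sn i \<cdot> me i (me (pr i) f))" for f
  have A: "shifts ?w 2 A"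
    unfolding A_def[abs_def] by (rule shifts_rules cc_J | simp)+
  have C: "shifts ?w 0 C"
    unfolding C_def[abs_def] by (rule shifts_sum, rule shifts_scale) (rule shifts_rules | simp)+
  define t where "t = Max (?w ` keys f)"
  have fin: "finite (?w ` keys f)" "?w ` keys f \<noteq> {}" using \<open>f \<noteq> 0\<close> by (simp_all add: keys_eq_empty)
  then have "t \<in> ?w ` keys f" unfolding t_def by (rule Max_in)
  then have 1: "keys (cmp ?w t f) \<noteq> {}" by (auto simp: keys_cmp)
  have "?w m \<le> t" if "m \<in> keys f" for m using that fin by (simp add: t_def)
  then have "keys (cmp ?w (t + 2) f) = {}" by (fastforce simp: keys_cmp)
  then have "cmp ?w (t + 2) f = 0" by (simp only: keys_eq_empty)
  moreover have "cmp ?w (t + 2) (A f + C f) = 0"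
    using assms by (simp add: RR_def A_def C_def clinD(5)[OF linear_cmp])
  ultimately have "A (cmp ?w t f) = 0"
    using shifts_cmp[OF A, of t f] shifts_cmp[OF C, of "t + 2" f]
    by (simp add: clinD(1)[OF linear_cmp] clinD(5)[OF shifts_linear[OF C]])
  then have "cmp ?w t f = 0" unfolding A_def using mx_inj cc_J by metis
  with 1 show False by simp
qed

text \<open>The polynomials in x_{2n+1} and the \<eta>_i with i in \<open>Ik k\<close>, encoded by
  vanishing derivatives so that membership follows from the commutation rules.\<close>

definition pure :: "nat \<Rightarrow> smono cvec \<Rightarrow> bool" where
  "pure k h \<longleftrightarrow> h \<in> SEv \<and> (\<forall>i\<in>I. dx i h = 0) \<and> de cc h = 0 \<and> (\<forall>i\<in>I. i \<notin> Ik k \<longrightarrow> de i h = 0)"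

lemma pureD: "pure k h \<Longrightarrow> h \<in> SEv" "pure k h \<Longrightarrow> i \<in> I \<Longrightarrow> dx i h = 0" "pure k h \<Longrightarrow> de cc h = 0"
  "pure k h \<Longrightarrow> i \<in> I \<Longrightarrow> i \<notin> Ik k \<Longrightarrow> de i h = 0"
  by (auto simp: pure_def)

lemma pure_om_eq: "pure k h \<Longrightarrow> i \<in> I \<Longrightarrow> om i h = me i (dx cc h) + sn i \<cdot> mx cc (de (pr i) h)"
  by (simp add: om_def pureD)

lemma kill_comm: "dx i h = 0 \<Longrightarrow> dx i (de j h) = 0" "dx i h = 0 \<Longrightarrow> dx i (dx j h) = 0"
  "de i h = 0 \<Longrightarrow> de i (de j h) = 0" "de i h = 0 \<Longrightarrow> de i (dx j h) = 0"
  by (simp_all add: de_dx de_de[of i] dx_dx[of i] flip: de_dx[of j i])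

lemma pure_mono: "N < n \<Longrightarrow> pure (n - N) h \<Longrightarrow> pure (n - Suc N) h"
  unfolding pure_def using Ik_step(10) by blast

lemma pure_om: "pure k h \<Longrightarrow> j \<in> Ik k \<Longrightarrow> pure k (om j h)"
  unfolding pure_def
  by (auto simp: om_def ccr kill_comm)

lemma pure_me: "pure k h \<Longrightarrow> j \<in> Ik k \<Longrightarrow> pure k (me j h)"
  unfolding pure_def by (auto simp: ccr)
lemma pure_mx: "pure k h \<Longrightarrow> pure k (mx cc h)"
  unfolding pure_def by (auto simp: ccr)
lemma pure_RR: "pure k h \<Longrightarrow> pure k (RR k h)"
  unfolding pure_def by (auto simp: dx_RR de_RR)
lemma pure_add: "pure k h \<Longrightarrow> pure k g \<Longrightarrow> pure k (h + g)"
  and pure_diff: "pure k h \<Longrightarrow> pure k g \<Longrightarrow> pure k (h - g)"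
  and pure_scale: "pure k h \<Longrightarrow> pure k (c \<cdot> h)"
  unfolding pure_def by auto
lemma pure_vac: "pure k vac"
  unfolding pure_def by auto

lemma d22_me: "j \<in> I \<Longrightarrow> d22 (me j f) = me j (d22 f) - (2 * sn j) \<cdot> de (pr j) f"
proof -
  assume j: "j \<in> I"
  then show ?thesis
    by (simp add: d22_def ccr scale_simps sum_simps) (rule cvec_ext, simp add: cvec_coord)
qed

lemma degL_me: "j \<in> I \<Longrightarrow> degL (me j f) = me j (degL f) + me j f"
proof -
  assume j: "j \<in> I"
  have "(\<Sum>i\<in>I. me i (me j (de i f))) = - (\<Sum>i\<in>I. me j (me i (de i f)))"
    by (simp add: me_me[of _ j] sum_negf)
  with j show ?thesis
    by (simp add: degL_def ccr scale_simps sum_simps)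
qed
lemma degL_mx_cc: "degL (mx cc f) = mx cc (degL f) + mx cc f"
  by (simp add: degL_def ccr scale_simps sum_simps)
lemma degL_RR: "degL (RR k f) = RR k (degL f) + 2 \<cdot> RR k f"
  unfolding two_scale by (simp add: RR_def degL_mx_cc degL_me scale_simps sum_simps)

lemma om_me: "j \<in> I \<Longrightarrow> i \<in> I \<Longrightarrow> om i (me j f) = - me j (om i f) + (if i = pr j then sn i \<cdot> mx cc f else 0)"
  by (auto simp: om_def ccr scale_simps me_me[of i j] me_me[of cc j] pr_eq_iff)

text \<open>\<open>TT N\<close> is the odd power $r^{2N+1}$ of the radius
  $r^2 = x_{2n+1}^2 + 2\sum_{n-N<j\le n} \eta_j\eta_{2n+1-j}$, a polynomial because the odd part of
  $r^2$ has vanishing $(N+1)$-st power. The recursion is the expansion in the pair of odd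
  variables added at each step.\<close>

primrec TT :: "nat \<Rightarrow> smono cvec" where
  "TT 0 = mx cc vac"
| "TT (Suc N) = RR (n - N) (TT N) + of_nat (2*N+3) \<cdot> me (n - N) (me (pr (n - N)) (TT N))"

lemma pure_TT: "N \<le> n \<Longrightarrow> pure (n - N) (TT N)"
proof (induction N)
  case 0
  then show ?case by (simp add: pure_mx pure_vac)
next
  case (Suc N)
  then have N: "N < n" and IH: "pure (n - N) (TT N)" by auto
  show ?case
    unfolding TT.simps
    by (intro pure_add pure_scale pure_me pure_mono[OF N] pure_RR IH) (simp_all add: Ik_step[OF N])
qed

lemma degL_TT: "N \<le> n \<Longrightarrow> degL (TT N) = of_nat (2*N+1) \<cdot> TT N"
proof (induction N)
  case 0
  then show ?case by (simp add: degL_mx_cc) (simp add: degL_def)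
next
  case (Suc N)
  then have N: "N < n" and IH: "degL (TT N) = of_nat (2*N+1) \<cdot> TT N" by auto
  show ?case
    unfolding TT.simps
    by (simp add: degL_RR degL_me IH Ik_step[OF N] scale_simps)
       (rule cvec_ext, simp add: cvec_coord)
qed

text \<open>The chain rule for r^(2N+1), multiplied by r^2 on both sides: the factor r^(2N-1) that
  it would produce is not a polynomial in these variables.\<close>

lemma RR_TT_aux:
  "N \<le> n \<Longrightarrow> RR (n - N) (dx cc (TT N)) = of_nat (2*N+1) \<cdot> mx cc (TT N) \<and>
    (\<forall>i\<in>Ik (n - N). RR (n - N) (de i (TT N)) = (of_nat (2*N+1) * sn i) \<cdot> me (pr i) (TT N))"
proof (induction N)
  case 0
  show ?case by (simp add: RR_def Ik_n ccr mx_mx)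
next
  case (Suc N)
  have N: "N < n" "N \<le> n" using Suc.prems by auto
  note IH = Suc.IH[OF N(2)]
  note st = Ik_step[OF N(1)]
  define m where "m = n - N"
  \<comment> \<open>The exponent of r^(2N+3): expanding (r^2 + 2 \<eta> \<eta>')^(N+3/2) in the new
    pair stops after the linear term, whose coefficient is 2N+3.\<close>
  define e :: complex where "e = of_nat (2*N+3)"
  have e2: "of_nat (2*N+1) = e - 2" "of_nat (2 * Suc N + 1) = e" by (simp_all add: e_def)
  have T: "TT (Suc N) = RR m (TT N) + e \<cdot> me m (me (pr m) (TT N))"
    by (simp add: m_def e_def)
  have R: "RR (n - Suc N) f = RR m f + 2 \<cdot> me m (me (pr m) f)" for f
    by (simp add: m_def RR_step[OF N(1)])
  note IH' = IH[unfolded e2, folded m_def, THEN conjunct1] IH[unfolded e2, folded m_def, THEN conjunct2, THEN bspec]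
  note st' = st[folded m_def]
  have p: "pure m (TT N)" using pure_TT[OF N(2)] by (simp add: m_def)
  have mm: "me (pr m) (me m f) = - me m (me (pr m) f)" for f by (rule me_me)
  show ?case
  proof (intro conjI ballI)
    have "dx cc (TT (Suc N)) = e \<cdot> mx cc (TT N) + e \<cdot> me m (me (pr m) (dx cc (TT N)))"
      unfolding T by (simp add: dx_RR ccr IH' flip: cvec.scale_left_distrib)
    then show "RR (n - Suc N) (dx cc (TT (Suc N))) = of_nat (2 * Suc N + 1) \<cdot> mx cc (TT (Suc N))"
      unfolding R e2
      by (simp del: TT.simps add: T RR_mx RR_me IH' scale_simps me_mx mm)
         (rule cvec_ext, simp add: cvec_coord)
  next
    fix i assume "i \<in> Ik (n - Suc N)"
    then consider "i = m" | "i = pr m" | "i \<in> Ik m" using st' by auto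
    then show "RR (n - Suc N) (de i (TT (Suc N))) = (of_nat (2 * Suc N + 1) * sn i) \<cdot> me (pr i) (TT (Suc N))"
    proof cases
      case 1
      have "de m (TT (Suc N)) = e \<cdot> me (pr m) (TT N)"
        unfolding T by (simp add: de_RR ccr pureD[OF p] st'(2-10))
      then show ?thesis unfolding R e2 1 by (simp del: TT.simps add: T RR_me scale_simps mm st'(2-10))
    next
      case i: 2
      have "de (pr m) (TT (Suc N)) = - (e \<cdot> me m (TT N))"
        unfolding T by (simp add: de_RR ccr pureD[OF p] st'(2-10))
      then show ?thesis unfolding R e2 i by (simp del: TT.simps add: T RR_me scale_simps mm st'(2-10))
    next
      case i: 3
      then have ne: "i \<noteq> m" "i \<noteq> pr m" using st'(5,6) by metis+
      have "de i (TT (Suc N)) = (e * sn i) \<cdot> me (pr i) (TT N) + e \<cdot> me m (me (pr m) (de i (TT N)))"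
        unfolding T using ne i by (simp add: de_RR ccr IH') (rule cvec_ext, simp add: cvec_coord)
      moreover have "me m (me (pr m) (me (pr i) f)) = me (pr i) (me m (me (pr m) f))" for f
        by (simp add: me_me[of _ "pr i"])
      ultimately show ?thesis unfolding R e2 using i
        by (simp del: TT.simps add: T RR_me IH' scale_simps mm)
           (rule cvec_ext, simp add: cvec_coord)
    qed
  qed
qed

lemma RR_TT:
  assumes "N \<le> n"
  shows "RR (n - N) (dx cc (TT N)) = of_nat (2*N+1) \<cdot> mx cc (TT N)"
    "i \<in> Ik (n - N) \<Longrightarrow> RR (n - N) (de i (TT N)) = (of_nat (2*N+1) * sn i) \<cdot> me (pr i) (TT N)"
  using RR_TT_aux[OF assms] by auto

text \<open>\<open>om i\<close> acts as an infinitesimal rotation preserving r^2. The two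
  contributions cancel after multiplication by r^2, where the chain rule is available, and
  \<open>RR_inj\<close> removes the factor.\<close>

lemma om_TT:
  assumes "N \<le> n" "i \<in> Ik (n - N)"
  shows "om i (TT N) = 0"
proof -
  have "RR (n - N) (om i (TT N)) = 0"
    using assms RR_TT[OF assms(1)]
    by (simp add: pure_om_eq[OF pure_TT] RR_me RR_mx me_mx)
  then show ?thesis by (rule RR_inj)
qed

text \<open>In superdimension M = 1 - 2N the Laplacian sends r^s to s(s + M - 2) r^(s-2); for s =
  2N+3 the factor is 2(2N+3).\<close>

lemma d22_RR_TT:
  assumes N: "N < n"
  shows "d22 (RR (n - N) (TT N)) = of_nat (4*N+6) \<cdot> TT N"
proof -
  define m where "m = n - N"
  define e :: complex where "e = of_nat (2*N+3)"
  have e2: "of_nat (2*N+1) = e - 2" by (simp add: e_def)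
  have p: "pure m (TT N)" using pure_TT[of N] N by (simp add: m_def)
  note RT = RR_TT[of N, folded m_def, unfolded e2]
  have a: "dx cc (RR m (TT N)) = e \<cdot> mx cc (TT N)"
    using RT N by (simp add: dx_RR flip: cvec.scale_left_distrib)
  have b: "de i (RR m (TT N)) = (if i \<in> Ik m then (e * sn i) \<cdot> me (pr i) (TT N) else 0)" if "i \<in> I" for i
    using RT N that p by (simp add: de_RR pureD flip: cvec.scale_left_distrib) (simp add: algebra_simps)
  have dL: "degL (TT N) = mx cc (dx cc (TT N)) + (\<Sum>i\<in>Ik m. me i (de i (TT N)))"
    unfolding degL_def using p by (intro arg_cong2[of _ _ _ _ "(+)"] refl sum.mono_neutral_right)
      (auto simp: pureD)
  have c: "(\<Sum>i\<in>I. sn i \<cdot> de i (de (pr i) (RR m (TT N)))) = (\<Sum>i\<in>Ik m. (- e) \<cdot> (TT N - me i (de i (TT N))))"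
  proof -
    have "(\<Sum>i\<in>I. sn i \<cdot> de i (de (pr i) (RR m (TT N)))) = (\<Sum>i\<in>Ik m. sn i \<cdot> de i (de (pr i) (RR m (TT N))))"
      using Ik_pr[of "pr _" m] by (intro sum.mono_neutral_right) (auto simp: b)
    also have "\<dots> = (\<Sum>i\<in>Ik m. (- e) \<cdot> (TT N - me i (de i (TT N))))"
      by (intro sum.cong) (auto simp: b ccr algebra_simps)
    finally show ?thesis .
  qed
  have cd: "card (Ik m) = 2*N" using N by (auto simp: card_Ik m_def)
  have "d22 (RR m (TT N)) = e \<cdot> (TT N + mx cc (dx cc (TT N))) + (\<Sum>i\<in>Ik m. (- e) \<cdot> (TT N - me i (de i (TT N))))"
    unfolding d22_def a c by (simp add: dx_mx add.commute)
  also have "\<dots> = e \<cdot> (TT N + degL (TT N) - of_nat (2*N) \<cdot> TT N)"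
    unfolding dL by (simp add: scale_simps sum_simps sum_const_cvec cd)
  also have "\<dots> = of_nat (4*N+6) \<cdot> TT N"
    using N by (simp add: degL_TT e_def flip: cvec.scale_left_distrib cvec.scale_left_diff_distrib)
      (simp add: algebra_simps flip: cvec.scale_left_distrib cvec.scale_left_diff_distrib)
  finally show ?thesis by (simp add: m_def)
qed

text \<open>The factor s(s + M - 2) vanishes at s = 2 - M = 2N+1. In the recursion, the term from
  the new pair contributes -2(2N+3) and cancels \<open>d22_RR_TT\<close>.\<close>

lemma d22_TT: "N \<le> n \<Longrightarrow> d22 (TT N) = 0"
proof (induction N)
  case 0
  then show ?case by (simp add: d22_def ccr)
next
  case (Suc N)
  then have N: "N < n" and IH: "d22 (TT N) = 0" by auto
  have p: "pure (n - N) (TT N)" using pure_TT[of N] N by simp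
  have "d22 (me (n - N) (me (pr (n - N)) (TT N))) = - (2 \<cdot> TT N)"
    by (simp add: Ik_step(2-10)[OF N] d22_me IH pureD[OF p] ccr)
  then show ?case
    unfolding TT.simps by (simp add: d22_RR_TT[OF N])
qed

text \<open>Pairs missing from \<open>RR k\<close> contribute nothing against a vector free of their
  variables, so \<open>RR k\<close> can be replaced by \<open>r22\<close>, the adjoint of
  \<open>d22\<close>.\<close>

lemma B_RR:
  assumes "pure k g"
  shows "B g (RR k f) = B (d22 g) f"
proof -
  have "B g (r22 f) = B g (RR k f)"
  proof -
    have "(\<Sum>i\<in>I. sn i * B g (me i (me (pr i) f))) = (\<Sum>i\<in>Ik k. sn i * B g (me i (me (pr i) f)))"
    proof (rule sum.mono_neutral_right)
      show "\<forall>i\<in>I - Ik k. sn i * B g (me i (me (pr i) f)) = 0"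
        using assms by (auto simp: B_sym[of g] B_me) (simp add: B_sym[of _ g] pureD B_sym[of "me _ f"])
    qed auto
    then show ?thesis by (simp add: r22_def RR_def B_lin)
  qed
  then show ?thesis by (simp add: B_d22)
qed

text \<open>One factor is rewritten with the larger radius \<open>RR (n - Suc N)\<close>, whose part
  is orthogonal to the harmonic \<open>TT (Suc N)\<close>. The rest gives the recursion factor
  -(2N+1)(2N+3).\<close>

lemma B_TT: "N \<le> n \<Longrightarrow> B (TT N) (TT N) \<noteq> 0"
proof (induction N)
  case 0
  then show ?case by (simp add: B_mx ccr) (simp add: vac_def B_bvec)
next
  case (Suc N)
  then have N: "N < n" and IH: "B (TT N) (TT N) \<noteq> 0" by auto
  define m where "m = n - N"
  define e :: complex where "e = of_nat (2*N+3)"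
  define E where "E = me m (me (pr m) (TT N))"
  have p: "pure m (TT N)" using pure_TT[of N] N by (simp add: m_def)
  note st = Ik_step[OF N, folded m_def]
  have T: "TT (Suc N) = RR m (TT N) + e \<cdot> E" by (simp add: m_def e_def E_def)
  have T2: "TT (Suc N) = RR (n - Suc N) (TT N) + (e - 2) \<cdot> E"
    unfolding T using RR_step[OF N, of "TT N"] by (simp add: E_def m_def)
      (rule cvec_ext, simp add: cvec_coord)
  have pS: "pure (n - Suc N) (TT (Suc N))" using pure_TT[of "Suc N"] N by simp
  have EE: "B E E = - B (TT N) (TT N)"
    unfolding E_def by (simp add: B_me ccr B_lin pureD[OF p] st(2-10))
  have RE: "B (RR m (TT N)) E = 0"
    unfolding E_def by (subst B_sym) (simp add: B_me de_RR pureD[OF p] st(2-10))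
  have "B (TT (Suc N)) (TT (Suc N)) = (e - 2) * B (TT (Suc N)) E"
    by (subst (2) T2) (use N in \<open>simp add: B_lin B_RR[OF pS] d22_TT del: TT.simps\<close>)
  also have "\<dots> = - ((e - 2) * e * B (TT N) (TT N))"
    unfolding T by (simp add: B_lin RE EE)
  finally have *: "B (TT (Suc N)) (TT (Suc N)) = - ((e - 2) * e * B (TT N) (TT N))" .
  have "e - 2 = of_nat (2*N+1)" by (simp add: e_def)
  then have "e - 2 \<noteq> 0" "e \<noteq> 0" unfolding e_def by (metis of_nat_eq_0_iff add_is_0 one_neq_zero zero_neq_numeral)+
  with IH * show ?case by simp
qed

section \<open>Anticommutators of the odd generators, and the two degrees\<close>

definition E :: "nat \<Rightarrow> nat \<Rightarrow> smono cvec \<Rightarrow> smono cvec" where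
  "E i j f = mx i (dx j f) + me i (de j f)"

lemma Ik_less: "i \<in> Ik k \<Longrightarrow> k < i \<and> k < pr i"
  unfolding Ik_def by blast

lemma cc_first:
  "k \<noteq> cc \<Longrightarrow> me k (me cc v) = - me cc (me k v)" "k \<noteq> cc \<Longrightarrow> de k (de cc v) = - de cc (de k v)"
  "k \<noteq> cc \<Longrightarrow> mx k (mx cc v) = mx cc (mx k v)" "k \<noteq> cc \<Longrightarrow> dx k (dx cc v) = dx cc (dx k v)"
  by (rule me_me de_de mx_mx dx_dx)+

text \<open>\<open>E i j\<close> is the matrix unit taking u_j to u_i, acting on the x and \<eta>
  variables simultaneously; the right-hand sides are the elements of sp(2n), which thus arises from
  the odd generators.\<close>

lemma om_om: "i \<in> I \<Longrightarrow> j \<in> I \<Longrightarrow>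
    om i (om j f) + om j (om i f) = sn j \<cdot> E i (pr j) f + sn i \<cdot> E j (pr i) f"
proof -
  assume ij: "i \<in> I" "j \<in> I"
  have ss: "sn i \<cdot> sn j \<cdot> v = sn j \<cdot> sn i \<cdot> v" for v :: "smono cvec" by (simp add: mult.commute)
  have a: "me j (me i v) = - me i (me j v)" "de (pr j) (de (pr i) v) = - de (pr i) (de (pr j) v)"
    "mx j (mx i v) = mx i (mx j v)" "dx (pr j) (dx (pr i) v) = dx (pr i) (dx (pr j) v)" for v
    by (rule me_me de_de mx_mx dx_dx)+
  have a': "me (pr i) (me i v) = - me i (me (pr i) v)" "de i (de (pr i) v) = - de (pr i) (de i v)"
    "mx (pr i) (mx i v) = mx i (mx (pr i) v)" "dx i (dx (pr i) v) = dx (pr i) (dx i v)" for v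
    by (rule me_me de_de mx_mx dx_dx)+
  consider "i = j" | "j = pr i" | "i \<noteq> j" "j \<noteq> pr i" by blast
  then show ?thesis
  proof cases
    case 1
    with ij show ?thesis
      by (simp add: om_def E_def ccr scale_simps cc_first)
  next
    case 2
    with ij show ?thesis
      by (simp add: om_def E_def ccr scale_simps cc_first a')
  next
    case 3
    then have "i \<noteq> pr j" using ij by auto
    with 3 ij show ?thesis
      by (simp add: om_def E_def ccr scale_simps cc_first a)
        (rule cvec_ext, simp add: cvec_coord)
  qed
qed

lemma om_sq: "i \<in> I \<Longrightarrow> om i (om i f) = sn i \<cdot> E i (pr i) f"
proof -
  assume "i \<in> I"
  then have "2 \<cdot> om i (om i f) = 2 \<cdot> sn i \<cdot> E i (pr i) f"
    unfolding two_scale by (simp add: om_om)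
  then show ?thesis by (simp del: cvec.scale_scale)
qed

lemma om_de: "j \<in> I \<Longrightarrow> i \<in> I \<Longrightarrow> om i (de j f) = - de j (om i f) + (if i = j then dx cc f else 0)"
  by (auto simp: om_def ccr scale_simps de_de[of "pr i" j] de_de[of cc j])
lemma d22_de: "d22 (de j f) = de j (d22 f)"
  by (simp add: d22_def ccr de_de[of _ j] scale_simps)
lemma degL_de: "j \<in> I \<Longrightarrow> degL (de j f) = de j (degL f) - de j f"
proof -
  assume j: "j \<in> I"
  have "(\<Sum>i\<in>I. me i (de j (de i f))) = - (\<Sum>i\<in>I. me i (de i (de j f)))"
    by (simp add: de_de[of j] sum_negf)
  with j show ?thesis
    by (simp add: degL_def ccr scale_simps sum_simps)
qed
lemma degL_dx_cc: "degL (dx cc f) = dx cc (degL f) - dx cc f"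
  by (simp add: degL_def ccr scale_simps sum_simps)

text \<open>\<open>wS\<close> counts the generators u_i \<otimes> v_1 and \<open>wL\<close> the
  generators u_i \<otimes> w_1; this is why the index 2n+1 changes sides for even and odd
  variables.\<close>

definition wL where "wL = wt (\<lambda>i. if i = cc then 1 else 0) (\<lambda>i. if i = cc then 0 else 1)"
definition wS where "wS = wt (\<lambda>i. if i = cc then 0 else 1) (\<lambda>i. if i = cc then 1 else 0)"

lemma degL_diag: "degL f = diag (\<lambda>m. of_int (wL m)) f"
  unfolding wL_def euler[symmetric] by (simp add: J_eq degL_def)
lemma degS_diag: "degS f = diag (\<lambda>m. of_int (wS m)) f"
  unfolding wS_def euler[symmetric] by (simp add: J_eq degS_def)

lemma degL_homd: "degL f = of_int t \<cdot> f \<longleftrightarrow> homd wL t f"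
  by (simp add: degL_diag homd_diag)
lemma degS_homd: "degS f = of_int t \<cdot> f \<longleftrightarrow> homd wS t f"
  by (simp add: degS_diag homd_diag)

lemma wL_nonneg: "0 \<le> wL m" and wS_nonneg: "0 \<le> wS m"
  by (auto simp: wL_def wS_def wt_def intro!: sum_nonneg)

lemma degL_neg: "degL f = of_int t \<cdot> f \<Longrightarrow> t < 0 \<Longrightarrow> f = 0"
  unfolding degL_homd homd_def using wL_nonneg by (metis all_not_in_conv keys_eq_empty linorder_not_less)
lemma degS_neg: "degS f = of_int t \<cdot> f \<Longrightarrow> t < 0 \<Longrightarrow> f = 0"
  unfolding degS_homd homd_def using wS_nonneg by (metis all_not_in_conv keys_eq_empty linorder_not_less)

lemma pure_degL: "pure k f \<Longrightarrow> degL f = mx cc (dx cc f) + (\<Sum>i\<in>Ik k. me i (de i f))"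
  unfolding degL_def by (intro arg_cong2[of _ _ _ _ "(+)"] refl sum.mono_neutral_right) (auto simp: pureD)

lemma pure_d22: "pure k f \<Longrightarrow> d22 f = dx cc (dx cc f) + (\<Sum>i\<in>Ik k. sn i \<cdot> de i (de (pr i) f))"
  unfolding d22_def by (intro arg_cong2[of _ _ _ _ "(+)"] refl sum.mono_neutral_right) (auto simp: pureD)

text \<open>\<open>hh N l\<close> spans the harmonic highest weight vectors of degree \<open>l\<close> in $x_{2n+1}$ and the odd variables
  with indices strictly between $n-N$ and $n+N+1$.\<close>

fun hh :: "nat \<Rightarrow> nat \<Rightarrow> smono cvec" where
  "hh 0 l = (if l = 0 then vac else if l = 1 then TT 0 else 0)"
| "hh (Suc N) l = (if l = 0 then vac else if l = 2*N+3 then TT (Suc N) else me (n - N) (hh N (l - 1)))"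

lemma hh_0 [simp]: "hh N 0 = vac" by (cases N) auto
lemma hh_top: "hh N (2*N+1) = TT N" by (cases N) auto
lemma hh_big: "2*N+1 < l \<Longrightarrow> hh N l = 0"
  by (induction N arbitrary: l) auto

text \<open>Highest weight conditions with respect to the pairs in \<open>Ik k\<close>. The
  \<open>om i\<close> with i \<le> n are the positive odd root vectors; on vectors they kill,
  \<open>om i\<close> after \<open>om j\<close> with n < j acts as the even root vector for
  \<epsilon>_i - \<epsilon>_{pr j}, which is positive when i < \<open>pr j\<close>.\<close>

definition Sing :: "nat \<Rightarrow> nat \<Rightarrow> smono cvec \<Rightarrow> bool" where
  "Sing k l h \<longleftrightarrow> pure k h \<and> degL h = of_nat l \<cdot> h \<and> d22 h = 0 \<and>
     (\<forall>i\<in>Ik k. i \<le> n \<longrightarrow> om i h = 0) \<and>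
     (\<forall>i\<in>Ik k. \<forall>j\<in>Ik k. i \<le> n \<longrightarrow> n < j \<longrightarrow> i < pr j \<longrightarrow> om i (om j h) = 0)"

lemma SingD: assumes "Sing k l h"
  shows "pure k h" "degL h = of_nat l \<cdot> h" "d22 h = 0" "i \<in> Ik k \<Longrightarrow> i \<le> n \<Longrightarrow> om i h = 0"
    "i \<in> Ik k \<Longrightarrow> j \<in> Ik k \<Longrightarrow> i \<le> n \<Longrightarrow> n < j \<Longrightarrow> i < pr j \<Longrightarrow> om i (om j h) = 0"
  using assms unfolding Sing_def by blast+

lemma Sing_vac: "Sing k 0 vac"
proof -
  have "om i vac = 0" for i by (simp add: om_def)
  then show ?thesis by (auto simp: Sing_def pure_vac degL_def d22_def)
qed

text \<open>With m = n - N, \<open>om m\<close> applied to a vector in the inner variables is a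
  multiple of \<eta>_m (\<open>mg\<close>), hence killed by the factor \<eta>_m. The other raising
  operators pass through this factor up to sign.\<close>

lemma Sing_me:
  assumes N: "N < n" and h: "Sing (n - N) l h"
  shows "Sing (n - Suc N) (Suc l) (me (n - N) h)"
  unfolding Sing_def
proof (intro conjI ballI impI)
  define m where "m = n - N"
  note st = Ik_step[OF N, folded m_def]
  note hD = SingD[OF h, folded m_def]
  show "pure (n - Suc N) (me (n - N) h)"
    by (intro pure_me pure_mono N SingD[OF h]) (rule Ik_step[OF N])
  show "degL (me (n - N) h) = of_nat (Suc l) \<cdot> me (n - N) h"
    by (simp add: Ik_step(2)[OF N] degL_me SingD[OF h] cvec.scale_left_distrib add.commute)
  show "d22 (me (n - N) h) = 0"
    by (simp add: Ik_step[OF N] d22_me SingD[OF h] pureD[OF SingD(1)[OF h]])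
  have mg: "me m (om m g) = 0" if "pure m g" for g
    by (simp add: pure_om_eq[OF that st(2)] pureD(4)[OF that pr_I[OF st(2)] st(6)] me_mx)
  have ne: "i \<noteq> pr m" if "i \<le> n" for i using that st(4) by auto
  have 1: "om i (me m h) = 0" if i: "i \<in> Ik (n - Suc N)" "i \<le> n" for i
  proof -
    have "i = m \<or> i \<in> Ik m" using i ne[OF i(2)] st(1) by auto
    then show ?thesis using i ne[OF i(2)] mg[OF hD(1)] hD(4)[of i] st(2) by (auto simp: om_me)
  qed
  then show "om i (me (n - N) h) = 0" if "i \<in> Ik (n - Suc N)" "i \<le> n" for i
    using that by (simp add: m_def)
  fix i j assume i: "i \<in> Ik (n - Suc N)" and j: "j \<in> Ik (n - Suc N)" "i \<le> n" "n < j" "i < pr j"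
  have "j \<noteq> pr m"
    using i j(4) st(2) N by (auto simp: m_def Ik_eq)
  moreover have "j \<noteq> m" using j st(3) by auto
  ultimately have jm: "j \<in> Ik m" using j st(1) by auto
  have "om i (om j h) = 0 \<or> i = m" using hD(5)[of i j] i j st(1) jm ne[OF j(2)] by auto
  moreover have "me m (om m (om j h)) = 0" by (rule mg[OF pure_om[OF hD(1) jm]])
  ultimately show "om i (om j (me (n - N) h)) = 0"
    using i j jm ne[OF j(2)] st(2) \<open>j \<noteq> pr m\<close> by (auto simp: om_me simp flip: m_def)
qed

lemma Sing_hh: "N \<le> n \<Longrightarrow> Sing (n - N) l (hh N l)"
proof (induction N arbitrary: l)
  case 0
  have "Sing n 1 (TT 0)"
    using pure_TT[of 0] degL_TT[of 0] d22_TT[of 0] by (simp add: Sing_def Ik_n)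
  moreover have "Sing n l 0" for l by (auto simp: Sing_def pure_def)
  ultimately show ?case by (simp add: Sing_vac)
next
  case (Suc N)
  then have N: "N < n" by simp
  have e: "2 * Suc N + 1 = 2 * N + 3" by simp
  have "Sing (n - Suc N) (2 * N + 3) (TT (Suc N))"
    using om_TT[OF Suc.prems] Suc.prems degL_TT[OF Suc.prems, unfolded e] unfolding Sing_def
    by (auto simp: pure_TT d22_TT simp del: TT.simps)
  moreover have "Sing (n - Suc N) (Suc (l - 1)) (me (n - N) (hh N (l - 1)))"
    using Sing_me[OF N Suc.IH] N by simp
  ultimately show ?case by (cases "l = 0 \<or> l = 2 * N + 3") (auto simp: Sing_vac simp del: TT.simps)
qed

lemma B_hh: "N \<le> n \<Longrightarrow> l \<le> 2*N+1 \<Longrightarrow> B (hh N l) (hh N l) \<noteq> 0"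
proof (induction N arbitrary: l)
  case 0
  then show ?case using B_TT[of 0] by (auto simp: vac_def B_bvec)
next
  case (Suc N)
  then have N: "N < n" by simp
  show ?case
  proof (cases "l = 0 \<or> l = 2*N+3")
    case True
    then show ?thesis using B_TT[OF Suc.prems(1)] by (auto simp: vac_def B_bvec simp del: TT.simps)
  next
    case False
    then have "B (hh N (l - 1)) (hh N (l - 1)) \<noteq> 0" using Suc by auto
    moreover have "de (n - N) (hh N (l - 1)) = 0"
      by (rule pureD(4)[OF SingD(1)[OF Sing_hh[of N]]]) (use N in \<open>simp_all add: Ik_step(2,5)\<close>)
    ultimately show ?thesis using False by (simp add: B_me ccr Ik_step(2,7)[OF N])
  qed
qed

lemma Sing_0:
  assumes "Sing k 0 h"
  shows "\<exists>g. h = g \<cdot> vac"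
proof (rule const_vac)
  note hD = SingD[OF assms]
  show "h \<in> SEv" using hD(1) by (simp add: pureD)
  have "dx cc h = 0"
    by (rule degL_neg[where t = "-1"]) (simp_all add: degL_dx_cc hD)
  then show "dx i h = 0" if "i \<in> J" for i using that hD(1) by (auto simp: J_eq pureD)
  have "de i h = 0" if "i \<in> I" for i
    by (rule degL_neg[where t = "-1"]) (simp_all add: degL_de hD that)
  then show "de i h = 0" if "i \<in> J" for i using that hD(1) by (auto simp: J_eq pureD)
qed

text \<open>Expansion in the outermost pair: h = h0 + \<eta>_m h1 + \<eta>_m \<eta>_{pr m} h3. The
  equations involving \<open>om m\<close> express the derivatives of h0 through h3, and the Euler
  identity turns this into l h0 = r^2 h3. Harmonicity then forces h3 = 0 or l = 2N+3, and h1, h3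
  satisfy the same conditions one level down.\<close>

lemma Sing_unique: "N \<le> n \<Longrightarrow> Sing (n - N) l h \<Longrightarrow> \<exists>g. h = g \<cdot> hh N l"
proof (induction N arbitrary: l h)
  case 0
  then have h: "Sing n l h" by simp
  note hD = SingD[OF h] and p = pureD[OF SingD(1)[OF h]]
  show ?case
  proof (cases "l = 0")
    case True
    then show ?thesis using Sing_0 h by simp
  next
    case False
    have "degL h = mx cc (dx cc h)" by (simp add: pure_degL[OF hD(1)] Ik_n)
    then have eq: "of_nat l \<cdot> h = mx cc (dx cc h)" using hD(2) by simp
    have "dx cc (dx cc h) = 0" using hD(3) by (simp add: pure_d22[OF hD(1)] Ik_n)
    then have "\<exists>g. dx cc h = g \<cdot> vac"
      using p by (intro const_vac) (auto simp: J_eq Ik_n kill_comm)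
    then obtain g where g: "dx cc h = g \<cdot> vac" by blast
    have "of_nat l \<cdot> g \<cdot> vac = g \<cdot> vac"
      using arg_cong[OF eq, of "dx cc"] by (simp add: g ccr)
    then have "of_nat l * g = g" by simp
    then have g0: "g = 0 \<or> l = 1" by simp
    have hg: "h = (g / of_nat l) \<cdot> mx cc vac"
      using arg_cong[OF eq, of "\<lambda>v. (1 / of_nat l) \<cdot> v"] False by (simp add: g)
    show ?thesis
    proof (cases "l = 1")
      case True
      then show ?thesis using hg by auto
    next
      case False
      then show ?thesis using hg g0 \<open>l \<noteq> 0\<close> by auto
    qed
  qed
next
  case (Suc N)
  then have N: "N < n" and h: "Sing (n - Suc N) l h" by auto
  define m where "m = n - N"
  note st = Ik_step[OF N, folded m_def]
  note hD = SingD[OF h] and p = pureD[OF SingD(1)[OF h]]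
  have mI: "m \<in> I" "m \<noteq> cc" "pr m \<noteq> cc" "m \<noteq> pr m" "pr m \<noteq> m" "pr m \<in> I" "pr (pr m) = m"
    using st(2) I_ne_cc pr_I[OF st(2)] by auto
  define g where "g = de m h"
  define h3 where "h3 = de (pr m) g"
  define h1 where "h1 = g - me (pr m) h3"
  define h0 where "h0 = h - me m g"
  have omm: "om m h = 0" by (rule hD(4)[OF st(8) st(3)])
  \<comment> \<open>The square of \<open>om m\<close> is the root vector for 2 \<epsilon>_m. As h
    has no x_i with i in \<open>I\<close>, it shows that \<eta>_{pr m} occurs in h only together
    with \<eta>_m.\<close>
  have "E m (pr m) h = 0" using om_sq[OF mI(1), of h] omm st(7) by simp
  then have a1: "me m (de (pr m) h) = 0" using p mI by (simp add: E_def)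
  have a2: "de (pr m) h = - me m h3"
    using arg_cong[OF a1, of "de m"] unfolding h3_def g_def
    by (simp add: ccr de_de[of m "pr m"] eq_neg_iff_add_eq_0)
  have z: "de m g = 0" "de m h3 = 0" "de (pr m) h3 = 0"
    unfolding h3_def g_def by (simp_all add: kill_comm)
  have om_om_0: "om m (om j h) = 0" if "j \<in> Ik m" for j
  proof (cases "j \<le> n")
    case True
    then show ?thesis using hD(4)[OF st(10)[OF that]] by simp
  next
    case False
    then show ?thesis using hD(5)[OF st(8) st(10)[OF that] st(3)] Ik_less[OF that] by simp
  qed
  have pm: "pure m f" if "pure (n - Suc N) f" "de m f = 0" "de (pr m) f = 0" for f
    using that st(1) unfolding pure_def by auto
  have pg: "pure (n - Suc N) g" "pure (n - Suc N) h3" "pure (n - Suc N) (me (pr m) h3)" "pure (n - Suc N) (me m g)"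
  proof -
    have "pure (n - Suc N) (de j f)" if "pure (n - Suc N) f" for j f
      using that unfolding pure_def by (auto simp: kill_comm)
    then show "pure (n - Suc N) g" "pure (n - Suc N) h3" using hD(1) by (auto simp: g_def h3_def)
    then show "pure (n - Suc N) (me (pr m) h3)" "pure (n - Suc N) (me m g)"
      using st by (auto intro: pure_me)
  qed
  have p3: "pure m h3" by (rule pm) (simp_all add: pg z)
  have p1': "pure m h1"
    by (rule pm) (auto simp: h1_def z ccr mI h3_def[symmetric] intro!: pure_diff pg)
  have p0: "pure m h0"
    by (rule pm) (auto simp: h0_def z ccr mI h3_def[symmetric] g_def[symmetric] a2 intro!: pure_diff pg hD)
  have dg: "degL g = of_int (int l - 1) \<cdot> g"
    unfolding g_def by (simp add: degL_de mI hD cvec.scale_left_diff_distrib)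
  have d3: "degL h3 = of_int (int l - 2) \<cdot> h3"
    unfolding h3_def by (simp add: degL_de mI dg) (rule cvec_ext, simp add: cvec_coord)
  have d1: "degL h1 = of_int (int l - 1) \<cdot> h1"
    unfolding h1_def by (simp add: degL_me mI dg d3) (rule cvec_ext, simp add: cvec_coord)
  have d0: "degL h0 = of_nat l \<cdot> h0"
    unfolding h0_def by (simp add: degL_me mI dg hD) (rule cvec_ext, simp add: cvec_coord)
  have neI: "i \<noteq> m" "i \<noteq> pr m" "i \<in> I" if "i \<in> Ik m" for i using that st(5,6) Ik_I by metis+
  have Km: "d22 g = 0" "i \<in> Ik m \<Longrightarrow> i \<le> n \<Longrightarrow> om i g = 0"
    "i \<in> Ik m \<Longrightarrow> j \<in> Ik m \<Longrightarrow> i \<le> n \<Longrightarrow> n < j \<Longrightarrow> i < pr j \<Longrightarrow> om i (om j g) = 0" for i j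
    unfolding g_def using hD(4)[of i] hD(5)[of i j] st(10)[of i] st(10)[of j] neI[of i] neI[of j]
    by (auto simp: d22_de om_de mI hD(3))
  have K3: "d22 h3 = 0" "i \<in> Ik m \<Longrightarrow> i \<le> n \<Longrightarrow> om i h3 = 0"
    "i \<in> Ik m \<Longrightarrow> j \<in> Ik m \<Longrightarrow> i \<le> n \<Longrightarrow> n < j \<Longrightarrow> i < pr j \<Longrightarrow> om i (om j h3) = 0" for i j
    unfolding h3_def using Km(2)[of i] Km(2)[of j] Km(3)[of i j] neI[of i] neI[of j]
    by (auto simp: d22_de om_de mI Km(1))
  have K1: "d22 h1 = 0" "i \<in> Ik m \<Longrightarrow> i \<le> n \<Longrightarrow> om i h1 = 0"
    "i \<in> Ik m \<Longrightarrow> j \<in> Ik m \<Longrightarrow> i \<le> n \<Longrightarrow> n < j \<Longrightarrow> i < pr j \<Longrightarrow> om i (om j h1) = 0" for i j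
    unfolding h1_def using Km(2)[of i] Km(2)[of j] Km(3)[of i j] K3(2)[of i] K3(2)[of j] K3(3)[of i j] neI[of i] neI[of j]
    by (auto simp: d22_me om_me mI z Km(1) K3(1))
  have b1: "dx cc h0 = mx cc h3"
  proof -
    have "me m (dx cc h) = me m (mx cc h3)"
      using omm a2 st(7) mI by (simp add: pure_om_eq[OF hD(1)] me_mx)
    from arg_cong[OF this, of "de m"] show ?thesis
      by (simp add: h0_def g_def ccr z algebra_simps)
  qed
  have b2: "de i h0 = sn i \<cdot> me (pr i) h3" if i: "i \<in> Ik m" for i
  proof -
    have ne: "i \<noteq> m" "i \<noteq> pr m" "pr i \<noteq> m" using i st(5,6) mI Ik_I[OF i] by (metis pr_pr)+
    have "sn (pr i) \<cdot> E m i h + sn m \<cdot> E (pr i) (pr m) h = 0"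
      using om_om[of m "pr i" h] om_om_0[of "pr i"] omm i mI by simp
    then have "me m (de i h) = sn i \<cdot> me m (me (pr i) h3)"
      using i mI p st(7) by (simp add: E_def a2 me_me[of "pr i" m] eq_neg_iff_add_eq_0 neg_eq_iff_add_eq_0)
    from arg_cong[OF this, of "de m"] show ?thesis using ne
      by (simp add: h0_def g_def ccr z algebra_simps de_de[of m i])
  qed
  \<comment> \<open>The Euler identity reassembles h0 from the derivatives \<open>b1\<close> and
    \<open>b2\<close>.\<close>
  have b4: "of_nat l \<cdot> h0 = RR m h3"
    using d0 unfolding pure_degL[OF p0] RR_def by (simp add: b1 b2)
  have d22h0: "d22 h0 = 2 \<cdot> h3"
    unfolding h0_def by (simp add: d22_me mI hD Km st(7) h3_def)
  \<comment> \<open>The Laplacian of h0 a second time, now from \<open>b1\<close> and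
    \<open>b2\<close>. Comparison with 2 h3 produces the factor l - 2N - 3.\<close>
  have "d22 h0 = h3 + degL h3 - of_nat (2*N) \<cdot> h3"
  proof -
    have "(\<Sum>i\<in>Ik m. sn i \<cdot> de i (de (pr i) h0)) = (\<Sum>i\<in>Ik m. me i (de i h3) - h3)"
      by (intro sum.cong refl) (simp add: b2 ccr scale_simps)
    moreover have "card (Ik m) = 2*N" using N by (auto simp: card_Ik m_def)
    ultimately show ?thesis
      unfolding pure_d22[OF p0] pure_degL[OF p3] b1 by (simp add: ccr sum_simps sum_const_cvec)
  qed
  then have eq: "h3 + of_int (int l - 2) \<cdot> h3 - of_nat (2*N) \<cdot> h3 - 2 \<cdot> h3 = 0"
    using d22h0 unfolding d3 by simp
  have "of_int (int l - 2 * int N - 3) \<cdot> h3 = h3 + of_int (int l - 2) \<cdot> h3 - of_nat (2*N) \<cdot> h3 - 2 \<cdot> h3"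
    by (rule cvec_ext, simp add: cvec_coord)
  then have "of_int (int l - 2 * int N - 3) \<cdot> h3 = 0" unfolding eq .
  then have "int l - 2 * int N - 3 = 0 \<or> h3 = 0"
    by (simp only: cvec.scale_eq_0_iff of_int_eq_0_iff)
  then have h3: "h3 = 0 \<or> l = 2*N+3" by linarith
  have hsum: "h = h0 + me m h1 + me m (me (pr m) h3)"
    by (simp add: h0_def h1_def)
  show ?case
  proof (cases "l = 0")
    case True
    then show ?thesis using Sing_0 h by simp
  next
    case l: False
    have "Sing m (l - 1) h1"
      unfolding Sing_def using p1' d1 K1 l by (simp add: of_nat_diff)
    then obtain g1 where g1: "h1 = g1 \<cdot> hh N (l - 1)" using Suc.IH N unfolding m_def by fastforce
    show ?thesis
    proof (cases "l = 2*N+3")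
      case True
      have "Sing m (2*N+1) h3"
        unfolding Sing_def using p3 d3 K3 True by simp
      then obtain g3 where g3: "h3 = g3 \<cdot> TT N"
        using Suc.IH[of "2*N+1" h3] N hh_top unfolding m_def by auto
      \<comment> \<open>Here h1 has degree 2N+2, one above the top degree of \<open>hh N\<close>,
        where \<open>hh\<close> takes the value 0.\<close>
      have h1: "h1 = 0" using g1 hh_big[of N "l - 1"] True by simp
      have "of_nat l \<cdot> h = g3 \<cdot> TT (Suc N)"
        unfolding hsum h1 scale_simps b4 by (simp add: g3 True m_def scale_simps)
      from arg_cong[OF this, of "\<lambda>v. (1 / of_nat l) \<cdot> v"] l
      have "h = (g3 / of_nat l) \<cdot> TT (Suc N)" by (simp del: TT.simps)
      then show ?thesis using True by (intro exI[of _ "g3 / of_nat l"]) (simp del: TT.simps)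
    next
      case False
      then have "h3 = 0" using h3 by simp
      then have "h0 = 0" using b4 l by simp
      then show ?thesis using hsum \<open>h3 = 0\<close> False l g1
        by (intro exI[of _ g1]) (simp add: m_def)
    qed
  qed
qed

end

declare One_nat_def [simp del]

context howe
begin

lemma one_I [simp]: "1 \<in> I" "Suc 0 \<in> I" and sn_1 [simp]: "sn 1 = 1" "sn (Suc 0) = 1"
  using n_pos by (auto simp: I_def sn_def)
lemma one_ne_cc [simp]: "1 \<noteq> cc" "Suc 0 \<noteq> cc" "cc \<noteq> 1" "cc \<noteq> Suc 0"
  using n_pos by (auto simp: cc_def)
lemma pr_gt: "i \<in> I \<Longrightarrow> i \<le> n \<Longrightarrow> n < pr i" and pr_le: "i \<in> I \<Longrightarrow> n < i \<Longrightarrow> pr i \<le> n"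
  by (auto simp: I_def pr_def)
lemma I_pos: "i \<in> I \<Longrightarrow> 1 \<le> i" by (auto simp: I_def)

subsection \<open>Joint singular vectors\<close>

text \<open>Setting $x_1 = 1$ and all other $x_i$ ($i\le 2n$) and $\eta_{2n+1}$ to $0$ is injective on
  homogeneous highest weight vectors, which reduces their classification to the harmonic
  polynomials above.\<close>

definition evx :: "smono cvec \<Rightarrow> smono cvec" where
  "evx = lin (\<lambda>(a, S). if (\<forall>i\<in>I. i \<noteq> 1 \<longrightarrow> lookup a i = 0) \<and> cc \<notin> S
     then bvec (Poly_Mapping.single cc (lookup a cc), S) else 0)"

lemma linear_evx: "clinear evx" by (simp add: evx_def linear_lin)
lemmas evx_lin [simp] = clinD[OF linear_evx]
lemmas clin_evx = clinear_comp[OF linear_evx] linear_evx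

lemma evx_bvec: "evx (bvec (a, S)) = (if (\<forall>i\<in>I. i \<noteq> 1 \<longrightarrow> lookup a i = 0) \<and> cc \<notin> S
     then bvec (Poly_Mapping.single cc (lookup a cc), S) else 0)"
  by (simp add: evx_def)

lemma evx_mx1: "evx (mx 1 f) = evx f"
  by (rule op_eqI[of "\<lambda>f. evx (mx 1 f)" evx]; (intro clin clin_evx)?)
     (auto simp: mx_bvec evx_bvec lookup_add lookup_single)
lemma evx_mx: "i \<in> I \<Longrightarrow> i \<noteq> 1 \<Longrightarrow> evx (mx i f) = 0"
  by (rule op_eqI[of "\<lambda>f. evx (mx i f)" "\<lambda>f. 0"]; (intro clin clin_evx)?)
     (auto simp: mx_bvec evx_bvec lookup_add lookup_single)
lemma evx_me_cc: "evx (me cc f) = 0"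
  by (rule op_eqI[of "\<lambda>f. evx (me cc f)" "\<lambda>f. 0"]; (intro clin clin_evx)?)
     (auto simp: me_bvec evx_bvec)
lemma evx_mx_cc: "evx (mx cc f) = mx cc (evx f)"
  by (rule op_eqI[of "\<lambda>f. evx (mx cc f)" "\<lambda>f. mx cc (evx f)"]; (intro clin clin_evx)?)
     (auto simp: mx_bvec evx_bvec lookup_add lookup_single simp flip: single_add)
lemma evx_dx_cc: "evx (dx cc f) = dx cc (evx f)"
  by (rule op_eqI[of "\<lambda>f. evx (dx cc f)" "\<lambda>f. dx cc (evx f)"]; (intro clin clin_evx)?)
     (auto simp: dx_bvec evx_bvec lookup_minus lookup_single simp flip: single_diff)
lemma evx_me: "i \<in> I \<Longrightarrow> evx (me i f) = me i (evx f)"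
  by (rule op_eqI[of "\<lambda>f. evx (me i f)" "\<lambda>f. me i (evx f)"]; (intro clin clin_evx)?)
     (auto simp: me_bvec evx_bvec)
lemma evx_de: "i \<in> I \<Longrightarrow> evx (de i f) = de i (evx f)"
  by (rule op_eqI[of "\<lambda>f. evx (de i f)" "\<lambda>f. de i (evx f)"]; (intro clin clin_evx)?)
     (auto simp: de_bvec evx_bvec)
lemma dx_evx: "i \<in> I \<Longrightarrow> dx i (evx f) = 0"
  by (rule op_eqI[of "\<lambda>f. dx i (evx f)" "\<lambda>f. 0"]; (intro clin clin_evx)?)
     (auto simp: dx_bvec evx_bvec lookup_single)
lemma de_cc_evx: "de cc (evx f) = 0"
  by (rule op_eqI[of "\<lambda>f. de cc (evx f)" "\<lambda>f. 0"]; (intro clin clin_evx)?)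
     (auto simp: de_bvec evx_bvec)
lemma evx_SE: "f \<in> SEv \<Longrightarrow> evx f \<in> SEv"
  by (rule SE_clinear[OF linear_evx]) (auto simp: evx_bvec intro!: bvec_SE split: if_splits)

lemmas evx_rules = evx_mx1 evx_mx evx_me_cc evx_mx_cc evx_dx_cc evx_me evx_de

lemma pure_evx: "f \<in> SEv \<Longrightarrow> pure 0 (evx f)"
  by (auto simp: pure_def evx_SE dx_evx de_cc_evx Ik_0)

lemma evx_pure:
  assumes "pure 0 f" shows "evx f = f"
proof (rule linear_eqI[OF linear_evx clinear_id])
  fix m assume m: "m \<in> keys f"
  obtain a S where mm: "m = (a, S)" by (cases m)
  have "degS f = of_int 0 \<cdot> f" using assms by (simp add: degS_def pureD)
  then have h: "homd wS 0 f" by (simp only: degS_homd)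
  then have "wS (a, S) = 0" using m mm by (auto simp: homd_def)
  then have z: "\<forall>i\<in>J. (if i = cc then 0 else 1) * int (lookup a i) + (if i \<in> S then if i = cc then 1 else 0 else 0) = 0"
    unfolding wS_def wt_def by (subst (asm) sum_nonneg_eq_0_iff) auto
  have cS: "cc \<notin> S" using bspec[OF z cc_J] by (auto split: if_splits)
  have aI: "lookup a i = 0" if "i \<in> I" for i using bspec[OF z I_J[OF that]] that by (auto split: if_splits)
  have "keys a \<subseteq> J" using assms m mm by (auto simp: pure_def SEv_iff)
  then have aJ: "lookup a i = 0" if "i \<notin> J" for i using that by (meson in_keys_iff subsetD)
  have "Poly_Mapping.single cc (lookup a cc) = a"
  proof (intro poly_mapping_eqI)
    fix i
    show "lookup (Poly_Mapping.single cc (lookup a cc)) i = lookup a i"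
      using aI[of i] aJ[of i] by (auto simp: lookup_single when_def J_eq)
  qed
  then show "evx (bvec m) = bvec m" using cS aI by (simp add: mm evx_bvec)
qed

lemma evx_om: "i \<in> I \<Longrightarrow> i \<noteq> 1 \<Longrightarrow> evx (om i f) = om i (evx f)"
  by (simp add: om_def evx_rules dx_evx de_cc_evx)
lemma evx_om1: "evx (om 1 f) = evx (de cc f) + om 1 (evx f)"
  by (simp add: om_def evx_rules evx_mx1 dx_evx de_cc_evx)
lemma evx_d22: "evx (d22 f) = d22 (evx f)"
  by (simp add: d22_def evx_rules)
lemma evx_degL: "evx (degL f) = degL (evx f)"
  by (simp add: degL_def evx_rules)
lemma evx_sum1: "(\<Sum>i\<in>I. evx (mx i (F i))) = evx (F 1)"
  by (subst sum.remove[of _ 1]) (auto simp: evx_mx1 evx_mx)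
text \<open>Of all terms only x_1 d/d\<eta>_1 survives the substitution. So \<open>p1 v = 0\<close>
  means that the restriction of v is free of \<eta>_1.\<close>

lemma evx_p1: "evx (p1 f) = - de 1 (evx f)"
  using evx_sum1[of "\<lambda>i. de i f"] by (simp add: p1_def evx_rules)
text \<open>The substitution sees only the x_1 term of \<open>degS\<close>. On homogeneous vectors
  this recovers the derivative in the eliminated variable from the degree.\<close>

lemma evx_dx1: "evx (dx 1 f) = evx (degS f)"
  using evx_sum1[of "\<lambda>i. dx i f"] by (simp add: degS_def evx_rules)

text \<open>Annihilation by the nilradical in terms of odd generators: the second clause covers the
  roots \<epsilon>_i - \<epsilon>_j, and the remaining positive even roots come from anticommutators
  of two \<open>om i\<close> with i \<le> n.\<close>

definition hw :: "smono cvec \<Rightarrow> bool" where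
  "hw v \<longleftrightarrow> (\<forall>i\<in>I. i \<le> n \<longrightarrow> om i v = 0) \<and>
     (\<forall>i\<in>I. \<forall>j\<in>I. i \<le> n \<longrightarrow> n < j \<longrightarrow> i < pr j \<longrightarrow> om i (om j v) = 0)"

lemma hwD: "hw v \<Longrightarrow> i \<in> I \<Longrightarrow> i \<le> n \<Longrightarrow> om i v = 0"
  "hw v \<Longrightarrow> i \<in> I \<Longrightarrow> j \<in> I \<Longrightarrow> i \<le> n \<Longrightarrow> n < j \<Longrightarrow> i < pr j \<Longrightarrow> om i (om j v) = 0"
  unfolding hw_def by blast+

lemma hw_om_om: "hw v \<Longrightarrow> i \<in> I \<Longrightarrow> j \<in> I \<Longrightarrow> i \<le> n \<Longrightarrow> i < pr j \<Longrightarrow> om i (om j v) = 0"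
  using hwD[of v i] hwD[of v j] by (cases "j \<le> n") (auto intro: hwD(2))

lemma hw_E: "hw v \<Longrightarrow> i \<in> I \<Longrightarrow> j \<in> I \<Longrightarrow> i \<le> n \<Longrightarrow> i < pr j \<Longrightarrow>
    sn j \<cdot> E i (pr j) v + sn i \<cdot> E j (pr i) v = 0"
  using om_om[of i j v] hw_om_om[of v i j] hwD(1)[of v i] by simp

lemma hw_lin: "hw 0" "hw u \<Longrightarrow> hw v \<Longrightarrow> hw (u + v)" "hw u \<Longrightarrow> hw v \<Longrightarrow> hw (u - v)" "hw v \<Longrightarrow> hw (c \<cdot> v)"
  unfolding hw_def by simp_all

text \<open>The principal grading: \<epsilon>_i has degree n + 1 - i, so every positive root,
  including the \<epsilon>_i - \<epsilon>_j with i < j, has positive degree.\<close>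

definition gi :: "nat \<Rightarrow> int" where
  "gi i = (if i \<in> I then if i \<le> n then int n + 1 - int i else int n - int i else 0)"

lemma gi_pr: "i \<in> I \<Longrightarrow> gi (pr i) = - gi i" by (auto simp: gi_def I_def pr_def)
lemma gi_pos: "i \<in> I \<Longrightarrow> i \<le> n \<Longrightarrow> 0 < gi i" by (auto simp: gi_def)
lemma gi_less: "i \<in> I \<Longrightarrow> j \<in> I \<Longrightarrow> i \<le> n \<Longrightarrow> i < pr j \<Longrightarrow> 0 < gi i + gi j"
  by (auto simp: gi_def I_def pr_def)
lemma gi_cc [simp]: "gi cc = 0" by (simp add: gi_def)

text \<open>Among the x_i with i in \<open>I\<close> only x_1 occurs, and homogeneity fixes its
  power, so setting x_1 = 1 loses nothing. The induction removes one power at a time by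
  differentiation.\<close>

lemma evx_inj_pure:
  "f \<in> SEv \<Longrightarrow> evx f = 0 \<Longrightarrow> homd wS (int D) f \<Longrightarrow> (\<And>i. i \<in> I \<Longrightarrow> i \<noteq> 1 \<Longrightarrow> dx i f = 0) \<Longrightarrow> de cc f = 0 \<Longrightarrow> f = 0"
proof (induction D arbitrary: f)
  case 0
  have dS: "degS f = mx 1 (dx 1 f)"
    using sum.remove[of I 1 "\<lambda>i. mx i (dx i f)"] 0(4,5) by (simp add: degS_def)
  have "degS f = 0" using 0(3) degS_homd[of f 0] by simp
  then have "dx 1 f = 0" using dS mx_inj[of 1 "dx 1 f"] I_J[OF one_I(1)] by simp
  then have "pure 0 f" using 0 unfolding pure_def by (auto simp: Ik_0)
  then show ?case using evx_pure 0(2) by simp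
next
  case (Suc D)
  have dS: "degS f = mx 1 (dx 1 f)"
    using sum.remove[of I 1 "\<lambda>i. mx i (dx i f)"] Suc(5,6) by (simp add: degS_def)
  have dS': "degS f = of_int (int (Suc D)) \<cdot> f" using Suc(4) by (simp only: degS_homd)
  have sh: "shifts wS (-1) (dx 1)"
    using shifts_dx[of 1 "\<lambda>i. if i = cc then 0 else 1"] by (simp add: wS_def)
  have "dx 1 f = 0"
  proof (rule Suc.IH)
    show "dx 1 f \<in> SEv" using Suc by simp
    show "evx (dx 1 f) = 0" unfolding evx_dx1 dS' using Suc(3) by simp
    show "homd wS (int D) (dx 1 f)" using shifts_homd[OF sh Suc(4)] by simp
    show "dx i (dx 1 f) = 0" if "i \<in> I" "i \<noteq> 1" for i by (rule kill_comm) (rule Suc(5)[OF that])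
    show "de cc (dx 1 f) = 0" by (rule kill_comm) (rule Suc(6))
  qed
  then have "of_nat (Suc D) \<cdot> f = 0" using dS dS' by simp
  then show ?case by (metis cvec.scale_eq_0_iff of_nat_eq_0_iff old.nat.distinct(2))
qed

text \<open>Let u be the lowest component of v when only the odd variables are graded, by
  \<open>gi\<close>. The parts of the highest weight equations that preserve this grading must
  vanish on u; they eliminate \<eta>_{2n+1} and all x_i with i in \<open>I\<close> other than x_1,
  and \<open>evx_inj_pure\<close> gives u = 0.\<close>

lemma hw_evx_inj:
  assumes v: "v \<in> SEv" "hw v" "evx v = 0" "homd wS (int D) v"
  shows "v = 0"
proof (rule ccontr)
  assume "v \<noteq> 0"
  define w where "w = wt (\<lambda>_. 0) gi"
  define t where "t = Min (w ` keys v)"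
  define u where "u = cmp w t v"
  have fin: "finite (w ` keys v)" "w ` keys v \<noteq> {}" using \<open>v \<noteq> 0\<close> by (simp_all add: keys_eq_empty)
  then have "t \<in> w ` keys v" unfolding t_def by (rule Min_in)
  then have "keys u \<noteq> {}" by (auto simp: keys_cmp u_def)
  then have u0: "u \<noteq> 0" by auto
  have low: "cmp w t' v = 0" if "t' < t" for t'
  proof -
    have "t \<le> w m" if "m \<in> keys v" for m using that fin by (simp add: t_def)
    then have "keys (cmp w t' v) = {}" using that by (fastforce simp: keys_cmp)
    then show ?thesis by simp
  qed
  have shm: "shifts w 0 (mx i)" "shifts w (gi i) (me i)" "shifts w 0 (dx i)" "shifts w (- gi i) (de i)" if "i \<in> J" for i
    using shifts_mx[OF that, of "\<lambda>_. 0" gi] shifts_me[OF that, of "\<lambda>_. 0" gi]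
      shifts_dx[OF that, of "\<lambda>_. 0" gi] shifts_de[OF that, of "\<lambda>_. 0" gi] by (simp_all add: w_def)
  note shc = shifts_comp[OF shm(1)] shifts_comp[OF shm(2)]
  \<comment> \<open>Extraction of the leading part: \<open>C\<close> raises the degree, so in the
    lowest degree t it would have to start from a component below t, which is zero.\<close>
  have split: "A u = 0" if A: "shifts w 0 A" and C: "shifts w k C" and k: "0 < k" and z: "A v + C v = 0" for A C k
  proof -
    have "cmp w t (A v + C v) = 0" using z by (simp add: clinD(5)[OF linear_cmp])
    then show ?thesis
      using shifts_cmp[OF A, of t v] shifts_cmp[OF C, of "t - k" v] low[of "t - k"] k
      by (simp add: clinD(1)[OF linear_cmp] u_def clinD(5)[OF shifts_linear[OF C]])
  qed
  have S: "mx i (de cc u) + me cc (dx (pr i) u) = 0" if i: "i \<in> I" "i \<le> n" for i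
  proof (rule split[where A = "\<lambda>u. mx i (de cc u) + me cc (dx (pr i) u)" and
        C = "\<lambda>u. me i (dx cc u) + mx cc (de (pr i) u)" and k = "gi i"])
    show "shifts w 0 (\<lambda>u. mx i (de cc u) + me cc (dx (pr i) u))"
      using i by (intro shifts_add shc[OF _ shm(3)] shc[OF _ shm(4)]) auto
    show "shifts w (gi i) (\<lambda>u. me i (dx cc u) + mx cc (de (pr i) u))"
      using i by (intro shifts_add shc[OF _ shm(3)] shc[OF _ shm(4)]) (auto simp: gi_pr)
    show "0 < gi i" using i by (rule gi_pos)
    show "mx i (de cc v) + me cc (dx (pr i) v) + (me i (dx cc v) + mx cc (de (pr i) v)) = 0"
      using hwD(1)[OF v(2) i] i by (simp add: om_def sn_def add_ac)
  qed
  have SS: "sn j \<cdot> mx i (dx (pr j) u) + sn i \<cdot> mx j (dx (pr i) u) = 0"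
    if i: "i \<in> I" "j \<in> I" "i \<le> n" "i < pr j" for i j
  proof (rule split[where A = "\<lambda>u. sn j \<cdot> mx i (dx (pr j) u) + sn i \<cdot> mx j (dx (pr i) u)" and
        C = "\<lambda>u. sn j \<cdot> me i (de (pr j) u) + sn i \<cdot> me j (de (pr i) u)" and k = "gi i + gi j"])
    show "shifts w 0 (\<lambda>u. sn j \<cdot> mx i (dx (pr j) u) + sn i \<cdot> mx j (dx (pr i) u))"
      using i by (intro shifts_add shifts_scale shc[OF _ shm(3)]) auto
    show "shifts w (gi i + gi j) (\<lambda>u. sn j \<cdot> me i (de (pr j) u) + sn i \<cdot> me j (de (pr i) u))"
      using i by (intro shifts_add shifts_scale shc[OF _ shm(4)]) (auto simp: gi_pr)
    show "0 < gi i + gi j" using i by (intro gi_less)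
    show "sn j \<cdot> mx i (dx (pr j) v) + sn i \<cdot> mx j (dx (pr i) v) +
      (sn j \<cdot> me i (de (pr j) v) + sn i \<cdot> me j (de (pr i) v)) = 0"
      using hw_E[OF v(2) i] by (simp add: E_def scale_simps add_ac)
  qed
  \<comment> \<open>Multiplying the equation for i = 1 by \<eta>_{2n+1} removes its second term; x_1
    is then cancelled.\<close>
  have me_de: "me cc (de cc u) = 0"
    using arg_cong[OF S[OF one_I(1)], of "me cc"] n_pos mx_inj[of 1 "me cc (de cc u)"] I_J[OF one_I(1)]
    by (simp add: me_mx)
  have dpr: "dx (pr i) u = 0" if i: "i \<in> I" "i \<le> n" for i
  proof -
    have "dx (pr i) u - me cc (de cc (dx (pr i) u)) = 0"
      using arg_cong[OF S[OF i], of "de cc"] i by (simp add: ccr kill_comm)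
    then show ?thesis using me_de by (simp add: ccr flip: dx_me)
  qed
  have dcc: "de cc u = 0"
    using S[OF one_I(1)] n_pos dpr[of 1] mx_inj[of 1 "de cc u"] I_J[OF one_I(1)] by simp
  have dx0: "dx i u = 0" if i: "i \<in> I" "i \<noteq> 1" for i
  proof (cases "i \<le> n")
    case True
    then have "sn (pr i) \<cdot> mx 1 (dx i u) = 0"
      using SS[of 1 "pr i"] i n_pos dpr[of 1] I_pos[OF i(1)] by simp
    then have "mx 1 (dx i u) = 0" using i by (simp add: sn_def split: if_splits)
    then show ?thesis by (rule mx_inj[OF I_J[OF one_I(1)]])
  next
    case False
    then show ?thesis using dpr[of "pr i"] i pr_le[of i] by simp
  qed
  have "u \<in> SEv" using v(1) by (auto simp: u_def SEv_iff keys_cmp)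
  moreover have "shifts w 0 evx"
    unfolding shifts_def
  proof (intro conjI linear_evx allI ballI)
    fix m m' assume m': "m' \<in> keys (evx (bvec m))"
    obtain a S where m: "m = (a, S)" by (cases m)
    have "snd m' = snd m" using m' by (auto simp: m evx_bvec split: if_splits)
    then show "w m' = w m + 0" by (simp add: w_def wt_def)
  qed
  then have "evx u = 0" using shifts_cmp[of w 0 evx t v] v(3) by (simp add: u_def clinD(5)[OF linear_cmp])
  moreover have "homd wS (int D) u" using v(4) by (auto simp: u_def homd_def keys_cmp)
  ultimately have "u = 0" using evx_inj_pure dx0 dcc by blast
  with u0 show False by simp
qed

section \<open>The vectors x_1^d h_l and their images under F_{1,2}\<close>

definition uu :: "nat \<Rightarrow> nat \<Rightarrow> smono cvec" where "uu d l = (mx 1 ^^ d) (hh n l)"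
definition vv :: "nat \<Rightarrow> nat \<Rightarrow> smono cvec" where "vv d l = p1 (uu d l)"

lemma om_mx: "i \<in> I \<Longrightarrow> j \<in> I \<Longrightarrow> om i (mx j f) = mx j (om i f) + (if j = pr i then sn i \<cdot> me cc f else 0)"
  by (auto simp: om_def ccr scale_simps mx_mx[of i j] mx_mx[of cc j] pr_eq_iff)

lemma hw_mx1: "hw f \<Longrightarrow> hw (mx 1 f)"
proof -
  assume f: "hw f"
  have 1: "1 \<noteq> pr i" if "i \<in> I" "i \<le> n" for i using that pr_gt[of i] n_pos by auto
  have 2: "om i (om j (mx 1 f)) = 0" if "i \<in> I" "j \<in> I" "i \<le> n" "n < j" "i < pr j" for i j
  proof -
    have "1 \<noteq> pr j" using that I_pos[of i] by linarith
    then show ?thesis using hwD(2)[OF f that] 1[OF that(1,3)] that by (simp add: om_mx[OF _ one_I(1)])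
  qed
  show ?thesis unfolding hw_def using hwD(1)[OF f] 1 2 by (auto simp: om_mx[OF _ one_I(1)])
qed

lemma hw_p1: "hw f \<Longrightarrow> hw (p1 f)"
  unfolding hw_def by (simp add: om_p1)

lemma Sing_hhn: "Sing 0 l (hh n l)" using Sing_hh[of n l] by simp
lemmas hhD = SingD[OF Sing_hhn]
lemmas hh_pure = pureD[OF hhD(1)]

lemma hw_hh: "hw (hh n l)"
  using hhD(4)[of _ l] hhD(5)[of _ _ l] unfolding hw_def by (auto simp: Ik_0)

lemma uu_0 [simp]: "uu 0 l = hh n l" and uu_Suc: "uu (Suc d) l = mx 1 (uu d l)" by (simp_all add: uu_def)

lemma uu_SE [simp]: "uu d l \<in> SEv"
  by (induction d) (simp_all add: uu_Suc hh_pure(1) I_J[OF one_I(1)])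

lemma hw_uu: "hw (uu d l)" by (induction d) (simp_all add: hw_hh uu_Suc hw_mx1)

lemma de_uu: "i \<in> I \<Longrightarrow> de i (hh n l) = 0 \<Longrightarrow> de i (uu d l) = 0"
  by (induction d) (simp_all add: uu_Suc de_mx)
lemma me_uu: "i \<in> I \<Longrightarrow> me i (hh n l) = 0 \<Longrightarrow> me i (uu d l) = 0"
  by (induction d) (simp_all add: uu_Suc me_mx)
lemma dx_uu: "i \<in> I \<Longrightarrow> i \<noteq> 1 \<Longrightarrow> dx i (uu d l) = 0"
  by (induction d) (simp_all add: uu_Suc dx_mx hh_pure)
lemma de_cc_uu: "de cc (uu d l) = 0"
  by (induction d) (simp_all add: uu_Suc de_mx hh_pure)
lemma mx_dx_uu: "mx 1 (dx 1 (uu d l)) = of_nat d \<cdot> uu d l"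
  by (induction d) (simp_all add: uu_Suc dx_mx hh_pure cvec.scale_left_distrib)
lemma dx1_uu: "dx 1 (uu (Suc d) l) = of_nat (Suc d) \<cdot> uu d l"
  using mx_dx_uu[of d l] by (simp add: uu_Suc dx_mx cvec.scale_left_distrib)
lemma d22_mx: "i \<in> I \<Longrightarrow> d22 (mx i f) = mx i (d22 f)"
  by (auto simp: d22_def ccr)
lemma d22_uu: "d22 (uu d l) = 0"
  by (induction d) (simp_all add: uu_Suc hhD d22_mx[OF one_I(1)])

lemma hh_me1: "1 \<le> l \<Longrightarrow> l \<le> 2*n \<Longrightarrow> hh n l = me 1 (hh (n - 1) (l - 1))"
proof -
  assume l: "1 \<le> l" "l \<le> 2*n"
  then have "l \<noteq> 0" "l \<noteq> 2*(n-1)+3" "n - (n - 1) = 1" "Suc (n - 1) = n" using n_pos by arith+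
  then show ?thesis using hh.simps(2)[of "n - 1" l] by (simp only: if_False)
qed

lemma degS_uu: "degS (uu d l) = of_nat d \<cdot> uu d l"
proof -
  have "(\<Sum>i\<in>I. mx i (dx i (uu d l))) = mx 1 (dx 1 (uu d l))"
    by (subst sum.remove[of _ 1]) (simp_all add: dx_uu)
  then show ?thesis using mx_dx_uu[of d l] by (simp add: degS_def de_cc_uu)
qed
lemma degL_mx: "i \<in> I \<Longrightarrow> degL (mx i f) = mx i (degL f)"
  by (auto simp: degL_def ccr mx_mx[of cc i])
lemma degL_uu: "degL (uu d l) = of_nat l \<cdot> uu d l"
  by (induction d) (simp_all add: uu_Suc hhD degL_mx[OF one_I(1)])

text \<open>For d > 0 the proofs that \<open>p2\<close> and \<open>q1\<close> kill x_1^d h_l use the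
  factor \<eta>_1, which h_l contains for 1 \<le> l \<le> 2n but not for l = 2n+1. The value l = 0
  is excluded because \<open>p1\<close> kills x_1^d; the vector 1 is treated separately.\<close>

definition valid :: "nat \<Rightarrow> nat \<Rightarrow> bool" where
  "valid d l \<longleftrightarrow> 1 \<le> l \<and> (l \<le> 2*n \<or> d = 0 \<and> l = 2*n+1)"

lemma p2_uu: "valid d l \<Longrightarrow> p2 (uu d l) = 0"
proof -
  assume v: "valid d l"
  have h: "p2 (hh n l) = 0" by (simp add: p2_def hh_pure kill_comm flip: de_dx)
  show ?thesis
  proof (cases "d = 0")
    case True with h show ?thesis by simp
  next
    case False
    then have "1 \<le> l" "l \<le> 2*n" using v by (auto simp: valid_def)
    then have hh: "hh n l = me 1 (hh (n - 1) (l - 1))" by (rule hh_me1)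
    have "pure 1 (hh (n - 1) (l - 1))" using SingD(1)[OF Sing_hh[of "n - 1"]] n_pos by simp
    then have "de (pr 1) (hh (n - 1) (l - 1)) = 0"
      by (rule pureD) (auto dest: Ik_less)
    then have "de (pr 1) (hh n l) = 0" by (simp add: hh ccr)
    then have d: "de (pr 1) (uu d l) = 0" for d by (intro de_uu) simp_all
    show ?thesis
      by (induction d) (use h d in \<open>simp_all add: uu_Suc p2_mx\<close>)
  qed
qed

lemma q1_uu: "valid d l \<Longrightarrow> q1 (uu d l) = 0"
proof -
  assume v: "valid d l"
  have "(\<Sum>i\<in>I. me i (dx i (uu d l))) = me 1 (dx 1 (uu d l))"
    by (subst sum.remove[of _ 1]) (simp_all add: dx_uu)
  also have "\<dots> = 0"
  proof (cases d)
    case 0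
    then show ?thesis using hh_pure(2)[OF one_I(1), of l] by simp
  next
    case (Suc d')
    then have "1 \<le> l" "l \<le> 2*n" using v by (auto simp: valid_def)
    then have "me 1 (hh n l) = 0" using hh_me1 by simp
    then show ?thesis using me_uu[of 1 l d'] dx1_uu[of d' l] Suc by simp
  qed
  finally show ?thesis by (simp add: q1_def de_cc_uu)
qed

lemma B_uu: "l \<le> 2*n+1 \<Longrightarrow> B (uu d l) (uu d l) \<noteq> 0"
proof (induction d)
  case 0
  then show ?case using B_hh[of n l] by simp
next
  case (Suc d)
  have "B (uu (Suc d) l) (uu (Suc d) l) = B (uu d l) (dx 1 (uu (Suc d) l))"
    using B_mx[OF I_J[OF one_I(1)], of "uu d l" "uu (Suc d) l"] by (simp add: uu_Suc)
  also have "\<dots> = of_nat (Suc d) * B (uu d l) (uu d l)"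
    unfolding dx1_uu B_scale_right ..
  finally show ?case using Suc by (metis mult_eq_0_iff of_nat_eq_0_iff old.nat.distinct(2))
qed

lemma shifts_p1: "shifts wS 1 p1" "shifts wL (-1) p1"
  unfolding p1_def[abs_def] wS_def wL_def
  by (intro shifts_diff shifts_sum shifts_comp[OF shifts_mx shifts_de] shifts_comp[OF shifts_me shifts_dx]; auto)+

text \<open>The odd reflection can be undone: the anticommutator of \<open>p1\<close> and
  \<open>q1\<close> acts on x_1^d h_l by d + l, which is nonzero, and this also gives the norm.
  Applying \<open>p1\<close> changes the two degrees by +1 and -1.\<close>

lemma vv_props:
  assumes "valid d l"
  shows "vv d l \<in> SEv" "hw (vv d l)" "p1 (vv d l) = 0" "p2 (vv d l) = 0"
    "homd wS (int d + 1) (vv d l)" "homd wL (int l - 1) (vv d l)" "B (vv d l) (vv d l) \<noteq> 0"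
    "q1 (vv d l) = of_nat (d + l) \<cdot> uu d l"
proof -
  show "vv d l \<in> SEv" "hw (vv d l)" "p1 (vv d l) = 0" by (simp_all add: vv_def hw_p1 hw_uu p1_p1)
  show "p2 (vv d l) = 0" using p1_p2[of "uu d l"] p2_uu[OF assms] by (simp add: vv_def d22_uu)
  have "homd wS (int d) (uu d l)" using degS_uu[of d l] by (simp flip: degS_homd)
  from shifts_homd[OF shifts_p1(1) this] show "homd wS (int d + 1) (vv d l)" by (simp add: vv_def)
  have "homd wL (int l) (uu d l)" using degL_uu[of d l] by (simp flip: degL_homd)
  from shifts_homd[OF shifts_p1(2) this] show "homd wL (int l - 1) (vv d l)" by (simp add: vv_def)
  show q: "q1 (vv d l) = of_nat (d + l) \<cdot> uu d l"
    using p1_q1[of "uu d l"] q1_uu[OF assms] by (simp add: vv_def degS_uu degL_uu cvec.scale_left_distrib)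
  have "B (vv d l) (vv d l) = of_nat (d + l) * B (uu d l) (uu d l)"
    using B_p1[of "uu d l" "vv d l"] by (simp add: q B_scale_right flip: vv_def)
  moreover have "d + l \<noteq> 0" "l \<le> 2*n+1" using assms by (auto simp: valid_def)
  ultimately show "B (vv d l) (vv d l) \<noteq> 0" using B_uu[of l d] by (metis mult_eq_0_iff of_nat_eq_0_iff)
qed

lemma evx_uu: "evx (uu d l) = hh n l"
proof -
  have "evx (uu d l) = evx (hh n l)" by (induction d) (simp_all add: uu_Suc evx_mx1)
  then show ?thesis by (simp add: evx_pure hhD)
qed

lemma evx_vv: "evx (vv d l) = - de 1 (hh n l)"
  by (simp add: vv_def evx_p1 evx_uu)

text \<open>In positive degree the restriction b of v has no \<eta>_1 and splits as A + \<eta>_{2n}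
  C, both coefficients being in the inner variables. A is singular there, and
  \<open>p2 v = 0\<close> yields (d + 2n - r) C = 0. If C = 0, b comes from h_{r+1} with r + 1 \<le>
  2n; otherwise degree bounds leave only d = 0, r = 2n, and b comes from r^(2n+1).\<close>

lemma joint_singular:
  assumes v: "v \<in> SEv" "v \<noteq> 0" "homd wS D v" "homd wL l v" and k: "hw v" "p1 v = 0" "p2 v = 0"
  shows "(\<exists>g. v = g \<cdot> vac) \<or> (\<exists>d l' g. valid d l' \<and> v = g \<cdot> vv d l')"
proof (cases "D = 0")
  case True
  then have dS: "degS v = 0" using v(3) degS_homd[of v 0] by simp
  have x0: "dx i v = 0" if "i \<in> I" for i
  proof (rule degS_neg[where t = "-1"])
    have "shifts wS (-1) (dx i)"
      using shifts_dx[OF I_J[OF that], of "\<lambda>i. if i = cc then 0 else 1"] that by (auto simp: wS_def)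
    from shifts_homd[OF this v(3)] show "degS (dx i v) = of_int (-1) \<cdot> dx i v"
      unfolding degS_homd True by simp
  qed simp
  have e0: "de cc v = 0"
  proof (rule degS_neg[where t = "-1"])
    have "shifts wS (-1) (de cc)"
      using shifts_de[OF cc_J, where we = "\<lambda>i. if i = cc then 1 else 0"] by (auto simp: wS_def)
    from shifts_homd[OF this v(3)] show "degS (de cc v) = of_int (-1) \<cdot> de cc v"
      unfolding degS_homd True by simp
  qed simp
  have "dx cc v = 0" using p1_de[of cc v] e0 k(2) by simp
  moreover have "de i v = 0" if "i \<in> I" for i using p1_dx[of i v] x0[OF that] k(2) that by simp
  ultimately have "\<exists>g. v = g \<cdot> vac" using x0 e0 v(1) by (intro const_vac) (auto simp: J_eq)
  then show ?thesis ..
next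
  case False
  have "D \<ge> 0" "l \<ge> 0"
  proof -
    from v(2) have "keys v \<noteq> {}" by simp
    then obtain m where "m \<in> keys v" by blast
    then have "D = wS m" "l = wL m" using v(3,4) by (auto simp: homd_def)
    then show "D \<ge> 0" "l \<ge> 0" using wS_nonneg wL_nonneg by auto
  qed
  \<comment> \<open>The off-by-one reflects F_{1,2}: the target \<open>vv d l\<close> has degrees d
    + 1 and l - 1, so D = d + 1 here and the label found below is \<open>Suc r\<close>.\<close>
  with False obtain d where D: "D = int d + 1" by (metis add.commute nonneg_int_cases of_nat_Suc of_nat_0 not0_implies_Suc)
  obtain r where l: "l = int r" using \<open>l \<ge> 0\<close> nonneg_int_cases by blast
  define b where "b = evx v"
  define C where "C = de (pr 1) b"
  define A where "A = b - me (pr 1) C"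
  have one: "n - Suc (n - 1) = 0" "n - (n - 1) = 1" "n - 1 < n" using n_pos by auto
  note st = Ik_step[OF one(3), unfolded one]
  have pI: "pr 1 \<in> I" "pr (pr 1) = 1" "pr 1 \<noteq> 1" "1 \<noteq> pr 1"
    using pr_I[OF one_I(1)] pr_pr[OF one_I(1)] pr_ne[OF one_I(1)] by auto
  have pb: "pure 0 b" unfolding b_def by (rule pure_evx[OF v(1)])
  have b1: "de 1 b = 0" using evx_p1[of v] k(2) by (simp add: b_def)
  have "d22 v = 0" using p1_p2[of v] k(2,3) by simp
  then have db: "d22 b = 0" using evx_d22[of v] by (simp add: b_def)
  have Lb: "degL b = of_nat r \<cdot> b"
    using v(4) degL_homd[of v l] evx_degL[of v] by (simp add: b_def l)
  have Sb: "evx (degS v) = of_nat (Suc d) \<cdot> b"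
    using v(3) degS_homd[of v D] by (simp add: b_def D add.commute)
  have neI: "i \<noteq> 1" "i \<noteq> pr 1" "i \<in> I" "1 < i" if "i \<in> Ik 1" for i
    using that st(5,6) Ik_I[OF that] Ik_less[OF that] by (metis)+
  have om_b: "i \<in> Ik 1 \<Longrightarrow> i \<le> n \<Longrightarrow> om i b = 0"
    "i \<in> Ik 1 \<Longrightarrow> j \<in> Ik 1 \<Longrightarrow> i \<le> n \<Longrightarrow> n < j \<Longrightarrow> i < pr j \<Longrightarrow> om i (om j b) = 0" for i j
    using hwD(1)[OF k(1), of i] hwD(2)[OF k(1), of i j] neI[of i] neI[of j] evx_om[of i v] evx_om[of j v] evx_om[of i "om j v"]
    by (auto simp: b_def)
  have C1: "de 1 C = 0" "de (pr 1) C = 0"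
    unfolding C_def by (rule kill_comm(3)[OF b1], simp)
  have om_C: "i \<in> Ik 1 \<Longrightarrow> i \<le> n \<Longrightarrow> om i C = 0"
    "i \<in> Ik 1 \<Longrightarrow> j \<in> Ik 1 \<Longrightarrow> i \<le> n \<Longrightarrow> n < j \<Longrightarrow> i < pr j \<Longrightarrow> om i (om j C) = 0" for i j
    unfolding C_def using om_b(1)[of i] om_b(2)[of i j] neI[of i] neI[of j] by (auto simp: om_de[OF pI(1)])
  have om_A: "i \<in> Ik 1 \<Longrightarrow> i \<le> n \<Longrightarrow> om i A = 0"
    "i \<in> Ik 1 \<Longrightarrow> j \<in> Ik 1 \<Longrightarrow> i \<le> n \<Longrightarrow> n < j \<Longrightarrow> i < pr j \<Longrightarrow> om i (om j A) = 0" for i j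
    unfolding A_def using om_b(1)[of i] om_b(2)[of i j] om_C(1)[of i] om_C(2)[of i j] neI[of i] neI[of j]
    by (auto simp: om_me[OF pI(1)] pI(2))
  have pm: "pure 1 f" if "pure 0 f" "de 1 f = 0" "de (pr 1) f = 0" for f
    using that st(1) unfolding pure_def by auto
  have "pure 0 C" using pb by (auto simp: C_def pure_def kill_comm)
  then have pC: "pure 1 C" using C1 by (rule pm)
  have "pure 0 A" unfolding A_def using st(9) by (intro pure_diff pb pure_me \<open>pure 0 C\<close>)
  moreover have "de 1 A = 0" "de (pr 1) A = 0"
    using b1 C1 C_def unfolding A_def by (simp_all add: ccr pI)
  ultimately have pA: "pure 1 A" by (rule pm)
  have LC: "degL C = of_int (int r - 1) \<cdot> C"
    unfolding C_def by (simp add: degL_de[OF pI(1)] Lb cvec.scale_left_diff_distrib)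
  have LA: "degL A = of_nat r \<cdot> A"
    unfolding A_def by (simp add: degL_me[OF pI(1)] LC[simplified] Lb) (rule cvec_ext, simp add: cvec_coord)
  have dC: "d22 C = 0" unfolding C_def by (simp add: d22_de db)
  have dA: "d22 A = 0" unfolding A_def using C1 by (simp add: d22_me[OF pI(1)] db dC pI(2))
  have SA: "Sing 1 r A" unfolding Sing_def using pA LA dA om_A by blast
  obtain gA where gA: "A = gA \<cdot> hh (n - 1) r" using Sing_unique[of "n - 1" r A] SA one by auto
  \<comment> \<open>The x-derivatives of v are not visible in b. The highest weight equations at x_1
    = 1, together with the degree, express each of them through b and C (\<open>evde\<close>,
    \<open>ev_i\<close>, \<open>ev_p\<close>, \<open>ev_1\<close>), so that the restriction of
    \<open>p2 v = 0\<close> becomes an identity in b and C.\<close>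
  have eqC: "of_int (int d + 2 * int n - int r) \<cdot> C = 0"
  proof -
    have evde: "evx (de cc v) = - om 1 b"
      using evx_om1[of v] hwD(1)[OF k(1) one_I(1)] n_pos by (simp add: b_def eq_neg_iff_add_eq_0)
    have omb: "om 1 b = me 1 (dx cc b) + mx cc C"
      using pure_om_eq[OF pb one_I(1)] by (simp add: C_def)
    have ev_i: "evx (dx i v) = sn i \<cdot> me (pr i) C - me 1 (de i b)" if i: "i \<in> Ik 1" for i
    proof -
      note ni = neI[OF i]
      have pi: "pr i \<noteq> 1" using ni pI(2) pr_pr[OF ni(3)] by metis
      have "sn (pr i) \<cdot> E 1 i v + sn 1 \<cdot> E (pr i) (pr 1) v = 0"
        using hw_E[OF k(1) one_I(1) pr_I[OF ni(3)]] ni n_pos by simp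
      from arg_cong[OF this, of evx] have "sn i \<cdot> (evx (dx i v) + me 1 (de i b)) = me (pr i) C"
        using ni pi by (simp add: E_def evx_rules evx_mx1 C_def b_def pI(1))
      from arg_cong[OF this, of "\<lambda>v. sn i \<cdot> v"] show ?thesis by (simp add: scale_simps algebra_simps)
    qed
    have ev_p: "evx (dx (pr 1) v) = - me 1 C"
    proof -
      have "E 1 (pr 1) v = 0" using om_sq[OF one_I(1), of v] hwD(1)[OF k(1) one_I(1)] n_pos by simp
      from arg_cong[OF this, of evx] show ?thesis
        by (simp add: E_def evx_rules evx_mx1 C_def b_def pI(1) eq_neg_iff_add_eq_0)
    qed
    have ev_1: "evx (dx 1 v) = of_nat (Suc d) \<cdot> b" using evx_dx1[of v] Sb by simp
    have sumI: "(\<Sum>i\<in>I. F i) = F 1 + F (pr 1) + (\<Sum>i\<in>Ik 1. F i)" for F :: "nat \<Rightarrow> smono cvec"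
      using st(1,5,6) pI(4) by (simp add: Ik_0 add.assoc)
    have 0: "0 = evx (p2 v)" using k(3) by simp
    also have "\<dots> = dx cc (evx (de cc v)) + (\<Sum>i\<in>I. sn i \<cdot> de (pr i) (evx (dx i v)))"
      by (simp add: p2_def evx_rules de_dx[of "pr _", symmetric])
    also have "\<dots> = - dx cc (om 1 b) + de (pr 1) (of_nat (Suc d) \<cdot> b) + de 1 (me 1 C)
        + (\<Sum>i\<in>Ik 1. sn i \<cdot> de (pr i) (sn i \<cdot> me (pr i) C - me 1 (de i b)))"
    proof -
      have "(\<Sum>i\<in>Ik 1. sn i \<cdot> de (pr i) (evx (dx i v))) = (\<Sum>i\<in>Ik 1. sn i \<cdot> de (pr i) (sn i \<cdot> me (pr i) C - me 1 (de i b)))"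
        by (intro sum.cong refl) (simp only: ev_i)
      then show ?thesis
        unfolding sumI evde ev_1 ev_p pI(2) using sn_pr[OF one_I(1)] by (simp add: add.assoc)
    qed
    also have "\<dots> = - (me 1 (dx cc (dx cc b)) + C + mx cc (dx cc C)) + of_nat (Suc d) \<cdot> C + C
        + (\<Sum>i\<in>Ik 1. (C - me (pr i) (de (pr i) C)) - me 1 (sn i \<cdot> de i (de (pr i) b)))"
    proof -
      have "(\<Sum>i\<in>Ik 1. sn i \<cdot> de (pr i) (sn i \<cdot> me (pr i) C - me 1 (de i b))) =
         (\<Sum>i\<in>Ik 1. (C - me (pr i) (de (pr i) C)) - me 1 (sn i \<cdot> de i (de (pr i) b)))"
      proof (intro sum.cong refl)
        fix i assume i: "i \<in> Ik 1"
        have "pr i \<noteq> 1" using neI[OF i] pI(2) pr_pr[of i] by metis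
        then show "sn i \<cdot> de (pr i) (sn i \<cdot> me (pr i) C - me 1 (de i b)) = (C - me (pr i) (de (pr i) C)) - me 1 (sn i \<cdot> de i (de (pr i) b))"
          using de_de[of "pr i" i b] by (simp add: ccr scale_simps)
      qed
      then show ?thesis unfolding omb using C1 by (simp add: ccr C_def)
    qed
    also have "\<dots> = of_nat (Suc d) \<cdot> C - degL C + of_nat (2*n-2) \<cdot> C - me 1 (d22 b)"
    proof -
      have s1: "(\<Sum>i\<in>Ik 1. me (pr i) (de (pr i) C)) = (\<Sum>i\<in>Ik 1. me i (de i C))"
        by (rule sum_Ik_pr)
      have "d22 b = dx cc (dx cc b) + (\<Sum>i\<in>Ik 1. sn i \<cdot> de i (de (pr i) b))"
        unfolding d22_def sumI pI(2) using b1 kill_comm(3)[OF b1] by simp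
      then show ?thesis
        using s1 unfolding pure_degL[OF pC] by (simp add: sum_simps sum_const_cvec card_Ik)
    qed
    also have "\<dots> = of_int (int d + 2 * int n - int r) \<cdot> C"
      unfolding db LC using n_pos by (simp add: of_nat_diff) (rule cvec_ext, simp add: cvec_coord)
    finally show ?thesis by simp
  qed
  have bform: "(\<exists>g. b = g \<cdot> de 1 (hh n (Suc r))) \<and> (b \<noteq> 0 \<longrightarrow> valid d (Suc r))"
  proof (cases "C = 0")
    case True
    then have bA: "b = gA \<cdot> hh (n - 1) r" using gA by (simp add: A_def)
    show ?thesis
    proof (cases "r \<le> 2*n - 1")
      case True
      then have "hh n (Suc r) = me 1 (hh (n - 1) r)" using hh_me1[of "Suc r"] n_pos by simp
      moreover have "de 1 (hh (n - 1) r) = 0"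
        using pureD(4)[OF SingD(1)[OF Sing_hh[of "n - 1"]]] one st(2,5) by simp
      ultimately have "de 1 (hh n (Suc r)) = hh (n - 1) r" by (simp add: ccr)
      then show ?thesis using bA True n_pos by (auto simp: valid_def)
    next
      case False
      then have "b = 0" using bA hh_big[of "n - 1" r] n_pos by simp
      then show ?thesis by (auto intro: exI[of _ 0])
    qed
  next
    case False
    then have "int d + 2 * int n - int r = 0" using eqC by (simp only: cvec.scale_eq_0_iff of_int_eq_0_iff) simp
    then have r: "r = d + 2*n" by linarith
    have "Sing 1 (r - 1) C" unfolding Sing_def using pC LC dC om_C r n_pos by (simp add: of_nat_diff)
    then obtain gC where gC: "C = gC \<cdot> hh (n - 1) (r - 1)" using Sing_unique[of "n - 1" "r - 1" C] one by auto
    \<comment> \<open>\<open>hh (n - 1)\<close> vanishes above degree 2n - 1; together with r = d +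
      2n this forces d = 0.\<close>
    have "r - 1 \<le> 2*(n-1)+1"
    proof (rule ccontr)
      assume "\<not> ?thesis"
      then have "hh (n - 1) (r - 1) = 0" using hh_big[of "n - 1" "r - 1"] by simp
      with gC False show False by simp
    qed
    then have d0: "d = 0" and r2: "r = 2*n" using r n_pos by auto
    have "A = 0" using gA hh_big[of "n - 1" r] r2 n_pos by simp
    moreover have "r - 1 = 2*(n-1)+1" using r2 n_pos by arith
    then have "C = gC \<cdot> TT (n - 1)" using gC hh_top[of "n - 1"] by simp
    ultimately have "b = gC \<cdot> me (pr 1) (TT (n - 1))" by (simp add: A_def)
    moreover have "de 1 (hh n (Suc r)) = of_nat (2*n+1) \<cdot> me (pr 1) (TT (n - 1))"
    proof -
      have e: "Suc (n - 1) = n" "2 * (n - 1) + 3 = 2 * n + 1" "Suc r = 2 * n + 1" using n_pos r2 by arith+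
      have "hh n (Suc r) = RR 1 (TT (n - 1)) + of_nat (2*n+1) \<cdot> me 1 (me (pr 1) (TT (n - 1)))"
        unfolding e(3) hh_top using TT.simps(2)[of "n - 1"] unfolding e one .
      moreover have "de 1 (TT (n - 1)) = 0" using pureD(4)[OF pure_TT[of "n - 1"] one_I(1)] one st(5) by simp
      ultimately show ?thesis using st(5) pI by (simp add: de_RR ccr)
    qed
    ultimately have "b = (gC / of_nat (2*n+1)) \<cdot> de 1 (hh n (Suc r))"
      by (metis cvec.scale_scale nonzero_eq_divide_eq of_nat_eq_0_iff add_is_0 one_neq_zero)
    then show ?thesis using d0 r2 n_pos by (auto simp: valid_def)
  qed
  then obtain g where g: "b = g \<cdot> de 1 (hh n (Suc r))" and val: "b \<noteq> 0 \<longrightarrow> valid d (Suc r)" by blast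
  have homv: "homd wS (int (d + 1)) v" using v(3) D by (simp add: add.commute)
  have "b \<noteq> 0"
  proof
    assume "b = 0"
    then have "v = 0" using hw_evx_inj[OF v(1) k(1) _ homv] by (simp add: b_def)
    with v(2) show False ..
  qed
  then have val: "valid d (Suc r)" using val by simp
  note V = vv_props[OF val]
  \<comment> \<open>The sign comes from \<open>evx_vv\<close>: the restriction of
    \<open>vv d l\<close> is minus the \<eta>_1-derivative of h_l.\<close>
  have "v + g \<cdot> vv d (Suc r) = 0"
  proof (rule hw_evx_inj)
    show "v + g \<cdot> vv d (Suc r) \<in> SEv" using v V by simp
    show "hw (v + g \<cdot> vv d (Suc r))" using k V by (intro hw_lin)
    show "evx (v + g \<cdot> vv d (Suc r)) = 0" using g by (simp add: evx_vv flip: b_def)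
    show "homd wS (int (d + 1)) (v + g \<cdot> vv d (Suc r))"
      using homv V(5) by (intro homd_add homd_scale) (simp_all add: add.commute)
  qed
  then have "v = (- g) \<cdot> vv d (Suc r)" by (simp add: eq_neg_iff_add_eq_0)
  then show ?thesis using val by blast
qed

end

subsection \<open>Orbits of singular vectors\<close>

text \<open>The unital associative algebra generated by \<open>G\<close>, as a set of operators.
  Generators are added on the left only, which makes orbits stable under \<open>G\<close> at once;
  \<open>alg_comp\<close> recovers all products.\<close>

inductive_set alg :: "('b cvec \<Rightarrow> 'b cvec) set \<Rightarrow> ('b cvec \<Rightarrow> 'b cvec) set" for G where
  alg_id: "(\<lambda>f. f) \<in> alg G"
| alg_gen: "A \<in> alg G \<Longrightarrow> g \<in> G \<Longrightarrow> (\<lambda>f. g (A f)) \<in> alg G"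
| alg_add: "A \<in> alg G \<Longrightarrow> A' \<in> alg G \<Longrightarrow> (\<lambda>f. A f + A' f) \<in> alg G"
| alg_scale: "A \<in> alg G \<Longrightarrow> (\<lambda>f. c \<cdot> A f) \<in> alg G"

lemma alg_linear:
  assumes "\<And>g. g \<in> G \<Longrightarrow> clinear g" "A \<in> alg G" shows "clinear A"
  using assms(2) by induction (auto intro: clinear_id clinear_add clinear_cmul clinear_comp assms(1))

lemma alg_comp:
  assumes G: "\<And>g. g \<in> G \<Longrightarrow> clinear g" and "A \<in> alg G" "A' \<in> alg G"
  shows "(\<lambda>f. A (A' f)) \<in> alg G"
  using assms(2) by induction (auto intro: alg.intros assms(3))

lemma alg_gen1: "g \<in> G \<Longrightarrow> g \<in> alg G"
  using alg_gen[OF alg_id] by blast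

lemma alg_commute1:
  assumes h: "clinear h" "\<And>g f. g \<in> G \<Longrightarrow> g (h f) = h (g f)" and A: "A \<in> alg G"
  shows "A (h f) = h (A f)"
  using A by (induction arbitrary: f) (simp_all add: h(2) clinD[OF h(1)])

lemma alg_commute:
  assumes G: "\<And>g. g \<in> G \<Longrightarrow> clinear g" and H: "\<And>h. h \<in> H \<Longrightarrow> clinear h"
    and c: "\<And>g h f. g \<in> G \<Longrightarrow> h \<in> H \<Longrightarrow> g (h f) = h (g f)" and A: "A \<in> alg G" and C: "C \<in> alg H"
  shows "A (C f) = C (A f)"
  using C
proof (induction arbitrary: f)
  case (alg_gen C h)
  have "A (h (C f)) = h (A (C f))"
    using alg_commute1[of h G A "C f"] H[OF alg_gen(2)] c[OF _ alg_gen(2)] A by blast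
  with alg_gen show ?case by simp
qed (simp_all add: clinD[OF alg_linear[OF G A]])

definition orb :: "('b cvec \<Rightarrow> 'b cvec) set \<Rightarrow> 'b cvec \<Rightarrow> 'b cvec set" where
  "orb G v = {A v | A. A \<in> alg G}"

lemma orbI: "A \<in> alg G \<Longrightarrow> A v \<in> orb G v" by (auto simp: orb_def)
lemma orbE: "f \<in> orb G v \<Longrightarrow> (\<And>A. A \<in> alg G \<Longrightarrow> f = A v \<Longrightarrow> P) \<Longrightarrow> P" by (auto simp: orb_def)
lemma orb_self: "v \<in> orb G v" using orbI[OF alg_id] .
lemma orb_closed: "f \<in> orb G v \<Longrightarrow> g \<in> G \<Longrightarrow> g f \<in> orb G v"
  by (erule orbE) (use orbI[OF alg_gen] in auto)
lemma orb_subspace: "cvec.subspace (orb G v)"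
  unfolding cvec.subspace_def
proof (intro conjI ballI allI)
  show "0 \<in> orb G v" using orbI[OF alg_scale[OF alg_id, of 0], of v] by simp
  show "x + y \<in> orb G v" if "x \<in> orb G v" "y \<in> orb G v" for x y
    using that by (elim orbE) (use orbI[OF alg_add] in auto)
  show "c \<cdot> x \<in> orb G v" if "x \<in> orb G v" for x c
    using that by (elim orbE) (use orbI[OF alg_scale] in auto)
qed
lemma orb_least:
  assumes "cvec.subspace N" "v \<in> N" "\<And>g f. g \<in> G \<Longrightarrow> f \<in> N \<Longrightarrow> g f \<in> N"
  shows "orb G v \<subseteq> N"
proof -
  have "A v \<in> N" if "A \<in> alg G" for A
    using that by induction (auto simp: assms cvec.subspace_add cvec.subspace_scale)
  then show ?thesis by (auto simp: orb_def)
qed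

section \<open>Parity, labels of the summands, and the two commuting algebras\<close>

context howe
begin

text \<open>The ambient monomials may carry infinite sets of odd indices. Intersecting with
  \<open>J\<close> keeps the count finite and changes nothing on S(E).\<close>

definition psn :: "smono \<Rightarrow> complex" where "psn m = (-1) ^ card (snd m \<inter> J)"
definition pty :: "smono cvec \<Rightarrow> smono cvec" where "pty = diag psn"

lemma linear_pty: "clinear pty" by (simp add: pty_def linear_diag)
lemmas pty_lin [simp] = clinD[OF linear_pty]

lemma pty_bvec: "pty (bvec (a, S)) = psn (a, S) \<cdot> bvec (a, S)" by (simp add: pty_def diag_bvec)
lemma psn_sq [simp]: "psn m * psn m = 1" by (simp add: psn_def flip: power_add)
lemma psn_insert: "i \<in> J \<Longrightarrow> i \<notin> S \<Longrightarrow> psn (a, insert i S) = - psn (a, S)"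
  by (simp add: psn_def)
lemma psn_remove: "i \<in> J \<Longrightarrow> i \<in> S \<Longrightarrow> psn (a, S - {i}) = - psn (a, S)"
  using psn_insert[of i "S - {i}" a] by (simp add: insert_absorb)

lemma pty_pty [simp]: "pty (pty f) = f"
  by (rule poly_mapping_eqI) (simp add: pty_def lookup_diag flip: mult.assoc)

lemma pty_mx: "pty (mx i f) = mx i (pty f)"
  by (rule op_eqI[of "\<lambda>f. pty (mx i f)" "\<lambda>f. mx i (pty f)"]; (intro clin clinear_comp[OF linear_pty] linear_pty)?)
     (auto simp: mx_bvec pty_bvec psn_def)
lemma pty_dx: "pty (dx i f) = dx i (pty f)"
  by (rule op_eqI[of "\<lambda>f. pty (dx i f)" "\<lambda>f. dx i (pty f)"]; (intro clin clinear_comp[OF linear_pty] linear_pty)?)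
     (auto simp: dx_bvec pty_bvec psn_def mult.commute)
lemma pty_me: "i \<in> J \<Longrightarrow> pty (me i f) = - me i (pty f)"
  by (rule op_eqI[of "\<lambda>f. pty (me i f)" "\<lambda>f. - me i (pty f)"]; (intro clin clinear_comp[OF linear_pty] linear_pty)?)
     (auto simp: me_bvec pty_bvec psn_insert mult.commute)
lemma pty_de: "i \<in> J \<Longrightarrow> pty (de i f) = - de i (pty f)"
  by (rule op_eqI[of "\<lambda>f. pty (de i f)" "\<lambda>f. - de i (pty f)"]; (intro clin clinear_comp[OF linear_pty] linear_pty)?)
     (auto simp: de_bvec pty_bvec psn_remove mult.commute)

lemmas pty_ops = pty_mx pty_dx pty_me pty_de

lemma pty_om: "i \<in> I \<Longrightarrow> pty (om i f) = - om i (pty f)"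
  by (simp add: om_def pty_ops scale_simps)
lemma pty_p1: "pty (p1 f) = - p1 (pty f)" by (simp add: p1_def pty_ops sum_negf)
lemma pty_p2: "pty (p2 f) = - p2 (pty f)" by (simp add: p2_def pty_ops sum_negf)
lemma pty_q1: "pty (q1 f) = - q1 (pty f)" by (simp add: q1_def pty_ops sum_negf)
lemma pty_q2: "pty (q2 f) = - q2 (pty f)" by (simp add: q2_def pty_ops sum_negf)
lemmas pty_pq = pty_p1 pty_p2 pty_q1 pty_q2

lemma pty_SE [simp]: "f \<in> SEv \<Longrightarrow> pty f \<in> SEv"
  by (auto simp: SEv_iff pty_def in_keys_iff lookup_diag)

lemma B_pty: "B (pty f) g = B f (pty g)"
  using B_adjI[OF linear_pty linear_pty, of 1 f g] by (simp add: pty_bvec B_bvec B_lin)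

lemma pty_RR: "pty (RR k f) = RR k (pty f)"
  by (simp add: RR_def pty_ops)
lemma pty_TT: "N \<le> n \<Longrightarrow> pty (TT N) = TT N"
proof (induction N)
  case 0
  have "pty vac = vac" by (simp add: vac_def pty_bvec psn_def)
  then show ?case by (simp add: pty_ops)
next
  case (Suc N)
  then have N: "N < n" by simp
  from Suc have "pty (TT N) = TT N" by simp
  then show ?case using Ik_step(2)[OF N] pr_I[OF Ik_step(2)[OF N]] by (simp add: pty_RR pty_ops)
qed

lemma pty_vac: "pty vac = vac" by (simp add: vac_def pty_bvec psn_def)

lemma pty_hh: "N \<le> n \<Longrightarrow> \<exists>e. e * e = 1 \<and> pty (hh N l) = e \<cdot> hh N l"
proof (induction N arbitrary: l)
  case 0
  then show ?case using pty_TT[of 0] by (intro exI[of _ 1]) (simp add: pty_vac)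
next
  case (Suc N)
  then have N: "N < n" by simp
  have "N \<le> n" using N by simp
  then obtain e where e: "e * e = 1" "pty (hh N (l - 1)) = e \<cdot> hh N (l - 1)" using Suc.IH by blast
  show ?case
  proof (cases "l = 0 \<or> l = 2*N+3")
    case True
    then show ?thesis using pty_TT[OF Suc.prems] by (intro exI[of _ 1]) (auto simp: pty_vac simp del: TT.simps)
  next
    case False
    then show ?thesis using e Ik_step(2)[OF N] by (intro exI[of _ "- e"]) (simp add: pty_ops)
  qed
qed

lemma pty_uu: "\<exists>e. e * e = 1 \<and> pty (uu d l) = e \<cdot> uu d l"
proof -
  obtain e where e: "e * e = 1" "pty (hh n l) = e \<cdot> hh n l" using pty_hh by blast
  then have "pty (uu d l) = e \<cdot> uu d l" by (induction d) (simp_all add: uu_Suc pty_ops)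
  with e show ?thesis by blast
qed

lemma pty_vv: "\<exists>e. e * e = 1 \<and> pty (vv d l) = e \<cdot> vv d l"
proof -
  obtain e where e: "e * e = 1" "pty (uu d l) = e \<cdot> uu d l" using pty_uu by blast
  then have "pty (vv d l) = (- e) \<cdot> vv d l" by (simp add: vv_def pty_p1)
  with e show ?thesis by (intro exI[of _ "- e"]) simp
qed

text \<open>The pair (d, l) of x_1^d h_l; two summands of equal spo weight have l and 2n+1-l. For
  \<open>Triv_lo\<close> it points to h_0 = 1, which \<open>p1\<close> kills, so \<open>sv\<close>
  uses the vector 1 itself.\<close>

fun dl :: "summand \<Rightarrow> nat \<times> nat" where
  "dl Triv_lo = (0, 0)"
| "dl Triv_hi = (0, 2*n+1)"
| "dl (Hook_lo d k) = (d, k)"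
| "dl (Hook_hi d k) = (d, 2*n+1-k)"

definition sv :: "summand \<Rightarrow> smono cvec" where
  "sv t = (if t = Triv_lo then vac else vv (fst (dl t)) (snd (dl t)))"
definition sD :: "summand \<Rightarrow> int" where
  "sD t = (if t = Triv_lo then 0 else int (fst (dl t)) + 1)"
definition sL :: "summand \<Rightarrow> int" where
  "sL t = (if t = Triv_lo then 0 else int (snd (dl t)) - 1)"

lemma summands_cases:
  assumes "t \<in> summands n"
  obtains "t = Triv_lo" | "t = Triv_hi" | d k where "t = Hook_lo d k" "1 \<le> k" "k \<le> n"
    | d k where "t = Hook_hi d k" "1 \<le> k" "k \<le> n"
  using assms by (auto simp: summands_def)

lemma valid_dl: "t \<in> summands n \<Longrightarrow> t \<noteq> Triv_lo \<Longrightarrow> valid (fst (dl t)) (snd (dl t))"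
  by (erule summands_cases) (auto simp: valid_def)

lemma valid_summand:
  assumes "valid d l"
  shows "\<exists>t\<in>summands n. t \<noteq> Triv_lo \<and> dl t = (d, l)"
proof -
  consider "d = 0" "l = 2*n+1" | "1 \<le> l" "l \<le> n" | "n < l" "l \<le> 2*n"
    using assms by (cases "l \<le> n") (auto simp: valid_def not_le)
  then show ?thesis
  proof cases
    case 1 then show ?thesis by (intro bexI[of _ Triv_hi]) (auto simp: summands_def)
  next
    case 2 then show ?thesis by (intro bexI[of _ "Hook_lo d l"]) (auto simp: summands_def)
  next
    case 3 then show ?thesis by (intro bexI[of _ "Hook_hi d (2*n+1-l)"]) (auto simp: summands_def)
  qed
qed

text \<open>The two degrees separate the summands. Orthogonality of distinct joint highest weight
  vectors and distinctness of the osp weights both rest on this.\<close>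

lemma s_inj: "t \<in> summands n \<Longrightarrow> t' \<in> summands n \<Longrightarrow> sD t = sD t' \<Longrightarrow> sL t = sL t' \<Longrightarrow> t = t'"
  by (erule summands_cases; erule summands_cases) (auto simp: sD_def sL_def)

lemma sv_props:
  assumes "t \<in> summands n"
  shows "sv t \<in> SEv" "hw (sv t)" "p1 (sv t) = 0" "p2 (sv t) = 0"
    "homd wS (sD t) (sv t)" "homd wL (sL t) (sv t)" "B (sv t) (sv t) \<noteq> 0"
proof -
  have "sv t \<in> SEv \<and> hw (sv t) \<and> p1 (sv t) = 0 \<and> p2 (sv t) = 0 \<and>
    homd wS (sD t) (sv t) \<and> homd wL (sL t) (sv t) \<and> B (sv t) (sv t) \<noteq> 0"
  proof (cases "t = Triv_lo")
    case True
    have "om i vac = 0" for i by (simp add: om_def)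
    moreover have "wS (0, {}) = 0" "wL (0, {}) = 0" by (simp_all add: wS_def wL_def wt_def)
    ultimately show ?thesis using True
      by (simp add: sv_def sD_def sL_def hw_def p1_def p2_def homd_def vac_def B_bvec)
        (simp add: vac_def[symmetric])
  next
    case False
    then show ?thesis using vv_props[OF valid_dl[OF assms False]]
      by (simp add: sv_def sD_def sL_def)
  qed
  then show "sv t \<in> SEv" "hw (sv t)" "p1 (sv t) = 0" "p2 (sv t) = 0"
    "homd wS (sD t) (sv t)" "homd wL (sL t) (sv t)" "B (sv t) (sv t) \<noteq> 0" by blast+
qed

lemma pty_sv: "\<exists>e. e * e = 1 \<and> pty (sv t) = e \<cdot> sv t"
  using pty_vv by (auto simp: sv_def pty_vac intro: exI[of _ 1])

lemma sv_ne: "t \<in> summands n \<Longrightarrow> sv t \<noteq> 0"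
  using sv_props(7) B_0 by metis

lemma sv_singular:
  assumes "v \<in> SEv" "v \<noteq> 0" "homd wS D v" "homd wL l v" "hw v" "p1 v = 0" "p2 v = 0"
  shows "\<exists>t\<in>summands n. \<exists>g. g \<noteq> 0 \<and> v = g \<cdot> sv t \<and> sD t = D \<and> sL t = l"
proof -
  have "\<exists>t\<in>summands n. \<exists>g. v = g \<cdot> sv t"
    using joint_singular[OF assms]
  proof
    assume "\<exists>g. v = g \<cdot> vac"
    then show ?thesis by (intro bexI[of _ Triv_lo]) (auto simp: sv_def summands_def)
  next
    assume "\<exists>d l' g. valid d l' \<and> v = g \<cdot> vv d l'"
    then show ?thesis using valid_summand by (fastforce simp: sv_def)
  qed
  then obtain t g where t: "t \<in> summands n" and g: "v = g \<cdot> sv t" by blast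
  have "g \<noteq> 0" using g assms(2) by auto
  have "homd wS (sD t) v" "homd wL (sL t) v" unfolding g using sv_props[OF t] by (auto intro: homd_scale)
  then have "sD t = D" "sL t = l" using homd_ne assms by metis+
  with t g \<open>g \<noteq> 0\<close> show ?thesis by blast
qed

text \<open>The parity twist in \<open>GP\<close> makes the anticommuting generators of osp(2|2) and spo(2n|1) commute.\<close>

definition GO where "GO = om ` I"
definition GP where "GP = {\<lambda>f. p1 (pty f), \<lambda>f. p2 (pty f), \<lambda>f. q1 (pty f), \<lambda>f. q2 (pty f)}"

lemma GO_linear: "g \<in> GO \<Longrightarrow> clinear g" by (auto simp: GO_def linear_om)
lemma GP_linear: "g \<in> GP \<Longrightarrow> clinear g"
  by (auto simp: GP_def intro: clinear_comp linear_p1 linear_p2 linear_q1 linear_q2 linear_pty)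

lemma GO_GP: "g \<in> GO \<Longrightarrow> h \<in> GP \<Longrightarrow> g (h f) = h (g f)"
  by (auto simp: GO_def GP_def om_p1 om_p2 om_q1 om_q2 pty_om)

lemma comm_AB: "A \<in> alg GO \<Longrightarrow> C \<in> alg GP \<Longrightarrow> A (C f) = C (A f)"
  using alg_commute[of GO GP A C f] GO_linear GP_linear GO_GP by blast

lemma alg_adj:
  assumes "\<And>g. g \<in> G \<Longrightarrow> \<exists>g'\<in>alg G. \<forall>f h. B (g f) h = B f (g' h)" "\<And>g. g \<in> G \<Longrightarrow> clinear g"
    and "A \<in> alg G"
  shows "\<exists>A'\<in>alg G. \<forall>f h. B (A f) h = B f (A' h)"
  using assms(3)
proof induction
  case alg_id then show ?case by (intro bexI[of _ "\<lambda>f. f"] alg.alg_id) simp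
next
  case (alg_gen A g)
  then obtain A' g' where "A' \<in> alg G" "\<forall>f h. B (A f) h = B f (A' h)" "g' \<in> alg G" "\<forall>f h. B (g f) h = B f (g' h)"
    using assms(1) by blast
  then show ?case by (intro bexI[of _ "\<lambda>f. A' (g' f)"]) (auto intro: alg_comp assms(2))
next
  case (alg_add A C)
  then obtain A' C' where "A' \<in> alg G" "\<forall>f h. B (A f) h = B f (A' h)" "C' \<in> alg G" "\<forall>f h. B (C f) h = B f (C' h)"
    by blast
  then show ?case by (intro bexI[of _ "\<lambda>f. A' f + C' f"]) (auto intro: alg.alg_add simp: B_lin)
next
  case (alg_scale A c)
  then obtain A' where "A' \<in> alg G" "\<forall>f h. B (A f) h = B f (A' h)" by blast
  then show ?case by (intro bexI[of _ "\<lambda>f. c \<cdot> A' f"]) (auto intro: alg.alg_scale simp: B_lin)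
qed

lemma adj_GO: "A \<in> alg GO \<Longrightarrow> \<exists>A'\<in>alg GO. \<forall>f h. B (A f) h = B f (A' h)"
proof (rule alg_adj)
  fix g assume "g \<in> GO"
  then obtain i where i: "i \<in> I" "g = om i" by (auto simp: GO_def)
  have "(\<lambda>f. (-1) \<cdot> om (pr i) f) \<in> alg GO"
    by (rule alg_scale, rule alg_gen1) (use i in \<open>auto simp: GO_def\<close>)
  then show "\<exists>g'\<in>alg GO. \<forall>f h. B (g f) h = B f (g' h)"
    using i by (auto simp: B_om B_lin intro!: bexI[of _ "\<lambda>f. (-1) \<cdot> om (pr i) f"])
qed (auto simp: GO_linear)

lemma adj_GP: "A \<in> alg GP \<Longrightarrow> \<exists>A'\<in>alg GP. \<forall>f h. B (A f) h = B f (A' h)"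
proof (rule alg_adj)
  fix g assume g: "g \<in> GP"
  have 1: "(\<lambda>f. (-1) \<cdot> h f) \<in> alg GP" if "h \<in> GP" for h
    by (rule alg_scale, rule alg_gen1) (rule that)
  have "\<exists>h\<in>GP. \<forall>f f'. B (g f) f' = B f ((-1) \<cdot> h f')"
    using g by (auto simp: GP_def B_p1 B_p2 B_q1 B_q2 B_pty pty_pq B_lin)
  then show "\<exists>g'\<in>alg GP. \<forall>f h. B (g f) h = B f (g' h)" using 1 by (metis (no_types, lifting))
qed (auto simp: GP_linear)

lemma alg_pty:
  assumes "\<And>g f. g \<in> G \<Longrightarrow> pty (g f) = - g (pty f)" "A \<in> alg G"
  shows "\<exists>A'\<in>alg G. \<forall>f. pty (A f) = A' (pty f)"
  using assms(2)
proof induction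
  case alg_id then show ?case by (intro bexI[of _ "\<lambda>f. f"] alg.alg_id) simp
next
  case (alg_gen A g)
  then obtain A' where A': "A' \<in> alg G" "\<And>f. pty (A f) = A' (pty f)" by metis
  have "(\<lambda>f. (-1) \<cdot> g (A' f)) \<in> alg G" by (rule alg.alg_scale, rule alg.alg_gen[OF A'(1) alg_gen(2)])
  moreover have "pty (g (A f)) = (-1) \<cdot> g (A' (pty f))" for f
    using assms(1)[OF alg_gen(2), of "A f"] by (simp add: A'(2))
  ultimately show ?case by (intro bexI[of _ "\<lambda>f. (-1) \<cdot> g (A' f)"]) simp_all
next
  case (alg_add A C)
  then obtain A' C' where A': "A' \<in> alg G" "\<And>f. pty (A f) = A' (pty f)" "C' \<in> alg G" "\<And>f. pty (C f) = C' (pty f)"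
    by metis
  then show ?case by (intro bexI[of _ "\<lambda>f. A' f + C' f"] alg.alg_add) simp_all
next
  case (alg_scale A c)
  then obtain A' where A': "A' \<in> alg G" "\<And>f. pty (A f) = A' (pty f)" by metis
  then show ?case by (intro bexI[of _ "\<lambda>f. c \<cdot> A' f"] alg.alg_scale) simp_all
qed

lemma pty_GO: "g \<in> GO \<Longrightarrow> pty (g f) = - g (pty f)" by (auto simp: GO_def pty_om)
lemma pty_GP: "g \<in> GP \<Longrightarrow> pty (g f) = - g (pty f)" by (auto simp: GP_def pty_pq)

lemma orb_pty:
  assumes "\<And>g f. g \<in> G \<Longrightarrow> pty (g f) = - g (pty f)" "\<And>g. g \<in> G \<Longrightarrow> clinear g" "f \<in> orb G (sv t)"
  shows "pty f \<in> orb G (sv t)"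
proof -
  obtain A where A: "A \<in> alg G" "f = A (sv t)" using assms(3) by (auto simp: orb_def)
  obtain A' where A': "A' \<in> alg G" "\<forall>f. pty (A f) = A' (pty f)" using alg_pty[OF assms(1) A(1)] by blast
  obtain e where "pty (sv t) = e \<cdot> sv t" using pty_sv by blast
  then have "pty f = e \<cdot> A' (sv t)" using A A' by (simp add: clinD[OF alg_linear[OF assms(2) A'(1)]])
  then show ?thesis using cvec.subspace_scale[OF orb_subspace orbI[OF A'(1)]] by simp
qed

section \<open>The orbits under the two algebras\<close>

definition VV where "VV t = orb GO (sv t)"
definition WW where "WW t = orb GP (sv t)"

lemma VV_sub: "cvec.subspace (VV t)" and WW_sub: "cvec.subspace (WW t)"
  and VV_sv: "sv t \<in> VV t" and WW_sv: "sv t \<in> WW t"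
  by (simp_all add: VV_def WW_def orb_subspace orb_self)
lemma VV_om: "f \<in> VV t \<Longrightarrow> i \<in> I \<Longrightarrow> om i f \<in> VV t"
  unfolding VV_def by (rule orb_closed) (auto simp: GO_def)
lemma VV_pty: "f \<in> VV t \<Longrightarrow> pty f \<in> VV t" unfolding VV_def by (rule orb_pty[OF pty_GO GO_linear])
lemma WW_pty: "f \<in> WW t \<Longrightarrow> pty f \<in> WW t" unfolding WW_def by (rule orb_pty[OF pty_GP GP_linear])

lemma WW_pq: assumes "f \<in> WW t" shows "p1 f \<in> WW t" "p2 f \<in> WW t" "q1 f \<in> WW t" "q2 f \<in> WW t"
proof -
  note * = orb_closed[OF WW_pty[OF assms, unfolded WW_def], folded WW_def]
  show "p1 f \<in> WW t" "p2 f \<in> WW t" "q1 f \<in> WW t" "q2 f \<in> WW t"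
    using *[of "\<lambda>f. p1 (pty f)"] *[of "\<lambda>f. p2 (pty f)"] *[of "\<lambda>f. q1 (pty f)"] *[of "\<lambda>f. q2 (pty f)"]
    by (simp_all add: GP_def)
qed

lemma shifts_om: "i \<in> I \<Longrightarrow> shifts wS 0 (om i)" "i \<in> I \<Longrightarrow> shifts wL 0 (om i)"
  unfolding om_def[abs_def] wS_def wL_def
  by (intro shifts_add shifts_scale shifts_comp[OF shifts_mx shifts_de] shifts_comp[OF shifts_me shifts_dx]; auto)+

lemma sub_Collect: "clinear A \<Longrightarrow> cvec.subspace {f. A f = 0}"
  by (auto simp: cvec.subspace_def clinD)

lemma sub_homd: "cvec.subspace {f. homd w t f}"
  by (auto simp: cvec.subspace_def homd_add homd_scale)

lemma hw_sub: "cvec.subspace {f. hw f}"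
  by (auto simp: cvec.subspace_def hw_lin)

text \<open>The \<open>om i\<close> supercommute with \<open>p1\<close> and \<open>p2\<close> and
  preserve both degrees, so these properties pass from the generator to its orbit.\<close>

lemma VV_props:
  assumes "t \<in> summands n" "f \<in> VV t"
  shows "f \<in> SEv" "p1 f = 0" "p2 f = 0" "homd wS (sD t) f" "homd wL (sL t) f"
proof -
  let ?N = "SEv \<inter> {f. p1 f = 0} \<inter> {f. p2 f = 0} \<inter> {f. homd wS (sD t) f} \<inter> {f. homd wL (sL t) f}"
  have "VV t \<subseteq> ?N"
    unfolding VV_def
  proof (rule orb_least)
    show "cvec.subspace ?N"
      by (intro cvec.subspace_inter subspace_SEv sub_Collect sub_homd linear_p1 linear_p2)
    show "sv t \<in> ?N" using sv_props[OF assms(1)] by simp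
    fix g f assume g: "g \<in> GO" and f: "f \<in> ?N"
    then obtain i where i: "i \<in> I" "g = om i" by (auto simp: GO_def)
    show "g f \<in> ?N" using f i om_p1[of i f] om_p2[of i f] shifts_homd[OF shifts_om(1), of i _ f] shifts_homd[OF shifts_om(2), of i _ f] by auto
  qed
  with assms(2) show "f \<in> SEv" "p1 f = 0" "p2 f = 0" "homd wS (sD t) f" "homd wL (sL t) f" by auto
qed

lemma hw_pty: "hw f \<Longrightarrow> hw (pty f)"
proof -
  assume "hw f"
  moreover have "om i (pty f) = - pty (om i f)" if "i \<in> I" for i f using pty_om[OF that] by simp
  ultimately show ?thesis unfolding hw_def by simp
qed

lemma hw_pq: "hw f \<Longrightarrow> hw (p1 f)" "hw f \<Longrightarrow> hw (p2 f)" "hw f \<Longrightarrow> hw (q1 f)" "hw f \<Longrightarrow> hw (q2 f)"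
  unfolding hw_def by (simp_all add: om_p1 om_p2 om_q1 om_q2)

lemma WW_props:
  assumes "t \<in> summands n" "f \<in> WW t"
  shows "f \<in> SEv" "hw f"
proof -
  have "WW t \<subseteq> SEv \<inter> {f. hw f}"
    unfolding WW_def
  proof (rule orb_least)
    show "cvec.subspace (SEv \<inter> {f. hw f})" by (intro cvec.subspace_inter subspace_SEv hw_sub)
    show "sv t \<in> SEv \<inter> {f. hw f}" using sv_props[OF assms(1)] by simp
    show "g f \<in> SEv \<inter> {f. hw f}" if "g \<in> GP" "f \<in> SEv \<inter> {f. hw f}" for g f
      using that by (auto simp: GP_def intro!: hw_pq hw_pty)
  qed
  with assms(2) show "f \<in> SEv" "hw f" by auto
qed

section \<open>Reaching singular vectors by raising and lowering\<close>

definition wT where "wT = wt (\<lambda>_. 1) (\<lambda>_. 1)"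
definition wG where "wG = wt gi gi"

lemma gi_bound: "gi i \<le> int n" by (auto simp: gi_def I_def)

lemma wG_bound: "wG m \<le> int n * wT m"
  unfolding wG_def wT_def wt_def sum_distrib_left
  by (intro sum_mono) (auto simp: distrib_left intro!: add_mono mult_right_mono gi_bound)

lemma shifts_om_GT: "i \<in> I \<Longrightarrow> shifts wG (gi i) (om i)" "i \<in> I \<Longrightarrow> shifts wT 0 (om i)"
  unfolding om_def[abs_def] wG_def wT_def
  by (intro shifts_add shifts_scale shifts_comp[OF shifts_mx shifts_de] shifts_comp[OF shifts_me shifts_dx]; auto simp: gi_pr)+

text \<open>A raising operator that does not kill the vector increases \<open>wG\<close> and keeps
  the total degree. As \<open>wG\<close> is at most n times the total degree, the process
  ends.\<close>

lemma raise:
  assumes N: "\<And>f i. f \<in> N \<Longrightarrow> i \<in> I \<Longrightarrow> om i f \<in> N" and u: "u \<in> N" "u \<noteq> 0"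
  shows "\<exists>w\<in>N. w \<noteq> 0 \<and> hw w"
proof -
  have main: "\<exists>w\<in>N. w \<noteq> 0 \<and> hw w"
    if "u \<in> N" "u \<noteq> 0" "\<forall>m\<in>keys u. t \<le> wG m \<and> wT m \<le> K" for u t K
    using that
  proof (induction "nat (int n * K + 1 - t)" arbitrary: u t rule: less_induct)
    case less
    show ?case
    proof (cases "hw u")
      case True then show ?thesis using less.prems by blast
    next
      case False
      have "keys u \<noteq> {}" using less.prems(2) by simp
      then obtain m where m: "m \<in> keys u" by blast
      have "t \<le> wG m" "wT m \<le> K" using less.prems(3) m by auto
      then have tK: "t \<le> int n * K"
        using wG_bound[of m] mult_left_mono[of "wT m" K "int n"] by linarith
      have step: ?thesis if A: "A u \<noteq> 0" "A u \<in> N" "shifts wG k A" "0 < k" "shifts wT 0 A" for A k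
      proof (rule less.hyps[of "t + 1"])
        show "nat (int n * K + 1 - (t + 1)) < nat (int n * K + 1 - t)" using tK by linarith
        show "\<forall>m\<in>keys (A u). t + 1 \<le> wG m \<and> wT m \<le> K"
        proof
          fix m' assume m': "m' \<in> keys (A u)"
          show "t + 1 \<le> wG m' \<and> wT m' \<le> K"
            using shifts_keys[OF A(3) m'] shifts_keys[OF A(5) m'] less.prems(3) A(4) by force
        qed
      qed (use A in auto)
      from False consider i where "i \<in> I" "i \<le> n" "om i u \<noteq> 0"
        | i j where "i \<in> I" "j \<in> I" "i \<le> n" "n < j" "i < pr j" "om i (om j u) \<noteq> 0"
        unfolding hw_def by blast
      then show ?thesis
      proof cases
        case 1
        then show ?thesis using N less.prems(1) shifts_om_GT gi_pos by (intro step[of "om i" "gi i"]) auto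
      next
        case 2
        show ?thesis
        proof (rule step[of "\<lambda>f. om i (om j f)" "gi i + gi j"])
          show "shifts wG (gi i + gi j) (\<lambda>f. om i (om j f))" "shifts wT 0 (\<lambda>f. om i (om j f))"
            using 2 by (auto intro: shifts_comp shifts_om_GT)
          show "0 < gi i + gi j" using 2 by (intro gi_less)
        qed (use 2 N less.prems(1) in auto)
      qed
    qed
  qed
  have fin: "finite (wG ` keys u)" "finite (wT ` keys u)" by auto
  show ?thesis
    by (rule main[OF u, of "Min (wG ` keys u)" "Max (wT ` keys u)"]) (use fin in auto)
qed

lemma shifts_p: "shifts wL (-1) p1" "shifts wL (-1) p2"
proof -
  show "shifts wL (-1) p1" by (rule shifts_p1(2))
  show "shifts wL (-1) p2"
    unfolding p2_def[abs_def] wL_def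
    by (intro shifts_add shifts_sum shifts_scale shifts_comp[OF shifts_dx shifts_de]; auto)
qed

text \<open>\<open>p1\<close> and \<open>p2\<close> lower the degree \<open>wL\<close>, which is
  never negative, so they can be applied with nonzero result only finitely often.\<close>

lemma lower:
  assumes N: "\<And>f. f \<in> N \<Longrightarrow> p1 f \<in> N" "\<And>f. f \<in> N \<Longrightarrow> p2 f \<in> N" and u: "u \<in> N" "u \<noteq> 0"
  shows "\<exists>w\<in>N. w \<noteq> 0 \<and> p1 w = 0 \<and> p2 w = 0"
proof -
  have main: "\<exists>w\<in>N. w \<noteq> 0 \<and> p1 w = 0 \<and> p2 w = 0"
    if "u \<in> N" "u \<noteq> 0" "\<forall>m\<in>keys u. wL m \<le> int K" for u K
    using that
  proof (induction K arbitrary: u)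
    case 0
    have "homd wL 0 u" using 0(3) wL_nonneg unfolding homd_def by (simp add: antisym)
    then have "homd wL (-1) (p1 u)" "homd wL (-1) (p2 u)" using shifts_homd[OF shifts_p(1)] shifts_homd[OF shifts_p(2)] by force+
    then have "p1 u = 0" "p2 u = 0" using degL_neg[of _ "-1"] degL_homd by (metis neg_less_0_iff_less zero_less_one)+
    with 0 show ?case by blast
  next
    case (Suc K)
    have b: "\<forall>m\<in>keys (p u). wL m \<le> int K" if "shifts wL (-1) p" for p
      using shifts_keys[OF that] Suc.prems(3) by fastforce
    show ?case
    proof (cases "p1 u = 0")
      case False then show ?thesis using Suc.IH[of "p1 u"] b[OF shifts_p(1)] N Suc.prems by blast
    next
      case 1: True
      show ?thesis
      proof (cases "p2 u = 0")
        case False then show ?thesis using Suc.IH[of "p2 u"] b[OF shifts_p(2)] N Suc.prems by blast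
      next
        case True then show ?thesis using 1 Suc.prems by blast
      qed
    qed
  qed
  have "\<forall>m\<in>keys u. wL m \<le> int (nat (Max (wL ` keys u)))"
  proof
    fix m assume "m \<in> keys u"
    then have "wL m \<le> Max (wL ` keys u)" by (intro Max_ge) auto
    then show "wL m \<le> int (nat (Max (wL ` keys u)))" by linarith
  qed
  from main[OF u this] show ?thesis .
qed

text \<open>A singular vector inside the orbit has the degrees of \<open>t\<close> and is killed by
  \<open>p1\<close> and \<open>p2\<close>, so the classification leaves only multiples of the
  generator.\<close>

lemma VV_irr:
  assumes t: "t \<in> summands n" and N: "N \<subseteq> VV t" "cvec.subspace N" "\<And>f i. f \<in> N \<Longrightarrow> i \<in> I \<Longrightarrow> om i f \<in> N"
    and u: "u \<in> N" "u \<noteq> 0"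
  shows "N = VV t"
proof -
  obtain w where w: "w \<in> N" "w \<noteq> 0" "hw w" using raise[of N u] N(3) u by blast
  note V = VV_props[OF t subsetD[OF N(1) w(1)]]
  obtain t' g where "t' \<in> summands n" "g \<noteq> 0" "w = g \<cdot> sv t'" "sD t' = sD t" "sL t' = sL t"
    using sv_singular[OF V(1) w(2) V(4,5) w(3) V(2,3)] by blast
  then have "w = g \<cdot> sv t" "g \<noteq> 0" using s_inj[OF _ t] by auto
  then have "sv t = (1 / g) \<cdot> w" by simp
  then have "sv t \<in> N" using cvec.subspace_scale[OF N(2) w(1)] by simp
  then have "VV t \<subseteq> N" unfolding VV_def by (rule orb_least[OF N(2)]) (auto simp: GO_def N(3))
  with N(1) show ?thesis by blast
qed

text \<open>Words in \<open>q1\<close> and \<open>q2\<close> applied to the generator. They are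
  homogeneous, so the degree operators act on them by scalars.\<close>

inductive_set Sw :: "summand \<Rightarrow> smono cvec set" for t where
  Sw_0: "sv t \<in> Sw t"
| Sw_1: "w \<in> Sw t \<Longrightarrow> q1 w \<in> Sw t"
| Sw_2: "w \<in> Sw t \<Longrightarrow> q2 w \<in> Sw t"

lemma shifts_q: "shifts wS (-1) q1" "shifts wL 1 q1" "shifts wS 1 q2" "shifts wL 1 q2"
  unfolding q1_def[abs_def] q2_def[abs_def] wS_def wL_def
  by (intro shifts_add shifts_diff shifts_sum shifts_scale shifts_comp[OF shifts_mx shifts_de]
    shifts_comp[OF shifts_me shifts_dx] shifts_comp[OF shifts_mx shifts_me] shifts_comp[OF shifts_me shifts_mx]; auto)+

lemma Sw_homd:
  assumes "t \<in> summands n" "w \<in> Sw t"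
  shows "\<exists>D l. homd wS D w \<and> homd wL l w"
  using assms(2)
proof induction
  case Sw_0 then show ?case using sv_props[OF assms(1)] by blast
next
  case (Sw_1 w) then show ?case using shifts_homd[OF shifts_q(1)] shifts_homd[OF shifts_q(2)] by blast
next
  case (Sw_2 w) then show ?case using shifts_homd[OF shifts_q(3)] shifts_homd[OF shifts_q(4)] by blast
qed

lemma span_closed:
  assumes "clinear A" "\<And>w. w \<in> S \<Longrightarrow> A w \<in> cvec.span T" "f \<in> cvec.span S"
  shows "A f \<in> cvec.span T"
  using assms(3)
proof (induction rule: cvec.span_induct_alt)
  case base then show ?case by (simp add: clinD(5)[OF assms(1)] cvec.span_zero)
next
  case (step c x y)
  then show ?case by (simp add: clinD[OF assms(1)] assms(2) cvec.span_add cvec.span_scale)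
qed

text \<open>A triangular decomposition: \<open>p1\<close> and \<open>p2\<close> move through a word
  in \<open>q1\<close>, \<open>q2\<close>, leaving scalar multiples of other words, until they reach
  the generator and kill it.\<close>

lemma WW_span:
  assumes t: "t \<in> summands n"
  shows "WW t = cvec.span (Sw t)"
proof
  let ?T = "cvec.span (Sw t)"
  have q: "q1 f \<in> ?T" "q2 f \<in> ?T" if "f \<in> ?T" for f
    by (rule span_closed[OF linear_q1 _ that], simp add: cvec.span_base Sw.Sw_1)
       (rule span_closed[OF linear_q2 _ that], simp add: cvec.span_base Sw.Sw_2)
  have p: "p1 w \<in> ?T \<and> p2 w \<in> ?T \<and> pty w \<in> ?T" if "w \<in> Sw t" for w
    using that
  proof induction
    case Sw_0
    obtain e where "pty (sv t) = e \<cdot> sv t" using pty_sv by blast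
    then show ?case using sv_props[OF t] by (simp add: cvec.span_zero cvec.span_scale cvec.span_base Sw.Sw_0)
  next
    case (Sw_1 w)
    obtain D l where "homd wS D w" "homd wL l w" using Sw_homd[OF t Sw_1(1)] by blast
    then have d: "degS w = of_int D \<cdot> w" "degL w = of_int l \<cdot> w" by (simp_all only: degS_homd degL_homd)
    have "w \<in> ?T" using Sw_1 by (simp add: cvec.span_base)
    then show ?case using Sw_1 q by (simp add: p1_q1 p2_q1 pty_q1 d cvec.span_add cvec.span_diff cvec.span_neg cvec.span_scale)
  next
    case (Sw_2 w)
    obtain D l where "homd wS D w" "homd wL l w" using Sw_homd[OF t Sw_2(1)] by blast
    then have d: "degS w = of_int D \<cdot> w" "degL w = of_int l \<cdot> w" by (simp_all only: degS_homd degL_homd)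
    have "w \<in> ?T" using Sw_2 by (simp add: cvec.span_base)
    then show ?case using Sw_2 q by (simp add: p1_q2 p2_q2 pty_q2 d cvec.span_add cvec.span_diff cvec.span_neg cvec.span_scale)
  qed
  have pT: "p1 f \<in> ?T" "p2 f \<in> ?T" "pty f \<in> ?T" if "f \<in> ?T" for f
    by (rule span_closed[OF linear_p1 _ that], simp add: p, rule span_closed[OF linear_p2 _ that], simp add: p)
       (rule span_closed[OF linear_pty _ that], simp add: p)
  show "WW t \<subseteq> ?T"
    unfolding WW_def by (rule orb_least) (auto simp: GP_def cvec.span_base Sw.Sw_0 q pT)
  have "w \<in> WW t" if "w \<in> Sw t" for w using that by induction (auto simp: WW_sv WW_pq)
  then show "?T \<subseteq> WW t" by (intro cvec.span_minimal WW_sub) auto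
qed

lemma WW_tri:
  assumes t: "t \<in> summands n" and w: "w \<in> WW t"
  shows "\<exists>c f g. w = c \<cdot> sv t + q1 f + q2 g"
  using w unfolding WW_span[OF t]
proof (induction rule: cvec.span_induct_alt)
  case base then show ?case by (intro exI[of _ 0]) simp
next
  case (step c x y)
  then obtain d f g where y: "y = d \<cdot> sv t + q1 f + q2 g" by blast
  from step(1) show ?case
  proof cases
    case Sw_0
    then show ?thesis using y by (intro exI[of _ "c + d"] exI[of _ f] exI[of _ g]) (simp add: cvec.scale_left_distrib add_ac)
  next
    case (Sw_1 x')
    then show ?thesis using y by (intro exI[of _ d] exI[of _ "c \<cdot> x' + f"] exI[of _ g]) (simp add: add_ac)
  next
    case (Sw_2 x')
    then show ?thesis using y by (intro exI[of _ d] exI[of _ f] exI[of _ "c \<cdot> x' + g"]) (simp add: add_ac)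
  qed
qed

text \<open>Images of \<open>q1\<close> and \<open>q2\<close> are orthogonal to everything killed by
  \<open>p1\<close> and \<open>p2\<close>, so only the coefficient of the generator is seen.\<close>

lemma WW_B:
  assumes "t \<in> summands n" "w \<in> WW t"
  shows "\<exists>c. \<forall>u. p1 u = 0 \<longrightarrow> p2 u = 0 \<longrightarrow> B w u = c * B (sv t) u"
proof -
  obtain c f g where "w = c \<cdot> sv t + q1 f + q2 g" using WW_tri[OF assms] by blast
  then show ?thesis by (intro exI[of _ c]) (simp add: B_lin B_q1 B_q2)
qed

lemma B_cmp: "homd w t g \<Longrightarrow> B f g = B (cmp w t f) g"
proof -
  assume g: "homd w t g"
  have "B f g = (\<Sum>m\<in>keys g. lookup g m * lookup f m * wgt m)" by (subst B_sym) (simp add: B_def)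
  also have "\<dots> = (\<Sum>m\<in>keys g. lookup g m * lookup (cmp w t f) m * wgt m)"
    using g by (intro sum.cong) (auto simp: lookup_cmp homd_def)
  also have "\<dots> = B (cmp w t f) g" by (subst B_sym) (simp add: B_def)
  finally show ?thesis .
qed

lemma B_homd_ne: "homd w t f \<Longrightarrow> homd w t' g \<Longrightarrow> t \<noteq> t' \<Longrightarrow> B f g = 0"
proof -
  assume *: "homd w t f" "homd w t' g" "t \<noteq> t'"
  have "cmp w t' f = 0" using homd_ne[of w t "cmp w t' f" t'] homd_cmp[of w t' f] * by (auto simp: homd_def keys_cmp)
  then show ?thesis using B_cmp[OF *(2), of f] by simp
qed

lemma VV_B_ne: "t \<in> summands n \<Longrightarrow> t' \<in> summands n \<Longrightarrow> t \<noteq> t' \<Longrightarrow> f \<in> VV t' \<Longrightarrow> B (sv t) f = 0"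
  using sv_props[of t] VV_props[of t' f] s_inj[of t t'] B_homd_ne by metis

text \<open>All conditions on w are homogeneous, so its component in the degrees of \<open>m\<close>
  is again singular, hence a nonzero multiple of some \<open>sv t\<close>; the other components are
  orthogonal to that vector.\<close>

lemma singular_component:
  assumes w: "w \<in> SEv" "hw w" "p1 w = 0" "p2 w = 0" and m: "m \<in> keys w"
  shows "\<exists>t\<in>summands n. sD t = wS m \<and> sL t = wL m \<and> B w (sv t) \<noteq> 0"
proof -
  define w' where "w' = cmp wS (wS m) (cmp wL (wL m) w)"
  have "m \<in> keys w'" using m by (simp add: w'_def keys_cmp)
  then have ne: "w' \<noteq> 0" by auto
  have SE: "w' \<in> SEv" using w(1) by (auto simp: w'_def SEv_iff keys_cmp)
  have hS: "homd wS (wS m) w'" by (simp add: w'_def homd_cmp)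
  have hL: "homd wL (wL m) w'" by (auto simp: w'_def homd_def keys_cmp)
  have omc: "om i (cmp wS a (cmp wL b x)) = cmp wS a (cmp wL b (om i x))" if "i \<in> I" for i a b x
    using shifts_cmp[OF shifts_om(1)[OF that], of a "cmp wL b x"] shifts_cmp[OF shifts_om(2)[OF that], of b x] by simp
  have c0: "cmp w t 0 = 0" for w :: "smono \<Rightarrow> int" and t by (rule clinD(5)[OF linear_cmp])
  have hw': "hw w'"
    unfolding hw_def w'_def by (simp add: omc hwD[OF w(2)] c0)
  have sp2: "shifts wS (-1) p2"
    unfolding p2_def[abs_def] wS_def
    by (intro shifts_add shifts_sum shifts_scale shifts_comp[OF shifts_dx shifts_de]; auto)
  have p1': "p1 w' = 0"
    using shifts_cmp[OF shifts_p1(1), of "wS m" "cmp wL (wL m) w"] shifts_cmp[OF shifts_p(1), of "wL m" w] w(3) c0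
    by (simp add: w'_def)
  have p2': "p2 w' = 0"
    using shifts_cmp[OF sp2, of "wS m" "cmp wL (wL m) w"] shifts_cmp[OF shifts_p(2), of "wL m" w] w(4) c0
    by (simp add: w'_def)
  obtain t g where t: "t \<in> summands n" "g \<noteq> 0" "w' = g \<cdot> sv t" "sD t = wS m" "sL t = wL m"
    using sv_singular[OF SE ne hS hL hw' p1' p2'] by blast
  have "B w (sv t) = B w' (sv t)"
    using B_cmp[OF sv_props(6)[OF t(1)], of w] B_cmp[OF sv_props(5)[OF t(1)], of "cmp wL (wL m) w"] t by (simp add: w'_def)
  also have "\<dots> \<noteq> 0" using t sv_props(7)[OF t(1)] by (simp add: B_lin)
  finally show ?thesis using t by blast
qed

text \<open>The danger is a vector of the orbit that is killed by \<open>p1\<close> and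
  \<open>p2\<close> but lies in other degrees. It would pair nontrivially with some
  \<open>sv t'\<close>, whereas by \<open>WW_B\<close> this pairing is a multiple of that of
  \<open>sv t\<close> with \<open>sv t'\<close>, which is zero unless t' = t.\<close>

lemma WW_irr:
  assumes t: "t \<in> summands n" and N: "N \<subseteq> WW t" "cvec.subspace N"
    "\<And>f. f \<in> N \<Longrightarrow> p1 f \<in> N" "\<And>f. f \<in> N \<Longrightarrow> p2 f \<in> N" "\<And>f. f \<in> N \<Longrightarrow> q1 f \<in> N" "\<And>f. f \<in> N \<Longrightarrow> q2 f \<in> N"
    and u: "u \<in> N" "u \<noteq> 0"
  shows "N = WW t"
proof -
  obtain w where w: "w \<in> N" "w \<noteq> 0" "p1 w = 0" "p2 w = 0" using lower[of N u] N u by blast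
  note W = WW_props[OF t subsetD[OF N(1) w(1)]]
  have deg: "sD t = wS m \<and> sL t = wL m" if m: "m \<in> keys w" for m
  proof -
    obtain t' where t': "t' \<in> summands n" "sD t' = wS m" "sL t' = wL m" "B w (sv t') \<noteq> 0"
      using singular_component[OF W w(3,4) m] by blast
    obtain c where "B w (sv t') = c * B (sv t) (sv t')"
      using WW_B[OF t subsetD[OF N(1) w(1)]] sv_props[OF t'(1)] by blast
    then have "B (sv t) (sv t') \<noteq> 0" using t'(4) by auto
    then have "t = t'" using VV_B_ne[OF t t'(1) _ VV_sv] by blast
    with t' show ?thesis by simp
  qed
  then have "homd wS (sD t) w" "homd wL (sL t) w" by (auto simp: homd_def)
  from sv_singular[OF W(1) w(2) this W(2) w(3,4)] obtain t' g
    where "t' \<in> summands n" "g \<noteq> 0" "w = g \<cdot> sv t'" "sD t' = sD t" "sL t' = sL t" by blast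
  then have "w = g \<cdot> sv t" "g \<noteq> 0" using s_inj[OF _ t] by auto
  then have "sv t = (1 / g) \<cdot> w" by simp
  then have sN: "sv t \<in> N" using cvec.subspace_scale[OF N(2) w(1)] by simp
  have "w \<in> N" if "w \<in> Sw t" for w using that by induction (auto simp: sN N)
  then have "cvec.span (Sw t) \<subseteq> N" using N(2) by (intro cvec.span_minimal) auto
  with N(1) show ?thesis by (simp add: WW_span[OF t])
qed

text \<open>With w' = b' (sv t'), the operators a and b' are moved to the other arguments by
  adjoints, using that the two algebras commute. The pairing that remains is of the kind in
  \<open>WW_B\<close>, and its scalar c depends on the osp part only.\<close>

lemma B_factor:
  assumes t: "t \<in> summands n" "t' \<in> summands n" and a: "a \<in> alg GO" "a' \<in> alg GO" and w: "w \<in> WW t" "w' \<in> WW t'"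
  shows "t = t' \<Longrightarrow> B (a w) (a' w') * B (sv t) (sv t) = B w w' * B (a (sv t)) (a' (sv t))"
    "t \<noteq> t' \<Longrightarrow> B (a w) (a' w') = 0"
proof -
  obtain b b' where b: "b \<in> alg GP" "w = b (sv t)" "b' \<in> alg GP" "w' = b' (sv t')"
    using w by (auto simp: WW_def orb_def)
  obtain as where as: "as \<in> alg GO" "\<forall>f h. B (a f) h = B f (as h)" using adj_GO[OF a(1)] by blast
  obtain bs where bs: "bs \<in> alg GP" "\<forall>f h. B (b' f) h = B f (bs h)" using adj_GP[OF b(3)] by blast
  define a2 where "a2 = (\<lambda>f. as (a' f))"
  have a2: "a2 \<in> alg GO" unfolding a2_def by (rule alg_comp[OF GO_linear as(1) a(2)])
  have bw: "bs w \<in> WW t" unfolding b(2) WW_def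
    by (rule orbI[where A = "\<lambda>f. bs (b f)"], rule alg_comp[OF GP_linear bs(1) b(1)])
  then obtain c where c: "\<And>u. p1 u = 0 \<Longrightarrow> p2 u = 0 \<Longrightarrow> B (bs w) u = c * B (sv t) u" using WW_B[OF t(1)] by blast
  have va: "a2 (sv t') \<in> VV t'" using a2 by (auto simp: VV_def orb_def)
  have "B (a w) (a' w') = B w (a2 (b' (sv t')))" using as(2) b(4) by (simp add: a2_def)
  also have "\<dots> = B w (b' (a2 (sv t')))" using comm_AB[OF a2 b(3)] by simp
  also have "\<dots> = B (bs w) (a2 (sv t'))" using bs(2) by (metis B_sym)
  also have "\<dots> = c * B (sv t) (a2 (sv t'))" using VV_props(2,3)[OF t(2) va] by (rule c)
  finally have 1: "B (a w) (a' w') = c * B (sv t) (a2 (sv t'))" .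
  show "B (a w) (a' w') = 0" if "t \<noteq> t'"
    unfolding 1 using VV_B_ne[OF t that va] by simp
  show "B (a w) (a' w') * B (sv t) (sv t) = B w w' * B (a (sv t)) (a' (sv t))" if "t = t'"
  proof -
    have "B w w' = B (bs w) (sv t)" using bs(2) b(4) that by (metis B_sym)
    also have "\<dots> = c * B (sv t) (sv t)" using sv_props[OF t(1)] by (intro c) auto
    finally show ?thesis using 1 as(2) that by (simp add: a2_def)
  qed
qed

section \<open>The orbits exhaust S(E)\<close>

lemma wT_eq: "wT m = wS m + wL m"
  unfolding wT_def wS_def wL_def wt_def sum.distrib[symmetric]
  by (intro sum.cong) auto

lemma alg_GO_SE: "A \<in> alg GO \<Longrightarrow> f \<in> SEv \<Longrightarrow> A f \<in> SEv"
  by (induction rule: alg.induct) (auto simp: GO_def)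

lemma alg_GO_shifts: "A \<in> alg GO \<Longrightarrow> shifts wT 0 A"
proof (induction rule: alg.induct)
  case (alg_gen A g)
  then obtain i where "i \<in> I" "g = om i" by (auto simp: GO_def)
  then show ?case using shifts_comp[OF shifts_om_GT(2) alg_gen.IH] by simp
qed (auto intro: shifts_id shifts_add shifts_scale)

lemma Sw_WW: "t \<in> summands n \<Longrightarrow> w \<in> Sw t \<Longrightarrow> w \<in> WW t"
  by (simp add: WW_span cvec.span_base)

definition Gen :: "smono cvec set" where
  "Gen = {A w | A w t. A \<in> alg GO \<and> t \<in> summands n \<and> w \<in> Sw t}"

lemma GenI: "A \<in> alg GO \<Longrightarrow> t \<in> summands n \<Longrightarrow> w \<in> Sw t \<Longrightarrow> A w \<in> Gen"
  by (auto simp: Gen_def)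

lemma Gen_span: "A \<in> alg GO \<Longrightarrow> t \<in> summands n \<Longrightarrow> w \<in> WW t \<Longrightarrow> A w \<in> cvec.span Gen"
  unfolding WW_span
  by (rule span_closed[OF alg_linear[OF GO_linear]]) (auto intro: cvec.span_base GenI)

lemma alg_GP_swap:
  assumes A: "A \<in> alg GO" and h: "(\<lambda>f. h (pty f)) \<in> GP"
  shows "\<exists>A'\<in>alg GO. \<forall>f. h (A f) = A' (h f)"
proof -
  obtain A' where A': "A' \<in> alg GO" "\<And>f. pty (A f) = A' (pty f)" using alg_pty[OF pty_GO A] by metis
  have "h (A f) = A' (h f)" for f
  proof -
    have "h (A f) = h (pty (pty (A f)))" by simp
    also have "\<dots> = h (pty (A' (pty f)))" by (simp add: A'(2))
    also have "\<dots> = A' (h (pty (pty f)))" using comm_AB[OF A'(1) alg_gen1[OF h], of "pty f"] by simp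
    finally show ?thesis by simp
  qed
  then show ?thesis using A'(1) by blast
qed

lemma Gen_closed:
  assumes "f \<in> cvec.span Gen"
  shows "i \<in> I \<Longrightarrow> om i f \<in> cvec.span Gen" "q1 f \<in> cvec.span Gen" "q2 f \<in> cvec.span Gen"
    "cmp wT K f \<in> cvec.span Gen"
proof -
  show "om i f \<in> cvec.span Gen" if i: "i \<in> I"
  proof (rule span_closed[OF linear_om _ assms])
    fix x assume "x \<in> Gen"
    then obtain A w t where x: "A \<in> alg GO" "t \<in> summands n" "w \<in> Sw t" "x = A w" by (auto simp: Gen_def)
    have "om i \<in> GO" using i by (simp add: GO_def)
    show "om i x \<in> cvec.span Gen"
      unfolding x(4) by (rule cvec.span_base, rule GenI[OF alg_gen[OF x(1) \<open>om i \<in> GO\<close>] x(2,3)])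
  qed
  have h: "h f \<in> cvec.span Gen" if h: "(\<lambda>f. h (pty f)) \<in> GP" "clinear h" "\<And>t f. f \<in> WW t \<Longrightarrow> h f \<in> WW t" for h
  proof (rule span_closed[OF h(2) _ assms])
    fix x assume "x \<in> Gen"
    then obtain A w t where x: "A \<in> alg GO" "t \<in> summands n" "w \<in> Sw t" "x = A w" by (auto simp: Gen_def)
    obtain A' where A': "A' \<in> alg GO" "h x = A' (h w)" using alg_GP_swap[OF x(1) h(1)] x(4) by metis
    show "h x \<in> cvec.span Gen" unfolding A'(2) by (rule Gen_span[OF A'(1) x(2) h(3)[OF Sw_WW[OF x(2,3)]]])
  qed
  show "q1 f \<in> cvec.span Gen" "q2 f \<in> cvec.span Gen"
    by (rule h; auto simp: GP_def linear_q1 linear_q2 WW_pq)+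
  show "cmp wT K f \<in> cvec.span Gen"
  proof (rule span_closed[OF linear_cmp _ assms])
    fix x assume "x \<in> Gen"
    then obtain A w t where x: "A \<in> alg GO" "t \<in> summands n" "w \<in> Sw t" "x = A w" by (auto simp: Gen_def)
    obtain D l where "homd wS D w" "homd wL l w" using Sw_homd[OF x(2,3)] by blast
    then have w: "homd wT (D + l) w" by (auto simp: homd_def wT_eq)
    have "homd wT (D + l) x" using shifts_homd[OF alg_GO_shifts[OF x(1)] w] x(4) by simp
    then have "cmp wT K x = x \<or> cmp wT K x = 0"
    proof (cases "K = D + l")
      case False
      have "homd wT (D + l) (cmp wT K x)" using \<open>homd wT (D + l) x\<close> by (auto simp: homd_def keys_cmp)
      then show ?thesis using homd_ne[OF homd_cmp[of wT K x] _ False] by simp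
    qed (auto intro: cmp_homd)
    moreover have "x \<in> cvec.span Gen" using x by (auto intro: cvec.span_base GenI)
    ultimately show "cmp wT K x \<in> cvec.span Gen" by (auto simp: cvec.span_zero)
  qed
qed

lemma Gen_SE: "cvec.span Gen \<subseteq> SEv"
proof (intro cvec.span_minimal subspace_SEv subsetI)
  fix x assume "x \<in> Gen"
  then obtain A w t where x: "A \<in> alg GO" "t \<in> summands n" "w \<in> Sw t" "x = A w" by (auto simp: Gen_def)
  show "x \<in> SEv" unfolding x(4) by (rule alg_GO_SE[OF x(1) WW_props(1)[OF x(2) Sw_WW[OF x(2,3)]]])
qed

text \<open>By adjointness the orthogonal complement is stable under \<open>p1\<close>,
  \<open>p2\<close> and the \<open>om i\<close>. Lowering and then raising inside it would lead to a
  joint singular vector, and such a vector has nonzero pairing with some generator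
  \<open>sv t\<close>.\<close>

lemma Gen_perp:
  assumes u: "u \<in> SEv" "\<And>f. f \<in> cvec.span Gen \<Longrightarrow> B u f = 0"
  shows "u = 0"
proof (rule ccontr)
  assume "u \<noteq> 0"
  let ?P = "{u \<in> SEv. \<forall>f\<in>cvec.span Gen. B u f = 0}"
  have "p1 f \<in> ?P" "p2 f \<in> ?P" if "f \<in> ?P" for f
    using that Gen_closed by (auto simp: B_p1 B_p2)
  then obtain w where w: "w \<in> ?P" "w \<noteq> 0" "p1 w = 0" "p2 w = 0" using lower[of ?P u] u \<open>u \<noteq> 0\<close> by blast
  let ?Q = "?P \<inter> {f. p1 f = 0 \<and> p2 f = 0}"
  have "om i f \<in> ?Q" if "f \<in> ?Q" "i \<in> I" for f i
    using that Gen_closed(1) om_p1[of i f] om_p2[of i f] by (auto simp: B_om)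
  then obtain v where v: "v \<in> ?Q" "v \<noteq> 0" "hw v" using raise[of ?Q w] w by blast
  have "keys v \<noteq> {}" using v(2) by simp
  then obtain m where "m \<in> keys v" by blast
  then obtain t where t: "t \<in> summands n" "B v (sv t) \<noteq> 0" using singular_component[of v m] v by blast
  have "sv t \<in> cvec.span Gen" using Gen_span[OF alg_id t(1) WW_sv] .
  with v t show False by simp
qed

text \<open>Finiteness of each graded piece allows a linear functional on it to be represented by a
  vector through the form, as \<open>Gen_total\<close> requires.\<close>

lemma finite_wT: "finite {m. keys (fst m) \<subseteq> J \<and> snd m \<subseteq> J \<and> wT m = K}" (is "finite ?M")
proof (rule finite_imageD)
  let ?h = "\<lambda>m :: smono. (restrict (lookup (fst m)) J, snd m)"
  have "?h ` ?M \<subseteq> (J \<rightarrow>\<^sub>E {0..nat K}) \<times> Pow J"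
  proof
    fix y assume "y \<in> ?h ` ?M"
    then obtain m where m: "m \<in> ?M" "y = ?h m" by blast
    have "lookup (fst m) i \<le> nat K" if i: "i \<in> J" for i
    proof -
      have "int (lookup (fst m) i) \<le> int (lookup (fst m) i) + (if i \<in> snd m then 1 else 0)" by simp
      also have "\<dots> \<le> wT m" unfolding wT_def wt_def
        using i member_le_sum[of i J "\<lambda>i. 1 * int (lookup (fst m) i) + (if i \<in> snd m then 1 else 0)"] by simp
      finally show ?thesis using m by simp
    qed
    then show "y \<in> (J \<rightarrow>\<^sub>E {0..nat K}) \<times> Pow J" using m by auto
  qed
  then show "finite (?h ` ?M)" by (rule finite_subset) (intro finite_cartesian_product finite_PiE, auto)
  show "inj_on ?h ?M"
  proof (rule inj_onI)
    fix m m' assume m: "m \<in> ?M" "m' \<in> ?M" "?h m = ?h m'"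
    have "lookup (fst m) i = lookup (fst m') i" for i
    proof (cases "i \<in> J")
      case True then show ?thesis using m(3) by (metis fst_conv restrict_apply')
    next
      case False
      then have "i \<notin> keys (fst m)" "i \<notin> keys (fst m')" using m by auto
      then show ?thesis by (simp add: in_keys_iff)
    qed
    then show "m = m'" using m(3) by (intro prod_eqI poly_mapping_eqI) auto
  qed
qed

lemma Gen_total: "cvec.span Gen = SEv"
proof
  show "cvec.span Gen \<subseteq> SEv" by (rule Gen_SE)
  have hom: "f \<in> cvec.span Gen" if f: "f \<in> SEv" "homd wT K f" for f K
  proof (rule ccontr)
    assume nf: "f \<notin> cvec.span Gen"
    obtain Bs where Bs: "Bs \<subseteq> cvec.span Gen" "cvec.independent Bs" "cvec.span Gen \<subseteq> cvec.span Bs"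
      by (rule cvec.maximal_independent_subset[of "cvec.span Gen"])
    have sp: "cvec.span Bs = cvec.span Gen" using Bs by (metis cvec.span_minimal cvec.subspace_span subset_antisym)
    then have ind: "cvec.independent (insert f Bs)" using Bs(2) nf by (simp add: cvec.independent_insert)
    \<comment> \<open>A functional that is 1 on \<open>f\<close> and 0 on the span of
      \<open>Gen\<close>, realised as a vector-valued map and read off as the coefficient at (0,
      {}).\<close>
    obtain \<phi> :: "smono cvec \<Rightarrow> smono cvec" where \<phi>: "clinear \<phi>" "\<forall>x\<in>insert f Bs. \<phi> x = (if x = f then vac else 0)"
      using cvec_pair.linear_independent_extend[OF ind, of "\<lambda>x. if x = f then vac else 0"] by blast
    have \<phi>f: "\<phi> f = vac" using \<phi>(2) by simp
    have \<phi>0: "\<phi> x = 0" if "x \<in> cvec.span Gen" for x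
    proof -
      have "x \<in> cvec.span Bs" using that sp by simp
      moreover have "f \<notin> Bs" using nf Bs(1) by blast
      then have "\<phi> b = 0" if "b \<in> Bs" for b using \<phi>(2) that by auto
      ultimately show ?thesis using cvec_pair.linear_eq_0_on_span[OF \<phi>(1)] by blast
    qed
    define M where "M = {m. keys (fst m) \<subseteq> J \<and> snd m \<subseteq> J \<and> wT m = K}"
    define c where "c m = lookup (\<phi> (bvec m)) (0, {})" for m
    \<comment> \<open>The vector representing this functional in degree K; the norms of the
      monomials are divided out.\<close>
    define u where "u = (\<Sum>m\<in>M. (c m / wgt m) \<cdot> bvec m)"
    have uSE: "u \<in> SEv" unfolding u_def by (intro SE_sum SE_simps) (auto simp: M_def SEv_iff)
    have Bu: "B u g = lookup (\<phi> (cmp wT K g)) (0, {})" if g: "g \<in> SEv" for g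
    proof -
      have kg: "keys (cmp wT K g) \<subseteq> M"
      proof
        fix m assume m: "m \<in> keys (cmp wT K g)"
        then have "case m of (a, S) \<Rightarrow> keys a \<subseteq> J \<and> S \<subseteq> J" using g unfolding SEv_iff keys_cmp by blast
        with m show "m \<in> M" by (auto simp: M_def keys_cmp)
      qed
      have "B u g = (\<Sum>m\<in>M. c m * lookup g m)"
        unfolding u_def B_sum(1) by (intro sum.cong refl) (simp add: B_scale_left B_sym[of "bvec _"] B_bvec_right)
      also have "\<dots> = (\<Sum>m\<in>M. lookup (cmp wT K g) m * c m)"
        by (intro sum.cong) (auto simp: lookup_cmp M_def)
      also have "\<dots> = (\<Sum>m\<in>keys (cmp wT K g). lookup (cmp wT K g) m * c m)"
        using kg finite_wT[of K] by (intro sum.mono_neutral_right) (auto simp: M_def in_keys_iff)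
      also have "\<dots> = lookup (\<phi> (cmp wT K g)) (0, {})"
        unfolding c_def by (subst (2) lookup_clinear[OF \<phi>(1)]) simp
      finally show ?thesis .
    qed
    have "B u g = 0" if "g \<in> cvec.span Gen" for g
      using Bu[of g] that Gen_SE \<phi>0[OF Gen_closed(4)[OF that]] by auto
    then have "u = 0" by (rule Gen_perp[OF uSE])
    then have "lookup (\<phi> f) (0, {}) = 0" using Bu[OF f(1)] cmp_homd[OF f(2)] by simp
    then show False by (simp add: \<phi>f vac_def lookup_bvec)
  qed
  show "SEv \<subseteq> cvec.span Gen"
  proof
    fix f assume f: "f \<in> SEv"
    have "f = (\<Sum>m\<in>keys f. lookup f m \<cdot> bvec m)" by (rule cvec_expand)
    moreover have "(\<Sum>m\<in>keys f. lookup f m \<cdot> bvec m) \<in> cvec.span Gen"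
    proof (intro cvec.span_sum cvec.span_scale)
      fix m assume "m \<in> keys f"
      then have "bvec m \<in> SEv" using f by (cases m) (auto simp: SEv_iff)
      then show "bvec m \<in> cvec.span Gen" by (rule hom[of _ "wT m"]) (simp add: homd_def)
    qed
    ultimately show "f \<in> cvec.span Gen" by simp
  qed
qed

subsection \<open>The action of spo(2n|1) in terms of the odd generators\<close>

text \<open>The action of the matrix unit taking u_j to u_i in gl(2n|1); \<open>s\<close> runs over
  the two basis vectors of the second tensor factor of \<open>E\<close>.\<close>

definition EE :: "nat \<Rightarrow> nat \<Rightarrow> smono cvec \<Rightarrow> smono cvec" where
  "EE i j f = (\<Sum>s\<in>UNIV. gen n i s \<star> dgen n j s f)"

lemma EE_eqs:
  "i \<in> I \<Longrightarrow> j \<in> I \<Longrightarrow> EE i j f = E i j f"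
  "i \<in> I \<Longrightarrow> EE i cc f = mx i (de cc f) + me i (dx cc f)"
  "j \<in> I \<Longrightarrow> EE cc j f = me cc (dx j f) + mx cc (de j f)"
  by (auto simp: EE_def E_def sum_bool gen_def dgen_def mx_def me_def I_def cc_def)

lemma spo_act_EE: "spo_act n X f = (\<Sum>j\<in>J. \<Sum>i\<in>J. entry X i j \<cdot> EE i j f)"
proof -
  have "spo_act n X f = (\<Sum>s\<in>UNIV. \<Sum>j\<in>J. \<Sum>i\<in>J. entry X i j \<cdot> gen n i s \<star> dgen n j s f)"
    by (simp add: spo_act_expand J_def)
  also have "\<dots> = (\<Sum>j\<in>J. \<Sum>i\<in>J. entry X i j \<cdot> EE i j f)"
    unfolding EE_def sum_bool by (simp add: scale_simps sum.distrib)
  finally show ?thesis .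
qed

lemma form_basis_eq: "i \<in> J \<Longrightarrow> j \<in> J \<Longrightarrow> form_basis n i j =
    (if i \<in> I \<and> j = pr i then sn i else if i = cc \<and> j = cc then 1 else 0)"
  by (auto simp: form_basis_def J_def I_def pr_def cc_def sn_def)

lemma form_eq: "form n v w = (\<Sum>i\<in>I. sn i * lookup v i * lookup w (pr i)) + lookup v cc * lookup w cc"
proof -
  have "form n v w = (\<Sum>i\<in>J. \<Sum>j\<in>J. lookup v i * lookup w j * form_basis n i j)"
    by (simp add: form_def J_def)
  also have "\<dots> = (\<Sum>i\<in>J. \<Sum>j\<in>J. if j = (if i = cc then cc else pr i) then lookup v i * lookup w j * (if i = cc then 1 else sn i) else 0)"
    by (intro sum.cong refl) (auto simp: form_basis_eq J_eq)
  also have "\<dots> = (\<Sum>i\<in>J. lookup v i * lookup w (if i = cc then cc else pr i) * (if i = cc then 1 else sn i))"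
    by (intro sum.cong refl) (auto simp: J_eq)
  also have "\<dots> = (\<Sum>i\<in>I. sn i * lookup v i * lookup w (pr i)) + lookup v cc * lookup w cc"
    by (simp add: J_eq add.commute mult_ac)
  finally show ?thesis .
qed

lemma spo_rel:
  assumes X: "X \<in> spo n p" and a: "a \<in> J" and b: "b \<in> J"
  shows "form n (X (bvec a)) (bvec b) + ksign p (a = cc) * form n (bvec a) (X (bvec b)) = 0"
proof -
  have "bvec a \<in> hom_part (natural n) (a = cc)" "bvec b \<in> vecs (natural n)"
    using a b by (auto simp: hom_part_def vecs_def natural_def J_def cc_def)
  then show ?thesis using X unfolding spo_def by blast
qed

lemma form_bvec: "b \<in> I \<Longrightarrow> form n v (bvec b) = - sn b * lookup v (pr b)"
  "form n v (bvec cc) = lookup v cc" "a \<in> I \<Longrightarrow> form n (bvec a) v = sn a * lookup v (pr a)"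
  "form n (bvec cc) v = lookup v cc"
proof -
  have pc: "i \<in> I \<Longrightarrow> pr i \<noteq> cc" for i using pr_I by fastforce
  show "b \<in> I \<Longrightarrow> form n v (bvec b) = - sn b * lookup v (pr b)"
    by (simp add: form_eq lookup_bvec if_distrib[of "\<lambda>x. _ * x"] cong: if_cong)
  show "form n v (bvec cc) = lookup v cc"
    using pc by (simp add: form_eq lookup_bvec eq_commute[of cc])
  show "a \<in> I \<Longrightarrow> form n (bvec a) v = sn a * lookup v (pr a)"
    by (simp add: form_eq lookup_bvec if_distrib[of "\<lambda>x. _ * x"] if_distrib[of "\<lambda>x. x * _"] cong: if_cong)
  show "form n (bvec cc) v = lookup v cc"
    by (simp add: form_eq lookup_bvec)
qed

lemma spo_gl: "X \<in> spo n p \<Longrightarrow> X \<in> gl n p" by (simp add: spo_def)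

lemma spo_entry0: "X \<in> spo n p \<Longrightarrow> i \<in> J \<Longrightarrow> j \<in> J \<Longrightarrow> (i = cc) \<noteq> (p \<noteq> (j = cc)) \<Longrightarrow> entry X i j = 0"
  using gl_entry[OF spo_gl, of X p i j] by (auto simp: J_def cc_def)

text \<open>Invariance of the form determines the row of X at 2n+1 from the column at 2n+1, and each
  column entry then carries exactly one \<open>om i\<close>.\<close>

lemma spo_odd_act:
  assumes X: "X \<in> spo n True"
  shows "spo_act n X f = (\<Sum>i\<in>I. entry X i cc \<cdot> om i f)"
proof -
  have rel: "entry X cc (pr i) = sn i * entry X i cc" if "i \<in> I" for i
    using spo_rel[OF X cc_J, of "pr i"] that by (simp add: form_bvec entry_def ksign_def)
  have z: "entry X i j = 0" if "i \<in> I" "j \<in> I" for i j using spo_entry0[OF X] that by auto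
  have z': "entry X cc cc = 0" using spo_entry0[OF X] by auto
  have "spo_act n X f = (\<Sum>i\<in>I. entry X i cc \<cdot> EE i cc f) + (\<Sum>j\<in>I. entry X cc j \<cdot> EE cc j f)"
    by (simp add: spo_act_EE J_eq z z' add.commute)
  also have "(\<Sum>j\<in>I. entry X cc j \<cdot> EE cc j f) = (\<Sum>j\<in>I. entry X cc (pr j) \<cdot> EE cc (pr j) f)"
    by (rule sum_pr[symmetric])
  also have "(\<Sum>i\<in>I. entry X i cc \<cdot> EE i cc f) + \<dots> = (\<Sum>i\<in>I. entry X i cc \<cdot> om i f)"
    by (simp add: sum.distrib[symmetric])
      (intro sum.cong refl, simp add: rel EE_eqs om_def scale_simps add_ac mult.commute)
  finally show ?thesis .
qed

text \<open>Invariance of the form makes \<open>sn j * entry X i (pr j)\<close> symmetric in i and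
  j; symmetrising the sum over matrix units yields the anticommutators of
  \<open>om_om\<close>.\<close>

lemma spo_even_act:
  assumes X: "X \<in> spo n False"
  shows "spo_act n X f = (\<Sum>i\<in>I. \<Sum>j\<in>I. (sn j * entry X i (pr j) / 2) \<cdot> (om i (om j f) + om j (om i f)))"
proof -
  have rel: "entry X j (pr i) = sn i * sn j * entry X i (pr j)" if "i \<in> I" "j \<in> I" for i j
  proof -
    have "- sn (pr j) * entry X j (pr i) + sn (pr i) * entry X i (pr j) = 0"
      using spo_rel[OF X, of "pr i" "pr j"] that by (simp add: form_bvec entry_def ksign_def)
    then have "sn j * entry X j (pr i) = sn i * entry X i (pr j)" using that by (simp add: add_eq_0_iff2)
    then have "sn j * (sn j * entry X j (pr i)) = sn j * (sn i * entry X i (pr j))" by simp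
    then show ?thesis by (simp add: mult_ac)
  qed
  have z: "entry X i cc = 0" "entry X cc i = 0" if "i \<in> I" for i using spo_entry0[OF X] that by auto
  have z': "entry X cc cc = 0"
    using spo_rel[OF X cc_J cc_J] by (simp add: form_bvec entry_def ksign_def)
  have "(\<Sum>i\<in>I. \<Sum>j\<in>I. (sn j * entry X i (pr j) / 2) \<cdot> (om i (om j f) + om j (om i f))) =
    (\<Sum>i\<in>I. \<Sum>j\<in>I. (1/2) \<cdot> (entry X i (pr j) \<cdot> E i (pr j) f) + (1/2) \<cdot> (entry X j (pr i) \<cdot> E j (pr i) f))"
  proof (intro sum.cong refl)
    fix i j assume ij: "i \<in> I" "j \<in> I"
    have 1: "sn j * entry X i (pr j) / 2 * sn i = 1 / 2 * entry X j (pr i)"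
      "sn j * entry X i (pr j) / 2 * sn j = 1 / 2 * entry X i (pr j)"
      unfolding rel[OF ij] by (simp_all add: mult_ac)
    show "(sn j * entry X i (pr j) / 2) \<cdot> (om i (om j f) + om j (om i f)) =
        (1/2) \<cdot> (entry X i (pr j) \<cdot> E i (pr j) f) + (1/2) \<cdot> (entry X j (pr i) \<cdot> E j (pr i) f)"
      unfolding om_om[OF ij] cvec.scale_right_distrib cvec.scale_scale 1 ..
  qed
  also have "\<dots> = (\<Sum>i\<in>I. \<Sum>j\<in>I. (1/2) \<cdot> (entry X i (pr j) \<cdot> E i (pr j) f)) + (\<Sum>i\<in>I. \<Sum>j\<in>I. (1/2) \<cdot> (entry X i (pr j) \<cdot> E i (pr j) f))"
    by (simp only: sum.distrib) (subst (3) sum.swap, rule refl)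
  also have "\<dots> = (\<Sum>i\<in>I. \<Sum>j\<in>I. entry X i (pr j) \<cdot> E i (pr j) f)"
    by (simp add: sum.distrib[symmetric] flip: cvec.scale_left_distrib)
  also have "\<dots> = (\<Sum>i\<in>I. \<Sum>j\<in>I. entry X i j \<cdot> EE i j f)"
  proof (rule sum.cong[OF refl])
    fix i assume i: "i \<in> I"
    have "(\<Sum>j\<in>I. entry X i (pr j) \<cdot> E i (pr j) f) = (\<Sum>j\<in>I. entry X i j \<cdot> E i j f)" by (rule sum_pr)
    then show "(\<Sum>j\<in>I. entry X i (pr j) \<cdot> E i (pr j) f) = (\<Sum>j\<in>I. entry X i j \<cdot> EE i j f)"
      using i by (simp add: EE_eqs)
  qed
  also have "\<dots> = (\<Sum>j\<in>I. \<Sum>i\<in>I. entry X i j \<cdot> EE i j f)" by (rule sum.swap)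
  also have "\<dots> = spo_act n X f"
    by (simp add: spo_act_EE J_eq z z')
  finally show ?thesis by simp
qed

definition omat :: "nat \<Rightarrow> nat cvec \<Rightarrow> nat cvec" where
  "omat i v = matunit i cc v + sn i \<cdot> matunit cc (pr i) v"

lemma lookup_omat: "lookup (omat i v) k = (if k = i then lookup v cc else 0) + (if k = cc then sn i * lookup v (pr i) else 0)"
  by (simp add: omat_def matunit_def lookup_add lookup_bvec)

lemma omat_spo:
  assumes i: "i \<in> I" shows "omat i \<in> spo n True"
proof -
  have pc: "pr i \<noteq> cc" "cc \<noteq> pr i" using I_ne_cc[OF pr_I[OF i]] by auto
  define a :: "nat \<Rightarrow> nat \<Rightarrow> complex" where "a k j = (if k = i \<and> j = cc then 1 else if k = cc \<and> j = pr i then sn i else 0)" for k j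
  have "omat i = (\<lambda>v. \<Sum>k\<in>{1..2*n+1}. \<Sum>j\<in>{1..2*n+1}. a k j \<cdot> matunit k j v)"
  proof
    fix v
    have "(\<Sum>k\<in>J. \<Sum>j\<in>J. a k j \<cdot> matunit k j v) =
      (\<Sum>k\<in>J. \<Sum>j\<in>J. (if j = cc then if k = i then matunit i cc v else 0 else 0) + (if j = pr i then if k = cc then sn i \<cdot> matunit cc (pr i) v else 0 else 0))"
      by (intro sum.cong refl) (auto simp: a_def pc i)
    also have "\<dots> = omat i v" using i by (simp add: sum.distrib omat_def)
    finally show "omat i v = (\<Sum>k\<in>{1..2*n+1}. \<Sum>j\<in>{1..2*n+1}. a k j \<cdot> matunit k j v)" by (simp only: J_def)
  qed
  moreover have par: "omat i v \<in> hom_part (natural n) (\<not> q)" if v: "v \<in> hom_part (natural n) q" for v q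
  proof -
    have vk: "lookup v k = 0 \<or> (k \<in> J \<and> (k = cc) = q)" for k
      using v by (auto simp: hom_part_def natural_def J_def cc_def subset_iff in_keys_iff)
    have "k \<in> J \<and> (k = cc) = (\<not> q)" if "lookup (omat i v) k \<noteq> 0" for k
      using that vk[of cc] vk[of "pr i"] i pc by (auto simp: lookup_omat split: if_splits)
    then show ?thesis by (auto simp: hom_part_def natural_def J_def cc_def subset_iff in_keys_iff)
  qed
  ultimately have gl: "omat i \<in> gl n True" unfolding gl_def by auto
  have "form n (omat i v) w + ksign True q * form n v (omat i w) = 0" if v: "v \<in> hom_part (natural n) q" for q v w
  proof -
    have vk: "lookup v k = 0 \<or> (k = cc) = q" for k
      using v by (auto simp: hom_part_def natural_def cc_def subset_iff in_keys_iff)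
    have 1: "form n (omat i v) w = sn i * lookup v cc * lookup w (pr i) + sn i * lookup v (pr i) * lookup w cc"
    proof -
      have "(\<Sum>k\<in>I. sn k * lookup (omat i v) k * lookup w (pr k)) = (\<Sum>k\<in>I. if k = i then sn i * lookup v cc * lookup w (pr i) else 0)"
        by (intro sum.cong refl) (auto simp: lookup_omat)
      then show ?thesis using i by (simp add: form_eq lookup_omat)
    qed
    have 2: "form n v (omat i w) = - sn i * lookup v (pr i) * lookup w cc + sn i * lookup v cc * lookup w (pr i)"
    proof -
      have "(\<Sum>k\<in>I. sn k * lookup v k * lookup (omat i w) (pr k)) = (\<Sum>k\<in>I. if k = pr i then - sn i * lookup v (pr i) * lookup w cc else 0)"
        using pc i by (intro sum.cong refl) (auto simp: lookup_omat I_ne_cc[OF pr_I])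
      then show ?thesis using i by (simp add: form_eq lookup_omat mult_ac)
    qed
    show ?thesis unfolding 1 2 using vk[of cc] vk[of "pr i"] pc by (cases q) (auto simp: ksign_def)
  qed
  with gl show ?thesis unfolding spo_def by auto
qed

lemma spo_act_omat: "i \<in> I \<Longrightarrow> spo_act n (omat i) f = om i f"
proof -
  assume i: "i \<in> I"
  have "entry (omat i) k cc = (if k = i then 1 else 0)" if "k \<in> I" for k
    using that i I_ne_cc[OF pr_I[OF i]] by (auto simp: entry_def lookup_omat lookup_bvec)
  then have "spo_act n (omat i) f = (\<Sum>k\<in>I. (if k = i then om i f else 0))"
    unfolding spo_odd_act[OF omat_spo[OF i]] by (intro sum.cong) auto
  with i show ?thesis by simp
qed

subsection \<open>The operators of osp(2|2)\<close>

text \<open>The sign in a product counts inversions by \<open>card\<close>, so the comparison is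
  made on \<open>SEv\<close>, where all index sets are finite.\<close>

lemma star_assoc:
  assumes "g \<in> SEv" "f \<in> SEv"
  shows "mx i g \<star> f = mx i (g \<star> f)" "me i g \<star> f = me i (g \<star> f)"
proof -
  have fin: "finite (snd m)" if "m \<in> keys h" "h \<in> SEv" for m h
    using that finite_subset[OF _ fin_J] by (cases m) (auto simp: SEv_iff)
  note L = clinear_comp[OF linear_smult_left] clinear_comp[OF linear_smult_right] clin linear_smult_left linear_smult_right
  have L1: "clinear (\<lambda>g. mx i g \<star> f)" "clinear (\<lambda>f. mx i g \<star> f)" "clinear (\<lambda>g. mx i (g \<star> f))" "clinear (\<lambda>f. mx i (g \<star> f))"
    "clinear (\<lambda>g. me i g \<star> f)" "clinear (\<lambda>f. me i g \<star> f)" "clinear (\<lambda>g. me i (g \<star> f))" "clinear (\<lambda>f. me i (g \<star> f))" for f g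
    using clinear_comp[OF linear_smult_left linear_mx] clinear_comp[OF linear_smult_left linear_me] linear_smult_right
      clinear_comp[OF linear_mx linear_smult_left] clinear_comp[OF linear_mx linear_smult_right]
      clinear_comp[OF linear_me linear_smult_left] clinear_comp[OF linear_me linear_smult_right] by auto
  show "mx i g \<star> f = mx i (g \<star> f)"
  proof (rule bilinear_eqI[where F = "\<lambda>g f. mx i g \<star> f" and G = "\<lambda>g f. mx i (g \<star> f)"])
    fix m m' :: smono
    show "mx i (bvec m) \<star> bvec m' = mx i (bvec m \<star> bvec m')"
      by (cases m; cases m') (simp add: mx_def xvar_assoc_mono del: smult_bvec)
  qed (rule L1)+
  show "me i g \<star> f = me i (g \<star> f)"
  proof (rule bilinear_eqI[where F = "\<lambda>g f. me i g \<star> f" and G = "\<lambda>g f. me i (g \<star> f)"])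
    fix m m' :: smono assume "m \<in> keys g" "m' \<in> keys f"
    then have "finite (snd m)" "finite (snd m')" using fin assms by blast+
    then show "me i (bvec m) \<star> bvec m' = me i (bvec m \<star> bvec m')"
      by (cases m; cases m') (simp add: me_def evar_assoc_mono del: smult_bvec)
  qed (rule L1)+
qed

lemma vac_star: "vac \<star> f = f"
  by (rule linear_eqI[OF linear_smult_right clinear_id]) (auto simp: vac_def)

lemma star_vac: "xvar i \<star> vac = xvar i" "evar i \<star> vac = evar i"
  by (simp_all add: vac_def xvar_smult_mono evar_smult_mono) (simp_all add: xvar_def evar_def)

lemma xvar_vac: "xvar i = mx i vac" and evar_vac: "evar i = me i vac"
  by (simp_all add: mx_def me_def star_vac)

lemma sum_I_split: "(\<Sum>i\<in>I. F i) = (\<Sum>i\<in>{1..n}. F i + F (pr i))" for F :: "nat \<Rightarrow> smono cvec"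
proof -
  have I: "I = {1..n} \<union> pr ` {1..n}" "{1..n} \<inter> pr ` {1..n} = {}" "inj_on pr {1..n}"
  proof -
    show "I = {1..n} \<union> pr ` {1..n}"
    proof
      show "I \<subseteq> {1..n} \<union> pr ` {1..n}"
      proof
        fix i assume i: "i \<in> I"
        show "i \<in> {1..n} \<union> pr ` {1..n}"
        proof (cases "i \<le> n")
          case False
          then have "pr i \<in> {1..n}" "i = pr (pr i)" using i by (auto simp: I_def pr_def)
          then show ?thesis by blast
        qed (use i in \<open>auto simp: I_def\<close>)
      qed
    qed (auto simp: I_def pr_def)
  qed (auto simp: pr_def inj_on_def)
  have "(\<Sum>i\<in>I. F i) = (\<Sum>i\<in>{1..n}. F i) + (\<Sum>i\<in>pr ` {1..n}. F i)"
    using I by (subst I(1), intro sum.union_disjoint) auto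
  then show ?thesis using I(3) by (simp add: sum.reindex sum.distrib)
qed

lemma n_I: "i \<in> {1..n} \<Longrightarrow> i \<in> I" "i \<in> {1..n} \<Longrightarrow> sn i = 1" by (auto simp: I_def sn_def)

text \<open>Sums over i \<le> n become signed sums over \<open>I\<close> by folding along
  \<open>pr\<close>. Associativity of the product enters for R_{12} and R_{22}, hence their
  restriction to \<open>SEv\<close>.\<close>

lemma osp_ops:
  "F12 n f = p1 f" "F21 n f = q1 f" "D12 n f = p2 f" "D22 n f = d22 f"
  "F11 n f = degS f + alpha n \<cdot> f" "F22 n f = degL f - alpha n \<cdot> f"
  "f \<in> SEv \<Longrightarrow> R12 n f = q2 f" "f \<in> SEv \<Longrightarrow> R22 n f = r22 f"
proof -
  show "F12 n f = p1 f" "F21 n f = q1 f" "F11 n f = degS f + alpha n \<cdot> f" "F22 n f = degL f - alpha n \<cdot> f"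
    by (simp_all add: F12_def p1_def F21_def q1_def F11_def degS_def F22_def degL_def I_def cc_def mx_def me_def add.commute)
  have pr: "2*n+1-i = pr i" "cc - i = pr i" "2*n+1 = cc" for i by (simp_all add: pr_def cc_def)
  show "D12 n f = p2 f"
    unfolding D12_def p2_def sum_I_split pr
    by (intro arg_cong2[of _ _ _ _ "(+)"] sum.cong refl) (use n_I in simp)
  show "D22 n f = d22 f"
    unfolding D22_def d22_def sum_I_split pr cvec.scale_sum_right
    by (intro arg_cong2[of _ _ _ _ "(+)"] sum.cong refl) (use n_I de_de[of "pr _"] in \<open>simp add: two_scale\<close>)
  show "R12 n f = q2 f" if f: "f \<in> SEv"
    unfolding R12_def q2_def sum_I_split pr
    unfolding xvar_vac evar_vac
    using f n_I by (simp add: smult_linear_simps star_assoc vac_star)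
        (simp add: smult_linear_simps star_assoc vac_star cvec_pair.linear_diff[OF linear_smult_left])
  show "R22 n f = r22 f" if f: "f \<in> SEv"
    unfolding R22_def r22_def sum_I_split pr
    unfolding xvar_vac evar_vac
    using f n_I me_me[of "pr _"] by (simp add: smult_linear_simps star_assoc vac_star two_scale scale_simps)
qed

end

lemma alg_zero: "(\<lambda>f. 0) \<in> alg G"
  using alg_scale[OF alg_id, of 0] by simp

lemma alg_sum: "finite A \<Longrightarrow> (\<And>i. i \<in> A \<Longrightarrow> F i \<in> alg G) \<Longrightarrow> (\<lambda>f. \<Sum>i\<in>A. F i f) \<in> alg G"
  by (induction rule: finite_induct) (simp_all add: alg_zero alg_add)

context howe
begin

subsection \<open>The action is a representation\<close>

text \<open>Uniform notation for even and odd variables, of parity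
  \<open>(i = cc) \<noteq> s\<close>, so that each family of canonical relations becomes one formula
  with a Koszul sign.\<close>

definition gm :: "nat \<Rightarrow> bool \<Rightarrow> smono cvec \<Rightarrow> smono cvec" where
  "gm i s = (if (i = cc) = s then mx i else me i)"
definition dm :: "nat \<Rightarrow> bool \<Rightarrow> smono cvec \<Rightarrow> smono cvec" where
  "dm i s = (if (i = cc) = s then dx i else de i)"

lemma EE_gm: "EE i j f = (\<Sum>s\<in>UNIV. gm i s (dm j s f))"
  unfolding EE_def by (intro sum.cong refl) (auto simp: gm_def dm_def gen_def dgen_def mx_def me_def cc_def)

lemma linear_gm: "clinear (gm i s)" and linear_dm: "clinear (dm i s)"
  by (simp_all add: gm_def dm_def linear_mx linear_me linear_dx linear_de)
lemmas gm_lin = clinD[OF linear_gm] clinD[OF linear_dm]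

lemma dm_gm: "dm j s (gm k t f) = (if j = k \<and> s = t then f else 0) +
    ksign ((j = cc) \<noteq> s) ((k = cc) \<noteq> t) \<cdot> gm k t (dm j s f)"
  by (auto simp: dm_def gm_def ccr ksign_def)
lemma gm_gm: "gm i s (gm k t f) = ksign ((i = cc) \<noteq> s) ((k = cc) \<noteq> t) \<cdot> gm k t (gm i s f)"
  using me_me[of i k f] mx_mx[of i k f] by (auto simp: gm_def ccr ksign_def)
lemma dm_dm: "dm i s (dm k t f) = ksign ((i = cc) \<noteq> s) ((k = cc) \<noteq> t) \<cdot> dm k t (dm i s f)"
  using de_de[of i k f] dx_dx[of i k f] by (auto simp: dm_def ccr ksign_def)

lemma EE_comm1:
  "gm i s (dm j s (gm k t (dm l t f))) -
     ksign ((i = cc) \<noteq> (j = cc)) ((k = cc) \<noteq> (l = cc)) \<cdot> gm k t (dm l t (gm i s (dm j s f))) =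
   (if j = k \<and> s = t then gm i s (dm l t f) else 0) -
     ksign ((i = cc) \<noteq> (j = cc)) ((k = cc) \<noteq> (l = cc)) \<cdot> (if l = i \<and> s = t then gm k t (dm j s f) else 0)"
proof -
  let ?P = "ksign ((i = cc) \<noteq> (j = cc)) ((k = cc) \<noteq> (l = cc))"
  have "?P * (ksign ((l = cc) \<noteq> t) ((i = cc) \<noteq> s) * (ksign ((k = cc) \<noteq> t) ((i = cc) \<noteq> s) * ksign ((l = cc) \<noteq> t) ((j = cc) \<noteq> s))) =
      ksign ((j = cc) \<noteq> s) ((k = cc) \<noteq> t)"
    by (simp add: ksign_def)
  then have sg: "?P \<cdot> ksign ((l = cc) \<noteq> t) ((i = cc) \<noteq> s) \<cdot> ksign ((k = cc) \<noteq> t) ((i = cc) \<noteq> s) \<cdot> ksign ((l = cc) \<noteq> t) ((j = cc) \<noteq> s) \<cdot> v =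
      ksign ((j = cc) \<noteq> s) ((k = cc) \<noteq> t) \<cdot> v" for v :: "smono cvec"
    unfolding cvec.scale_scale by simp
  have A: "gm i s (dm j s (gm k t (dm l t f))) = (if j = k \<and> s = t then gm i s (dm l t f) else 0) +
      ksign ((j = cc) \<noteq> s) ((k = cc) \<noteq> t) \<cdot> gm i s (gm k t (dm j s (dm l t f)))"
    unfolding dm_gm gm_lin by (simp add: gm_lin)
  have C: "gm k t (dm l t (gm i s (dm j s f))) = (if l = i \<and> s = t then gm k t (dm j s f) else 0) +
      ksign ((l = cc) \<noteq> t) ((i = cc) \<noteq> s) \<cdot> ksign ((k = cc) \<noteq> t) ((i = cc) \<noteq> s) \<cdot> ksign ((l = cc) \<noteq> t) ((j = cc) \<noteq> s) \<cdot>
        gm i s (gm k t (dm j s (dm l t f)))"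
    unfolding dm_gm gm_gm[of k t i s] dm_dm[of l t j s] gm_lin by (auto simp: gm_lin)
  show ?thesis unfolding A C cvec.scale_right_distrib sg by simp
qed

text \<open>The relations of matrix units in gl(2n|1). The terms with two multiplications and two
  derivations cancel by the sign identity in \<open>EE_comm1\<close>, leaving only
  contractions.\<close>

lemma EE_comm:
  "EE i j (EE k l f) - ksign ((i = cc) \<noteq> (j = cc)) ((k = cc) \<noteq> (l = cc)) \<cdot> EE k l (EE i j f) =
   (if j = k then EE i l f else 0) - ksign ((i = cc) \<noteq> (j = cc)) ((k = cc) \<noteq> (l = cc)) \<cdot> (if l = i then EE k j f else 0)"
    (is "_ - ?P \<cdot> _ = _")
proof -
  have "EE i j (EE k l f) - ?P \<cdot> EE k l (EE i j f) =
      (\<Sum>s\<in>UNIV. \<Sum>t\<in>UNIV. gm i s (dm j s (gm k t (dm l t f))) - ?P \<cdot> gm k t (dm l t (gm i s (dm j s f))))"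
    unfolding EE_gm sum_bool by (simp add: gm_lin scale_simps) 
  also have "\<dots> = (\<Sum>s\<in>UNIV. \<Sum>t\<in>UNIV. (if j = k \<and> s = t then gm i s (dm l t f) else 0) - ?P \<cdot> (if l = i \<and> s = t then gm k t (dm j s f) else 0))"
    by (simp only: EE_comm1)
  also have "\<dots> = (if j = k then EE i l f else 0) - ?P \<cdot> (if l = i then EE k j f else 0)"
    unfolding EE_gm sum_bool by (auto simp: scale_simps)
  finally show ?thesis .
qed

lemma linear_EE: "clinear (EE i j)"
  unfolding EE_gm[abs_def] by (intro clinear_sum clinear_comp[OF linear_gm linear_dm])

lemma gl_lookup:
  assumes X: "X \<in> gl n p" and i: "i \<in> J"
  shows "lookup (X v) i = (\<Sum>j\<in>J. entry X i j * lookup v j)"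
proof -
  obtain a where a: "X = (\<lambda>v. \<Sum>i\<in>J. \<Sum>j\<in>J. a i j \<cdot> matunit i j v)"
    using X by (auto simp: gl_def J_def)
  have l: "lookup (X v) i = (\<Sum>j\<in>J. a i j * lookup v j)" for v
  proof -
    have "lookup (X v) i = (\<Sum>k\<in>J. if k = i then \<Sum>j\<in>J. a i j * lookup v j else 0)"
      unfolding a lookup_sum by (intro sum.cong refl) (auto simp: matunit_def lookup_bvec intro!: sum.neutral)
    with i show ?thesis by simp
  qed
  have "entry X i j = a i j" if "j \<in> J" for j
    using that unfolding entry_def l by (simp add: lookup_bvec if_distrib[of "\<lambda>x. _ * x"] cong: if_cong)
  then show ?thesis unfolding l by (intro sum.cong) auto
qed

lemma entry_supercomm:
  assumes X: "X \<in> gl n p" and Y: "Y \<in> gl n q" and i: "i \<in> J"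
  shows "entry (supercomm p q X Y) i l = (\<Sum>k\<in>J. entry X i k * entry Y k l) - ksign p q * (\<Sum>k\<in>J. entry Y i k * entry X k l)"
  using gl_lookup[OF X i, of "Y (bvec l)"] gl_lookup[OF Y i, of "X (bvec l)"]
  by (simp add: entry_def supercomm_def lookup_minus)

lemma spo_act_EE2: "spo_act n X f = (\<Sum>i\<in>J. \<Sum>j\<in>J. entry X i j \<cdot> EE i j f)"
  unfolding spo_act_EE by (rule sum.swap)

text \<open>Bilinear extension of \<open>EE_comm\<close>: a nonzero entry of a homogeneous matrix
  has the parity of the matrix, so \<open>ksign p q\<close> agrees with the sign for matrix units in
  every nonzero term.\<close>

lemma spo_act_supercomm:
  assumes X: "X \<in> gl n p" and Y: "Y \<in> gl n q"
  shows "spo_act n (supercomm p q X Y) f =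
    spo_act n X (spo_act n Y f) - ksign p q \<cdot> spo_act n Y (spo_act n X f)"
proof -
  have par: "entry X i j = 0 \<or> p = ((i = cc) \<noteq> (j = cc))" "entry Y i j = 0 \<or> q = ((i = cc) \<noteq> (j = cc))"
    if "i \<in> J" "j \<in> J" for i j
    using gl_entry[OF X, of i j] gl_entry[OF Y, of i j] that by (auto simp: J_def cc_def)
  have YX: "spo_act n Y (spo_act n X f) = (\<Sum>i\<in>J. \<Sum>j\<in>J. \<Sum>k\<in>J. \<Sum>l\<in>J. (entry X i j * entry Y k l) \<cdot> EE k l (EE i j f))"
  proof -
    have "spo_act n Y (spo_act n X f) = (\<Sum>k\<in>J. \<Sum>l\<in>J. \<Sum>i\<in>J. \<Sum>j\<in>J. (entry X i j * entry Y k l) \<cdot> EE k l (EE i j f))"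
      unfolding spo_act_EE2[of Y] spo_act_EE2[of X] clinD(6)[OF linear_EE] clinD(4)[OF linear_EE] cvec.scale_sum_right
      by (intro sum.cong refl) (simp add: mult.commute)
    also have "\<dots> = (\<Sum>k\<in>J. \<Sum>i\<in>J. \<Sum>l\<in>J. \<Sum>j\<in>J. (entry X i j * entry Y k l) \<cdot> EE k l (EE i j f))"
      by (rule sum.cong[OF refl], rule sum.swap)
    also have "\<dots> = (\<Sum>i\<in>J. \<Sum>k\<in>J. \<Sum>l\<in>J. \<Sum>j\<in>J. (entry X i j * entry Y k l) \<cdot> EE k l (EE i j f))"
      by (rule sum.swap)
    also have "\<dots> = (\<Sum>i\<in>J. \<Sum>k\<in>J. \<Sum>j\<in>J. \<Sum>l\<in>J. (entry X i j * entry Y k l) \<cdot> EE k l (EE i j f))"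
      by (rule sum.cong[OF refl], rule sum.cong[OF refl], rule sum.swap)
    also have "\<dots> = (\<Sum>i\<in>J. \<Sum>j\<in>J. \<Sum>k\<in>J. \<Sum>l\<in>J. (entry X i j * entry Y k l) \<cdot> EE k l (EE i j f))"
      by (rule sum.cong[OF refl], rule sum.swap)
    finally show ?thesis .
  qed
  have XY: "spo_act n X (spo_act n Y f) = (\<Sum>i\<in>J. \<Sum>j\<in>J. \<Sum>k\<in>J. \<Sum>l\<in>J. (entry X i j * entry Y k l) \<cdot> EE i j (EE k l f))"
    unfolding spo_act_EE2[of Y] spo_act_EE2[of X] clinD(6)[OF linear_EE] clinD(4)[OF linear_EE] cvec.scale_sum_right
    by (intro sum.cong refl) simp
  have "spo_act n X (spo_act n Y f) - ksign p q \<cdot> spo_act n Y (spo_act n X f) =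
    (\<Sum>i\<in>J. \<Sum>j\<in>J. \<Sum>k\<in>J. \<Sum>l\<in>J. (entry X i j * entry Y k l) \<cdot> (EE i j (EE k l f) - ksign p q \<cdot> EE k l (EE i j f)))"
    unfolding XY YX cvec.scale_sum_right sum_subtractf[symmetric] cvec.scale_right_diff_distrib
    by (intro sum.cong refl) (simp add: mult.commute mult.left_commute)
  also have "\<dots> = (\<Sum>i\<in>J. \<Sum>j\<in>J. \<Sum>k\<in>J. \<Sum>l\<in>J. (entry X i j * entry Y k l) \<cdot>
      ((if j = k then EE i l f else 0) - ksign p q \<cdot> (if l = i then EE k j f else 0)))"
  proof (intro sum.cong refl)
    fix i j k l assume ij: "i \<in> J" "j \<in> J" "k \<in> J" "l \<in> J"
    show "(entry X i j * entry Y k l) \<cdot> (EE i j (EE k l f) - ksign p q \<cdot> EE k l (EE i j f)) =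
      (entry X i j * entry Y k l) \<cdot> ((if j = k then EE i l f else 0) - ksign p q \<cdot> (if l = i then EE k j f else 0))"
      using par(1)[OF ij(1,2)] par(2)[OF ij(3,4)]
    proof (elim disjE)
      assume p: "p = ((i = cc) \<noteq> (j = cc))" and q: "q = ((k = cc) \<noteq> (l = cc))"
      show ?thesis unfolding p q by (simp only: EE_comm)
    qed simp_all
  qed
  also have "\<dots> = (\<Sum>i\<in>J. \<Sum>l\<in>J. \<Sum>k\<in>J. (entry X i k * entry Y k l) \<cdot> EE i l f)
      - ksign p q \<cdot> (\<Sum>k\<in>J. \<Sum>j\<in>J. \<Sum>i\<in>J. (entry Y k i * entry X i j) \<cdot> EE k j f)"
  proof -
    have 1: "(\<Sum>i\<in>J. \<Sum>j\<in>J. \<Sum>k\<in>J. \<Sum>l\<in>J. (entry X i j * entry Y k l) \<cdot> (if j = k then EE i l f else 0)) =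
       (\<Sum>i\<in>J. \<Sum>l\<in>J. \<Sum>k\<in>J. (entry X i k * entry Y k l) \<cdot> EE i l f)"
    proof (rule sum.cong[OF refl])
      fix i assume "i \<in> J"
      have "(\<Sum>j\<in>J. \<Sum>k\<in>J. \<Sum>l\<in>J. (entry X i j * entry Y k l) \<cdot> (if j = k then EE i l f else 0)) =
         (\<Sum>j\<in>J. \<Sum>k\<in>J. if j = k then \<Sum>l\<in>J. (entry X i j * entry Y k l) \<cdot> EE i l f else 0)"
        by (rule sum.cong[OF refl], rule sum.cong[OF refl]) auto
      also have "\<dots> = (\<Sum>j\<in>J. \<Sum>l\<in>J. (entry X i j * entry Y j l) \<cdot> EE i l f)"
        by (rule sum.cong[OF refl]) simp
      also have "\<dots> = (\<Sum>l\<in>J. \<Sum>k\<in>J. (entry X i k * entry Y k l) \<cdot> EE i l f)" by (rule sum.swap)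
      finally show "(\<Sum>j\<in>J. \<Sum>k\<in>J. \<Sum>l\<in>J. (entry X i j * entry Y k l) \<cdot> (if j = k then EE i l f else 0)) = \<dots>" .
    qed
    have 2: "(\<Sum>i\<in>J. \<Sum>j\<in>J. \<Sum>k\<in>J. \<Sum>l\<in>J. (entry X i j * entry Y k l) \<cdot> (if l = i then EE k j f else 0)) =
       (\<Sum>k\<in>J. \<Sum>j\<in>J. \<Sum>i\<in>J. (entry Y k i * entry X i j) \<cdot> EE k j f)"
    proof -
      have "(\<Sum>i\<in>J. \<Sum>j\<in>J. \<Sum>k\<in>J. \<Sum>l\<in>J. (entry X i j * entry Y k l) \<cdot> (if l = i then EE k j f else 0)) =
         (\<Sum>i\<in>J. \<Sum>j\<in>J. \<Sum>k\<in>J. (entry Y k i * entry X i j) \<cdot> EE k j f)"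
      proof (intro sum.cong refl)
        fix i j k assume "i \<in> J" "j \<in> J" "k \<in> J"
        have "(\<Sum>l\<in>J. (entry X i j * entry Y k l) \<cdot> (if l = i then EE k j f else 0)) = (\<Sum>l\<in>J. if l = i then (entry Y k i * entry X i j) \<cdot> EE k j f else 0)"
          by (intro sum.cong refl) (auto simp: mult.commute)
        with \<open>i \<in> J\<close> show "(\<Sum>l\<in>J. (entry X i j * entry Y k l) \<cdot> (if l = i then EE k j f else 0)) = (entry Y k i * entry X i j) \<cdot> EE k j f" by simp
      qed
      also have "\<dots> = (\<Sum>i\<in>J. \<Sum>k\<in>J. \<Sum>j\<in>J. (entry Y k i * entry X i j) \<cdot> EE k j f)"
        by (rule sum.cong[OF refl], rule sum.swap)
      also have "\<dots> = (\<Sum>k\<in>J. \<Sum>i\<in>J. \<Sum>j\<in>J. (entry Y k i * entry X i j) \<cdot> EE k j f)" by (rule sum.swap)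
      also have "\<dots> = (\<Sum>k\<in>J. \<Sum>j\<in>J. \<Sum>i\<in>J. (entry Y k i * entry X i j) \<cdot> EE k j f)"
        by (rule sum.cong[OF refl], rule sum.swap)
      finally show ?thesis .
    qed
    show ?thesis unfolding 1[symmetric] 2[symmetric] cvec.scale_sum_right sum_subtractf[symmetric] cvec.scale_right_diff_distrib
      by (intro sum.cong refl) (simp add: mult.commute mult.left_commute)
  qed
  also have "\<dots> = (\<Sum>i\<in>J. \<Sum>l\<in>J. entry (supercomm p q X Y) i l \<cdot> EE i l f)"
    unfolding cvec.scale_sum_right sum_subtractf[symmetric]
    by (intro sum.cong refl) (simp add: entry_supercomm[OF X Y] cvec.scale_left_diff_distrib cvec.scale_sum_left scale_simps sum_subtractf sum_distrib_left)
  also have "\<dots> = spo_act n (supercomm p q X Y) f"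
    unfolding spo_act_EE2 ..
  finally show ?thesis by simp
qed

lemma spo_act_lin: "spo_act n (\<lambda>u. a \<cdot> X u + b \<cdot> Y u) f = a \<cdot> spo_act n X f + b \<cdot> spo_act n Y f"
  by (simp add: spo_act_EE entry_def lookup_add cvec.scale_left_distrib sum.distrib scale_simps)

lemma spo_alg:
  assumes "X \<in> spo n p" shows "spo_act n X \<in> alg GO"
proof (cases p)
  case True
  then have X: "spo_act n X = (\<lambda>f. \<Sum>i\<in>I. entry X i cc \<cdot> om i f)" using spo_odd_act assms by auto
  show ?thesis unfolding X by (intro alg_sum alg_scale alg_gen1 fin_I) (auto simp: GO_def)
next
  case False
  then have X: "spo_act n X = (\<lambda>f. \<Sum>i\<in>I. \<Sum>j\<in>I. (sn j * entry X i (pr j) / 2) \<cdot> (om i (om j f) + om j (om i f)))"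
    using spo_even_act assms by auto
  have "(\<lambda>f. om i (om j f)) \<in> alg GO" if "i \<in> I" "j \<in> I" for i j
    using alg_gen[OF alg_gen1, of "om j" GO "om i"] that by (auto simp: GO_def)
  then show ?thesis unfolding X by (intro alg_sum fin_I, intro alg_scale alg_add) auto
qed

lemma spo_pty: "X \<in> spo n p \<Longrightarrow> pty (spo_act n X f) = (if p then -1 else 1) \<cdot> spo_act n X (pty f)"
  by (cases p) (simp_all add: spo_odd_act spo_even_act pty_om sum_negf)

lemma VV_spo: "X \<in> spo n p \<Longrightarrow> f \<in> VV t \<Longrightarrow> spo_act n X f \<in> VV t"
  unfolding VV_def by (erule orbE) (auto intro!: orbI[OF alg_comp[OF GO_linear spo_alg]])

subsection \<open>Weights\<close>

definition HH :: "nat \<Rightarrow> smono cvec \<Rightarrow> smono cvec" where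
  "HH i f = E i i f - E (pr i) (pr i) f"

lemma HH_om: "i \<in> I \<Longrightarrow> i \<le> n \<Longrightarrow> HH i f = - (om i (om (pr i) f) + om (pr i) (om i f))"
proof -
  assume i: "i \<in> I" "i \<le> n"
  then have "sn i = 1" by (simp add: sn_def)
  with i show ?thesis by (simp add: om_om HH_def)
qed

lemma HH_cartan: "i \<in> I \<Longrightarrow> i \<le> n \<Longrightarrow> spo_act n (spo_cartan n i) f = HH i f"
proof -
  assume i: "i \<in> I" "i \<le> n"
  have e: "entry (spo_cartan n i) k j = (if k = i \<and> j = i then 1 else 0) - (if k = pr i \<and> j = pr i then 1 else 0)" for k j
    by (auto simp: entry_def spo_cartan_def matunit_def lookup_minus lookup_bvec pr_def)
  have "spo_act n (spo_cartan n i) f = (\<Sum>j\<in>J. \<Sum>k\<in>J. (if k = i then if j = i then EE i i f else 0 else 0) - (if k = pr i then if j = pr i then EE (pr i) (pr i) f else 0 else 0))"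
    unfolding spo_act_EE e by (intro sum.cong refl) auto
  also have "\<dots> = HH i f" using i by (simp add: sum_subtractf HH_def EE_eqs)
  finally show ?thesis .
qed

lemma HH_p1: "i \<in> I \<Longrightarrow> i \<le> n \<Longrightarrow> HH i (p1 f) = p1 (HH i f)"
  by (simp add: HH_om om_p1)

lemma HH_me: "m \<in> I \<Longrightarrow> i \<in> I \<Longrightarrow> HH i (me m f) = me m (HH i f) + ((if i = m then 1 else 0) - (if pr i = m then 1 else 0)) \<cdot> me m f"
  by (auto simp: HH_def E_def ccr me_me[of i m] me_me[of "pr i" m] scale_simps cvec.scale_left_diff_distrib)

lemma HH_mx: "m \<in> I \<Longrightarrow> i \<in> I \<Longrightarrow> HH i (mx m f) = mx m (HH i f) + ((if i = m then 1 else 0) - (if pr i = m then 1 else 0)) \<cdot> mx m f"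
  by (auto simp: HH_def E_def ccr mx_mx[of i m] mx_mx[of "pr i" m] scale_simps cvec.scale_left_diff_distrib)

text \<open>For i in \<open>Ik (n - N)\<close> the Cartan element is an anticommutator of operators
  that kill r^(2N+1); for other i its variables do not occur there.\<close>

lemma HH_TT: "N \<le> n \<Longrightarrow> i \<in> I \<Longrightarrow> i \<le> n \<Longrightarrow> HH i (TT N) = 0"
proof (cases "i \<in> Ik (n - N)")
  case True
  assume N: "N \<le> n" "i \<in> I" "i \<le> n"
  then show ?thesis using True om_TT[OF N(1)] by (simp add: HH_om)
next
  case False
  assume N: "N \<le> n" "i \<in> I" "i \<le> n"
  note p = pureD[OF pure_TT[OF N(1)]]
  show ?thesis using N False p by (simp add: HH_def E_def)
qed

lemma HH_vac: "HH i vac = 0" by (simp add: HH_def E_def)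

text \<open>Unfolding the recursion, \<open>hh N l\<close> is a product of min(l, 2N+1-l)
  consecutive variables \<eta>, starting at index n-N+1, times 1 or an odd power of a smaller
  radius. The latter has weight 0.\<close>

lemma HH_hh: "N \<le> n \<Longrightarrow> i \<in> I \<Longrightarrow> i \<le> n \<Longrightarrow> l \<le> 2*N+1 \<Longrightarrow>
    HH i (hh N l) = (if n - N < i \<and> i \<le> n - N + min l (2*N+1-l) then 1 else 0) \<cdot> hh N l"
proof (induction N arbitrary: l)
  case 0
  then show ?case using HH_TT[of 0 i] by (auto simp: HH_vac)
next
  case (Suc N)
  then have N: "N < n" by simp
  show ?case
  proof (cases "l = 0 \<or> l = 2*N+3")
    case True
    then show ?thesis using HH_TT[OF Suc.prems(1-3)] by (auto simp: HH_vac simp del: TT.simps)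
  next
    case False
    then have l: "1 \<le> l" "l \<le> 2*N+2" using Suc.prems by auto
    then have IH: "HH i (hh N (l - 1)) = (if n - N < i \<and> i \<le> n - N + min (l - 1) (2*N+1-(l - 1)) then 1 else 0) \<cdot> hh N (l - 1)"
      using Suc by auto
    have np: "pr i \<noteq> n - N" using pr_gt[OF Suc.prems(2,3)] by simp
    have hh: "hh (Suc N) l = me (n - N) (hh N (l - 1))" using False by simp
    have c: "(n - Suc N < i \<and> i \<le> n - Suc N + min l (2 * Suc N + 1 - l)) \<longleftrightarrow>
      i = n - N \<or> (n - N < i \<and> i \<le> n - N + min (l - 1) (2*N+1-(l - 1)))" using l N by auto
    show ?thesis unfolding hh HH_me[OF Ik_step(2)[OF N] Suc.prems(2)] IH c using np by auto
  qed
qed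

lemma HH_uu: "i \<in> I \<Longrightarrow> i \<le> n \<Longrightarrow> l \<le> 2*n+1 \<Longrightarrow>
    HH i (uu d l) = ((if i = 1 then of_nat d else 0) + (if i \<le> min l (2*n+1-l) then 1 else 0)) \<cdot> uu d l"
proof (induction d)
  case 0
  then show ?case using HH_hh[of n i l] I_pos[of i] by simp
next
  case (Suc d)
  have "pr i \<noteq> 1" using pr_gt[of i] Suc.prems n_pos by auto
  then show ?case using Suc I_pos[of i] HH_mx[OF one_I(1), of i "uu d l"] unfolding uu_Suc
    by (auto simp: cvec.scale_left_distrib)
qed

text \<open>Since \<open>p1\<close> commutes with the Cartan elements, the weight is that of x_1^d
  h_l. The first entry d + 1 combines the power of x_1 with the factor \<eta>_1, and l and 2n+1-l
  give the same number of further ones.\<close>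

lemma HH_sv:
  assumes t: "t \<in> summands n" and i: "i \<in> {1..n}"
  shows "HH i (sv t) = spo_weight n t ! (i - 1) \<cdot> sv t"
proof -
  have iI: "i \<in> I" "i \<le> n" using i n_I by auto
  have hw: "hook_weight n d k ! (i - 1) = (if i = 1 then of_nat d + 1 else if i \<le> k then 1 else 0)" if "1 \<le> k" "k \<le> n" for d k
    using that i by (auto simp: hook_weight_def nth_append nth_Cons' )
  show ?thesis
  proof (cases "t = Triv_lo")
    case True
    have "i - 1 < n" using i by auto
    then show ?thesis using True by (simp add: sv_def HH_vac)
  next
    case False
    then have val: "valid (fst (dl t)) (snd (dl t))" using valid_dl t by blast
    then have "snd (dl t) \<le> 2*n+1" by (auto simp: valid_def)
    then have H: "HH i (sv t) = ((if i = 1 then of_nat (fst (dl t)) else 0) + (if i \<le> min (snd (dl t)) (2*n+1-snd (dl t)) then 1 else 0)) \<cdot> sv t"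
      using False iI by (simp add: sv_def vv_def HH_p1 HH_uu)
    show ?thesis unfolding H using t False i
      by (cases rule: summands_cases) (auto simp: hw)
  qed
qed

text \<open>A nonzero coefficient requires i < \<open>pr j\<close>, equivalently j <
  \<open>pr i\<close>. Then i or j is at most n, and the anticommutator is killed by
  \<open>hw_om_om\<close> and \<open>hwD\<close> with the roles chosen accordingly.\<close>

lemma sv_nil_even:
  assumes t: "t \<in> summands n" and X: "X \<in> spo_nil_even n"
  shows "spo_act n X (sv t) = 0"
proof -
  have X': "X \<in> spo n False" "\<And>i j. i \<in> I \<Longrightarrow> j \<in> I \<Longrightarrow> j \<le> i \<Longrightarrow> entry X i j = 0"
    using X by (auto simp: spo_nil_even_def I_def)
  have h: "hw (sv t)" using sv_props[OF t] by simp
  have "(sn j * entry X i (pr j) / 2) \<cdot> (om i (om j (sv t)) + om j (om i (sv t))) = 0" if ij: "i \<in> I" "j \<in> I" for i j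
  proof (cases "i < pr j")
    case False
    then show ?thesis using X'(2)[of i "pr j"] ij by simp
  next
    case True
    then have ji: "j < pr i" using ij by (auto simp: I_def pr_def)
    show ?thesis
    proof (cases "i \<le> n")
      case i: True
      then show ?thesis using hw_om_om[OF h ij i True] hwD(1)[OF h ij(1) i] by simp
    next
      case False
      then have j: "j \<le> n" using True ij pr_le[of "pr j"] by (cases "j \<le> n") (auto dest: pr_le)
      then show ?thesis using hw_om_om[OF h ij(2,1) j ji] hwD(1)[OF h ij(2) j] by simp
    qed
  qed
  then show ?thesis unfolding spo_even_act[OF X'(1)] by (simp add: sum.neutral)
qed

lemma sv_nil_odd:
  assumes t: "t \<in> summands n" and k: "k \<in> {1..n}"
  shows "spo_act n (spo_nil_odd n k) (sv t) = 0"
proof -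
  have "spo_nil_odd n k = omat k"
    using n_I(2)[OF k] by (auto simp: spo_nil_odd_def omat_def cc_def pr_def)
  then show ?thesis using spo_act_omat[OF n_I(1)[OF k]] hwD(1)[of "sv t" k] sv_props[OF t] n_I(1)[OF k] k by simp
qed

subsection \<open>Comparing the two copies of each spo(2n|1)-module\<close>

text \<open>Selects the summand whose orbit provides the spo-module for every summand of the same
  spo weight.\<close>

fun lo :: "summand \<Rightarrow> summand" where
  "lo Triv_lo = Triv_lo" | "lo Triv_hi = Triv_lo" | "lo (Hook_lo d k) = Hook_lo d k" | "lo (Hook_hi d k) = Hook_lo d k"

lemma lo_summand: "t \<in> summands n \<Longrightarrow> lo t \<in> summands n"
  by (erule summands_cases) (auto simp: summands_def)

text \<open>Multiplication by $r^{2n+1}$ commutes with spo(2n|1) and sends $x_1^d h_k$ to the image of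
  $x_1^d h_{2n+1-k}$ under a power of \<open>r22\<close>. As \<open>r22\<close> is injective, an operator from the algebra generated by
  spo(2n|1) that kills the former kills the latter.\<close>

lemma TT_star_0: "g \<in> SEv \<Longrightarrow> TT 0 \<star> g = mx cc g"
  by (simp add: star_assoc vac_star)

lemma TT_star:
  assumes "g \<in> SEv" "N \<le> n"
  shows "N < n \<Longrightarrow> TT (Suc N) \<star> g = RR (n - N) (TT N \<star> g) + of_nat (2*N+3) \<cdot> me (n - N) (me (pr (n - N)) (TT N \<star> g))"
proof -
  have T: "TT N \<in> SEv" using pureD(1)[OF pure_TT[OF assms(2)]] .
  assume N: "N < n"
  note m = Ik_step(2)[OF N]
  have R: "RR k h \<star> g = RR k (h \<star> g)" if "h \<in> SEv" for h k
    using that assms by (simp add: RR_def smult_linear_simps star_assoc)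
  show "TT (Suc N) \<star> g = RR (n - N) (TT N \<star> g) + of_nat (2*N+3) \<cdot> me (n - N) (me (pr (n - N)) (TT N \<star> g))"
    using T m assms by (simp add: smult_linear_simps star_assoc R)
qed

lemma TT_star_me: "N \<le> n \<Longrightarrow> g \<in> SEv \<Longrightarrow> j \<in> J \<Longrightarrow> TT N \<star> me j g = me j (TT N \<star> g)"
proof (induction N)
  case 0
  then show ?case by (simp add: TT_star_0 me_mx del: TT.simps)
next
  case (Suc N)
  then have N: "N < n" "N \<le> n" by auto
  have c: "me a (me b (me j f)) = me j (me a (me b f))" for a b f by (simp add: me_me[of _ j])
  show ?case using Suc N by (simp add: TT_star RR_me c del: TT.simps)
qed

lemma TT_star_mx: "N \<le> n \<Longrightarrow> g \<in> SEv \<Longrightarrow> j \<in> J \<Longrightarrow> TT N \<star> mx j g = mx j (TT N \<star> g)"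
proof (induction N)
  case 0
  then show ?case by (simp add: TT_star_0 mx_mx del: TT.simps)
next
  case (Suc N)
  then have N: "N < n" "N \<le> n" by auto
  show ?case using Suc N by (simp add: TT_star RR_mx me_mx del: TT.simps)
qed

lemma TT_star_vac: "N \<le> n \<Longrightarrow> TT N \<star> vac = TT N"
proof (induction N)
  case 0
  have "TT 0 \<star> vac = mx cc vac" by (rule TT_star_0[OF vac_SE])
  then show ?case by simp
next
  case (Suc N)
  then have N: "N < n" "N \<le> n" by auto
  then show ?case using Suc.IH TT_star[OF vac_SE N(2,1)] by simp
qed

lemma hh_SE: "N \<le> n \<Longrightarrow> hh N l \<in> SEv"
  using pureD(1)[OF SingD(1)[OF Sing_hh]] .

text \<open>Both sides contain the first k of the variables \<eta>, next to which the corresponding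
  pairs drop out of every radius. What remains are powers of the inner radius, with 2N+1 = 2k +
  (2(N-k)+1).\<close>

lemma TT_star_hh: "N \<le> n \<Longrightarrow> k \<le> N \<Longrightarrow> TT N \<star> hh N k = (RR (n - N) ^^ k) (hh N (2*N+1-k))"
proof (induction N arbitrary: k)
  case 0
  then show ?case using TT_star_vac[of 0] by simp
next
  case (Suc N)
  then have N: "N < n" "N \<le> n" by auto
  show ?case
  proof (cases k)
    case 0
    have "hh (Suc N) (2 * Suc N + 1) = TT (Suc N)" by (rule hh_top)
    then show ?thesis using TT_star_vac[OF Suc.prems(1)] 0 by (simp del: hh.simps TT.simps)
  next
    case (Suc k')
    define m where "m = n - N"
    note st = Ik_step[OF N(1), folded m_def]
    have k': "k' \<le> N" using Suc.prems Suc by simp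
    \<comment> \<open>Next to \<eta>_m the contribution of the new pair to r^2 vanishes.\<close>
    have RS: "RR (n - Suc N) (me m f) = me m (RR m f)" for f
      using RR_step[OF N(1), of "me m f"] me_me[of "pr m" m f] by (simp add: RR_me m_def[symmetric])
    have RSk: "(RR (n - Suc N) ^^ k) (me m f) = me m ((RR m ^^ k) f)" for f k
      by (induction k) (simp_all add: RS)
    have ne: "k \<noteq> 2*N+3" "2 * Suc N + 1 - k \<noteq> 0" "2 * Suc N + 1 - k \<noteq> 2*N+3" "2 * Suc N + 1 - k - 1 = 2*N+1-k'" "k - 1 = k'" "k \<noteq> 0"
      using k' Suc by auto
    have h1: "hh (Suc N) k = me m (hh N k')" using ne by (simp add: m_def del: TT.simps)
    have h2: "hh (Suc N) (2 * Suc N + 1 - k) = me m (hh N (2*N+1-k'))"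
      unfolding hh.simps ne(4) m_def using ne by simp
    have "TT (Suc N) \<star> hh (Suc N) k = me m (TT (Suc N) \<star> hh N k')"
      unfolding h1 using Suc.prems st(2) hh_SE[OF N(2)] by (simp add: TT_star_me del: TT.simps)
    also have "\<dots> = me m (RR m (TT N \<star> hh N k'))"
      unfolding TT_star[OF hh_SE[OF N(2)] N(2) N(1)] by (simp add: m_def)
    also have "\<dots> = me m (RR m ((RR m ^^ k') (hh N (2*N+1-k'))))"
      using Suc.IH[OF N(2) k'] by (simp add: m_def)
    also have "\<dots> = (RR (n - Suc N) ^^ k) (hh (Suc N) (2 * Suc N + 1 - k))"
      unfolding h2 RSk using Suc by simp
    finally show ?thesis .
  qed
qed

lemma TT_star_uu: "k \<le> n \<Longrightarrow> TT n \<star> uu d k = (r22 ^^ k) (uu d (2*n+1-k))"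
proof (induction d)
  case 0
  then show ?case using TT_star_hh[of n k] by (simp add: RR_0[abs_def, symmetric] fun_eq_iff RR_0 [symmetric])
next
  case (Suc d)
  have "(r22 ^^ k) (mx 1 f) = mx 1 ((r22 ^^ k) f)" for f
    by (induction k) (simp_all add: RR_0[symmetric] RR_mx)
  then show ?case using Suc by (simp add: uu_Suc TT_star_mx I_J[OF one_I(1)])
qed

text \<open>r^(2n+1) is even and killed by \<open>om i\<close>, so the Leibniz rule for the matrix
  \<open>omat i\<close> leaves a single term without sign.\<close>

lemma om_star: "i \<in> I \<Longrightarrow> g \<in> SEv \<Longrightarrow> om i (TT n \<star> g) = TT n \<star> om i g"
proof -
  assume i: "i \<in> I" and g: "g \<in> SEv"
  have T: "TT n \<in> hom_part (SE_space n) False"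
  proof -
    have SE: "TT n \<in> SEv" using pureD(1)[OF pure_TT[of n]] by simp
    have "even (card (snd m))" if m: "m \<in> keys (TT n)" for m
    proof -
      have "psn m * lookup (TT n) m = lookup (TT n) m"
        using pty_TT[of n] by (metis lookup_diag pty_def order_refl)
      then have "psn m = 1" using m by (simp add: in_keys_iff)
      moreover have "case m of (a, S) \<Rightarrow> keys a \<subseteq> J \<and> S \<subseteq> J" using SE m unfolding SEv_iff by blast
      then have "snd m \<inter> J = snd m" by auto
      ultimately show ?thesis by (simp add: psn_def minus_one_power_iff split: if_splits)
    qed
    then show ?thesis using SE by (force simp: hom_part_def SE_space_def SEv_def vecs_def)
  qed
  have "om i (TT n) = 0" using om_TT[of n i] i by (simp add: Ik_0)
  then have "spo_act n (omat i) (TT n \<star> g) = TT n \<star> spo_act n (omat i) g"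
    using spo_act_superderivation[OF spo_gl[OF omat_spo[OF i]] T, of g] g
    by (simp add: spo_act_omat[OF i] SEv_def ksign_def smult_linear_simps)
  then show ?thesis by (simp add: spo_act_omat[OF i])
qed

lemma alg_star: "A \<in> alg GO \<Longrightarrow> g \<in> SEv \<Longrightarrow> A (TT n \<star> g) = TT n \<star> A g"
proof (induction rule: alg.induct)
  case (alg_gen A h)
  then obtain i where "i \<in> I" "h = om i" by (auto simp: GO_def)
  then show ?case using alg_gen alg_GO_SE by (simp add: om_star)
qed (simp_all add: smult_linear_simps)

lemma om_r22: "i \<in> I \<Longrightarrow> om i (r22 f) = r22 (om i f)"
proof -
  assume i: "i \<in> I"
  have r: "r22 f = q1 (q2 f) + q2 (q1 f)" for f by (simp add: q1_q2)
  show ?thesis using i unfolding r by (simp add: om_q1 om_q2)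
qed

lemma alg_r22: "A \<in> alg GO \<Longrightarrow> A ((r22 ^^ k) f) = (r22 ^^ k) (A f)"
proof -
  assume A: "A \<in> alg GO"
  have "A (r22 g) = r22 (A g)" for g
    by (rule alg_commute1[OF linear_r22 _ A]) (auto simp: GO_def om_r22)
  then show ?thesis by (induction k) simp_all
qed

lemma r22_inj: "(r22 ^^ k) f = 0 \<Longrightarrow> f = 0"
  by (induction k) (use RR_inj[of 0] in \<open>auto simp: RR_0\<close>)

text \<open>A commutes with \<open>h\<close> after \<open>pty\<close>, and on a parity eigenvector
  the twist is only the sign e.\<close>

lemma alg_p1_kill:
  assumes A: "A \<in> alg GO" and f: "A f = 0" "pty f = e \<cdot> f" "e * e = 1" and h: "(\<lambda>f. h (pty f)) \<in> GP"
  shows "A (h f) = 0"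
proof -
  have h': "clinear (\<lambda>f. h (pty f))" by (rule GP_linear[OF h])
  have "h (pty (e \<cdot> f)) = h f" using f(2,3) by simp
  then have "A (h f) = A (h (pty (e \<cdot> f)))" by simp
  also have "\<dots> = h (pty (A (e \<cdot> f)))" by (rule comm_AB[OF A alg_gen1[OF h]])
  also have "\<dots> = 0" using f(1) clinD(5)[OF h'] by (simp add: clinD(4)[OF alg_linear[OF GO_linear A]])
  finally show ?thesis .
qed

text \<open>The chain for a hook: \<open>q1\<close> leads from \<open>vv d k\<close> back to x_1^d
  h_k with nonzero factor d + k, multiplication by r^(2n+1) gives r^(2k) x_1^d h_{2n+1-k}, the power
  of r^2 is cancelled, and \<open>p1\<close> leads to the second vector. Each step is compatible
  with A up to a parity twist.\<close>

lemma lo_kill: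
  assumes t: "t \<in> summands n" and A: "A \<in> alg GO" and k: "A (sv (lo t)) = 0"
  shows "A (sv t) = 0"
proof -
  have GP': "(\<lambda>f. p1 (pty f)) \<in> GP" "(\<lambda>f. q1 (pty f)) \<in> GP" by (auto simp: GP_def)
  have hi: "A (vv d l) = 0" if "A (uu d l) = 0" for d l
  proof -
    obtain e where "e * e = 1" "pty (uu d l) = e \<cdot> uu d l" using pty_uu by blast
    then show ?thesis unfolding vv_def using alg_p1_kill[OF A that _ _ GP'(1)] by blast
  qed
  have tr: "A (uu d (2*n+1-k)) = 0" if "k \<le> n" "A (uu d k) = 0" for d k
  proof -
    have "A (TT n \<star> uu d k) = 0" using that alg_star[OF A uu_SE] by (simp add: smult_linear_simps)
    then have "(r22 ^^ k) (A (uu d (2*n+1-k))) = 0" using TT_star_uu[OF that(1)] alg_r22[OF A] by simp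
    then show ?thesis by (rule r22_inj)
  qed
  from t show ?thesis
  proof (cases rule: summands_cases)
    case 2
    have "A (uu 0 0) = 0" using k 2 by (simp add: sv_def)
    from tr[OF _ this] have "A (uu 0 (2*n+1)) = 0" by simp
    then show ?thesis using 2 hi[of 0 "2*n+1"] by (simp add: sv_def)
  next
    case (4 d r)
    have val: "valid d r" using 4 by (auto simp: valid_def)
    obtain e where e: "e * e = 1" "pty (vv d r) = e \<cdot> vv d r" using pty_vv by blast
    have "A (vv d r) = 0" using k 4 by (simp add: sv_def)
    then have "A (q1 (vv d r)) = 0" using alg_p1_kill[OF A _ e(2,1) GP'(2)] by blast
    then have "of_nat (d + r) \<cdot> A (uu d r) = 0"
      by (simp add: vv_props(8)[OF val] clinD(4)[OF alg_linear[OF GO_linear A]])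
    then have "A (uu d r) = 0" using 4 by (metis cvec.scale_eq_0_iff of_nat_eq_0_iff add_is_0 not_one_le_zero)
    then have "A (uu d (2*n+1-r)) = 0" using tr 4 by blast
    then show ?thesis using 4 hi by (simp add: sv_def)
  qed (use k in auto)
qed

lemma lo_kill_WW:
  assumes t: "t \<in> summands n" and A: "A \<in> alg GO" and k: "A (sv (lo t)) = 0" and w: "w \<in> WW t"
  shows "A w = 0"
proof -
  obtain C where C: "C \<in> alg GP" "w = C (sv t)" using w by (auto simp: WW_def orb_def)
  show ?thesis unfolding C(2) comm_AB[OF A C(1)] lo_kill[OF t A k] by (rule clinD(5)[OF alg_linear[OF GP_linear C(1)]])
qed

end

lemma lin_comp: "clinear F \<Longrightarrow> F (lin g v) = lin (\<lambda>b. F (g b)) v"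
  by (simp add: lin_def clinD(4) clinD(6))

lemma lin_cong: "(\<And>b. b \<in> keys v \<Longrightarrow> g b = h b) \<Longrightarrow> lin g v = lin h v"
  by (simp add: lin_def)

context howe
begin

definition sgp :: "bool \<Rightarrow> complex" where "sgp p = (if p then -1 else 1)"

lemma sgp_ne [simp]: "sgp p \<noteq> 0"
  and sgp_xor: "sgp (p \<noteq> q) = sgp p * sgp q" and sgp_inj: "sgp p = sgp q \<longleftrightarrow> p = q"
  by (auto simp: sgp_def)

lemma SEv_hom: "f \<in> hom_part (SE_space n) p \<longleftrightarrow> f \<in> SEv \<and> pty f = sgp p \<cdot> f"
proof -
  have par: "psn m = sgp (par (SE_space n) m)" if "m \<in> basis (SE_space n)" for m
  proof -
    have "snd m \<inter> J = snd m" using that by (auto simp: SE_space_def J_def)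
    then show ?thesis by (cases m) (auto simp: psn_def SE_space_def sgp_def)
  qed
  show ?thesis
  proof
    assume f: "f \<in> hom_part (SE_space n) p"
    then have "f \<in> SEv" by (auto simp: hom_part_def SEv_def vecs_def)
    moreover have "pty f = sgp p \<cdot> f"
    proof (rule poly_mapping_eqI)
      fix m
      show "lookup (pty f) m = lookup (sgp p \<cdot> f) m"
        using f par[of m] by (cases "m \<in> keys f") (auto simp: pty_def lookup_diag hom_part_def in_keys_iff)
    qed
    ultimately show "f \<in> SEv \<and> pty f = sgp p \<cdot> f" by blast
  next
    assume f: "f \<in> SEv \<and> pty f = sgp p \<cdot> f"
    show "f \<in> hom_part (SE_space n) p"
      unfolding hom_part_def
    proof (intro CollectI subsetI conjI)
      fix m assume m: "m \<in> keys f"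
      then show b: "m \<in> basis (SE_space n)" using f by (auto simp: SEv_def vecs_def)
      have "psn m * lookup f m = sgp p * lookup f m"
        using f by (metis lookup_cscale lookup_diag pty_def)
      then have "psn m = sgp p" using m by (simp add: in_keys_iff)
      then show "par (SE_space n) m = p" using par[OF b] by (simp add: sgp_inj)
    qed
  qed
qed

subsection \<open>Operators of osp(2|2) on the orbits\<close>

text \<open>The even operators are recovered from the odd generators and scalars, so stability under
  \<open>p1\<close>, \<open>p2\<close>, \<open>q1\<close>, \<open>q2\<close> gives stability under
  all of osp(2|2).\<close>

lemma deg_eqs:
  "degS f = (1/2) \<cdot> (p1 (q1 f) + q1 (p1 f) - p2 (q2 f) - q2 (p2 f) - (2 * of_nat n - 1) \<cdot> f)"
  "degL f = (1/2) \<cdot> (p1 (q1 f) + q1 (p1 f) + p2 (q2 f) + q2 (p2 f) + (2 * of_nat n - 1) \<cdot> f)"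
  by (simp_all add: p1_q1 p2_q2) (rule cvec_ext, simp add: cvec_coord)+

lemma pair_eqs: "d22 f = p1 (p2 f) + p2 (p1 f)" "r22 f = q1 (q2 f) + q2 (q1 f)"
  by (simp_all add: p1_p2 q1_q2)

lemma osp_form:
  "Y \<in> osp n True \<Longrightarrow> \<exists>a b c d. \<forall>f\<in>SEv. Y f = a \<cdot> p1 f + b \<cdot> q1 f + c \<cdot> p2 f + d \<cdot> q2 f"
  "Y \<in> osp n False \<Longrightarrow> \<exists>a b c d. \<forall>f\<in>SEv. Y f = a \<cdot> (degS f + alpha n \<cdot> f) + b \<cdot> (degL f - alpha n \<cdot> f) + c \<cdot> d22 f + d \<cdot> r22 f"
  by (auto simp: osp_def osp_ops) blast+

lemma osp_linear: "Y \<in> osp n p \<Longrightarrow> clinear Y"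
proof -
  have l: "clinear (F12 n)" "clinear (F21 n)" "clinear (D12 n)" "clinear (D22 n)" "clinear (F11 n)" "clinear (F22 n)"
    unfolding osp_ops(1-6)[abs_def] by (intro linear_p1 linear_q1 linear_p2 linear_d22 clinear_add clinear_diff linear_degS linear_degL clin)+
  have r: "clinear (R12 n)" "clinear (R22 n)"
    unfolding R12_def[abs_def] R22_def[abs_def] by (rule linear_smult_right)+
  show "Y \<in> osp n p \<Longrightarrow> clinear Y"
    using l r by (auto simp: osp_def intro!: clinear_add clinear_cmul split: if_splits)
qed

lemma osp_induct:
  assumes Y: "Y \<in> osp n p"
    and sub: "cvec.subspace N" "N \<subseteq> SEv"
    and cl: "\<And>f. f \<in> N \<Longrightarrow> p1 f \<in> N" "\<And>f. f \<in> N \<Longrightarrow> p2 f \<in> N" "\<And>f. f \<in> N \<Longrightarrow> q1 f \<in> N" "\<And>f. f \<in> N \<Longrightarrow> q2 f \<in> N"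
    and f: "f \<in> N"
  shows "Y f \<in> N"
proof -
  note s = cvec.subspace_add[OF sub(1)] cvec.subspace_diff[OF sub(1)] cvec.subspace_scale[OF sub(1)]
  show ?thesis
  proof (cases p)
    case True
    then obtain a b c d where "\<forall>f\<in>SEv. Y f = a \<cdot> p1 f + b \<cdot> q1 f + c \<cdot> p2 f + d \<cdot> q2 f" using osp_form(1)[of Y] Y True by auto
    then have "Y f = a \<cdot> p1 f + b \<cdot> q1 f + c \<cdot> p2 f + d \<cdot> q2 f" using f sub(2) by blast
    then show ?thesis using f by (simp add: s cl)
  next
    case False
    then obtain a b c d where "\<forall>f\<in>SEv. Y f = a \<cdot> (degS f + alpha n \<cdot> f) + b \<cdot> (degL f - alpha n \<cdot> f) + c \<cdot> d22 f + d \<cdot> r22 f"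
      using osp_form(2)[of Y] Y False by auto
    then have "Y f = a \<cdot> (degS f + alpha n \<cdot> f) + b \<cdot> (degL f - alpha n \<cdot> f) + c \<cdot> d22 f + d \<cdot> r22 f" using f sub(2) by blast
    then show ?thesis unfolding deg_eqs pair_eqs using f by (simp only: s cl)
  qed
qed

lemma osp_WW: "Y \<in> osp n p \<Longrightarrow> t \<in> summands n \<Longrightarrow> f \<in> WW t \<Longrightarrow> Y f \<in> WW t"
  by (rule osp_induct[OF _ WW_sub]) (auto simp: WW_pq WW_props)

lemma osp_mem: "F12 n \<in> osp n True" "F21 n \<in> osp n True" "D12 n \<in> osp n True" "R12 n \<in> osp n True"
  "F11 n \<in> osp n False" "F22 n \<in> osp n False" "D22 n \<in> osp n False" "R22 n \<in> osp n False"
proof -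
  have o: "(\<lambda>f. a \<cdot> F12 n f + b \<cdot> F21 n f + c \<cdot> D12 n f + d \<cdot> R12 n f) \<in> osp n True" for a b c d by (auto simp: osp_def)
  have e: "(\<lambda>f. a \<cdot> F11 n f + b \<cdot> F22 n f + c \<cdot> D22 n f + d \<cdot> R22 n f) \<in> osp n False" for a b c d by (auto simp: osp_def)
  show "F12 n \<in> osp n True" "F21 n \<in> osp n True" "D12 n \<in> osp n True" "R12 n \<in> osp n True"
    using o[of 1 0 0 0] o[of 0 1 0 0] o[of 0 0 1 0] o[of 0 0 0 1] by simp_all
  show "F11 n \<in> osp n False" "F22 n \<in> osp n False" "D22 n \<in> osp n False" "R22 n \<in> osp n False"
    using e[of 1 0 0 0] e[of 0 1 0 0] e[of 0 0 1 0] e[of 0 0 0 1] by simp_all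
qed

text \<open>Conjugation by the parity operator. It replaces the sign (-1)^(|Y||A|) when an odd Y
  passes an operator A that need not be homogeneous.\<close>

definition conj :: "(smono cvec \<Rightarrow> smono cvec) \<Rightarrow> smono cvec \<Rightarrow> smono cvec" where
  "conj A f = pty (A (pty f))"

lemma conj_alg: "A \<in> alg GO \<Longrightarrow> conj A \<in> alg GO"
proof -
  assume "A \<in> alg GO"
  then obtain A' where A': "A' \<in> alg GO" "\<And>f. pty (A f) = A' (pty f)" using alg_pty[OF pty_GO] by metis
  have "conj A = A'" by (rule ext) (simp add: conj_def A'(2))
  with A' show ?thesis by simp
qed

lemma conj_conj: "conj (conj A) = A"
  by (rule ext) (simp add: conj_def)

lemma pq_swap: "A \<in> alg GO \<Longrightarrow> p1 (A f) = conj A (p1 f)" "A \<in> alg GO \<Longrightarrow> p2 (A f) = conj A (p2 f)"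
  "A \<in> alg GO \<Longrightarrow> q1 (A f) = conj A (q1 f)" "A \<in> alg GO \<Longrightarrow> q2 (A f) = conj A (q2 f)"
proof -
  have h: "h (A f) = conj A (h f)" if A: "A \<in> alg GO" and h: "(\<lambda>f. h (pty f)) \<in> GP" for h
  proof -
    have "h (A f) = h (pty (conj A (pty f)))" by (simp add: conj_def)
    also have "\<dots> = conj A (h (pty (pty f)))" using comm_AB[OF conj_alg[OF A] alg_gen1[OF h], of "pty f"] by simp
    finally show ?thesis by simp
  qed
  show "A \<in> alg GO \<Longrightarrow> p1 (A f) = conj A (p1 f)" "A \<in> alg GO \<Longrightarrow> p2 (A f) = conj A (p2 f)"
    "A \<in> alg GO \<Longrightarrow> q1 (A f) = conj A (q1 f)" "A \<in> alg GO \<Longrightarrow> q2 (A f) = conj A (q2 f)"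
    by (rule h; auto simp: GP_def)+
qed

lemma osp_swap:
  assumes Y: "Y \<in> osp n p" and A: "A \<in> alg GO" and f: "f \<in> SEv"
  shows "Y (A f) = (if p then conj A else A) (Y f)"
proof -
  note C = conj_alg[OF A]
  note L = clinD[OF alg_linear[OF GO_linear A]] clinD[OF alg_linear[OF GO_linear C]]
  note Af = alg_GO_SE[OF A f]
  show ?thesis
  proof (cases p)
    case True
    then obtain a b c d where "\<forall>f\<in>SEv. Y f = a \<cdot> p1 f + b \<cdot> q1 f + c \<cdot> p2 f + d \<cdot> q2 f" using osp_form(1)[of Y] Y True by auto
    then show ?thesis using True f Af by (simp add: pq_swap[OF A] L)
  next
    case False
    then obtain a b c d where Y: "\<forall>f\<in>SEv. Y f = a \<cdot> (degS f + alpha n \<cdot> f) + b \<cdot> (degL f - alpha n \<cdot> f) + c \<cdot> d22 f + d \<cdot> r22 f"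
      using osp_form(2)[of Y] Y False by auto
    have "degS (A f) = A (degS f)" "degL (A f) = A (degL f)" "d22 (A f) = A (d22 f)" "r22 (A f) = A (r22 f)"
      unfolding deg_eqs pair_eqs by (simp_all only: pq_swap[OF A] pq_swap[OF C] conj_conj L)
    then show ?thesis using False f Af Y by (simp add: L)
  qed
qed

lemma osp_pty:
  assumes Y: "Y \<in> osp n p" and f: "f \<in> SEv"
  shows "pty (Y f) = sgp p \<cdot> Y (pty f)"
proof (cases p)
  case True
  then obtain a b c d where "\<forall>f\<in>SEv. Y f = a \<cdot> p1 f + b \<cdot> q1 f + c \<cdot> p2 f + d \<cdot> q2 f" using osp_form(1)[of Y] Y True by auto
  then show ?thesis using True f by (simp add: pty_pq sgp_def)
next
  case False
  then obtain a b c d where Y: "\<forall>f\<in>SEv. Y f = a \<cdot> (degS f + alpha n \<cdot> f) + b \<cdot> (degL f - alpha n \<cdot> f) + c \<cdot> d22 f + d \<cdot> r22 f"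
    using osp_form(2)[of Y] Y False by auto
  have "degS (pty f) = pty (degS f)" "degL (pty f) = pty (degL f)" "d22 (pty f) = pty (d22 f)" "r22 (pty f) = pty (r22 f)"
    unfolding deg_eqs pair_eqs by (simp_all add: pty_pq)
  then show ?thesis using False f Y by (simp add: sgp_def)
qed

text \<open>The radical of the form on the orbit is stable under the \<open>om i\<close>;
  irreducibility leaves zero or everything, and the nonzero norm of \<open>sv t\<close> excludes the
  latter.\<close>

lemma VV_nondeg:
  assumes t: "t \<in> summands n" and f: "f \<in> VV t" "\<And>a. a \<in> alg GO \<Longrightarrow> B f (a (sv t)) = 0"
  shows "f = 0"
proof (rule ccontr)
  assume "f \<noteq> 0"
  let ?N = "{f \<in> VV t. \<forall>a\<in>alg GO. B f (a (sv t)) = 0}"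
  have "?N = VV t"
  proof (rule VV_irr[OF t _ _ _ _ \<open>f \<noteq> 0\<close>])
    show "cvec.subspace ?N"
      using cvec.subspace_add[OF VV_sub] cvec.subspace_scale[OF VV_sub] cvec.subspace_0[OF VV_sub]
      by (auto simp: cvec.subspace_def B_lin)
    fix g i assume g: "g \<in> ?N" and i: "i \<in> I"
    have "B (om i g) (a (sv t)) = 0" if a: "a \<in> alg GO" for a
    proof -
      have "om (pr i) \<in> GO" using i by (simp add: GO_def)
      then show ?thesis using g alg_gen[OF a, of "om (pr i)"] by (auto simp: B_om[OF i])
    qed
    then show "om i g \<in> ?N" using g i by (auto simp: VV_om)
  qed (use f in auto)
  then have "sv t \<in> ?N" using VV_sv by simp
  then have "\<forall>a\<in>alg GO. B (sv t) (a (sv t)) = 0" by blast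
  from bspec[OF this alg_id] have "B (sv t) (sv t) = 0" .
  then show False using sv_props(7)[OF t] by simp
qed

lemma WW_nondeg:
  assumes t: "t \<in> summands n" and f: "f \<in> WW t" "\<And>w. w \<in> WW t \<Longrightarrow> B f w = 0"
  shows "f = 0"
proof (rule ccontr)
  assume "f \<noteq> 0"
  let ?N = "{f \<in> WW t. \<forall>w\<in>WW t. B f w = 0}"
  have "?N = WW t"
  proof (rule WW_irr[OF t _ _ _ _ _ _ _ \<open>f \<noteq> 0\<close>])
    show "cvec.subspace ?N"
      using cvec.subspace_add[OF WW_sub] cvec.subspace_scale[OF WW_sub] cvec.subspace_0[OF WW_sub]
      by (auto simp: cvec.subspace_def B_lin)
  qed (use f in \<open>auto simp: WW_pq B_p1 B_p2 B_q1 B_q2\<close>)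
  then have "sv t \<in> ?N" using WW_sv by simp
  then show False using sv_props(7)[OF t] by simp
qed

lemma alg_diff: "A \<in> alg G \<Longrightarrow> C \<in> alg G \<Longrightarrow> (\<lambda>f. A f - C f) \<in> alg G"
  using alg_add[of A G "\<lambda>f. (-1) \<cdot> C f"] alg_scale[of C G "-1"] by simp

text \<open>Converse of \<open>lo_kill\<close>, by irreducibility: the images of
  \<open>sv (lo t)\<close> under operators killing \<open>sv t\<close> form an invariant subspace.
  Were it nonzero, some such C would fix \<open>sv (lo t)\<close>; then the identity minus C kills
  \<open>sv (lo t)\<close>, hence also \<open>sv t\<close>, although C kills
  \<open>sv t\<close>.\<close>

lemma kill_lo:
  assumes t: "t \<in> summands n" and A: "A \<in> alg GO" "A (sv t) = 0"
  shows "A (sv (lo t)) = 0"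
proof (rule ccontr)
  assume ne: "A (sv (lo t)) \<noteq> 0"
  let ?N = "{C (sv (lo t)) | C. C \<in> alg GO \<and> C (sv t) = 0}"
  have "?N = VV (lo t)"
  proof (rule VV_irr[OF lo_summand[OF t] _ _ _ _ ne])
    show "?N \<subseteq> VV (lo t)" by (auto simp: VV_def orb_def)
    show "A (sv (lo t)) \<in> ?N" using A by blast
    show "cvec.subspace ?N"
      unfolding cvec.subspace_def
    proof (intro conjI ballI allI)
      show "0 \<in> ?N" using alg_zero by force
      fix x y assume "x \<in> ?N" "y \<in> ?N"
      then obtain C C' where C: "C \<in> alg GO" "C (sv t) = 0" "x = C (sv (lo t))" "C' \<in> alg GO" "C' (sv t) = 0" "y = C' (sv (lo t))" by blast
      show "x + y \<in> ?N" using alg_add[OF C(1,4)] C by force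
    next
      fix x c assume "x \<in> ?N"
      then obtain C where C: "C \<in> alg GO" "C (sv t) = 0" "x = C (sv (lo t))" by blast
      show "c \<cdot> x \<in> ?N" using alg_scale[OF C(1), of c] C by force
    qed
    fix x i assume "x \<in> ?N" and i: "i \<in> I"
    then obtain C where C: "C \<in> alg GO" "C (sv t) = 0" "x = C (sv (lo t))" by blast
    have "om i \<in> GO" using i by (simp add: GO_def)
    then show "om i x \<in> ?N" using alg_gen[OF C(1), of "om i"] C by force
  qed
  then have "sv (lo t) \<in> ?N" using VV_sv by simp
  then obtain C where C: "C \<in> alg GO" "C (sv t) = 0" "sv (lo t) = C (sv (lo t))" by blast
  have "sv t - C (sv t) = 0"
    by (rule lo_kill[OF t alg_diff[OF alg_id C(1)]]) (use C in simp)
  then show False using C(2) sv_ne[OF t] by simp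
qed

subsection \<open>Homogeneous bases indexed by natural numbers\<close>

text \<open>The orbits are subspaces of S(E), while the modules of the statement are given by a
  homogeneous basis of natural numbers; \<psi> identifies the vectors supported on \<open>bs\<close>
  with \<open>U\<close>.\<close>

definition nbasis :: "smono cvec set \<Rightarrow> nat set \<Rightarrow> (nat \<Rightarrow> bool) \<Rightarrow> (nat cvec \<Rightarrow> smono cvec) \<Rightarrow> bool" where
  "nbasis U bs pa \<psi> \<longleftrightarrow> clinear \<psi> \<and> inj_on \<psi> {v. keys v \<subseteq> bs} \<and> \<psi> ` {v. keys v \<subseteq> bs} = U \<and>
     (\<forall>k\<in>bs. pty (\<psi> (bvec k)) = sgp (pa k) \<cdot> \<psi> (bvec k))"

text \<open>Bounded total degree leaves finitely many monomials, so an independent set is a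
  countable union of finite sets.\<close>

lemma countable_independent:
  assumes "Bs \<subseteq> SEv" "cvec.independent Bs"
  shows "countable Bs"
proof -
  let ?M = "\<lambda>K :: nat. {m. keys (fst m) \<subseteq> J \<and> snd m \<subseteq> J \<and> wT m \<le> int K}"
  have fin: "finite (?M K)" for K
  proof (rule finite_subset)
    show "?M K \<subseteq> (\<Union>k\<in>{0..int K}. {m. keys (fst m) \<subseteq> J \<and> snd m \<subseteq> J \<and> wT m = k})"
      using wS_nonneg wL_nonneg by (auto simp: wT_eq intro: add_nonneg_nonneg)
  qed (auto intro: finite_wT)
  have "finite (Bs \<inter> cvec.span (bvec ` ?M K))" for K
    using cvec.independent_span_bound[of "bvec ` ?M K" "Bs \<inter> cvec.span (bvec ` ?M K)"] fin[of K]
      cvec.independent_mono[OF assms(2)] by auto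
  moreover have "Bs \<subseteq> (\<Union>K. Bs \<inter> cvec.span (bvec ` ?M K))"
  proof
    fix b assume b: "b \<in> Bs"
    define K where "K = nat (Max (insert 0 (wT ` keys b)))"
    have "b = (\<Sum>m\<in>keys b. lookup b m \<cdot> bvec m)" by (rule cvec_expand)
    also have "\<dots> \<in> cvec.span (bvec ` ?M K)"
    proof (intro cvec.span_sum cvec.span_scale cvec.span_base imageI)
      fix m assume m: "m \<in> keys b"
      have "wT m \<le> Max (insert 0 (wT ` keys b))" using m by (intro Max_ge) auto
      moreover have "b \<in> SEv" using b assms(1) by blast
      then have "case m of (a, S) \<Rightarrow> keys a \<subseteq> J \<and> S \<subseteq> J" using m unfolding SEv_iff by blast
      ultimately show "m \<in> ?M K" by (auto simp: K_def)
    qed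
    finally show "b \<in> (\<Union>K. Bs \<inter> cvec.span (bvec ` ?M K))" using b by blast
  qed
  ultimately show ?thesis by (meson countable_UN countable_finite countable_subset countableI_type)
qed

text \<open>A maximal independent set of homogeneous vectors spans \<open>U\<close>, since u is half
  the sum of u + \<open>pty u\<close> and u - \<open>pty u\<close>.\<close>

lemma nbasis_exists:
  assumes U: "cvec.subspace U" "U \<subseteq> SEv" "\<And>f. f \<in> U \<Longrightarrow> pty f \<in> U"
  shows "\<exists>bs pa \<psi>. nbasis U bs pa \<psi>"
proof -
  let ?V = "{f \<in> U. \<exists>p. pty f = sgp p \<cdot> f}"
  obtain Bs where Bs: "Bs \<subseteq> ?V" "cvec.independent Bs" "?V \<subseteq> cvec.span Bs"
    by (rule cvec.maximal_independent_subset[of ?V])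
  have "Bs \<subseteq> SEv" using Bs(1) U(2) by blast
  then have cnt: "countable Bs" using Bs(2) by (rule countable_independent)
  define dec where "dec = from_nat_into Bs"
  define idx where "idx = to_nat_on Bs"
  have di: "dec (idx b) = b" if "b \<in> Bs" for b using that cnt by (simp add: dec_def idx_def)
  have idi: "idx (dec k) = k" if "k \<in> idx ` Bs" for k using that di by auto
  define \<psi> :: "nat cvec \<Rightarrow> smono cvec" where "\<psi> = lin dec"
  let ?D = "{v. keys v \<subseteq> idx ` Bs}"
  have lin: "clinear \<psi>" by (simp add: \<psi>_def linear_lin)
  have D: "cvec.subspace ?D"
  proof (unfold cvec.subspace_def, intro conjI ballI allI)
    show "x + y \<in> ?D" if "x \<in> ?D" "y \<in> ?D" for x y using that keys_add[of x y] by blast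
    show "c \<cdot> x \<in> ?D" if "x \<in> ?D" for c x using that keys_cscale[of c x] by blast
  qed simp
  have "inj_on \<psi> ?D"
  proof (rule inj_onI)
    fix x y assume xy: "x \<in> ?D" "y \<in> ?D" "\<psi> x = \<psi> y"
    define z where "z = x - y"
    have z: "z \<in> ?D" "\<psi> z = 0" using xy cvec.subspace_diff[OF D] by (auto simp: z_def clinD(2)[OF lin])
    have inj: "inj_on dec (keys z)" 
    proof (rule inj_onI)
      fix k k' assume "k \<in> keys z" "k' \<in> keys z" "dec k = dec k'"
      then show "k = k'" using z(1) idi[of k] idi[of k'] by auto
    qed
    have "(\<Sum>b\<in>dec ` keys z. lookup z (idx b) \<cdot> b) = (\<Sum>k\<in>keys z. lookup z (idx (dec k)) \<cdot> dec k)"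
      by (simp add: sum.reindex[OF inj])
    also have "\<dots> = \<psi> z" unfolding \<psi>_def lin_def
    proof (intro sum.cong refl)
      fix k assume "k \<in> keys z"
      then have "k \<in> idx ` Bs" using z(1) by blast
      then show "lookup z (idx (dec k)) \<cdot> dec k = lookup z k \<cdot> dec k" by (simp only: idi)
    qed
    finally have s0: "(\<Sum>b\<in>dec ` keys z. lookup z (idx b) \<cdot> b) = 0" using z(2) by simp
    have "dec ` keys z \<subseteq> Bs" using z(1) di by fastforce
    then have "lookup z (idx b) = 0" if "b \<in> dec ` keys z" for b
      using cvec.independentD[OF Bs(2) _ _ s0 that] by simp
    then have "lookup z k = 0" if "k \<in> keys z" for k using that z(1) di by fastforce
    then have "z = 0" by (intro poly_mapping_eqI) (metis in_keys_iff lookup_zero)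
    then show "x = y" by (simp add: z_def)
  qed
  moreover have "\<psi> ` ?D = U"
  proof
    show "\<psi> ` ?D \<subseteq> U"
    proof
      fix u assume "u \<in> \<psi> ` ?D"
      then obtain v where v: "keys v \<subseteq> idx ` Bs" "u = \<psi> v" by blast
      show "u \<in> U" unfolding v(2) \<psi>_def lin_def
        using v(1) di Bs(1) by (intro cvec.subspace_sum[OF U(1)] cvec.subspace_scale[OF U(1)]) fastforce
    qed
    have "cvec.span Bs \<subseteq> \<psi> ` ?D"
    proof (rule cvec.span_minimal)
      show "Bs \<subseteq> \<psi> ` ?D"
      proof
        fix b assume b: "b \<in> Bs"
        show "b \<in> \<psi> ` ?D" by (rule image_eqI[of _ _ "bvec (idx b)"]) (use b in \<open>simp_all add: \<psi>_def di\<close>)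
      qed
      show "cvec.subspace (\<psi> ` ?D)" by (rule cvec_pair.linear_subspace_image[OF lin D])
    qed
    moreover have "U \<subseteq> cvec.span Bs"
    proof
      fix u assume u: "u \<in> U"
      have "u + pty u \<in> ?V" "u - pty u \<in> ?V"
        using u U(3) cvec.subspace_add[OF U(1)] cvec.subspace_diff[OF U(1)]
        by (auto simp: sgp_def add.commute intro: exI[of _ False] exI[of _ True])
      then have sp: "u + pty u \<in> cvec.span Bs" "u - pty u \<in> cvec.span Bs" using Bs(3) by blast+
      have "(1/2) \<cdot> (u + pty u) + (1/2) \<cdot> (u - pty u) \<in> cvec.span Bs"
        by (rule cvec.span_add[OF cvec.span_scale[OF sp(1)] cvec.span_scale[OF sp(2)]])
      moreover have "(1/2) \<cdot> (u + pty u) + (1/2) \<cdot> (u - pty u) = u"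
        by (rule cvec_ext) (simp add: cvec_coord)
      ultimately show "u \<in> cvec.span Bs" by simp
    qed
    ultimately show "U \<subseteq> \<psi> ` ?D" by blast
  qed
  moreover have "\<forall>k\<in>idx ` Bs. pty (\<psi> (bvec k)) = sgp (SOME p. pty (\<psi> (bvec k)) = sgp p \<cdot> \<psi> (bvec k)) \<cdot> \<psi> (bvec k)"
  proof
    fix k assume "k \<in> idx ` Bs"
    then have "\<exists>p. pty (\<psi> (bvec k)) = sgp p \<cdot> \<psi> (bvec k)" using di Bs(1) by (auto simp: \<psi>_def)
    then show "pty (\<psi> (bvec k)) = sgp (SOME p. pty (\<psi> (bvec k)) = sgp p \<cdot> \<psi> (bvec k)) \<cdot> \<psi> (bvec k)"
      by (rule someI_ex)
  qed
  ultimately have "nbasis U (idx ` Bs) (\<lambda>k. SOME p. pty (\<psi> (bvec k)) = sgp p \<cdot> \<psi> (bvec k)) \<psi>"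
    using lin by (simp add: nbasis_def)
  then show ?thesis by blast
qed

lemma nbasisD:
  assumes "nbasis U bs pa \<psi>"
  shows "clinear \<psi>" "keys v \<subseteq> bs \<Longrightarrow> \<psi> v \<in> U" "keys v \<subseteq> bs \<Longrightarrow> keys w \<subseteq> bs \<Longrightarrow> \<psi> v = \<psi> w \<Longrightarrow> v = w"
    "u \<in> U \<Longrightarrow> \<exists>v. keys v \<subseteq> bs \<and> \<psi> v = u" "k \<in> bs \<Longrightarrow> pty (\<psi> (bvec k)) = sgp (pa k) \<cdot> \<psi> (bvec k)"
  using assms unfolding nbasis_def inj_on_def by (simp, blast, blast, blast, blast)

text \<open>The action on the subspace transported to coordinates, with all parities shifted by
  \<sigma>. The parameter \<open>act\<close> covers \<open>spo_act n\<close> as well as osp, whose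
  elements are already operators on S(E).\<close>

definition nmod :: "nat set \<Rightarrow> (nat \<Rightarrow> bool) \<Rightarrow> (nat cvec \<Rightarrow> smono cvec) \<Rightarrow> bool \<Rightarrow>
    (('u cvec \<Rightarrow> 'u cvec) \<Rightarrow> smono cvec \<Rightarrow> smono cvec) \<Rightarrow> ('u, nat) supermod" where
  "nmod bs pa \<psi> \<sigma> act = \<lparr> basis = bs, par = (\<lambda>k. pa k \<noteq> \<sigma>),
     rep = (\<lambda>p X v. inv_into {v. keys v \<subseteq> bs} \<psi> (act X (\<psi> v))) \<rparr>"

context
  fixes U bs pa \<psi>
  assumes nb: "nbasis U bs pa \<psi>"
begin

definition \<iota> :: "smono cvec \<Rightarrow> nat cvec" where "\<iota> = inv_into {v. keys v \<subseteq> bs} \<psi>"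

lemma iota: "u \<in> U \<Longrightarrow> \<psi> (\<iota> u) = u" "u \<in> U \<Longrightarrow> keys (\<iota> u) \<subseteq> bs" "keys v \<subseteq> bs \<Longrightarrow> \<iota> (\<psi> v) = v"
proof -
  have im: "\<psi> ` {v. keys v \<subseteq> bs} = U" and inj: "inj_on \<psi> {v. keys v \<subseteq> bs}" using nb by (auto simp: nbasis_def)
  show "u \<in> U \<Longrightarrow> \<psi> (\<iota> u) = u" unfolding \<iota>_def by (rule f_inv_into_f) (simp add: im)
  show "u \<in> U \<Longrightarrow> keys (\<iota> u) \<subseteq> bs" unfolding \<iota>_def using inv_into_into[of u \<psi> "{v. keys v \<subseteq> bs}"] im by simp
  show "keys v \<subseteq> bs \<Longrightarrow> \<iota> (\<psi> v) = v" unfolding \<iota>_def using inv_into_f_f[OF inj] by simp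
qed

lemma iotaI: "keys v \<subseteq> bs \<Longrightarrow> \<psi> v = u \<Longrightarrow> \<iota> u = v" using iota(3) by blast

lemma sub_bs: "keys v \<subseteq> bs \<Longrightarrow> keys w \<subseteq> bs \<Longrightarrow> keys (v + w) \<subseteq> bs" "keys v \<subseteq> bs \<Longrightarrow> keys (c \<cdot> v) \<subseteq> bs"
  using keys_add[of v w] keys_cscale[of c v] by auto

lemma iota_lin: "u \<in> U \<Longrightarrow> u' \<in> U \<Longrightarrow> \<iota> (u + u') = \<iota> u + \<iota> u'" "u \<in> U \<Longrightarrow> \<iota> (c \<cdot> u) = c \<cdot> \<iota> u" "\<iota> 0 = 0"
proof -
  show "\<iota> (u + u') = \<iota> u + \<iota> u'" if "u \<in> U" "u' \<in> U"
    by (rule iotaI[OF sub_bs(1)[OF iota(2)[OF that(1)] iota(2)[OF that(2)]]])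
      (simp add: clinD(1)[OF nbasisD(1)[OF nb]] iota(1) that)
  show "\<iota> (c \<cdot> u) = c \<cdot> \<iota> u" if "u \<in> U"
    by (rule iotaI[OF sub_bs(2)[OF iota(2)[OF that]]]) (simp add: clinD(4)[OF nbasisD(1)[OF nb]] iota(1) that)
  show "\<iota> 0 = 0" by (rule iotaI) (simp_all add: clinD(5)[OF nbasisD(1)[OF nb]])
qed

lemma U_sub: "cvec.subspace U"
proof -
  have "cvec.subspace {v. keys v \<subseteq> bs}" unfolding cvec.subspace_def using sub_bs by auto
  from cvec_pair.linear_subspace_image[OF nbasisD(1)[OF nb] this] show ?thesis using nb by (simp add: nbasis_def)
qed

lemma iota_diff: "u \<in> U \<Longrightarrow> u' \<in> U \<Longrightarrow> \<iota> (u - c \<cdot> u') = \<iota> u - c \<cdot> \<iota> u'"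
  using iota_lin(1)[of u "(- c) \<cdot> u'"] iota_lin(2)[of u' "- c"] cvec.subspace_scale[OF U_sub, of u' "- c"] by simp

lemma pty_psi: "keys v \<subseteq> bs \<Longrightarrow> pty (\<psi> v) = \<psi> (diag (\<lambda>k. sgp (pa k)) v)"
proof (rule linear_eqI[where F = "\<lambda>v. pty (\<psi> v)" and G = "\<lambda>v. \<psi> (diag (\<lambda>k. sgp (pa k)) v)"])
  show "clinear (\<lambda>v. pty (\<psi> v))" "clinear (\<lambda>v. \<psi> (diag (\<lambda>k. sgp (pa k)) v))"
    using nbasisD(1)[OF nb] linear_pty linear_diag by (auto intro: clinear_comp)
qed (use nbasisD(5)[OF nb] in \<open>auto simp: diag_bvec clinD(4)[OF nbasisD(1)[OF nb]]\<close>)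

lemma hom_psi:
  assumes v: "keys v \<subseteq> bs"
  shows "keys v \<subseteq> {k \<in> bs. (pa k \<noteq> \<sigma>) = q} \<longleftrightarrow> pty (\<psi> v) = (sgp q * sgp \<sigma>) \<cdot> \<psi> v"
proof -
  have "pty (\<psi> v) = (sgp q * sgp \<sigma>) \<cdot> \<psi> v \<longleftrightarrow> \<psi> (diag (\<lambda>k. sgp (pa k)) v) = \<psi> ((sgp q * sgp \<sigma>) \<cdot> v)"
    by (simp add: pty_psi[OF v] clinD(4)[OF nbasisD(1)[OF nb]])
  also have "\<dots> \<longleftrightarrow> diag (\<lambda>k. sgp (pa k)) v = (sgp q * sgp \<sigma>) \<cdot> v"
  proof -
    have "keys (diag (\<lambda>k. sgp (pa k)) v) \<subseteq> bs" using v by (auto simp: in_keys_iff lookup_diag)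
    then show ?thesis
      using nbasisD(3)[OF nb, of "diag (\<lambda>k. sgp (pa k)) v" "(sgp q * sgp \<sigma>) \<cdot> v"] sub_bs(2)[OF v] by auto
  qed
  also have "\<dots> \<longleftrightarrow> (\<forall>k. sgp (pa k) * lookup v k = sgp q * sgp \<sigma> * lookup v k)"
    by (simp add: poly_mapping_eq_iff fun_eq_iff lookup_diag)
  also have "\<dots> \<longleftrightarrow> keys v \<subseteq> {k \<in> bs. (pa k \<noteq> \<sigma>) = q}"
    using v by (auto simp: sgp_def subset_iff in_keys_iff split: if_splits)
  finally show ?thesis ..
qed

lemma nmod_simps: "vecs (nmod bs pa \<psi> \<sigma> act) = {v. keys v \<subseteq> bs}" "basis (nmod bs pa \<psi> \<sigma> act) = bs"
  "par (nmod bs pa \<psi> \<sigma> act) k = (pa k \<noteq> \<sigma>)"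
  "rep (nmod bs pa \<psi> \<sigma> act) p X v = \<iota> (act X (\<psi> v))"
  "v \<in> hom_part (nmod bs pa \<psi> \<sigma> act) q \<longleftrightarrow> keys v \<subseteq> bs \<and> pty (\<psi> v) = (sgp q * sgp \<sigma>) \<cdot> \<psi> v"
  using hom_psi[of v \<sigma> q] by (auto simp: nmod_def vecs_def \<iota>_def hom_part_def)

lemma nmod_irreducible:
  assumes A1: "\<And>p X. X \<in> L p \<Longrightarrow> clinear (act X)"
    and A2: "\<And>p X f. X \<in> L p \<Longrightarrow> f \<in> U \<Longrightarrow> act X f \<in> U"
    and A3: "\<And>p X f. X \<in> L p \<Longrightarrow> f \<in> U \<Longrightarrow> pty (act X f) = sgp p \<cdot> act X (pty f)"
    and A4: "\<And>p X Y a b f. X \<in> L p \<Longrightarrow> Y \<in> L p \<Longrightarrow> f \<in> U \<Longrightarrow> act (\<lambda>u. a \<cdot> X u + b \<cdot> Y u) f = a \<cdot> act X f + b \<cdot> act Y f"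
    and A5: "\<And>p q X Y f. X \<in> L p \<Longrightarrow> Y \<in> L q \<Longrightarrow> f \<in> U \<Longrightarrow>
       act (supercomm p q X Y) f = act X (act Y f) - ksign p q \<cdot> act Y (act X f)"
    and ne: "u0 \<in> U" "u0 \<noteq> 0"
    and irr: "\<And>N. N \<subseteq> U \<Longrightarrow> cvec.subspace N \<Longrightarrow> (\<And>p X f. X \<in> L p \<Longrightarrow> f \<in> N \<Longrightarrow> act X f \<in> N) \<Longrightarrow> N = {0} \<or> N = U"
  shows "irreducible L (nmod bs pa \<psi> \<sigma> act)"
proof -
  note L = nbasisD(1)[OF nb]
  note \<psi>U = nbasisD(2)[OF nb]
  have sm: "supermodule L (nmod bs pa \<psi> \<sigma> act)"
    unfolding supermodule_def
  proof (intro conjI allI ballI)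
    fix p X assume X: "X \<in> L p"
    show "linear_on (vecs (nmod bs pa \<psi> \<sigma> act)) (rep (nmod bs pa \<psi> \<sigma> act) p X)"
      unfolding linear_on_def nmod_simps using A1[OF X] A2[OF X] \<psi>U
      by (auto simp: clinD[OF L] clinD[OF A1[OF X]] iota_lin)
    fix q
    show "rep (nmod bs pa \<psi> \<sigma> act) p X ` hom_part (nmod bs pa \<psi> \<sigma> act) q \<subseteq> hom_part (nmod bs pa \<psi> \<sigma> act) (p \<noteq> q)"
    proof
      fix w assume "w \<in> rep (nmod bs pa \<psi> \<sigma> act) p X ` hom_part (nmod bs pa \<psi> \<sigma> act) q"
      then obtain v where v: "keys v \<subseteq> bs" "pty (\<psi> v) = (sgp q * sgp \<sigma>) \<cdot> \<psi> v" "w = \<iota> (act X (\<psi> v))"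
        by (auto simp: nmod_simps)
      have a: "act X (\<psi> v) \<in> U" using A2[OF X] \<psi>U v by blast
      have "pty (act X (\<psi> v)) = (sgp p * (sgp q * sgp \<sigma>)) \<cdot> act X (\<psi> v)"
        using A3[OF X \<psi>U[OF v(1)]] v(2) by (simp add: clinD(4)[OF A1[OF X]])
      then show "w \<in> hom_part (nmod bs pa \<psi> \<sigma> act) (p \<noteq> q)"
        unfolding nmod_simps v(3) using iota(1,2)[OF a] sgp_xor[of p q] by (simp add: mult.assoc)
    qed
  next
    fix p X Y a b v assume X: "X \<in> L p" "Y \<in> L p" and v: "v \<in> vecs (nmod bs pa \<psi> \<sigma> act)"
    then have "\<psi> v \<in> U" using \<psi>U by (simp add: nmod_simps)
    then show "rep (nmod bs pa \<psi> \<sigma> act) p (\<lambda>u. a \<cdot> X u + b \<cdot> Y u) v =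
      a \<cdot> rep (nmod bs pa \<psi> \<sigma> act) p X v + b \<cdot> rep (nmod bs pa \<psi> \<sigma> act) p Y v"
      unfolding nmod_simps using A4[OF X] A2[OF X(1)] A2[OF X(2)] cvec.subspace_scale[OF U_sub] by (simp add: iota_lin)
  next
    fix p q X Y v assume X: "X \<in> L p" "Y \<in> L q" and v: "v \<in> vecs (nmod bs pa \<psi> \<sigma> act)"
    then have f: "\<psi> v \<in> U" using \<psi>U by (simp add: nmod_simps)
    show "rep (nmod bs pa \<psi> \<sigma> act) (p \<noteq> q) (supercomm p q X Y) v =
      rep (nmod bs pa \<psi> \<sigma> act) p X (rep (nmod bs pa \<psi> \<sigma> act) q Y v) -
      ksign p q \<cdot> rep (nmod bs pa \<psi> \<sigma> act) q Y (rep (nmod bs pa \<psi> \<sigma> act) p X v)"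
      unfolding nmod_simps using A5[OF X f] A2[OF X(1)] A2[OF X(2)] f by (simp add: iota iota_diff)
  qed
  have nz: "vecs (nmod bs pa \<psi> \<sigma> act) \<noteq> {0}"
  proof -
    have "\<iota> u0 \<in> vecs (nmod bs pa \<psi> \<sigma> act)" using iota(2)[OF ne(1)] by (simp add: nmod_simps)
    moreover have "\<iota> u0 \<noteq> 0" using iota(1)[OF ne(1)] ne(2) clinD(5)[OF L] by metis
    ultimately show ?thesis by blast
  qed
  have "N = {0} \<or> N = vecs (nmod bs pa \<psi> \<sigma> act)" if N: "submodule L (nmod bs pa \<psi> \<sigma> act) N" for N
  proof -
    have N1: "N \<subseteq> {v. keys v \<subseteq> bs}" "cvec.subspace N" "\<And>p X v. X \<in> L p \<Longrightarrow> v \<in> N \<Longrightarrow> \<iota> (act X (\<psi> v)) \<in> N"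
      using N unfolding submodule_def nmod_simps by blast+
    have "\<psi> ` N = {0} \<or> \<psi> ` N = U"
    proof (rule irr)
      show "\<psi> ` N \<subseteq> U" using N1(1) \<psi>U by blast
      show "cvec.subspace (\<psi> ` N)" by (rule cvec_pair.linear_subspace_image[OF L N1(2)])
      fix p X f assume X: "X \<in> L p" and "f \<in> \<psi> ` N"
      then obtain v where v: "v \<in> N" "f = \<psi> v" by blast
      have "f \<in> U" using v N1(1) \<psi>U by blast
      then show "act X f \<in> \<psi> ` N" using N1(3)[OF X v(1)] iota(1)[OF A2[OF X]] v(2) by (metis image_eqI)
    qed
    then show ?thesis
    proof
      assume z: "\<psi> ` N = {0}"
      have "v = 0" if v: "v \<in> N" for v
      proof -
        have "\<psi> v = \<psi> 0" using z v clinD(5)[OF L] by auto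
        moreover have "keys v \<subseteq> bs" "keys (0 :: nat cvec) \<subseteq> bs" using N1(1) v by auto
        ultimately show ?thesis using nbasisD(3)[OF nb] by blast
      qed
      then show ?thesis using cvec.subspace_0[OF N1(2)] by blast
    next
      assume u: "\<psi> ` N = U"
      have "v \<in> N" if "keys v \<subseteq> bs" for v
      proof -
        have "\<psi> v \<in> \<psi> ` N" using u \<psi>U[OF that] by simp
        then obtain w where "w \<in> N" "\<psi> w = \<psi> v" by force
        then show ?thesis using nbasisD(3)[OF nb, of w v] N1(1) that by auto
      qed
      then show ?thesis using N1(1) by (auto simp: nmod_simps)
    qed
  qed
  with sm nz show ?thesis unfolding irreducible_def by blast
qed

end

end

section \<open>Tensors, weights and parities of the summands\<close>

lemma lin_bvec_id: "clinear F \<Longrightarrow> lin (\<lambda>c. F (bvec c)) y = F y"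
  by (rule linear_eqI[OF linear_lin]) simp_all

lemma keys_lin: "keys (lin g v) \<subseteq> (\<Union>b\<in>keys v. keys (g b))"
proof -
  have "keys (lin g v) \<subseteq> (\<Union>b\<in>keys v. keys (lookup v b \<cdot> g b))"
    unfolding lin_def by (rule keys_sum)
  also have "\<dots> \<subseteq> (\<Union>b\<in>keys v. keys (g b))" by (intro UN_mono keys_cscale subset_refl)
  finally show ?thesis .
qed

lemma clinear_expand2:
  fixes A :: "'b cvec \<Rightarrow> 'c cvec"
  assumes "clinear A"
  shows "A f = (\<Sum>m\<in>keys f. lookup f m \<cdot> A (bvec m))"
proof -
  have "A f = A (\<Sum>m\<in>keys f. lookup f m \<cdot> bvec m)"
    using cvec_expand[of f] by (rule arg_cong)
  then show ?thesis by (simp only: clinD(6)[OF assms] clinD(4)[OF assms])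
qed

lemma inject_tensor_keys: "keys (inject t (tensor_vec x y)) \<subseteq> {t} \<times> (keys x \<times> keys y)"
proof
  fix m assume "m \<in> keys (inject t (tensor_vec x y))"
  then obtain b where b: "b \<in> keys (tensor_vec x y)" "m \<in> keys (bvec (t, b))"
    using keys_lin[of "\<lambda>b. bvec (t, b)" "tensor_vec x y"] unfolding inject_def by blast
  obtain i where i: "i \<in> keys x" "b \<in> keys (lin (\<lambda>c. bvec (i, c)) y)"
    using keys_lin[of "\<lambda>b. lin (\<lambda>c. bvec (b, c)) y" x] b(1) unfolding tensor_vec_def by blast
  obtain j where "j \<in> keys y" "b \<in> keys (bvec (i, j))"
    using keys_lin[of "\<lambda>c. bvec (i, c)" y] i(2) by blast
  with b i show "m \<in> {t} \<times> (keys x \<times> keys y)" by simp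
qed

lemma inject_scale: "inject t (c \<cdot> v) = c \<cdot> inject t v"
  by (simp add: inject_def lin_simps)

context howe
begin

lemma B_expand: "clinear F \<Longrightarrow> B (F v) u = (\<Sum>m\<in>keys v. lookup v m * B (F (bvec m)) u)"
  by (subst clinear_expand2) (simp_all add: B_lin)

lemma spo_weight_lo: "spo_weight n (lo t) = spo_weight n t"
  by (cases t) auto

text \<open>The first entry determines d, and the sum of the entries then determines k.\<close>

lemma hook_weight_inj:
  assumes k: "1 \<le> k" "k \<le> n" "1 \<le> k'" "k' \<le> n" and eq: "hook_weight n d k = hook_weight n d' k'"
  shows "d = d' \<and> k = k'"
proof
  show "d = d'" using eq by (simp add: hook_weight_def)
  have "sum_list (hook_weight n d k) = of_nat d + 1 + of_nat (k - 1)" for d k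
    by (simp add: hook_weight_def sum_list_replicate)
  then have "(of_nat (k - 1) :: complex) = of_nat (k' - 1)" using eq \<open>d = d'\<close> by (metis add_left_cancel)
  then have "k - 1 = k' - 1" by (rule of_nat_eq_iff[THEN iffD1])
  then show "k = k'" using k by linarith
qed

lemma hook_weight_nz: "1 \<le> k \<Longrightarrow> k \<le> n \<Longrightarrow> hook_weight n d k \<noteq> replicate n 0"
proof
  assume "hook_weight n d k = replicate n 0"
  then have "hook_weight n d k ! 0 = replicate n 0 ! 0" by simp
  then have "of_nat d + 1 = (0 :: complex)" using n_pos by (simp add: hook_weight_def)
  then show False by (metis of_nat_Suc of_nat_eq_0_iff add.commute nat.distinct(1))
qed

text \<open>Makes the spo-module a well-defined function of the weight.\<close>

lemma spo_weight_inj: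
  assumes t: "t \<in> summands n" "t' \<in> summands n" and eq: "spo_weight n t = spo_weight n t'"
  shows "lo t = lo t'"
  using t(1)
proof (cases rule: summands_cases)
  case 1
  show ?thesis using t(2) by (cases rule: summands_cases) (use 1 eq hook_weight_nz in fastforce)+
next
  case 2
  show ?thesis using t(2) by (cases rule: summands_cases) (use 2 eq hook_weight_nz in fastforce)+
next
  case (3 d k)
  show ?thesis using t(2) by (cases rule: summands_cases) (use 3 eq hook_weight_nz[of k d] hook_weight_inj[of k _ d] in auto)
next
  case (4 d k)
  show ?thesis using t(2) by (cases rule: summands_cases) (use 4 eq hook_weight_nz[of k d] hook_weight_inj[of k _ d] in auto)
qed

lemma osp_weight_eq: "t \<in> summands n \<Longrightarrow> osp_weight n t = (of_int (sD t) + alpha n, of_int (sL t) - alpha n)"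
  by (erule summands_cases) (auto simp: sD_def sL_def of_nat_diff algebra_simps)

lemma osp_weight_inj:
  assumes t: "t \<in> summands n" "t' \<in> summands n" and eq: "osp_weight n t = osp_weight n t'"
  shows "t = t'"
  using s_inj[OF t] eq unfolding osp_weight_eq[OF t(1)] osp_weight_eq[OF t(2)] by simp

lemma length_spo_weight: "t \<in> summands n \<Longrightarrow> length (spo_weight n t) = n"
  by (erule summands_cases) (auto simp: hook_weight_def)

definition eo :: "summand \<Rightarrow> bool" where "eo t = (SOME p. pty (sv t) = sgp p \<cdot> sv t)"

lemma eo: "pty (sv t) = sgp (eo t) \<cdot> sv t"
proof -
  obtain e where e: "e * e = 1" "pty (sv t) = e \<cdot> sv t" using pty_sv by blast
  have "e = 1 \<or> e = -1" using e(1) by (simp add: square_eq_1_iff)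
  then have "\<exists>p. pty (sv t) = sgp p \<cdot> sv t" using e(2) by (auto simp: sgp_def intro: exI[of _ False] exI[of _ True])
  then show ?thesis unfolding eo_def by (rule someI_ex)
qed

end

subsection \<open>The decomposition\<close>

locale howe_data = howe +
  fixes bsV :: "summand \<Rightarrow> nat set" and paV \<psi>V bsW paW \<psi>W
  assumes nV: "t \<in> summands n \<Longrightarrow> nbasis (VV t) (bsV t) (paV t) (\<psi>V t)"
    and nW: "t \<in> summands n \<Longrightarrow> nbasis (WW t) (bsW t) (paW t) (\<psi>W t)"
begin

text \<open>The parity is shifted by \<open>eo\<close> so that the highest weight vector of every \<open>modV t\<close> is even; thus
  the module depends only on the weight, and the actual parity is carried by \<open>modW\<close>.\<close>

definition modV :: "summand \<Rightarrow> (nat, nat) supermod" where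
  "modV t = nmod (bsV t) (paV t) (\<psi>V t) (eo t) (spo_act n)"
definition modW :: "summand \<Rightarrow> (smono, nat) supermod" where
  "modW t = nmod (bsW t) (paW t) (\<psi>W t) False (\<lambda>Y. Y)"

lemma modV_irr:
  assumes t: "t \<in> summands n"
  shows "spo_irreducible n (spo_weight n t) (modV t)"
proof -
  note nb = nV[OF t]
  have irr: "irreducible (spo n) (modV t)"
    unfolding modV_def
  proof (rule nmod_irreducible[OF nb, where ?u0.0 = "sv t"])
    show "N = {0} \<or> N = VV t"
      if N: "N \<subseteq> VV t" "cvec.subspace N" "\<And>p X f. X \<in> spo n p \<Longrightarrow> f \<in> N \<Longrightarrow> spo_act n X f \<in> N" for N
    proof (cases "N = {0}")
      case False
      then obtain u where u: "u \<in> N" "u \<noteq> 0" using cvec.subspace_0[OF N(2)] by blast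
      have "om i f \<in> N" if "f \<in> N" "i \<in> I" for f i
        using N(3)[OF omat_spo[OF that(2)] that(1)] spo_act_omat[OF that(2)] by simp
      then show ?thesis using VV_irr[OF t N(1,2) _ u] by blast
    qed simp
    show "pty (spo_act n X f) = sgp p \<cdot> spo_act n X (pty f)" if "X \<in> spo n p" for p X f
      using spo_pty[OF that] by (simp add: sgp_def)
    show "spo_act n (supercomm p q X Y) f = spo_act n X (spo_act n Y f) - ksign p q \<cdot> spo_act n Y (spo_act n X f)"
      if "X \<in> spo n p" "Y \<in> spo n q" for p q X Y f
      by (rule spo_act_supercomm[OF spo_gl[OF that(1)] spo_gl[OF that(2)]])
  qed (auto simp: linear_spo_act VV_spo spo_act_lin VV_sv sv_ne[OF t])
  let ?v = "\<iota> (bsV t) (\<psi>V t) (sv t)"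
  have sv: "sv t \<in> VV t" by (rule VV_sv)
  note i = iota[OF nb] and il = iota_lin[OF nb]
  have v: "?v \<in> hom_part (modV t) False" "?v \<noteq> 0"
  proof -
    show "?v \<in> hom_part (modV t) False"
      unfolding modV_def nmod_simps[OF nb] using i(1,2)[OF sv] eo[of t] by (simp add: sgp_def)
    show "?v \<noteq> 0" using i(1)[OF sv] sv_ne[OF t] clinD(5)[OF nbasisD(1)[OF nb]] by metis
  qed
  have r: "rep (modV t) p X ?v = \<iota> (bsV t) (\<psi>V t) (spo_act n X (sv t))" for p X
    unfolding modV_def nmod_simps[OF nb] i(1)[OF sv] ..
  have "rep (modV t) False X ?v = 0" if "X \<in> spo_nil_even n" for X
    unfolding r sv_nil_even[OF t that] by (rule il)
  moreover have "rep (modV t) True (spo_nil_odd n k) ?v = 0" if "k \<in> {1..n}" for k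
    unfolding r sv_nil_odd[OF t that] by (rule il)
  moreover have "rep (modV t) False (spo_cartan n j) ?v = spo_weight n t ! (j - 1) \<cdot> ?v" if j: "j \<in> {1..n}" for j
  proof -
    have "spo_act n (spo_cartan n j) (sv t) = spo_weight n t ! (j - 1) \<cdot> sv t"
      using HH_cartan[OF n_I(1)[OF j]] HH_sv[OF t j] j by simp
    then show ?thesis unfolding r by (simp add: il(2)[OF sv])
  qed
  ultimately show ?thesis
    unfolding spo_irreducible_def using irr v length_spo_weight[OF t] by blast
qed

lemma modW_irr:
  assumes t: "t \<in> summands n"
  shows "osp_irreducible n (osp_weight n t) (modW t)"
proof -
  note nb = nW[OF t]
  have irr: "irreducible (osp n) (modW t)"
    unfolding modW_def
  proof (rule nmod_irreducible[OF nb, where ?u0.0 = "sv t"])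
    show "N = {0} \<or> N = WW t"
      if N: "N \<subseteq> WW t" "cvec.subspace N" "\<And>p X f. X \<in> osp n p \<Longrightarrow> f \<in> N \<Longrightarrow> X f \<in> N" for N
    proof (cases "N = {0}")
      case False
      then obtain u where u: "u \<in> N" "u \<noteq> 0" using cvec.subspace_0[OF N(2)] by blast
      have "p1 f \<in> N" "p2 f \<in> N" "q1 f \<in> N" "q2 f \<in> N" if "f \<in> N" for f
        using N(3)[OF osp_mem(1) that] N(3)[OF osp_mem(2) that] N(3)[OF osp_mem(3) that] N(3)[OF osp_mem(4) that]
          WW_props(1)[OF t, of f] N(1) that by (auto simp: osp_ops)
      then show ?thesis using WW_irr[OF t N(1,2) _ _ _ _ u] by blast
    qed simp
    show "pty (X f) = sgp p \<cdot> X (pty f)" if "X \<in> osp n p" "f \<in> WW t" for p X f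
      using osp_pty[OF that(1) WW_props(1)[OF t that(2)]] .
    show "X f \<in> WW t" if "X \<in> osp n p" "f \<in> WW t" for p X f by (rule osp_WW[OF that(1) t that(2)])
  qed (auto simp: osp_linear supercomm_def WW_sv sv_ne[OF t])
  let ?v = "\<iota> (bsW t) (\<psi>W t) (sv t)"
  have sv: "sv t \<in> WW t" by (rule WW_sv)
  note i = iota[OF nb] and il = iota_lin[OF nb]
  have v: "?v \<in> hom_part (modW t) (eo t)" "?v \<noteq> 0"
  proof -
    show "?v \<in> hom_part (modW t) (eo t)"
      unfolding modW_def nmod_simps[OF nb] using i(1,2)[OF sv] eo[of t] by (simp add: sgp_def)
    show "?v \<noteq> 0" using i(1)[OF sv] sv_ne[OF t] clinD(5)[OF nbasisD(1)[OF nb]] by metis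
  qed
  have r: "rep (modW t) p X ?v = \<iota> (bsW t) (\<psi>W t) (X (sv t))" for p X
    unfolding modW_def nmod_simps[OF nb] i(1)[OF sv] ..
  note S = sv_props[OF t]
  have d: "degS (sv t) = of_int (sD t) \<cdot> sv t" "degL (sv t) = of_int (sL t) \<cdot> sv t"
    using S(5,6) by (simp_all only: degS_homd degL_homd)
  have "d22 (sv t) = 0" using pair_eqs(1)[of "sv t"] S by simp
  then have "rep (modW t) True (F12 n) ?v = 0" "rep (modW t) True (D12 n) ?v = 0" "rep (modW t) False (D22 n) ?v = 0"
    unfolding r osp_ops using S il(3) by simp_all
  moreover have "rep (modW t) False (F11 n) ?v = fst (osp_weight n t) \<cdot> ?v" "rep (modW t) False (F22 n) ?v = snd (osp_weight n t) \<cdot> ?v"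
    unfolding r osp_ops d osp_weight_eq[OF t] fst_conv snd_conv
      cvec.scale_left_distrib[symmetric] cvec.scale_left_diff_distrib[symmetric] by (rule il(2)[OF sv])+
  ultimately show ?thesis unfolding osp_irreducible_def using irr v by blast
qed

text \<open>An operator a_i producing the i-th basis vector of the orbit of \<open>sv (lo t)\<close>
  from its generator. The same operator is then applied to the osp orbit of t, also when t differs
  from \<open>lo t\<close>.\<close>

definition aop :: "summand \<Rightarrow> nat \<Rightarrow> smono cvec \<Rightarrow> smono cvec" where
  "aop t i = (SOME a. a \<in> alg GO \<and> a (sv (lo t)) = \<psi>V (lo t) (bvec i))"

lemma aop:
  assumes "t \<in> summands n" "i \<in> bsV (lo t)"
  shows "aop t i \<in> alg GO" "aop t i (sv (lo t)) = \<psi>V (lo t) (bvec i)"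
proof -
  have "\<psi>V (lo t) (bvec i) \<in> VV (lo t)"
    using nbasisD(2)[OF nV[OF lo_summand[OF assms(1)]], of "bvec i"] assms(2) by simp
  then have "\<exists>a. a \<in> alg GO \<and> a (sv (lo t)) = \<psi>V (lo t) (bvec i)" by (auto simp: VV_def orb_def)
  from someI_ex[OF this] show "aop t i \<in> alg GO" "aop t i (sv (lo t)) = \<psi>V (lo t) (bvec i)"
    by (simp_all add: aop_def)
qed

definition Phi :: "(summand \<times> nat \<times> nat) cvec \<Rightarrow> smono cvec" where
  "Phi = lin (\<lambda>(t, i, j). aop t i (\<psi>W t (bvec j)))"

lemma linear_Phi: "clinear Phi" by (simp add: Phi_def linear_lin)

definition DV :: "(summand \<times> nat \<times> nat) cvec set" where
  "DV = {v. keys v \<subseteq> {(t, i, j). t \<in> summands n \<and> i \<in> bsV (lo t) \<and> j \<in> bsW t}}"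

lemma DV_sub: "cvec.subspace DV"
  unfolding cvec.subspace_def DV_def
proof (intro conjI ballI allI)
  fix x y :: "(summand \<times> nat \<times> nat) cvec" and c :: complex
  assume "x \<in> {v. keys v \<subseteq> {(t, i, j). t \<in> summands n \<and> i \<in> bsV (lo t) \<and> j \<in> bsW t}}"
  note x = this[unfolded mem_Collect_eq]
  show "c \<cdot> x \<in> {v. keys v \<subseteq> {(t, i, j). t \<in> summands n \<and> i \<in> bsV (lo t) \<and> j \<in> bsW t}}"
    unfolding mem_Collect_eq by (rule subset_trans[OF keys_cscale x])
  assume "y \<in> {v. keys v \<subseteq> {(t, i, j). t \<in> summands n \<and> i \<in> bsV (lo t) \<and> j \<in> bsW t}}"
  note y = this[unfolded mem_Collect_eq]
  show "x + y \<in> {v. keys v \<subseteq> {(t, i, j). t \<in> summands n \<and> i \<in> bsV (lo t) \<and> j \<in> bsW t}}"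
    unfolding mem_Collect_eq by (rule subset_trans[OF keys_add Un_least[OF x y]])
qed simp

lemma DV_keys: "v \<in> DV \<Longrightarrow> (t, i, j) \<in> keys v \<Longrightarrow> t \<in> summands n \<and> i \<in> bsV (lo t) \<and> j \<in> bsW t"
  by (auto simp: DV_def)

lemma psiW_mem: "t \<in> summands n \<Longrightarrow> keys y \<subseteq> bsW t \<Longrightarrow> \<psi>W t y \<in> WW t"
  using nbasisD(2)[OF nW] .

lemma Phi_bvec: "Phi (bvec (t, i, j)) = aop t i (\<psi>W t (bvec j))"
  by (simp add: Phi_def)

lemma alg_combination:
  assumes t: "t \<in> summands n" and x: "keys x \<subseteq> bsV (lo t)"
  shows "(\<lambda>f. lin (\<lambda>b. aop t b f) x) \<in> alg GO" "lin (\<lambda>b. aop t b (sv (lo t))) x = \<psi>V (lo t) x"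
proof -
  show "(\<lambda>f. lin (\<lambda>b. aop t b f) x) \<in> alg GO"
    unfolding lin_def using aop(1)[OF t] x by (intro alg_sum alg_scale) auto
  have "lin (\<lambda>b. aop t b (sv (lo t))) x = lin (\<lambda>b. \<psi>V (lo t) (bvec b)) x"
    using aop(2)[OF t] x by (intro lin_cong) auto
  also have "\<dots> = \<psi>V (lo t) x" by (rule lin_bvec_id[OF nbasisD(1)[OF nV[OF lo_summand[OF t]]]])
  finally show "lin (\<lambda>b. aop t b (sv (lo t))) x = \<psi>V (lo t) x" .
qed

text \<open>Two operators with the same value on \<open>sv (lo t)\<close> differ by one that kills
  it, and by \<open>lo_kill_WW\<close> this difference kills the osp orbit of t. Hence the choice
  made in \<open>aop\<close> is immaterial.\<close>

lemma Phi_tensor: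
  assumes t: "t \<in> summands n" and x: "keys x \<subseteq> bsV (lo t)" and y: "keys y \<subseteq> bsW t"
    and A: "A \<in> alg GO" "A (sv (lo t)) = \<psi>V (lo t) x"
  shows "Phi (inject t (tensor_vec x y)) = A (\<psi>W t y)"
proof -
  have "Phi (inject t (tensor_vec x y)) = lin (\<lambda>b. lin (\<lambda>c. Phi (bvec (t, b, c))) y) x"
    unfolding inject_def tensor_vec_def lin_comp[OF linear_Phi] lin_comp[OF linear_lin] lin_bvec ..
  also have "\<dots> = lin (\<lambda>b. aop t b (\<psi>W t y)) x"
  proof (rule lin_cong)
    fix b assume "b \<in> keys x"
    then have "b \<in> bsV (lo t)" using x by blast
    then have "clinear (\<lambda>w. aop t b (\<psi>W t w))"
      using clinear_comp[OF alg_linear[OF GO_linear aop(1)[OF t]] nbasisD(1)[OF nW[OF t]]] by blast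
    then show "lin (\<lambda>c. Phi (bvec (t, b, c))) y = aop t b (\<psi>W t y)"
      unfolding Phi_bvec by (rule lin_bvec_id)
  qed
  also have "\<dots> = A (\<psi>W t y)"
  proof -
    have "lin (\<lambda>b. aop t b (\<psi>W t y)) x - A (\<psi>W t y) = 0"
      by (rule lo_kill_WW[OF t alg_diff[OF alg_combination(1)[OF t x] A(1)] _ psiW_mem[OF t y]])
        (simp add: alg_combination(2)[OF t x] A(2))
    then show ?thesis by simp
  qed
  finally show ?thesis .
qed

lemma tensor_DV: "t \<in> summands n \<Longrightarrow> keys x \<subseteq> bsV (lo t) \<Longrightarrow> keys y \<subseteq> bsW t \<Longrightarrow> inject t (tensor_vec x y) \<in> DV"
  using inject_tensor_keys[of t x y] unfolding DV_def by blast

lemma Phi_SE: "v \<in> DV \<Longrightarrow> Phi v \<in> SEv"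
proof -
  assume v: "v \<in> DV"
  have "Phi (bvec m) \<in> SEv" if "m \<in> keys v" for m
  proof -
    obtain t i j where m: "m = (t, i, j)" by (cases m)
    have d: "t \<in> summands n" "i \<in> bsV (lo t)" "j \<in> bsW t" using DV_keys[OF v] that m by auto
    show ?thesis unfolding m Phi_bvec
      using alg_GO_SE[OF aop(1)[OF d(1,2)] WW_props(1)[OF d(1) psiW_mem[OF d(1)]]] d(3) by simp
  qed
  then show ?thesis by (subst clinear_expand2[OF linear_Phi]) (intro SE_sum SE_simps)
qed

lemma Phi_surj: "Phi ` DV = SEv"
proof
  show "Phi ` DV \<subseteq> SEv" using Phi_SE by blast
  have "Gen \<subseteq> Phi ` DV"
  proof
    fix g assume "g \<in> Gen"
    then obtain A w t where g: "A \<in> alg GO" "t \<in> summands n" "w \<in> Sw t" "g = A w" by (auto simp: Gen_def)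
    have "A (sv (lo t)) \<in> VV (lo t)" using g(1) by (auto simp: VV_def orb_def)
    then obtain x where x: "keys x \<subseteq> bsV (lo t)" "\<psi>V (lo t) x = A (sv (lo t))"
      using nbasisD(4)[OF nV[OF lo_summand[OF g(2)]]] by blast
    obtain y where y: "keys y \<subseteq> bsW t" "\<psi>W t y = w"
      using nbasisD(4)[OF nW[OF g(2)] Sw_WW[OF g(2,3)]] by blast
    have "g = Phi (inject t (tensor_vec x y))"
      using Phi_tensor[OF g(2) x(1) y(1) g(1)] x(2) y(2) g(4) by simp
    then show "g \<in> Phi ` DV" using tensor_DV[OF g(2) x(1) y(1)] by blast
  qed
  then have "cvec.span Gen \<subseteq> Phi ` DV"
    by (rule cvec.span_minimal) (rule cvec_pair.linear_subspace_image[OF linear_Phi DV_sub])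
  then show "SEv \<subseteq> Phi ` DV" by (simp add: Gen_total)
qed

text \<open>For fixed t and j the coefficients form S j, realised by the operator A j. Nondegeneracy
  is used twice: on the osp orbit to isolate j, then on the spo orbit of \<open>sv t\<close> to
  obtain \<open>A j (sv t) = 0\<close>. Finally \<open>kill_lo\<close> moves this to
  \<open>sv (lo t)\<close>, where S j is the coordinate vector.\<close>

lemma Phi_kernel:
  assumes v: "v \<in> DV" and 0: "Phi v = 0"
  shows "v = 0"
proof (rule poly_mapping_eqI)
  fix m :: "summand \<times> nat \<times> nat"
  obtain t i j where m: "m = (t, i, j)" by (cases m)
  show "lookup v m = lookup 0 m"
  proof (cases "m \<in> keys v")
    case False then show ?thesis by (simp add: in_keys_iff)
  next
    case True
    have tij: "t \<in> summands n" "i \<in> bsV (lo t)" "j \<in> bsW t" using DV_keys[OF v] True m by auto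
    note t = tij(1)
    define S where "S j = lin (\<lambda>(t', i', j'). if t' = t \<and> j' = j then bvec i' else 0) v" for j
    have S_keys: "keys (S j) \<subseteq> bsV (lo t)" for j
    proof
      fix k assume "k \<in> keys (S j)"
      then obtain m' where m': "m' \<in> keys v" "k \<in> keys (case m' of (t', i', j') \<Rightarrow> if t' = t \<and> j' = j then bvec i' else 0)"
        unfolding S_def using keys_lin by fastforce
      then show "k \<in> bsV (lo t)" using DV_keys[OF v] by (cases m') (auto split: if_splits)
    qed
    define A where "A j f = lin (\<lambda>b. aop t b f) (S j)" for j f
    have A_alg: "A j \<in> alg GO" and A_lo: "A j (sv (lo t)) = \<psi>V (lo t) (S j)" for j
      unfolding A_def[abs_def] using alg_combination[OF t S_keys] by auto
    have key: "B (A j (sv t)) (a' (sv t)) = 0" if a': "a' \<in> alg GO" for a' j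
    proof -
      \<comment> \<open>The spo factor is contracted against a' (sv t), leaving a coordinate vector
        in the osp factor; the summands other than t are removed by orthogonality in
        \<open>B_factor\<close>.\<close>
      define T where "T = lin (\<lambda>(t', i', j'). if t' = t then B (aop t i' (sv t)) (a' (sv t)) \<cdot> bvec j' else 0) v"
      have T_keys: "keys T \<subseteq> bsW t"
      proof
        fix k assume "k \<in> keys T"
        then obtain m' where m': "m' \<in> keys v" "k \<in> keys (case m' of (t', i', j') \<Rightarrow> if t' = t then B (aop t i' (sv t)) (a' (sv t)) \<cdot> bvec j' else 0)"
          unfolding T_def using keys_lin by fastforce
        then show "k \<in> bsW t" using DV_keys[OF v] keys_cscale by (cases m') (fastforce split: if_splits)
      qed
      have "B (\<psi>W t T) w' = 0" if w': "w' \<in> WW t" for w'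
      proof -
        have "B (\<psi>W t T) w' = (\<Sum>m\<in>keys v. lookup v m * B (\<psi>W t (case m of (t', i', j') \<Rightarrow> if t' = t then B (aop t i' (sv t)) (a' (sv t)) \<cdot> bvec j' else 0)) w')"
unfolding T_def by (subst B_expand[OF clinear_comp[OF nbasisD(1)[OF nW[OF t]] linear_lin]]) (simp only: lin_bvec)
        also have "\<dots> = (\<Sum>m\<in>keys v. lookup v m * (B (Phi (bvec m)) (a' w') * B (sv t) (sv t)))"
        proof (intro sum.cong refl arg_cong2[of _ _ _ _ "(*)"])
          fix m' assume m': "m' \<in> keys v"
          obtain t' i' j' where mm: "m' = (t', i', j')" by (cases m')
          have d: "t' \<in> summands n" "i' \<in> bsV (lo t')" "j' \<in> bsW t'" using DV_keys[OF v] m' mm by auto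
          have W: "\<psi>W t' (bvec j') \<in> WW t'" using psiW_mem[OF d(1)] d(3) by simp
          show "B (\<psi>W t (case m' of (t', i', j') \<Rightarrow> if t' = t then B (aop t i' (sv t)) (a' (sv t)) \<cdot> bvec j' else 0)) w' = B (Phi (bvec m')) (a' w') * B (sv t) (sv t)"
          proof (cases "t' = t")
            case True
            then show ?thesis
              using B_factor(1)[OF d(1) t aop(1)[OF d(1,2)] a' W w' True] True
              by (simp add: mm Phi_bvec clinD(4)[OF nbasisD(1)[OF nW[OF t]]] B_scale_left mult.commute)
          next
            case False
            then show ?thesis
              using B_factor(2)[OF d(1) t aop(1)[OF d(1,2)] a' W w' False]
              by (simp add: mm Phi_bvec clinD(5)[OF nbasisD(1)[OF nW[OF t]]])
          qed
        qed
        also have "\<dots> = B (Phi v) (a' w') * B (sv t) (sv t)"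
          unfolding B_expand[OF linear_Phi, of v] by (simp add: sum_distrib_right mult.assoc)
        finally show ?thesis by (simp add: 0)
      qed
      then have "\<psi>W t T = 0" by (rule WW_nondeg[OF t psiW_mem[OF t T_keys]])
      then have "T = 0"
        using nbasisD(3)[OF nW[OF t] T_keys, of 0] clinD(5)[OF nbasisD(1)[OF nW[OF t]]] by simp
      have "B (A j (sv t)) (a' (sv t)) = (\<Sum>m\<in>keys v. lookup v m * B (case m of (t', i', j') \<Rightarrow> if t' = t \<and> j' = j then aop t i' (sv t) else 0) (a' (sv t)))"
      proof -
        have "A j (sv t) = lin (\<lambda>m. case m of (t', i', j') \<Rightarrow> if t' = t \<and> j' = j then aop t i' (sv t) else 0) v"
          unfolding A_def S_def lin_comp[OF linear_lin] by (intro lin_cong) (auto simp: lin_simps split: prod.splits)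
        then show ?thesis by (simp add: lin_def B_lin)
      qed
      also have "\<dots> = lookup T j"
        unfolding T_def lin_def lookup_sum by (intro sum.cong refl) (auto simp: lookup_bvec split: prod.splits)
      finally show ?thesis using \<open>T = 0\<close> by simp
    qed
    have "A j (sv t) \<in> VV t" using A_alg by (auto simp: VV_def orb_def)
    then have "A j (sv t) = 0" using key by (rule VV_nondeg[OF t])
    then have "A j (sv (lo t)) = 0" by (rule kill_lo[OF t A_alg])
    then have "\<psi>V (lo t) (S j) = 0" by (simp add: A_lo)
    then have "S j = 0"
      using nbasisD(3)[OF nV[OF lo_summand[OF t]] S_keys, of 0] clinD(5)[OF nbasisD(1)[OF nV[OF lo_summand[OF t]]]] by simp
    moreover have "lookup (S j) i = lookup v m"
    proof -
      have "lookup (S j) i = (\<Sum>m'\<in>keys v. if m' = m then lookup v m else 0)"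
        unfolding S_def lin_def lookup_sum m by (intro sum.cong refl) (auto simp: lookup_bvec split: prod.splits)
      then show ?thesis using True by simp
    qed
    ultimately show ?thesis by simp
  qed
qed

lemma Phi_inj: "v \<in> DV \<Longrightarrow> w \<in> DV \<Longrightarrow> Phi v = Phi w \<Longrightarrow> v = w"
  using Phi_kernel[of "v - w"] cvec.subspace_diff[OF DV_sub] by (simp add: clinD(2)[OF linear_Phi])

text \<open>On \<open>sv (lo t)\<close> both sides are multiples of one basis vector of known
  parity; \<open>lo_kill_WW\<close> carries the resulting identity of operators over to the osp
  orbit.\<close>

lemma conj_aop:
  assumes t: "t \<in> summands n" and i: "i \<in> bsV (lo t)" and w: "w \<in> WW t"
  shows "conj (aop t i) w = (sgp (paV (lo t) i) * sgp (eo (lo t))) \<cdot> aop t i w"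
proof -
  note a = aop[OF t i]
  have "conj (aop t i) (sv (lo t)) = (sgp (eo (lo t)) * sgp (paV (lo t) i)) \<cdot> \<psi>V (lo t) (bvec i)"
    using nbasisD(5)[OF nV[OF lo_summand[OF t]] i] by (simp add: conj_def eo clinD(4)[OF alg_linear[OF GO_linear a(1)]] a(2))
  then have "conj (aop t i) w - (sgp (paV (lo t) i) * sgp (eo (lo t))) \<cdot> aop t i w = 0"
    by (intro lo_kill_WW[OF t alg_diff[OF conj_alg[OF a(1)] alg_scale[OF a(1)]] _ w]) (simp add: a(2) mult.commute)
  then show ?thesis by simp
qed

context
  fixes M :: "summand \<Rightarrow> (nat, smono, nat \<times> nat) joint_mod"
  assumes M: "\<And>t. t \<in> summands n \<Longrightarrow> M t = outer_tensor (modV (lo t)) (modW t)"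
begin

abbreviation "DS \<equiv> direct_sum (summands n) M"

lemma DS_basis: "basis DS = {(t, i, j). t \<in> summands n \<and> i \<in> bsV (lo t) \<and> j \<in> bsW t}"
  using M
  by (auto simp: direct_sum_def outer_tensor_def modV_def modW_def nmod_def)

lemma DS_vecs: "vecs DS = DV"
  by (simp add: vecs_def DV_def DS_basis)

lemma DS_par: "t \<in> summands n \<Longrightarrow> par DS (t, i, j) = ((paV (lo t) i \<noteq> eo (lo t)) \<noteq> paW t j)"
  using M by (auto simp: direct_sum_def outer_tensor_def modV_def modW_def nmod_def)

lemma DS_lrep: "t \<in> summands n \<Longrightarrow> lrep DS p X (bvec (t, i, j)) =
    inject t (tensor_vec (rep (modV (lo t)) p X (bvec i)) (bvec j))"
  using M by (simp add: direct_sum_def outer_tensor_def)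

lemma DS_rrep: "t \<in> summands n \<Longrightarrow> rrep DS p Y (bvec (t, i, j)) =
    inject t (ksign p (par (modV (lo t)) i) \<cdot> tensor_vec (bvec i) (rep (modW t) p Y (bvec j)))"
  using M by (simp add: direct_sum_def outer_tensor_def)

lemma DS_linear: "clinear (lrep DS p X)" "clinear (rrep DS p Y)"
  by (simp_all add: direct_sum_def linear_lin)

lemma Phi_lrep_bvec:
  assumes X: "X \<in> spo n p" and t: "t \<in> summands n" "i \<in> bsV (lo t)" "j \<in> bsW t"
  shows "lrep DS p X (bvec (t, i, j)) \<in> DV" "Phi (lrep DS p X (bvec (t, i, j))) = spo_act n X (Phi (bvec (t, i, j)))"
proof -
  note nb = nV[OF lo_summand[OF t(1)]]
  have i: "\<psi>V (lo t) (bvec i) \<in> VV (lo t)" using nbasisD(2)[OF nb] t(2) by simp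
  define x where "x = rep (modV (lo t)) p X (bvec i)"
  have x: "x = \<iota> (bsV (lo t)) (\<psi>V (lo t)) (spo_act n X (\<psi>V (lo t) (bvec i)))"
    unfolding x_def modV_def nmod_simps[OF nb] ..
  have xk: "keys x \<subseteq> bsV (lo t)" "\<psi>V (lo t) x = spo_act n X (\<psi>V (lo t) (bvec i))"
    unfolding x using iota(1,2)[OF nb VV_spo[OF X i]] by auto
  have jk: "keys (bvec j) \<subseteq> bsW t" using t(3) by simp
  have a: "(\<lambda>f. spo_act n X (aop t i f)) \<in> alg GO" by (rule alg_comp[OF GO_linear spo_alg[OF X] aop(1)[OF t(1,2)]])
  show "lrep DS p X (bvec (t, i, j)) \<in> DV"
    unfolding DS_lrep[OF t(1)] x_def[symmetric] by (rule tensor_DV[OF t(1) xk(1) jk])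
  show "Phi (lrep DS p X (bvec (t, i, j))) = spo_act n X (Phi (bvec (t, i, j)))"
    unfolding DS_lrep[OF t(1)] x_def[symmetric] Phi_bvec
    by (rule Phi_tensor[OF t(1) xk(1) jk a]) (simp add: aop(2)[OF t(1,2)] xk(2))
qed

text \<open>The sign of the outer tensor product for odd Y is the one by which
  \<open>conj (aop t i)\<close> differs from \<open>aop t i\<close>; the shift by
  \<open>eo (lo t)\<close> in \<open>modV\<close> makes the two agree.\<close>

lemma Phi_rrep_bvec:
  assumes Y: "Y \<in> osp n p" and t: "t \<in> summands n" "i \<in> bsV (lo t)" "j \<in> bsW t"
  shows "rrep DS p Y (bvec (t, i, j)) \<in> DV" "Phi (rrep DS p Y (bvec (t, i, j))) = Y (Phi (bvec (t, i, j)))"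
proof -
  note nb = nW[OF t(1)] and nv = nV[OF lo_summand[OF t(1)]]
  have j: "\<psi>W t (bvec j) \<in> WW t" using nbasisD(2)[OF nb] t(3) by simp
  define y where "y = rep (modW t) p Y (bvec j)"
  have y: "y = \<iota> (bsW t) (\<psi>W t) (Y (\<psi>W t (bvec j)))"
    unfolding y_def modW_def nmod_simps[OF nb] ..
  have yk: "keys y \<subseteq> bsW t" "\<psi>W t y = Y (\<psi>W t (bvec j))"
    unfolding y using iota(1,2)[OF nb osp_WW[OF Y t(1) j]] by auto
  have ik: "keys (bvec i) \<subseteq> bsV (lo t)" using t(2) by simp
  have pv: "par (modV (lo t)) i = (paV (lo t) i \<noteq> eo (lo t))" unfolding modV_def nmod_simps[OF nv] ..
  show "rrep DS p Y (bvec (t, i, j)) \<in> DV"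
    unfolding DS_rrep[OF t(1)] y_def[symmetric] inject_scale
    by (rule cvec.subspace_scale[OF DV_sub tensor_DV[OF t(1) ik yk(1)]])
  have "Phi (rrep DS p Y (bvec (t, i, j))) = ksign p (paV (lo t) i \<noteq> eo (lo t)) \<cdot> aop t i (Y (\<psi>W t (bvec j)))"
    unfolding DS_rrep[OF t(1)] y_def[symmetric] inject_scale clinD(4)[OF linear_Phi] pv
    using Phi_tensor[OF t(1) ik yk(1) aop[OF t(1,2)]] yk(2) by simp
  also have "\<dots> = (if p then conj (aop t i) else aop t i) (Y (\<psi>W t (bvec j)))"
    using conj_aop[OF t(1,2) osp_WW[OF Y t(1) j]] by (auto simp: ksign_def sgp_def)
  also have "\<dots> = Y (Phi (bvec (t, i, j)))"
    unfolding Phi_bvec by (rule osp_swap[OF Y aop(1)[OF t(1,2)] WW_props(1)[OF t(1) j], symmetric])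
  finally show "Phi (rrep DS p Y (bvec (t, i, j))) = Y (Phi (bvec (t, i, j)))" .
qed

lemma Phi_pty_bvec:
  assumes t: "t \<in> summands n" "i \<in> bsV (lo t)" "j \<in> bsW t"
  shows "pty (Phi (bvec (t, i, j))) = sgp (par DS (t, i, j)) \<cdot> Phi (bvec (t, i, j))"
proof -
  have j: "\<psi>W t (bvec j) \<in> WW t" using psiW_mem[OF t(1)] t(3) by simp
  have "pty (aop t i (\<psi>W t (bvec j))) = conj (aop t i) (pty (\<psi>W t (bvec j)))" by (simp add: conj_def)
  also have "\<dots> = sgp (paW t j) \<cdot> conj (aop t i) (\<psi>W t (bvec j))"
    using nbasisD(5)[OF nW[OF t(1)] t(3)] clinD(4)[OF alg_linear[OF GO_linear conj_alg[OF aop(1)[OF t(1,2)]]]] by simp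
  also have "\<dots> = sgp (par DS (t, i, j)) \<cdot> aop t i (\<psi>W t (bvec j))"
  proof -
    have "sgp (paW t j) * (sgp (paV (lo t) i) * sgp (eo (lo t))) = sgp ((paV (lo t) i \<noteq> eo (lo t)) \<noteq> paW t j)"
      by (auto simp: sgp_def)
    then show ?thesis by (simp add: conj_aop[OF t(1,2) j] DS_par[OF t(1)] del: not_iff)
  qed
  finally show ?thesis by (simp only: Phi_bvec)
qed

lemma transfer_keys:
  assumes "clinear F" "clinear G" "v \<in> DV"
    and "\<And>t i j. t \<in> summands n \<Longrightarrow> i \<in> bsV (lo t) \<Longrightarrow> j \<in> bsW t \<Longrightarrow> F (bvec (t, i, j)) = G (bvec (t, i, j))"
  shows "F v = G v"
proof (rule linear_eqI[OF assms(1,2)])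
  fix m assume "m \<in> keys v"
  then show "F (bvec m) = G (bvec m)" using DV_keys[OF assms(3)] assms(4) by (cases m) blast
qed

lemma DV_linear:
  assumes "clinear F" "v \<in> DV"
    and "\<And>t i j. t \<in> summands n \<Longrightarrow> i \<in> bsV (lo t) \<Longrightarrow> j \<in> bsW t \<Longrightarrow> F (bvec (t, i, j)) \<in> DV"
  shows "F v \<in> DV"
proof (subst clinear_expand2[OF assms(1)], intro cvec.subspace_sum[OF DV_sub] cvec.subspace_scale[OF DV_sub])
  fix m assume "m \<in> keys v"
  then show "F (bvec m) \<in> DV" using DV_keys[OF assms(2)] assms(3) by (cases m) blast
qed

lemma SE_iso: "joint_iso (spo n) (osp n) (SE n) DS"
proof -
  define \<phi> where "\<phi> = inv_into DV Phi"
  have inj: "inj_on Phi DV" using Phi_inj by (intro inj_onI)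
  have \<phi>1: "Phi (\<phi> f) = f" "\<phi> f \<in> DV" if "f \<in> SEv" for f
    using that Phi_surj f_inv_into_f[of f Phi DV] inv_into_into[of f Phi DV] by (auto simp: \<phi>_def)
  have \<phi>2: "\<phi> f = v" if "v \<in> DV" "Phi v = f" for f v
    using inv_into_f_f[OF inj that(1)] that(2) by (simp add: \<phi>_def)
  have SEvecs: "vecs (SE n) = SEv" by (simp add: SE_def vecs_def SEv_def)
  have SEhom: "hom_part (SE n) p = hom_part (SE_space n) p" for p by (simp add: SE_def hom_part_def)
  have SErep: "lrep (SE n) p X = spo_act n X" "rrep (SE n) p Y = Y" for p X Y by (simp_all add: SE_def)
  show ?thesis
    unfolding joint_iso_def
  proof (intro exI[of _ \<phi>] conjI allI ballI)
    show "linear_on (vecs (SE n)) \<phi>"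
      unfolding linear_on_def SEvecs
      using \<phi>1 cvec.subspace_add[OF DV_sub] cvec.subspace_scale[OF DV_sub]
      by (auto intro!: \<phi>2 simp: clinD[OF linear_Phi])
    show "bij_betw \<phi> (vecs (SE n)) (vecs DS)"
      unfolding SEvecs DS_vecs \<phi>_def using inj Phi_surj by (intro bij_betw_inv_into) (simp add: bij_betw_def)
  next
    fix p
    show "\<phi> ` hom_part (SE n) p \<subseteq> hom_part DS p"
    proof
      fix v assume "v \<in> \<phi> ` hom_part (SE n) p"
      then obtain f where f: "f \<in> SEv" "pty f = sgp p \<cdot> f" "v = \<phi> f" by (auto simp: SEhom SEv_hom)
      have v: "v \<in> DV" "Phi v = f" using \<phi>1 f by auto
      have "pty (Phi v) = Phi (diag (\<lambda>m. sgp (par DS m)) v)"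
        by (rule transfer_keys[where F = "\<lambda>v. pty (Phi v)" and G = "\<lambda>v. Phi (diag (\<lambda>m. sgp (par DS m)) v)"])
          (auto intro: clinear_comp linear_pty linear_Phi linear_diag v simp: Phi_pty_bvec diag_bvec clinD(4)[OF linear_Phi])
      then have "Phi (diag (\<lambda>m. sgp (par DS m)) v) = Phi (sgp p \<cdot> v)" using f v by (simp add: clinD(4)[OF linear_Phi])
      moreover have "diag (\<lambda>m. sgp (par DS m)) v \<in> DV"
      proof (rule DV_linear[OF linear_diag v(1)])
        fix t i j assume "t \<in> summands n" "i \<in> bsV (lo t)" "j \<in> bsW t"
        then have "bvec (t, i, j) \<in> DV" by (simp add: DV_def)
        then show "diag (\<lambda>m. sgp (par DS m)) (bvec (t, i, j)) \<in> DV"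
          unfolding diag_bvec by (rule cvec.subspace_scale[OF DV_sub])
      qed
      ultimately have eq: "diag (\<lambda>m. sgp (par DS m)) v = sgp p \<cdot> v"
        using Phi_inj cvec.subspace_scale[OF DV_sub v(1)] by blast
      have "par DS m = p" if "m \<in> keys v" for m
        using that arg_cong[OF eq, of "\<lambda>v. lookup v m"] by (simp add: lookup_diag in_keys_iff sgp_inj)
      moreover have "keys v \<subseteq> basis DS" using v(1) DS_vecs by (auto simp: vecs_def)
      ultimately show "v \<in> hom_part DS p" by (auto simp: hom_part_def)
    qed
  next
    fix p X f assume X: "X \<in> spo n p" and "f \<in> vecs (SE n)"
    then have f: "f \<in> SEv" by (simp add: SEvecs)
    note v = \<phi>1[OF f]
    have "lrep DS p X (\<phi> f) \<in> DV" using Phi_lrep_bvec(1)[OF X] by (rule DV_linear[OF DS_linear(1) v(2)])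
    moreover have "Phi (lrep DS p X (\<phi> f)) = spo_act n X (Phi (\<phi> f))"
      by (rule transfer_keys[OF clinear_comp[OF linear_Phi DS_linear(1)] clinear_comp[OF linear_spo_act linear_Phi] v(2) Phi_lrep_bvec(2)[OF X]])
    ultimately show "\<phi> (lrep (SE n) p X f) = lrep DS p X (\<phi> f)"
      unfolding SErep v(1) by (rule \<phi>2)
  next
    fix p Y f assume Y: "Y \<in> osp n p" and "f \<in> vecs (SE n)"
    then have f: "f \<in> SEv" by (simp add: SEvecs)
    note v = \<phi>1[OF f]
    have "rrep DS p Y (\<phi> f) \<in> DV" using Phi_rrep_bvec(1)[OF Y] by (rule DV_linear[OF DS_linear(2) v(2)])
    moreover have "Phi (rrep DS p Y (\<phi> f)) = Y (Phi (\<phi> f))"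
      by (rule transfer_keys[OF clinear_comp[OF linear_Phi DS_linear(2)] clinear_comp[OF osp_linear[OF Y] linear_Phi] v(2) Phi_rrep_bvec(2)[OF Y]])
    ultimately show "\<phi> (rrep (SE n) p Y f) = rrep DS p Y (\<phi> f)"
      unfolding SErep v(1) by (rule \<phi>2)
  qed
qed

end

end

theorem theorem6p9:
  fixes n :: nat
  assumes "n \<ge> 1"
  shows "\<exists>(V :: complex list \<Rightarrow> (nat, nat) supermod) (W :: complex \<times> complex \<Rightarrow> (smono, nat) supermod).
           (\<forall>s\<in>summands n.
              spo_irreducible n (spo_weight n s) (V (spo_weight n s)) \<and>
              osp_irreducible n (osp_weight n s) (W (osp_weight n s))) \<and>
           joint_iso (spo n) (osp n) (SE n)
             (direct_sum (summands n)
                (\<lambda>s. outer_tensor (V (spo_weight n s)) (W (osp_weight n s))))"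
proof -
  interpret howe n by unfold_locales (rule assms)
  have "\<forall>t. \<exists>bs pa \<psi>. t \<in> summands n \<longrightarrow> nbasis (VV t) bs pa \<psi>"
    using nbasis_exists[OF VV_sub _ VV_pty] VV_props(1) by blast
  then obtain bsV paV \<psi>V where V: "\<And>t. t \<in> summands n \<Longrightarrow> nbasis (VV t) (bsV t) (paV t) (\<psi>V t)" by metis
  have "\<forall>t. \<exists>bs pa \<psi>. t \<in> summands n \<longrightarrow> nbasis (WW t) bs pa \<psi>"
    using nbasis_exists[OF WW_sub _ WW_pty] WW_props(1) by blast
  then obtain bsW paW \<psi>W where W: "\<And>t. t \<in> summands n \<Longrightarrow> nbasis (WW t) (bsW t) (paW t) (\<psi>W t)" by metis
  interpret howe_data n bsV paV \<psi>V bsW paW \<psi>W by unfold_locales (fact V, fact W)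
  \<comment> \<open>A summand of the given weight is chosen and replaced by its \<open>lo\<close>;
    \<open>spo_weight_inj\<close> makes the result independent of the choice.\<close>
  define tV where "tV l = lo (SOME t. t \<in> summands n \<and> spo_weight n t = l)" for l
  define tW where "tW m = (SOME t. t \<in> summands n \<and> osp_weight n t = m)" for m
  have tV: "tV (spo_weight n t) = lo t" if t: "t \<in> summands n" for t
  proof -
    have "\<exists>t'. t' \<in> summands n \<and> spo_weight n t' = spo_weight n t" using t by blast
    from someI_ex[OF this] show ?thesis unfolding tV_def using spo_weight_inj t by blast
  qed
  have tW: "tW (osp_weight n t) = t" if t: "t \<in> summands n" for t
  proof -
    have "\<exists>t'. t' \<in> summands n \<and> osp_weight n t' = osp_weight n t" using t by blast
    from someI_ex[OF this] show ?thesis unfolding tW_def using osp_weight_inj t by blast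
  qed
  show ?thesis
  proof (intro exI[of _ "\<lambda>l. modV (tV l)"] exI[of _ "\<lambda>m. modW (tW m)"] conjI ballI)
    fix s assume s: "s \<in> summands n"
    show "spo_irreducible n (spo_weight n s) (modV (tV (spo_weight n s)))"
      using modV_irr[OF lo_summand[OF s]] by (simp add: tV[OF s] spo_weight_lo)
    show "osp_irreducible n (osp_weight n s) (modW (tW (osp_weight n s)))"
      using modW_irr[OF s] by (simp add: tW[OF s])
  next
    show "joint_iso (spo n) (osp n) (SE n)
      (direct_sum (summands n) (\<lambda>s. outer_tensor (modV (tV (spo_weight n s))) (modW (tW (osp_weight n s)))))"
      by (rule SE_iso) (simp add: tV tW)
  qed
qed

end
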